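(* Let $\underline{\mathcal F}$ and $\underline{\mathcal F}'$ be abelian $\tau$-sheaves of the same characteristic $c:\operatorname{Spec}L\to C$ over a field $L\supset\mathbb F_q$. If $\operatorname{Hom}(\underline{\mathcal F},\underline{\mathcal F}')\neq\{0\}$, then $\operatorname{wt}(\underline{\mathcal F})=\operatorname{wt}(\underline{\mathcal F}')$.
   Context: Notation: $\mathbb F_q$ is a finite field with $q$ elements, $C$ a smooth projective geometrically irreducible curve over $\mathbb F_q$, $\infty\in C(\mathbb F_q)$ a fixed rational point. For a field $L\supset\mathbb F_q$ put $C_L=C\times_{\mathbb F_q}\operatorname{Spec}L$; $\sigma$ is the endomorphism of $C_L$ which is the identity on $C$ and the $q$-Frobenius on $L$, and $\sigma^*$ is pullback along $\sigma$. For a divisor $D$ on $C$ and a coherent sheaf $\mathcal G$ on $C_L$, $\mathcal G(D)=\mathcal G\otimes\mathcal O_{C_L}(D)$. Abelian $\tau$-sheaves: fix a morphism $c:\operatorname{Spec}L\to C$ and let $\mathcal J$ be the ideal sheaf on $C_L$ of the graph of $c$. An abelian $\tau$-sheaf $\underline{\mathcal F}=(\mathcal F_i,\Pi_i,\tau_i)_{i\in\mathbb Z}$ of rank $r$, dimension $d$ (non-negative integers) and characteristic $c$ over $L$ consists of locally free sheaves $\mathcal F_i$ of rank $r$ on $C_L$ and injective $\mathcal O_{C_L}$-morphisms $\Pi_i:\mathcal F_i\to\mathcal F_{i+1}$, $\tau_i:\sigma^*\mathcal F_i\to\mathcal F_{i+1}$ such that (1) $\Pi_{i+1}\circ\tau_i=\tau_{i+1}\circ\sigma^*\Pi_i$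 for all $i$; (2) there are integers $k,l>0$ with $ld=kr$ such that for all $i$ the morphism $\Pi_{i+l-1}\circ\cdots\circ\Pi_i$ identifies $\mathcal F_i$ with the subsheaf $\mathcal F_{i+l}(-k\cdot\infty)$ of $\mathcal F_{i+l}$ (compatibly, $\tau_{i+l}=\tau_i\otimes 1$ under $\mathcal F_{i+l}=\mathcal F_i(k\cdot\infty)$); (3) $\dim_L\operatorname{coker}\Pi_i=d$ for all $i$; (4) $\operatorname{coker}\tau_i$ is annihilated by $\mathcal J^d$ and has $L$-dimension $d$ for all $i$. The zero sheaf $\underline 0$ (rank $0$, dimension $0$) is allowed. A morphism $f:\underline{\mathcal F}\to\underline{\mathcal F}'$ is a collection of morphisms $f_i:\mathcal F_i\to\mathcal F'_i$ with $f_{i+1}\circ\Pi_i=\Pi'_i\circ f_i$ and $f_{i+1}\circ\tau_i=\tau'_i\circ\sigma^*f_i$; the set of these is $\operatorname{Hom}(\underline{\mathcal F},\underline{\mathcal F}')$. The weight is $\operatorname{wt}(\underline{\mathcal F})=d/r$ if $\underline{\mathcal F}\ne\underline 0$ and $\operatorname{wt}(\underline 0)=0$. *)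

theory Defs
  imports
    "HOL-Algebra.Ring_Divisibility" "HOL-Algebra.Free_Abelian_Groups" "HOL-Algebra.Generated_Rings"
    "HOL-Algebra.Generated_Groups" "HOL-Algebra.Module" "HOL-Analysis.Abstract_Topology"
begin

section \<open>Commutative algebra\<close>

definition local_ring :: "'a ring \<Rightarrow> bool" where
  "local_ring R \<longleftrightarrow> cring R \<and> (\<exists>!m. maximalideal m R)"

definition nonunits :: "'a ring \<Rightarrow> 'a set" where
  "nonunits R = carrier R - Units R"

text \<open>The supremum of the lengths of strictly increasing chains in a family of sets is \<open>n\<close>.
  For prime ideals this is Krull dimension, for irreducible closed sets it is the dimension of a
  topological space.\<close>

definition has_chain :: "'a set set \<Rightarrow> nat \<Rightarrow> bool" where
  "has_chain \<C> n \<longleftrightarrow> (\<exists>c. (\<forall>i\<le>n. c i \<in> \<C>) \<and> (\<forall>i<n. c i \<subset> c (Suc i)))"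

definition chain_dim :: "'a set set \<Rightarrow> nat \<Rightarrow> bool" where
  "chain_dim \<C> n \<longleftrightarrow> has_chain \<C> n \<and> \<not> has_chain \<C> (Suc n)"

definition regular_local_ring :: "'a ring \<Rightarrow> bool" where
  "regular_local_ring R \<longleftrightarrow> local_ring R \<and> noetherian_ring R \<and>
     (\<exists>n S. chain_dim {P. primeideal P R} n \<and> S \<subseteq> carrier R \<and> finite S \<and> card S = n \<and>
        maximalideal (genideal R S) R)"

text \<open>The fraction \<open>a / s\<close>, as the class of all pairs equivalent to \<open>(a, s)\<close>, and the
  localization at a prime ideal.\<close>

definition fraction :: "'a ring \<Rightarrow> 'a set \<Rightarrow> 'a \<Rightarrow> 'a \<Rightarrow> ('a \<times> 'a) set" where
  "fraction A P a s = {(b, t). b \<in> carrier A \<and> t \<in> carrier A - P \<and>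
     (\<exists>u \<in> carrier A - P. u \<otimes>\<^bsub>A\<^esub> (t \<otimes>\<^bsub>A\<^esub> a) = u \<otimes>\<^bsub>A\<^esub> (s \<otimes>\<^bsub>A\<^esub> b))}"

definition localization :: "'a ring \<Rightarrow> 'a set \<Rightarrow> ('a \<times> 'a) set ring" where
  "localization A P =
    \<lparr>carrier = {fraction A P a s | a s. a \<in> carrier A \<and> s \<in> carrier A - P},
     monoid.mult = (\<lambda>x y. \<Union>(a, s)\<in>x. \<Union>(b, t)\<in>y. fraction A P (a \<otimes>\<^bsub>A\<^esub> b) (s \<otimes>\<^bsub>A\<^esub> t)),
     monoid.one = fraction A P \<one>\<^bsub>A\<^esub> \<one>\<^bsub>A\<^esub>,
     ring.zero = fraction A P \<zero>\<^bsub>A\<^esub> \<one>\<^bsub>A\<^esub>,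
     add = (\<lambda>x y. \<Union>(a, s)\<in>x. \<Union>(b, t)\<in>y.
        fraction A P ((a \<otimes>\<^bsub>A\<^esub> t) \<oplus>\<^bsub>A\<^esub> (b \<otimes>\<^bsub>A\<^esub> s)) (s \<otimes>\<^bsub>A\<^esub> t))\<rparr>"

text \<open>The tensor product \<open>A \<otimes> B\<close> of two \<open>k\<close>-algebras \<open>\<alpha> : k \<rightarrow> A\<close> and \<open>\<beta> : k \<rightarrow> B\<close>, as the
  quotient of the monoid ring \<open>\<int>[A \<times> B]\<close> by the ideal generated by the bilinearity
  relations; \<open>frag_of (a, b)\<close> represents the pure tensor of \<open>a\<close> and \<open>b\<close>.\<close>

definition pair_ring :: "'a ring \<Rightarrow> 'b ring \<Rightarrow> ('a \<times> 'b \<Rightarrow>\<^sub>0 int) ring" where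
  "pair_ring A B =
    \<lparr>carrier = {c. Poly_Mapping.keys c \<subseteq> carrier A \<times> carrier B},
     monoid.mult = (\<lambda>c d. frag_extend (\<lambda>(a, b). frag_extend
        (\<lambda>(a', b'). frag_of (a \<otimes>\<^bsub>A\<^esub> a', b \<otimes>\<^bsub>B\<^esub> b')) d) c),
     monoid.one = frag_of (\<one>\<^bsub>A\<^esub>, \<one>\<^bsub>B\<^esub>),
     ring.zero = 0,
     add = (+)\<rparr>"

definition tensor_ideal ::
    "'k ring \<Rightarrow> 'a ring \<Rightarrow> ('k \<Rightarrow> 'a) \<Rightarrow> 'b ring \<Rightarrow> ('k \<Rightarrow> 'b) \<Rightarrow> ('a \<times> 'b \<Rightarrow>\<^sub>0 int) set" where
  "tensor_ideal k A \<alpha> B \<beta> = genideal (pair_ring A B)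
     ({frag_of (a \<oplus>\<^bsub>A\<^esub> a', b) - frag_of (a, b) - frag_of (a', b) | a a' b.
         a \<in> carrier A \<and> a' \<in> carrier A \<and> b \<in> carrier B} \<union>
      {frag_of (a, b \<oplus>\<^bsub>B\<^esub> b') - frag_of (a, b) - frag_of (a, b') | a b b'.
         a \<in> carrier A \<and> b \<in> carrier B \<and> b' \<in> carrier B} \<union>
      {frag_of (\<alpha> c \<otimes>\<^bsub>A\<^esub> a, b) - frag_of (a, \<beta> c \<otimes>\<^bsub>B\<^esub> b) | a b c.
         a \<in> carrier A \<and> b \<in> carrier B \<and> c \<in> carrier k})"

definition tensor_ring ::
    "'k ring \<Rightarrow> 'a ring \<Rightarrow> ('k \<Rightarrow> 'a) \<Rightarrow> 'b ring \<Rightarrow> ('k \<Rightarrow> 'b) \<Rightarrow> ('a \<times> 'b \<Rightarrow>\<^sub>0 int) set ring" where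
  "tensor_ring k A \<alpha> B \<beta> = pair_ring A B Quot tensor_ideal k A \<alpha> B \<beta>"

definition tensor_class ::
    "'k ring \<Rightarrow> 'a ring \<Rightarrow> ('k \<Rightarrow> 'a) \<Rightarrow> 'b ring \<Rightarrow> ('k \<Rightarrow> 'b) \<Rightarrow> ('a \<times> 'b \<Rightarrow>\<^sub>0 int)
      \<Rightarrow> ('a \<times> 'b \<Rightarrow>\<^sub>0 int) set" where
  "tensor_class k A \<alpha> B \<beta> c = tensor_ideal k A \<alpha> B \<beta> +>\<^bsub>pair_ring A B\<^esub> c"

text \<open>Extension of scalars \<open>M \<otimes> S\<close> of an \<open>R\<close>-module \<open>M\<close> along \<open>h : R \<rightarrow> S\<close>, as an
  \<open>S\<close>-module. The fields \<open>mult\<close> and \<open>one\<close> of module records carry no information.\<close>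

definition ext_rel ::
    "'a ring \<Rightarrow> ('a, 'm) module \<Rightarrow> ('a \<Rightarrow> 'b) \<Rightarrow> 'b ring \<Rightarrow> ('m \<times> 'b \<Rightarrow>\<^sub>0 int) set" where
  "ext_rel R M h S = generate (free_Abelian_group (carrier M \<times> carrier S))
     ({frag_of (m \<oplus>\<^bsub>M\<^esub> m', b) - frag_of (m, b) - frag_of (m', b) | m m' b.
         m \<in> carrier M \<and> m' \<in> carrier M \<and> b \<in> carrier S} \<union>
      {frag_of (m, b \<oplus>\<^bsub>S\<^esub> b') - frag_of (m, b) - frag_of (m, b') | m b b'.
         m \<in> carrier M \<and> b \<in> carrier S \<and> b' \<in> carrier S} \<union>
      {frag_of (a \<odot>\<^bsub>M\<^esub> m, b) - frag_of (m, h a \<otimes>\<^bsub>S\<^esub> b) | m b a.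
         m \<in> carrier M \<and> b \<in> carrier S \<and> a \<in> carrier R})"

definition ext_class ::
    "'a ring \<Rightarrow> ('a, 'm) module \<Rightarrow> ('a \<Rightarrow> 'b) \<Rightarrow> 'b ring \<Rightarrow> ('m \<times> 'b \<Rightarrow>\<^sub>0 int)
      \<Rightarrow> ('m \<times> 'b \<Rightarrow>\<^sub>0 int) set" where
  "ext_class R M h S c = ext_rel R M h S #>\<^bsub>free_Abelian_group (carrier M \<times> carrier S)\<^esub> c"

definition ext_scalars ::
    "'a ring \<Rightarrow> ('a, 'm) module \<Rightarrow> ('a \<Rightarrow> 'b) \<Rightarrow> 'b ring
      \<Rightarrow> ('b, ('m \<times> 'b \<Rightarrow>\<^sub>0 int) set) module" where
  "ext_scalars R M h S =
    \<lparr>carrier = {ext_class R M h S c | c. Poly_Mapping.keys c \<subseteq> carrier M \<times> carrier S},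
     monoid.mult = (\<lambda>_ _. undefined),
     monoid.one = undefined,
     ring.zero = ext_class R M h S 0,
     add = (\<lambda>x y. x <#>\<^bsub>free_Abelian_group (carrier M \<times> carrier S)\<^esub> y),
     smult = (\<lambda>b x. \<Union>c\<in>x. ext_class R M h S
        (frag_extend (\<lambda>(m, b'). frag_of (m, b \<otimes>\<^bsub>S\<^esub> b')) c))\<rparr>"

definition quot_module :: "('a, 'm) module \<Rightarrow> 'm set \<Rightarrow> ('a, 'm set) module" where
  "quot_module M N =
    \<lparr>carrier = a_rcosets\<^bsub>M\<^esub> N,
     monoid.mult = (\<lambda>_ _. undefined),
     monoid.one = undefined,
     ring.zero = N,
     add = set_add M,
     smult = (\<lambda>a x. \<Union>m\<in>x. N +>\<^bsub>M\<^esub> (a \<odot>\<^bsub>M\<^esub> m))\<rparr>"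

definition restrict_scalars :: "('e \<Rightarrow> 'a) \<Rightarrow> ('a, 'm) module \<Rightarrow> ('e, 'm) module" where
  "restrict_scalars h M =
    \<lparr>carrier = carrier M, monoid.mult = monoid.mult M, monoid.one = monoid.one M, ring.zero = ring.zero M, add = add M,
     smult = (\<lambda>e m. h e \<odot>\<^bsub>M\<^esub> m)\<rparr>"

definition is_basis :: "'a ring \<Rightarrow> ('a, 'm) module \<Rightarrow> nat \<Rightarrow> (nat \<Rightarrow> 'm) \<Rightarrow> bool" where
  "is_basis R M r e \<longleftrightarrow> e \<in> {..<r} \<rightarrow> carrier M \<and>
     bij_betw (\<lambda>a. \<Oplus>\<^bsub>M\<^esub>j\<in>{..<r}. a j \<odot>\<^bsub>M\<^esub> e j) ({..<r} \<rightarrow>\<^sub>E carrier R) (carrier M)"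

section \<open>Sheaves and locally ringed spaces\<close>

record ('p, 's) ringed_space =
  space :: "'p topology"
  sect :: "'p set \<Rightarrow> 's ring"
  res :: "'p set \<Rightarrow> 'p set \<Rightarrow> 's \<Rightarrow> 's" \<comment> \<open>\<open>res X U V\<close> restricts from \<open>U\<close> to \<open>V \<subseteq> U\<close>\<close>

abbreviation pts :: "('p, 's) ringed_space \<Rightarrow> 'p set" where
  "pts X \<equiv> topspace (space X)"

abbreviation opn :: "('p, 's) ringed_space \<Rightarrow> 'p set \<Rightarrow> bool" where
  "opn X \<equiv> openin (space X)"

record ('p, 's, 'm) module_sheaf =
  msect :: "'p set \<Rightarrow> ('s, 'm) module"
  mres :: "'p set \<Rightarrow> 'p set \<Rightarrow> 'm \<Rightarrow> 'm"

definition set_sheaf ::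
    "'p topology \<Rightarrow> ('p set \<Rightarrow> 's set) \<Rightarrow> ('p set \<Rightarrow> 'p set \<Rightarrow> 's \<Rightarrow> 's) \<Rightarrow> bool" where
  "set_sheaf T S \<rho> \<longleftrightarrow>
     (\<forall>U V. openin T U \<and> openin T V \<and> V \<subseteq> U \<longrightarrow> \<rho> U V \<in> S U \<rightarrow> S V) \<and>
     (\<forall>U s. openin T U \<and> s \<in> S U \<longrightarrow> \<rho> U U s = s) \<and>
     (\<forall>U V W s. openin T U \<and> openin T V \<and> openin T W \<and> W \<subseteq> V \<and> V \<subseteq> U \<and> s \<in> S U \<longrightarrow>
        \<rho> V W (\<rho> U V s) = \<rho> U W s) \<and>
     (\<forall>\<V> s t. (\<forall>V\<in>\<V>. openin T V) \<and> s \<in> S (\<Union>\<V>) \<and> t \<in> S (\<Union>\<V>) \<and>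
        (\<forall>V\<in>\<V>. \<rho> (\<Union>\<V>) V s = \<rho> (\<Union>\<V>) V t) \<longrightarrow> s = t) \<and>
     (\<forall>\<V> g. (\<forall>V\<in>\<V>. openin T V \<and> g V \<in> S V) \<and>
        (\<forall>V\<in>\<V>. \<forall>W\<in>\<V>. \<rho> V (V \<inter> W) (g V) = \<rho> W (V \<inter> W) (g W)) \<longrightarrow>
        (\<exists>s \<in> S (\<Union>\<V>). \<forall>V\<in>\<V>. \<rho> (\<Union>\<V>) V s = g V))"

definition sheaf_of_rings :: "('p, 's) ringed_space \<Rightarrow> bool" where
  "sheaf_of_rings X \<longleftrightarrow>
     (\<forall>U. opn X U \<longrightarrow> cring (sect X U)) \<and>
     (\<forall>U V. opn X U \<and> opn X V \<and> V \<subseteq> U \<longrightarrow> res X U V \<in> ring_hom (sect X U) (sect X V)) \<and>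
     set_sheaf (space X) (\<lambda>U. carrier (sect X U)) (res X)"

definition sheaf_of_modules :: "('p, 's) ringed_space \<Rightarrow> ('p, 's, 'm) module_sheaf \<Rightarrow> bool" where
  "sheaf_of_modules X F \<longleftrightarrow>
     (\<forall>U. opn X U \<longrightarrow> module (sect X U) (msect F U)) \<and>
     (\<forall>U V. opn X U \<and> opn X V \<and> V \<subseteq> U \<longrightarrow>
        (\<forall>s \<in> carrier (msect F U). \<forall>t \<in> carrier (msect F U).
           mres F U V (s \<oplus>\<^bsub>msect F U\<^esub> t) = mres F U V s \<oplus>\<^bsub>msect F V\<^esub> mres F U V t) \<and>
        (\<forall>a \<in> carrier (sect X U). \<forall>s \<in> carrier (msect F U).
           mres F U V (a \<odot>\<^bsub>msect F U\<^esub> s) = res X U V a \<odot>\<^bsub>msect F V\<^esub> mres F U V s)) \<and>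
     set_sheaf (space X) (\<lambda>U. carrier (msect F U)) (mres F)"

text \<open>The germ at \<open>x\<close> of a section \<open>s\<close> over \<open>U\<close>: all pairs \<open>(V, t)\<close> agreeing with it near
  \<open>x\<close>.\<close>

definition germ ::
    "'p topology \<Rightarrow> ('p set \<Rightarrow> 's set) \<Rightarrow> ('p set \<Rightarrow> 'p set \<Rightarrow> 's \<Rightarrow> 's) \<Rightarrow> 'p \<Rightarrow> 'p set \<Rightarrow> 's
      \<Rightarrow> ('p set \<times> 's) set" where
  "germ T S \<rho> x U s = {(V, t). openin T V \<and> x \<in> V \<and> t \<in> S V \<and>
     (\<exists>W. openin T W \<and> x \<in> W \<and> W \<subseteq> U \<inter> V \<and> \<rho> U W s = \<rho> V W t)}"

definition rgerm :: "('p, 's) ringed_space \<Rightarrow> 'p \<Rightarrow> 'p set \<Rightarrow> 's \<Rightarrow> ('p set \<times> 's) set" where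
  "rgerm X = germ (space X) (\<lambda>U. carrier (sect X U)) (res X)"

definition mgerm ::
    "('p, 's) ringed_space \<Rightarrow> ('p, 's, 'm) module_sheaf \<Rightarrow> 'p \<Rightarrow> 'p set \<Rightarrow> 'm
      \<Rightarrow> ('p set \<times> 'm) set" where
  "mgerm X F = germ (space X) (\<lambda>U. carrier (msect F U)) (mres F)"

definition stalk :: "('p, 's) ringed_space \<Rightarrow> 'p \<Rightarrow> ('p set \<times> 's) set ring" where
  "stalk X x =
    \<lparr>carrier = {rgerm X x U s | U s. opn X U \<and> x \<in> U \<and> s \<in> carrier (sect X U)},
     monoid.mult = (\<lambda>A B. \<Union>(U, s)\<in>A. \<Union>(V, t)\<in>B. rgerm X x (U \<inter> V)
        (res X U (U \<inter> V) s \<otimes>\<^bsub>sect X (U \<inter> V)\<^esub> res X V (U \<inter> V) t)),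
     monoid.one = rgerm X x (pts X) \<one>\<^bsub>sect X (pts X)\<^esub>,
     ring.zero = rgerm X x (pts X) \<zero>\<^bsub>sect X (pts X)\<^esub>,
     add = (\<lambda>A B. \<Union>(U, s)\<in>A. \<Union>(V, t)\<in>B. rgerm X x (U \<inter> V)
        (res X U (U \<inter> V) s \<oplus>\<^bsub>sect X (U \<inter> V)\<^esub> res X V (U \<inter> V) t))\<rparr>"

definition mstalk ::
    "('p, 's) ringed_space \<Rightarrow> ('p, 's, 'm) module_sheaf \<Rightarrow> 'p
      \<Rightarrow> (('p set \<times> 's) set, ('p set \<times> 'm) set) module" where
  "mstalk X F x =
    \<lparr>carrier = {mgerm X F x U s | U s. opn X U \<and> x \<in> U \<and> s \<in> carrier (msect F U)},
     monoid.mult = (\<lambda>_ _. undefined),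
     monoid.one = undefined,
     ring.zero = mgerm X F x (pts X) \<zero>\<^bsub>msect F (pts X)\<^esub>,
     add = (\<lambda>A B. \<Union>(U, s)\<in>A. \<Union>(V, t)\<in>B. mgerm X F x (U \<inter> V)
        (mres F U (U \<inter> V) s \<oplus>\<^bsub>msect F (U \<inter> V)\<^esub> mres F V (U \<inter> V) t)),
     smult = (\<lambda>A B. \<Union>(U, a)\<in>A. \<Union>(V, t)\<in>B. mgerm X F x (U \<inter> V)
        (res X U (U \<inter> V) a \<odot>\<^bsub>msect F (U \<inter> V)\<^esub> mres F V (U \<inter> V) t))\<rparr>"

definition locally_ringed_space :: "('p, 's) ringed_space \<Rightarrow> bool" where
  "locally_ringed_space X \<longleftrightarrow> sheaf_of_rings X \<and> (\<forall>x \<in> pts X. local_ring (stalk X x))"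

definition open_subspace :: "('p, 's) ringed_space \<Rightarrow> 'p set \<Rightarrow> ('p, 's) ringed_space" where
  "open_subspace X U = X\<lparr>space := subtopology (space X) U\<rparr>"

text \<open>A morphism consists of the map on points and, for each open \<open>V\<close> of the target, the map
  \<open>comor \<phi> V\<close> from sections over \<open>V\<close> to sections over the preimage of \<open>V\<close>.\<close>

record ('p, 's, 'q, 't) rs_map =
  on_pts :: "'p \<Rightarrow> 'q"
  comor :: "'q set \<Rightarrow> 't \<Rightarrow> 's"

definition pre :: "('p, 's) ringed_space \<Rightarrow> ('p, 's, 'q, 't) rs_map \<Rightarrow> 'q set \<Rightarrow> 'p set" where
  "pre X \<phi> V = {x \<in> pts X. on_pts \<phi> x \<in> V}"

definition lrs_morphism ::
    "('p, 's) ringed_space \<Rightarrow> ('q, 't) ringed_space \<Rightarrow> ('p, 's, 'q, 't) rs_map \<Rightarrow> bool" where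
  "lrs_morphism X Y \<phi> \<longleftrightarrow>
     continuous_map (space X) (space Y) (on_pts \<phi>) \<and>
     (\<forall>V. opn Y V \<longrightarrow> comor \<phi> V \<in> ring_hom (sect Y V) (sect X (pre X \<phi> V))) \<and>
     (\<forall>V W. opn Y V \<and> opn Y W \<and> W \<subseteq> V \<longrightarrow> (\<forall>a \<in> carrier (sect Y V).
        comor \<phi> W (res Y V W a) = res X (pre X \<phi> V) (pre X \<phi> W) (comor \<phi> V a))) \<and>
     (\<forall>x \<in> pts X. \<forall>V a. opn Y V \<and> on_pts \<phi> x \<in> V \<and> a \<in> carrier (sect Y V) \<and>
        rgerm X x (pre X \<phi> V) (comor \<phi> V a) \<in> Units (stalk X x) \<longrightarrow>
        rgerm Y (on_pts \<phi> x) V a \<in> Units (stalk Y (on_pts \<phi> x)))"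

definition lrs_isomorphism ::
    "('p, 's) ringed_space \<Rightarrow> ('q, 't) ringed_space \<Rightarrow> ('p, 's, 'q, 't) rs_map \<Rightarrow> bool" where
  "lrs_isomorphism X Y \<phi> \<longleftrightarrow> lrs_morphism X Y \<phi> \<and>
     homeomorphic_map (space X) (space Y) (on_pts \<phi>) \<and>
     (\<forall>V. opn Y V \<longrightarrow> bij_betw (comor \<phi> V) (carrier (sect Y V)) (carrier (sect X (pre X \<phi> V))))"

definition closed_immersion ::
    "('p, 's) ringed_space \<Rightarrow> ('q, 't) ringed_space \<Rightarrow> ('p, 's, 'q, 't) rs_map \<Rightarrow> bool" where
  "closed_immersion X Y \<phi> \<longleftrightarrow> lrs_morphism X Y \<phi> \<and>
     closed_map (space X) (space Y) (on_pts \<phi>) \<and> inj_on (on_pts \<phi>) (pts X) \<and>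
     (\<forall>x \<in> pts X. \<forall>g \<in> carrier (stalk X x). \<exists>V b. opn Y V \<and> on_pts \<phi> x \<in> V \<and>
        b \<in> carrier (sect Y V) \<and> rgerm X x (pre X \<phi> V) (comor \<phi> V b) = g)"

definition comp_map ::
    "('q, 't) ringed_space \<Rightarrow> ('q, 't, 'r, 'u) rs_map \<Rightarrow> ('p, 's, 'q, 't) rs_map
      \<Rightarrow> ('p, 's, 'r, 'u) rs_map" where
  "comp_map Y \<psi> \<phi> =
    \<lparr>on_pts = on_pts \<psi> \<circ> on_pts \<phi>, comor = (\<lambda>V a. comor \<phi> (pre Y \<psi> V) (comor \<psi> V a))\<rparr>"

definition same_map ::
    "('p, 's) ringed_space \<Rightarrow> ('q, 't) ringed_space
      \<Rightarrow> ('p, 's, 'q, 't) rs_map \<Rightarrow> ('p, 's, 'q, 't) rs_map \<Rightarrow> bool" where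
  "same_map X Y \<phi> \<psi> \<longleftrightarrow> (\<forall>x \<in> pts X. on_pts \<phi> x = on_pts \<psi> x) \<and>
     (\<forall>V. opn Y V \<longrightarrow> (\<forall>a \<in> carrier (sect Y V). comor \<phi> V a = comor \<psi> V a))"

text \<open>The ringed space whose sections over \<open>W\<close> are the functions with values in given rings
  \<open>R p\<close> that locally coincide with a member of a given family \<open>B\<close>.\<close>

definition local_sections ::
    "'p topology \<Rightarrow> ('p \<Rightarrow> 'b set) \<Rightarrow> ('p set \<Rightarrow> ('p \<Rightarrow> 'b) set) \<Rightarrow> 'p set \<Rightarrow> ('p \<Rightarrow> 'b) set" where
  "local_sections T S B W = {s \<in> (\<Pi>\<^sub>E p\<in>W. S p).
     \<forall>p\<in>W. \<exists>V. openin T V \<and> p \<in> V \<and> V \<subseteq> W \<and> (\<exists>b \<in> B V. \<forall>x\<in>V. s x = b x)}"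

definition function_space ::
    "'p topology \<Rightarrow> ('p \<Rightarrow> 'b ring) \<Rightarrow> ('p set \<Rightarrow> ('p \<Rightarrow> 'b) set) \<Rightarrow> ('p, 'p \<Rightarrow> 'b) ringed_space" where
  "function_space T R B =
    \<lparr>space = T,
     sect = (\<lambda>W. \<lparr>carrier = local_sections T (\<lambda>p. carrier (R p)) B W,
        monoid.mult = (\<lambda>s t. \<lambda>p\<in>W. s p \<otimes>\<^bsub>R p\<^esub> t p),
        monoid.one = (\<lambda>p\<in>W. \<one>\<^bsub>R p\<^esub>),
        ring.zero = (\<lambda>p\<in>W. \<zero>\<^bsub>R p\<^esub>),
        add = (\<lambda>s t. \<lambda>p\<in>W. s p \<oplus>\<^bsub>R p\<^esub> t p)\<rparr>),
     res = (\<lambda>U V s. restrict s V)\<rparr>"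

definition function_module ::
    "('p, 's) ringed_space \<Rightarrow> ('p \<Rightarrow> (('p set \<times> 's) set, 'n) module)
      \<Rightarrow> ('p set \<Rightarrow> ('p \<Rightarrow> 'n) set) \<Rightarrow> ('p, 's, 'p \<Rightarrow> 'n) module_sheaf" where
  "function_module X N B =
    \<lparr>msect = (\<lambda>W. \<lparr>carrier = local_sections (space X) (\<lambda>p. carrier (N p)) B W,
        monoid.mult = (\<lambda>_ _. undefined),
        monoid.one = undefined,
        ring.zero = (\<lambda>p\<in>W. \<zero>\<^bsub>N p\<^esub>),
        add = (\<lambda>s t. \<lambda>p\<in>W. s p \<oplus>\<^bsub>N p\<^esub> t p),
        smult = (\<lambda>a s. \<lambda>p\<in>W. rgerm X p W a \<odot>\<^bsub>N p\<^esub> s p)\<rparr>),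
     mres = (\<lambda>U V s. restrict s V)\<rparr>"

section \<open>Schemes\<close>

definition Spec :: "'a ring \<Rightarrow> ('a set, 'a set \<Rightarrow> ('a \<times> 'a) set) ringed_space" where
  "Spec A = function_space
     (topology_generated_by ((\<lambda>f. {P. primeideal P A \<and> f \<notin> P}) ` carrier A))
     (localization A)
     (\<lambda>V. {\<lambda>P. fraction A P a f | a f. a \<in> carrier A \<and> f \<in> carrier A \<and> (\<forall>P\<in>V. f \<notin> P)})"

definition spec_const :: "'a ring \<Rightarrow> 'a \<Rightarrow> 'a set \<Rightarrow> ('a \<times> 'a) set" where
  "spec_const A a = (\<lambda>P \<in> {P. primeideal P A}. fraction A P a \<one>\<^bsub>A\<^esub>)"

definition affine_open :: "('p, 's) ringed_space \<Rightarrow> 'p set \<Rightarrow> bool" where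
  "affine_open X U \<longleftrightarrow> opn X U \<and>
     (\<exists>(A :: 's ring) \<phi>. cring A \<and> lrs_isomorphism (open_subspace X U) (Spec A) \<phi>)"

definition scheme :: "('p, 's) ringed_space \<Rightarrow> bool" where
  "scheme X \<longleftrightarrow> locally_ringed_space X \<and> (\<forall>x \<in> pts X. \<exists>U. affine_open X U \<and> x \<in> U)"

text \<open>A scheme over \<open>Spec k\<close> is given by a ring homomorphism \<open>\<gamma>\<close> from \<open>k\<close> to its global
  functions.\<close>

definition scheme_over :: "'k ring \<Rightarrow> ('p, 's) ringed_space \<Rightarrow> ('k \<Rightarrow> 's) \<Rightarrow> bool" where
  "scheme_over k X \<gamma> \<longleftrightarrow> scheme X \<and> \<gamma> \<in> ring_hom k (sect X (pts X))"

definition morphism_over ::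
    "'k ring \<Rightarrow> ('p, 's) ringed_space \<Rightarrow> ('k \<Rightarrow> 's) \<Rightarrow> ('q, 't) ringed_space \<Rightarrow> ('k \<Rightarrow> 't)
      \<Rightarrow> ('p, 's, 'q, 't) rs_map \<Rightarrow> bool" where
  "morphism_over k X \<gamma> Y \<delta> \<phi> \<longleftrightarrow> lrs_morphism X Y \<phi> \<and>
     (\<forall>c \<in> carrier k. comor \<phi> (pts Y) (\<delta> c) = \<gamma> c)"

text \<open>The base change \<open>X\<^sub>E\<close> of a \<open>k\<close>-scheme \<open>X\<close> along a field extension \<open>\<iota> : k \<rightarrow> E\<close>. Its points
  over \<open>x\<close> are the primes of \<open>\<O>\<^sub>X\<^sub>,\<^sub>x \<otimes>\<^sub>k E\<close> lying over the maximal ideal of \<open>\<O>\<^sub>X\<^sub>,\<^sub>x\<close>, and its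
  local rings are the localizations at these primes. The topology and the functions come from
  elements of \<open>\<O>\<^sub>X(U) \<otimes>\<^sub>k E\<close>, represented by formal sums \<open>c\<close> of pairs.\<close>

definition stalk_algebra :: "('p, 's) ringed_space \<Rightarrow> ('k \<Rightarrow> 's) \<Rightarrow> 'p \<Rightarrow> 'k \<Rightarrow> ('p set \<times> 's) set" where
  "stalk_algebra X \<gamma> x c = rgerm X x (pts X) (\<gamma> c)"

type_synonym ('p, 's, 'e) fib = "((('p set \<times> 's) set \<times> 'e) \<Rightarrow>\<^sub>0 int) set"
type_synonym ('p, 's, 'e) bc_point = "'p \<times> ('p, 's, 'e) fib set"
type_synonym ('p, 's, 'e) bc_fun =
  "('p, 's, 'e) bc_point \<Rightarrow> (('p, 's, 'e) fib \<times> ('p, 's, 'e) fib) set"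

definition fib_class ::
    "'k ring \<Rightarrow> ('p, 's) ringed_space \<Rightarrow> ('k \<Rightarrow> 's) \<Rightarrow> 'e ring \<Rightarrow> ('k \<Rightarrow> 'e) \<Rightarrow> 'p
      \<Rightarrow> ((('p set \<times> 's) set \<times> 'e) \<Rightarrow>\<^sub>0 int) \<Rightarrow> ('p, 's, 'e) fib" where
  "fib_class k X \<gamma> E \<iota> x = tensor_class k (stalk X x) (stalk_algebra X \<gamma> x) E \<iota>"

definition fib_ring ::
    "'k ring \<Rightarrow> ('p, 's) ringed_space \<Rightarrow> ('k \<Rightarrow> 's) \<Rightarrow> 'e ring \<Rightarrow> ('k \<Rightarrow> 'e) \<Rightarrow> 'p
      \<Rightarrow> ('p, 's, 'e) fib ring" where
  "fib_ring k X \<gamma> E \<iota> x = tensor_ring k (stalk X x) (stalk_algebra X \<gamma> x) E \<iota>"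

definition fib_value ::
    "'k ring \<Rightarrow> ('p, 's) ringed_space \<Rightarrow> ('k \<Rightarrow> 's) \<Rightarrow> 'e ring \<Rightarrow> ('k \<Rightarrow> 'e) \<Rightarrow> 'p set
      \<Rightarrow> ('s \<times> 'e \<Rightarrow>\<^sub>0 int) \<Rightarrow> 'p \<Rightarrow> ('p, 's, 'e) fib" where
  "fib_value k X \<gamma> E \<iota> U c x = fib_class k X \<gamma> E \<iota> x
     (frag_extend (\<lambda>(a, e). frag_of (rgerm X x U a, e)) c)"

definition bc_pts ::
    "'k ring \<Rightarrow> ('p, 's) ringed_space \<Rightarrow> ('k \<Rightarrow> 's) \<Rightarrow> 'e ring \<Rightarrow> ('k \<Rightarrow> 'e)
      \<Rightarrow> ('p, 's, 'e) bc_point set" where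
  "bc_pts k X \<gamma> E \<iota> = {(x, P). x \<in> pts X \<and> primeideal P (fib_ring k X \<gamma> E \<iota> x) \<and>
     {a \<in> carrier (stalk X x). fib_class k X \<gamma> E \<iota> x (frag_of (a, \<one>\<^bsub>E\<^esub>)) \<in> P}
       = nonunits (stalk X x)}"

definition base_change ::
    "'k ring \<Rightarrow> ('p, 's) ringed_space \<Rightarrow> ('k \<Rightarrow> 's) \<Rightarrow> 'e ring \<Rightarrow> ('k \<Rightarrow> 'e)
      \<Rightarrow> (('p, 's, 'e) bc_point, ('p, 's, 'e) bc_fun) ringed_space" where
  "base_change k X \<gamma> E \<iota> = function_space
     (topology_generated_by
        {{(x, P) \<in> bc_pts k X \<gamma> E \<iota>. x \<in> U \<and> fib_value k X \<gamma> E \<iota> U c x \<notin> P} | U c.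
           opn X U \<and> Poly_Mapping.keys c \<subseteq> carrier (sect X U) \<times> carrier E})
     (\<lambda>(x, P). localization (fib_ring k X \<gamma> E \<iota> x) P)
     (\<lambda>V. {\<lambda>(x, P). fraction (fib_ring k X \<gamma> E \<iota> x) P
                (fib_value k X \<gamma> E \<iota> U a x) (fib_value k X \<gamma> E \<iota> U f x) | U a f.
           opn X U \<and> Poly_Mapping.keys a \<subseteq> carrier (sect X U) \<times> carrier E \<and>
           Poly_Mapping.keys f \<subseteq> carrier (sect X U) \<times> carrier E \<and>
           (\<forall>(x, P) \<in> V. x \<in> U \<and> fib_value k X \<gamma> E \<iota> U f x \<notin> P)})"

definition bc_const ::
    "'k ring \<Rightarrow> ('p, 's) ringed_space \<Rightarrow> ('k \<Rightarrow> 's) \<Rightarrow> 'e ring \<Rightarrow> ('k \<Rightarrow> 'e)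
      \<Rightarrow> 'e \<Rightarrow> ('p, 's, 'e) bc_fun" where
  "bc_const k X \<gamma> E \<iota> e = restrict (\<lambda>(x, P). fraction (fib_ring k X \<gamma> E \<iota> x) P
       (fib_class k X \<gamma> E \<iota> x (frag_of (\<one>\<^bsub>stalk X x\<^esub>, e))) \<one>\<^bsub>fib_ring k X \<gamma> E \<iota> x\<^esub>)
     (bc_pts k X \<gamma> E \<iota>)"

definition bc_proj ::
    "'k ring \<Rightarrow> ('p, 's) ringed_space \<Rightarrow> ('k \<Rightarrow> 's) \<Rightarrow> 'e ring \<Rightarrow> ('k \<Rightarrow> 'e)
      \<Rightarrow> (('p, 's, 'e) bc_point, ('p, 's, 'e) bc_fun, 'p, 's) rs_map" where
  "bc_proj k X \<gamma> E \<iota> =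
    \<lparr>on_pts = fst,
     comor = (\<lambda>V a. restrict (\<lambda>(x, P). fraction (fib_ring k X \<gamma> E \<iota> x) P
          (fib_class k X \<gamma> E \<iota> x (frag_of (rgerm X x V a, \<one>\<^bsub>E\<^esub>))) \<one>\<^bsub>fib_ring k X \<gamma> E \<iota> x\<^esub>)
        {(x, P) \<in> bc_pts k X \<gamma> E \<iota>. x \<in> V})\<rparr>"

text \<open>The endomorphism \<open>\<sigma>\<close> of \<open>X\<^sub>E\<close> that is the identity on \<open>X\<close> and the \<open>q\<close>-Frobenius on \<open>E\<close>,
  where \<open>q\<close> is the cardinality of \<open>k\<close>.\<close>

definition fib_frob ::
    "'k ring \<Rightarrow> ('p, 's) ringed_space \<Rightarrow> ('k \<Rightarrow> 's) \<Rightarrow> 'e ring \<Rightarrow> ('k \<Rightarrow> 'e) \<Rightarrow> 'p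
      \<Rightarrow> ('p, 's, 'e) fib \<Rightarrow> ('p, 's, 'e) fib" where
  "fib_frob k X \<gamma> E \<iota> x z = (\<Union>c\<in>z. fib_class k X \<gamma> E \<iota> x
     (frag_extend (\<lambda>(a, e). frag_of (a, e [^]\<^bsub>E\<^esub> card (carrier k))) c))"

definition frob_pts ::
    "'k ring \<Rightarrow> ('p, 's) ringed_space \<Rightarrow> ('k \<Rightarrow> 's) \<Rightarrow> 'e ring \<Rightarrow> ('k \<Rightarrow> 'e)
      \<Rightarrow> ('p, 's, 'e) bc_point \<Rightarrow> ('p, 's, 'e) bc_point" where
  "frob_pts k X \<gamma> E \<iota> =
     (\<lambda>(x, P). (x, {z \<in> carrier (fib_ring k X \<gamma> E \<iota> x). fib_frob k X \<gamma> E \<iota> x z \<in> P}))"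

definition rel_frob ::
    "'k ring \<Rightarrow> ('p, 's) ringed_space \<Rightarrow> ('k \<Rightarrow> 's) \<Rightarrow> 'e ring \<Rightarrow> ('k \<Rightarrow> 'e)
      \<Rightarrow> (('p, 's, 'e) bc_point, ('p, 's, 'e) bc_fun, ('p, 's, 'e) bc_point, ('p, 's, 'e) bc_fun) rs_map"
  where
  "rel_frob k X \<gamma> E \<iota> =
    \<lparr>on_pts = frob_pts k X \<gamma> E \<iota>,
     comor = (\<lambda>V s. restrict (\<lambda>(x, P). \<Union>(a, f) \<in> s (frob_pts k X \<gamma> E \<iota> (x, P)).
          fraction (fib_ring k X \<gamma> E \<iota> x) P (fib_frob k X \<gamma> E \<iota> x a) (fib_frob k X \<gamma> E \<iota> x f))
        {p \<in> bc_pts k X \<gamma> E \<iota>. frob_pts k X \<gamma> E \<iota> p \<in> V})\<rparr>"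

text \<open>\<open>Proj\<close> of a graded ring \<open>S\<close> with homogeneous components \<open>H d\<close>.\<close>

definition Proj :: "'a ring \<Rightarrow> (nat \<Rightarrow> 'a set) \<Rightarrow> ('a set, 'a set \<Rightarrow> ('a \<times> 'a) set) ringed_space" where
  "Proj S H = function_space
     (topology_generated_by
        {{P. primeideal P S \<and> P = genideal S (\<Union>d. P \<inter> H d) \<and> f \<notin> P} | f d. 0 < d \<and> f \<in> H d})
     (\<lambda>P. localization S P
        \<lparr>carrier := {fraction S P a f | a f d. a \<in> H d \<and> f \<in> H d \<and> f \<notin> P}\<rparr>)
     (\<lambda>V. {\<lambda>P. fraction S P a f | a f d. a \<in> H d \<and> f \<in> H d \<and> (\<forall>P\<in>V. f \<notin> P)})"

text \<open>Polynomials in \<open>x\<^sub>0, \<dots>, x\<^sub>n\<close> over \<open>k\<close>, as functions from monomials (multisets of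
  indices) to coefficients.\<close>

definition mpoly_ring :: "'k ring \<Rightarrow> nat \<Rightarrow> (nat multiset \<Rightarrow> 'k) ring" where
  "mpoly_ring k n =
    \<lparr>carrier = {p. (\<forall>m. p m \<in> carrier k) \<and> finite {m. p m \<noteq> \<zero>\<^bsub>k\<^esub>} \<and>
        (\<forall>m. p m \<noteq> \<zero>\<^bsub>k\<^esub> \<longrightarrow> set_mset m \<subseteq> {..n})},
     monoid.mult = (\<lambda>p r m. \<Oplus>\<^bsub>k\<^esub>a\<in>{a. a \<subseteq># m}. p a \<otimes>\<^bsub>k\<^esub> r (m - a)),
     monoid.one = (\<lambda>m. if m = {#} then \<one>\<^bsub>k\<^esub> else \<zero>\<^bsub>k\<^esub>),
     ring.zero = (\<lambda>m. \<zero>\<^bsub>k\<^esub>),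
     add = (\<lambda>p r m. p m \<oplus>\<^bsub>k\<^esub> r m)\<rparr>"

definition mpoly_degree :: "'k ring \<Rightarrow> nat \<Rightarrow> nat \<Rightarrow> (nat multiset \<Rightarrow> 'k) set" where
  "mpoly_degree k n d = {p \<in> carrier (mpoly_ring k n). \<forall>m. p m \<noteq> \<zero>\<^bsub>k\<^esub> \<longrightarrow> size m = d}"

definition proj_space ::
    "'k ring \<Rightarrow> nat \<Rightarrow> ((nat multiset \<Rightarrow> 'k) set,
      (nat multiset \<Rightarrow> 'k) set \<Rightarrow> ((nat multiset \<Rightarrow> 'k) \<times> (nat multiset \<Rightarrow> 'k)) set) ringed_space" where
  "proj_space k n = Proj (mpoly_ring k n) (mpoly_degree k n)"

definition proj_const ::
    "'k ring \<Rightarrow> nat \<Rightarrow> 'k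
      \<Rightarrow> (nat multiset \<Rightarrow> 'k) set \<Rightarrow> ((nat multiset \<Rightarrow> 'k) \<times> (nat multiset \<Rightarrow> 'k)) set" where
  "proj_const k n c = (\<lambda>P \<in> pts (proj_space k n). fraction (mpoly_ring k n) P
     (\<lambda>m. if m = {#} then c else \<zero>\<^bsub>k\<^esub>) \<one>\<^bsub>mpoly_ring k n\<^esub>)"

definition projective_over :: "'k ring \<Rightarrow> ('p, 's) ringed_space \<Rightarrow> ('k \<Rightarrow> 's) \<Rightarrow> bool" where
  "projective_over k X \<gamma> \<longleftrightarrow> (\<exists>n \<phi>. morphism_over k X \<gamma> (proj_space k n) (proj_const k n) \<phi> \<and>
     closed_immersion X (proj_space k n) \<phi>)"

definition irreducible_in :: "'p topology \<Rightarrow> 'p set \<Rightarrow> bool" where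
  "irreducible_in T Z \<longleftrightarrow> Z \<subseteq> topspace T \<and> Z \<noteq> {} \<and>
     (\<forall>A B. closedin T A \<and> closedin T B \<and> Z \<subseteq> A \<union> B \<longrightarrow> Z \<subseteq> A \<or> Z \<subseteq> B)"

definition scheme_dim :: "('p, 's) ringed_space \<Rightarrow> nat \<Rightarrow> bool" where
  "scheme_dim X n \<longleftrightarrow> chain_dim {Z. closedin (space X) Z \<and> irreducible_in (space X) Z} n"

definition locally_of_finite_type :: "'k ring \<Rightarrow> ('p, 's) ringed_space \<Rightarrow> ('k \<Rightarrow> 's) \<Rightarrow> bool" where
  "locally_of_finite_type k X \<gamma> \<longleftrightarrow> (\<forall>x \<in> pts X. \<exists>U H. affine_open X U \<and> x \<in> U \<and>
     H \<subseteq> carrier (sect X U) \<and> finite H \<and>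
     generate_ring (sect X U) (res X (pts X) U ` \<gamma> ` carrier k \<union> H) = carrier (sect X U))"

text \<open>Smoothness (locally of finite type and geometrically regular) and geometric irreducibility
  are conditions on the base changes to all field extensions of \<open>k\<close>. Since types cannot be
  quantified, the extensions considered are those with elements in \<^typ>\<open>nat\<close> and those with elements
  in the type \<open>'e\<close> of the first argument. Over a finite (or countable) field \<open>k\<close> every countable
  extension, in particular every finitely generated one and the algebraic closure, has a copy in
  \<^typ>\<open>nat\<close>. For these both notions are already equivalent to the usual ones, whatever \<open>'e\<close> is.\<close>

definition ext_regular ::
    "'e itself \<Rightarrow> 'k ring \<Rightarrow> ('p, 's) ringed_space \<Rightarrow> ('k \<Rightarrow> 's) \<Rightarrow> bool" where
  "ext_regular _ k X \<gamma> \<longleftrightarrow> (\<forall>(E :: 'e ring) \<iota>. field E \<and> \<iota> \<in> ring_hom k E \<longrightarrow>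
     (\<forall>y \<in> pts (base_change k X \<gamma> E \<iota>). regular_local_ring (stalk (base_change k X \<gamma> E \<iota>) y)))"

definition ext_irreducible ::
    "'e itself \<Rightarrow> 'k ring \<Rightarrow> ('p, 's) ringed_space \<Rightarrow> ('k \<Rightarrow> 's) \<Rightarrow> bool" where
  "ext_irreducible _ k X \<gamma> \<longleftrightarrow> (\<forall>(E :: 'e ring) \<iota>. field E \<and> \<iota> \<in> ring_hom k E \<longrightarrow>
     irreducible_in (space (base_change k X \<gamma> E \<iota>)) (pts (base_change k X \<gamma> E \<iota>)))"

definition smooth_over ::
    "'e itself \<Rightarrow> 'k ring \<Rightarrow> ('p, 's) ringed_space \<Rightarrow> ('k \<Rightarrow> 's) \<Rightarrow> bool" where
  "smooth_over e k X \<gamma> \<longleftrightarrow> locally_of_finite_type k X \<gamma> \<and>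
     ext_regular TYPE(nat) k X \<gamma> \<and> ext_regular e k X \<gamma>"

definition geometrically_irreducible ::
    "'e itself \<Rightarrow> 'k ring \<Rightarrow> ('p, 's) ringed_space \<Rightarrow> ('k \<Rightarrow> 's) \<Rightarrow> bool" where
  "geometrically_irreducible e k X \<gamma> \<longleftrightarrow>
     ext_irreducible TYPE(nat) k X \<gamma> \<and> ext_irreducible e k X \<gamma>"

definition smooth_projective_curve ::
    "'e itself \<Rightarrow> 'k ring \<Rightarrow> ('p, 's) ringed_space \<Rightarrow> ('k \<Rightarrow> 's) \<Rightarrow> bool" where
  "smooth_projective_curve e k C \<gamma> \<longleftrightarrow> scheme_over k C \<gamma> \<and> scheme_dim C 1 \<and>
     projective_over k C \<gamma> \<and> smooth_over e k C \<gamma> \<and> geometrically_irreducible e k C \<gamma>"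

section \<open>Sheaves of modules\<close>

definition sheaf_hom ::
    "('p, 's) ringed_space \<Rightarrow> ('p, 's, 'm) module_sheaf \<Rightarrow> ('p, 's, 'n) module_sheaf
      \<Rightarrow> ('p set \<Rightarrow> 'm \<Rightarrow> 'n) \<Rightarrow> bool" where
  "sheaf_hom X F G \<phi> \<longleftrightarrow> (\<forall>U. opn X U \<longrightarrow>
     \<phi> U \<in> carrier (msect F U) \<rightarrow> carrier (msect G U) \<and>
     (\<forall>s \<in> carrier (msect F U). \<forall>t \<in> carrier (msect F U).
        \<phi> U (s \<oplus>\<^bsub>msect F U\<^esub> t) = \<phi> U s \<oplus>\<^bsub>msect G U\<^esub> \<phi> U t) \<and>
     (\<forall>a \<in> carrier (sect X U). \<forall>s \<in> carrier (msect F U).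
        \<phi> U (a \<odot>\<^bsub>msect F U\<^esub> s) = a \<odot>\<^bsub>msect G U\<^esub> \<phi> U s) \<and>
     (\<forall>V. opn X V \<and> V \<subseteq> U \<longrightarrow> (\<forall>s \<in> carrier (msect F U).
        \<phi> V (mres F U V s) = mres G U V (\<phi> U s))))"

definition sheaf_inj ::
    "('p, 's) ringed_space \<Rightarrow> ('p, 's, 'm) module_sheaf \<Rightarrow> ('p set \<Rightarrow> 'm \<Rightarrow> 'n) \<Rightarrow> bool" where
  "sheaf_inj X F \<phi> \<longleftrightarrow> (\<forall>U. opn X U \<longrightarrow> inj_on (\<phi> U) (carrier (msect F U)))"

definition locally_free ::
    "('p, 's) ringed_space \<Rightarrow> ('p, 's, 'm) module_sheaf \<Rightarrow> nat \<Rightarrow> bool" where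
  "locally_free X F r \<longleftrightarrow> sheaf_of_modules X F \<and> (\<forall>x \<in> pts X. \<exists>U e. opn X U \<and> x \<in> U \<and>
     e \<in> {..<r} \<rightarrow> carrier (msect F U) \<and>
     (\<forall>V. opn X V \<and> V \<subseteq> U \<longrightarrow> is_basis (sect X V) (msect F V) r (\<lambda>j. mres F U V (e j))))"

text \<open>The pullback \<open>\<phi>\<^sup>*F\<close> along \<open>\<phi> : X \<rightarrow> Y\<close> has stalk \<open>F\<^sub>y \<otimes> \<O>\<^sub>X\<^sub>,\<^sub>x\<close> (over \<open>\<O>\<^sub>Y\<^sub>,\<^sub>y\<close>) at \<open>x\<close>
  where \<open>y = \<phi> x\<close>; its sections are locally given by elements of \<open>F(W) \<otimes> \<O>\<^sub>X(V)\<close>,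
  \<open>\<phi>(V) \<subseteq> W\<close>.\<close>

definition stalk_map ::
    "('p, 's) ringed_space \<Rightarrow> ('p, 's, 'q, 't) rs_map \<Rightarrow> 'p \<Rightarrow> ('q set \<times> 't) set
      \<Rightarrow> ('p set \<times> 's) set" where
  "stalk_map X \<phi> x A = (\<Union>(V, a)\<in>A. rgerm X x (pre X \<phi> V) (comor \<phi> V a))"

type_synonym ('p, 's, 'q, 'm) pb_sect =
  "'p \<Rightarrow> (('q set \<times> 'm) set \<times> ('p set \<times> 's) set \<Rightarrow>\<^sub>0 int) set"

definition pb_class ::
    "('p, 's) ringed_space \<Rightarrow> ('q, 't) ringed_space \<Rightarrow> ('p, 's, 'q, 't) rs_map
      \<Rightarrow> ('q, 't, 'm) module_sheaf \<Rightarrow> 'p \<Rightarrow> (('q set \<times> 'm) set \<times> ('p set \<times> 's) set \<Rightarrow>\<^sub>0 int)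
      \<Rightarrow> (('q set \<times> 'm) set \<times> ('p set \<times> 's) set \<Rightarrow>\<^sub>0 int) set" where
  "pb_class X Y \<phi> F x = ext_class (stalk Y (on_pts \<phi> x)) (mstalk Y F (on_pts \<phi> x))
     (stalk_map X \<phi> x) (stalk X x)"

definition pullback ::
    "('p, 's) ringed_space \<Rightarrow> ('q, 't) ringed_space \<Rightarrow> ('p, 's, 'q, 't) rs_map
      \<Rightarrow> ('q, 't, 'm) module_sheaf \<Rightarrow> ('p, 's, ('p, 's, 'q, 'm) pb_sect) module_sheaf" where
  "pullback X Y \<phi> F = function_module X
     (\<lambda>x. ext_scalars (stalk Y (on_pts \<phi> x)) (mstalk Y F (on_pts \<phi> x))
        (stalk_map X \<phi> x) (stalk X x))
     (\<lambda>V. {\<lambda>x. pb_class X Y \<phi> F x (frag_extend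
              (\<lambda>(t, a). frag_of (mgerm Y F (on_pts \<phi> x) W t, rgerm X x V a)) c) | W c.
         opn Y W \<and> V \<subseteq> pre X \<phi> W \<and>
         Poly_Mapping.keys c \<subseteq> carrier (msect F W) \<times> carrier (sect X V)})"

definition mstalk_map ::
    "('p, 's) ringed_space \<Rightarrow> ('p, 's, 'n) module_sheaf \<Rightarrow> ('p set \<Rightarrow> 'm \<Rightarrow> 'n) \<Rightarrow> 'p
      \<Rightarrow> ('p set \<times> 'm) set \<Rightarrow> ('p set \<times> 'n) set" where
  "mstalk_map X G f x A = (\<Union>(U, s)\<in>A. mgerm X G x U (f U s))"

definition pullback_map ::
    "('p, 's) ringed_space \<Rightarrow> ('q, 't) ringed_space \<Rightarrow> ('p, 's, 'q, 't) rs_map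
      \<Rightarrow> ('q, 't, 'n) module_sheaf \<Rightarrow> ('q set \<Rightarrow> 'm \<Rightarrow> 'n)
      \<Rightarrow> 'p set \<Rightarrow> ('p, 's, 'q, 'm) pb_sect \<Rightarrow> ('p, 's, 'q, 'n) pb_sect" where
  "pullback_map X Y \<phi> G f U s = (\<lambda>x\<in>U. \<Union>c \<in> s x. pb_class X Y \<phi> G x (frag_extend
     (\<lambda>(A, b). frag_of (mstalk_map Y G f (on_pts \<phi> x) A, b)) c))"

definition stalk_image ::
    "('p, 's) ringed_space \<Rightarrow> ('p, 's, 'm) module_sheaf \<Rightarrow> ('p, 's, 'n) module_sheaf
      \<Rightarrow> ('p set \<Rightarrow> 'm \<Rightarrow> 'n) \<Rightarrow> 'p \<Rightarrow> ('p set \<times> 'n) set set" where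
  "stalk_image X F G f x = {mgerm X G x U (f U s) | U s. opn X U \<and> x \<in> U \<and> s \<in> carrier (msect F U)}"

definition cokernel ::
    "('p, 's) ringed_space \<Rightarrow> ('p, 's, 'm) module_sheaf \<Rightarrow> ('p, 's, 'n) module_sheaf
      \<Rightarrow> ('p set \<Rightarrow> 'm \<Rightarrow> 'n) \<Rightarrow> ('p, 's, 'p \<Rightarrow> ('p set \<times> 'n) set set) module_sheaf" where
  "cokernel X F G f = function_module X
     (\<lambda>x. quot_module (mstalk X G x) (stalk_image X F G f x))
     (\<lambda>V. {\<lambda>x. stalk_image X F G f x +>\<^bsub>mstalk X G x\<^esub> mgerm X G x V s | s.
         s \<in> carrier (msect G V)})"

text \<open>The \<open>L\<close>-dimension of a sheaf on an \<open>L\<close>-scheme with finite support is that of its space of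
  global sections.\<close>

definition has_dim ::
    "'l ring \<Rightarrow> ('p, 's) ringed_space \<Rightarrow> ('l \<Rightarrow> 's) \<Rightarrow> ('p, 's, 'm) module_sheaf \<Rightarrow> nat \<Rightarrow> bool" where
  "has_dim L X \<gamma> F d \<longleftrightarrow> (\<exists>e. is_basis L (restrict_scalars \<gamma> (msect F (pts X))) d e)"

definition kernel_ideal ::
    "('p, 's) ringed_space \<Rightarrow> ('q, 't) ringed_space \<Rightarrow> ('p, 's, 'q, 't) rs_map \<Rightarrow> 'q set \<Rightarrow> 't set" where
  "kernel_ideal X Y \<phi> V = a_kernel (sect Y V) (sect X (pre X \<phi> V)) (comor \<phi> V)"

definition structure_module :: "('p, 's) ringed_space \<Rightarrow> ('p, 's, 's) module_sheaf" where
  "structure_module X =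
    \<lparr>msect = (\<lambda>U. \<lparr>carrier = carrier (sect X U), monoid.mult = monoid.mult (sect X U), monoid.one = monoid.one (sect X U),
        ring.zero = ring.zero (sect X U), add = add (sect X U), smult = monoid.mult (sect X U)\<rparr>),
     mres = res X\<rparr>"

text \<open>The subsheaf \<open>\<I>\<cdot>S\<close> of \<open>F\<close>, for an ideal sheaf \<open>\<I>\<close> and a subsheaf \<open>S\<close> of \<open>F\<close>.\<close>

definition ideal_times ::
    "('p, 's) ringed_space \<Rightarrow> ('p, 's, 'm) module_sheaf \<Rightarrow> ('p set \<Rightarrow> 's set) \<Rightarrow> ('p set \<Rightarrow> 'm set)
      \<Rightarrow> 'p set \<Rightarrow> 'm set" where
  "ideal_times X F \<I> S U = {s \<in> carrier (msect F U). \<forall>x\<in>U. \<exists>W. opn X W \<and> x \<in> W \<and> W \<subseteq> U \<and>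
     (\<exists>(n :: nat) a t. a \<in> {..<n} \<rightarrow> \<I> W \<and> t \<in> {..<n} \<rightarrow> S W \<and>
        mres F U W s = (\<Oplus>\<^bsub>msect F W\<^esub>j\<in>{..<n}. a j \<odot>\<^bsub>msect F W\<^esub> t j))}"

primrec ideal_pow ::
    "('p, 's) ringed_space \<Rightarrow> ('p set \<Rightarrow> 's set) \<Rightarrow> nat \<Rightarrow> 'p set \<Rightarrow> 's set" where
  "ideal_pow X \<I> 0 = (\<lambda>U. carrier (sect X U))"
| "ideal_pow X \<I> (Suc n) = ideal_times X (structure_module X) \<I> (ideal_pow X \<I> n)"

text \<open>The ideal sheaf on \<open>X\<close> generated by the pullbacks of the sections of an ideal sheaf on
  \<open>Y\<close>.\<close>

definition inverse_image_ideal ::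
    "('p, 's) ringed_space \<Rightarrow> ('q, 't) ringed_space \<Rightarrow> ('p, 's, 'q, 't) rs_map
      \<Rightarrow> ('q set \<Rightarrow> 't set) \<Rightarrow> 'p set \<Rightarrow> 's set" where
  "inverse_image_ideal X Y \<phi> \<I> U = {s \<in> carrier (sect X U). \<forall>x\<in>U. \<exists>W V. opn X W \<and> x \<in> W \<and> W \<subseteq> U \<and>
     opn Y V \<and> W \<subseteq> pre X \<phi> V \<and>
     (\<exists>(n :: nat) a b. a \<in> {..<n} \<rightarrow> carrier (sect X W) \<and> b \<in> {..<n} \<rightarrow> \<I> V \<and>
        res X U W s = (\<Oplus>\<^bsub>sect X W\<^esub>j\<in>{..<n}.
           a j \<otimes>\<^bsub>sect X W\<^esub> res X (pre X \<phi> V) W (comor \<phi> V (b j))))}"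

section \<open>Abelian \<open>\<tau>\<close>-sheaves\<close>

text \<open>\<open>\<O>(-n\<cdot>\<infinity>)\<close> on \<open>C\<^sub>L\<close>: the pullback of the \<open>n\<close>-th power of the ideal sheaf of the
  rational point \<open>\<infinity> : Spec k \<rightarrow> C\<close>.\<close>

definition O_minus ::
    "'k ring \<Rightarrow> ('p, 's) ringed_space \<Rightarrow> ('k \<Rightarrow> 's) \<Rightarrow> 'l ring \<Rightarrow> ('k \<Rightarrow> 'l)
      \<Rightarrow> ('k set, 'k set \<Rightarrow> ('k \<times> 'k) set, 'p, 's) rs_map
      \<Rightarrow> nat \<Rightarrow> ('p, 's, 'l) bc_point set \<Rightarrow> ('p, 's, 'l) bc_fun set" where
  "O_minus k C \<gamma> L \<iota> pinf n = inverse_image_ideal (base_change k C \<gamma> L \<iota>) C (bc_proj k C \<gamma> L \<iota>)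
     (ideal_pow C (kernel_ideal (Spec k) C pinf) n)"

text \<open>The graph \<open>\<Gamma> : Spec L \<rightarrow> C\<^sub>L\<close> of \<open>c : Spec L \<rightarrow> C\<close>.\<close>

definition is_graph ::
    "'k ring \<Rightarrow> ('p, 's) ringed_space \<Rightarrow> ('k \<Rightarrow> 's) \<Rightarrow> 'l ring \<Rightarrow> ('k \<Rightarrow> 'l)
      \<Rightarrow> ('l set, 'l set \<Rightarrow> ('l \<times> 'l) set, 'p, 's) rs_map
      \<Rightarrow> ('l set, 'l set \<Rightarrow> ('l \<times> 'l) set, ('p, 's, 'l) bc_point, ('p, 's, 'l) bc_fun) rs_map
      \<Rightarrow> bool" where
  "is_graph k C \<gamma> L \<iota> c \<Gamma> \<longleftrightarrow>
     morphism_over L (Spec L) (spec_const L) (base_change k C \<gamma> L \<iota>) (bc_const k C \<gamma> L \<iota>) \<Gamma> \<and>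
     same_map (Spec L) C (comp_map (base_change k C \<gamma> L \<iota>) (bc_proj k C \<gamma> L \<iota>) \<Gamma>) c"

record ('p, 's, 'm) tau_sheaf =
  rank :: nat
  dimension :: nat
  sheaf :: "int \<Rightarrow> ('p, 's, 'm) module_sheaf"
  Pi_map :: "int \<Rightarrow> 'p set \<Rightarrow> 'm \<Rightarrow> 'm"
  tau_map :: "int \<Rightarrow> 'p set \<Rightarrow> ('p, 's, 'p, 'm) pb_sect \<Rightarrow> 'm"

primrec Pi_iter :: "('p, 's, 'm) tau_sheaf \<Rightarrow> int \<Rightarrow> nat \<Rightarrow> 'p set \<Rightarrow> 'm \<Rightarrow> 'm" where
  "Pi_iter T i 0 U s = s"
| "Pi_iter T i (Suc n) U s = Pi_map T (i + int n) U (Pi_iter T i n U s)"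

text \<open>Abelian \<open>\<tau>\<close>-sheaves on an \<open>L\<close>-scheme \<open>X\<close> (structure map \<open>\<delta>\<close>) with endomorphism \<open>\<sigma>\<close>, ideal
  sheaves \<open>\<I> n\<close> (for \<open>\<O>(-n\<cdot>\<infinity>)\<close>) and ideal sheaf \<open>\<J>\<close> of the graph. The subsheaf \<open>F(-n\<cdot>\<infinity>)\<close>
  of \<open>F\<close> is the image \<open>\<O>(-n\<cdot>\<infinity>)\<cdot>F\<close> of \<open>F \<otimes> \<O>(-n\<cdot>\<infinity>)\<close>. The last conjunct of the periodicity
  condition is \<open>\<tau>\<^sub>i\<^sub>+\<^sub>l = \<tau>\<^sub>i \<otimes> 1\<close>, twisted by \<open>-n\<cdot>\<infinity>\<close>, i.e. under the identification
  of \<open>F\<^sub>i\<close> with \<open>F\<^sub>i\<^sub>+\<^sub>l(-n\<cdot>\<infinity>)\<close>.\<close>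

definition abelian_tau_sheaf_on ::
    "'l ring \<Rightarrow> ('p, 's) ringed_space \<Rightarrow> ('l \<Rightarrow> 's) \<Rightarrow> ('p, 's, 'p, 's) rs_map
      \<Rightarrow> (nat \<Rightarrow> 'p set \<Rightarrow> 's set) \<Rightarrow> ('p set \<Rightarrow> 's set) \<Rightarrow> ('p, 's, 'm) tau_sheaf \<Rightarrow> bool" where
  "abelian_tau_sheaf_on L X \<delta> \<sigma> \<I> \<J> T \<longleftrightarrow>
     (\<forall>i. locally_free X (sheaf T i) (rank T)) \<and>
     (\<forall>i. sheaf_hom X (sheaf T i) (sheaf T (i + 1)) (Pi_map T i) \<and>
        sheaf_inj X (sheaf T i) (Pi_map T i)) \<and>
     (\<forall>i. sheaf_hom X (pullback X X \<sigma> (sheaf T i)) (sheaf T (i + 1)) (tau_map T i) \<and>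
        sheaf_inj X (pullback X X \<sigma> (sheaf T i)) (tau_map T i)) \<and>
     (\<forall>i U. opn X U \<longrightarrow> (\<forall>s \<in> carrier (msect (pullback X X \<sigma> (sheaf T i)) U).
        Pi_map T (i + 1) U (tau_map T i U s) =
        tau_map T (i + 1) U (pullback_map X X \<sigma> (sheaf T (i + 1)) (Pi_map T i) U s))) \<and>
     (\<exists>n l. 0 < n \<and> 0 < l \<and> l * dimension T = n * rank T \<and>
        (\<forall>i U. opn X U \<longrightarrow>
           Pi_iter T i l U ` carrier (msect (sheaf T i) U) =
             ideal_times X (sheaf T (i + int l)) (\<I> n)
               (\<lambda>W. carrier (msect (sheaf T (i + int l)) W)) U \<and>
           (\<forall>s \<in> carrier (msect (pullback X X \<sigma> (sheaf T i)) U).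
              tau_map T (i + int l) U
                (pullback_map X X \<sigma> (sheaf T (i + int l)) (Pi_iter T i l) U s) =
              Pi_iter T (i + 1) l U (tau_map T i U s)))) \<and>
     (\<forall>i. has_dim L X \<delta> (cokernel X (sheaf T i) (sheaf T (i + 1)) (Pi_map T i)) (dimension T)) \<and>
     (\<forall>i. let Q = cokernel X (pullback X X \<sigma> (sheaf T i)) (sheaf T (i + 1)) (tau_map T i) in
        has_dim L X \<delta> Q (dimension T) \<and>
        (\<forall>U. opn X U \<longrightarrow> (\<forall>a \<in> ideal_pow X \<J> (dimension T) U. \<forall>s \<in> carrier (msect Q U).
           a \<odot>\<^bsub>msect Q U\<^esub> s = \<zero>\<^bsub>msect Q U\<^esub>)))"

text \<open>Abelian \<open>\<tau>\<close>-sheaves on \<open>C\<^sub>L\<close>; the characteristic \<open>c\<close> enters through its graph \<open>\<Gamma>\<close>.\<close>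

definition abelian_tau_sheaf ::
    "'k ring \<Rightarrow> ('p, 's) ringed_space \<Rightarrow> ('k \<Rightarrow> 's)
      \<Rightarrow> ('k set, 'k set \<Rightarrow> ('k \<times> 'k) set, 'p, 's) rs_map \<Rightarrow> 'l ring \<Rightarrow> ('k \<Rightarrow> 'l)
      \<Rightarrow> ('l set, 'l set \<Rightarrow> ('l \<times> 'l) set, ('p, 's, 'l) bc_point, ('p, 's, 'l) bc_fun) rs_map
      \<Rightarrow> (('p, 's, 'l) bc_point, ('p, 's, 'l) bc_fun, 'm) tau_sheaf \<Rightarrow> bool" where
  "abelian_tau_sheaf k C \<gamma> pinf L \<iota> \<Gamma> T \<longleftrightarrow>
     abelian_tau_sheaf_on L (base_change k C \<gamma> L \<iota>) (bc_const k C \<gamma> L \<iota>) (rel_frob k C \<gamma> L \<iota>)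
       (O_minus k C \<gamma> L \<iota> pinf) (kernel_ideal (Spec L) (base_change k C \<gamma> L \<iota>) \<Gamma>) T"

text \<open>Morphisms are normalized to be \<open>undefined\<close> outside the sections over open sets, so that
  equal morphisms are equal functions.\<close>

definition tau_Hom ::
    "('p, 's) ringed_space \<Rightarrow> ('p, 's, 'p, 's) rs_map \<Rightarrow> ('p, 's, 'm) tau_sheaf
      \<Rightarrow> ('p, 's, 'n) tau_sheaf \<Rightarrow> (int \<Rightarrow> 'p set \<Rightarrow> 'm \<Rightarrow> 'n) set" where
  "tau_Hom X \<sigma> T T' = {f.
     (\<forall>i U. f i U \<in> extensional (if opn X U then carrier (msect (sheaf T i) U) else {})) \<and>
     (\<forall>i. sheaf_hom X (sheaf T i) (sheaf T' i) (f i)) \<and>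
     (\<forall>i U. opn X U \<longrightarrow> (\<forall>s \<in> carrier (msect (sheaf T i) U).
        f (i + 1) U (Pi_map T i U s) = Pi_map T' i U (f i U s))) \<and>
     (\<forall>i U. opn X U \<longrightarrow> (\<forall>s \<in> carrier (msect (pullback X X \<sigma> (sheaf T i)) U).
        f (i + 1) U (tau_map T i U s) =
        tau_map T' i U (pullback_map X X \<sigma> (sheaf T' i) (f i) U s)))}"

definition tau_zero_hom ::
    "('p, 's) ringed_space \<Rightarrow> ('p, 's, 'm) tau_sheaf \<Rightarrow> ('p, 's, 'n) tau_sheaf
      \<Rightarrow> int \<Rightarrow> 'p set \<Rightarrow> 'm \<Rightarrow> 'n" where
  "tau_zero_hom X T T' i U =
     (\<lambda>s \<in> (if opn X U then carrier (msect (sheaf T i) U) else {}). \<zero>\<^bsub>msect (sheaf T' i) U\<^esub>)"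

definition is_zero_tau_sheaf :: "('p, 's) ringed_space \<Rightarrow> ('p, 's, 'm) tau_sheaf \<Rightarrow> bool" where
  "is_zero_tau_sheaf X T \<longleftrightarrow>
     (\<forall>i U. opn X U \<longrightarrow> carrier (msect (sheaf T i) U) = {\<zero>\<^bsub>msect (sheaf T i) U\<^esub>})"

definition weight :: "('p, 's) ringed_space \<Rightarrow> ('p, 's, 'm) tau_sheaf \<Rightarrow> rat" where
  "weight X T = (if is_zero_tau_sheaf X T then 0 else of_nat (dimension T) / of_nat (rank T))"

end

theory Submission
  imports Defs "HOL-Algebra.Ideal_Product" "HOL-Algebra.Sylow" "HOL-Algebra.Multiplicative_Group"
begin

text \<open>
  Let \<open>f : F \<rightarrow> F'\<close> be a nonzero homomorphism. The weight \<open>d / r\<close> of \<open>F\<close> equals \<open>n / l\<close>, where the \<open>l\<close>-fold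
  composition of the maps \<open>\<Pi>\<close> identifies \<open>F\<^sub>i\<close> with \<open>\<O>(-n\<cdot>\<infinity>) F\<^sub>i\<^sub>+\<^sub>l\<close>, and likewise \<open>n' / l'\<close> for \<open>F'\<close>. The
  proof compares these slopes on the stalks at a point \<open>y\<close> of \<open>C\<^sub>L\<close> over \<open>\<infinity>\<close>; such a point is the kernel of the
  evaluation \<open>\<O>\<^sub>C\<^sub>,\<^sub>\<infinity> \<otimes> L \<rightarrow> L\<close> (\<open>point_over_infinity\<close>).

  Let \<open>A\<close> be the local ring at \<open>y\<close>. It is regular, hence a noetherian domain (\<open>regular_local_ring_domain\<close>, by
  Krull's principal ideal theorem). The ideal of \<open>\<infinity>\<close> generates an ideal of \<open>A\<close>, and \<open>\<O>(-n\<cdot>\<infinity>)\<close> has the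
  \<open>n\<close>-th power \<open>D n\<close> of this ideal as stalk. A stalk of \<open>F\<close> is a free module that is isomorphic to \<open>D n\<close>
  times a free module, which forces \<open>D n\<close>, and then all \<open>D q\<close>, to be principal: \<open>D q\<close> is
  generated by \<open>w\<^sup>q\<close> for some nonunit \<open>w\<close> (\<open>principal_of_free_image\<close>, \<open>D_principal\<close>). So going \<open>l l' q\<close> steps
  through \<open>F\<close> multiplies by \<open>w\<close> to the power \<open>n l' q\<close>, and through \<open>F'\<close> to the power \<open>n' l q\<close>. If these
  exponents differ, commuting with \<open>\<Pi>\<close> makes the values of \<open>f\<close> on the stalks divisible by arbitrarily high powers
  of \<open>w\<close>, and they vanish by Krull's intersection theorem (\<open>periodic_system_slope\<close>).

  A homomorphism that vanishes at one stalk vanishes near it, and then everywhere, because \<open>C\<^sub>L\<close> is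
  irreducible with local rings that are domains (\<open>hom_zero_everywhere\<close>). What is used here is that a function on
  \<open>C\<^sub>L\<close> that has value zero in all local rings over some nonempty open set has zero germs everywhere
  (\<open>germ_zero_everywhere\<close>). Functions on \<open>C\<^sub>L\<close> are given locally by elements of \<open>\<O>\<^sub>C(U) \<otimes> L\<close>, while
  points and local rings refer to \<open>\<O>\<^sub>C\<^sub>,\<^sub>x \<otimes> L\<close>, and the passage between the two rests on lifting
  tensor relations from a stalk to an affine neighbourhood (\<open>tensor_relation_lifts\<close>).

  Finally, the set of homomorphisms differs from \<open>{0}\<close> because of a nonzero member and not for want of \<open>0\<close>. That \<open>0\<close>
  commutes with \<open>\<tau>\<close> depends on \<open>\<sigma>\<close> acting on germs, that is, on the additivity of the \<open>q\<close>-th power map on \<open>L\<close>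
  (\<open>zero_hom_in_tau_Hom\<close>).
\<close>

section \<open>Ideals of noetherian rings\<close>

lemma (in cring) idealI_cring:
  assumes "I \<subseteq> carrier R" "\<zero> \<in> I" "\<And>a b. a \<in> I \<Longrightarrow> b \<in> I \<Longrightarrow> a \<oplus> b \<in> I"
    "\<And>a r. a \<in> I \<Longrightarrow> r \<in> carrier R \<Longrightarrow> r \<otimes> a \<in> I"
  shows "ideal I R"
proof (rule idealI)
  show "subgroup I (add_monoid R)"
  proof (rule subgroup.intro)
    fix x assume x: "x \<in> I"
    then have "(\<ominus> \<one>) \<otimes> x \<in> I" using assms(4) by simp
    moreover have "(\<ominus> \<one>) \<otimes> x = \<ominus> x" using x assms(1) by (simp add: l_minus subsetD)
    ultimately show "inv\<^bsub>add_monoid R\<^esub> x \<in> I" by (simp add: a_inv_def)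
  qed (use assms in auto)
  show "ring R" by unfold_locales
  fix a x assume a: "a \<in> I" and x: "x \<in> carrier R"
  show "x \<otimes> a \<in> I" using assms(4) a x .
  then show "a \<otimes> x \<in> I" using a x assms(1) m_comm by (metis subsetD)
qed

lemma (in ring) ideal_diff: "ideal I R \<Longrightarrow> a \<in> I \<Longrightarrow> b \<in> I \<Longrightarrow> a \<ominus> b \<in> I"
  unfolding minus_eq by (simp add: additive_subgroup.a_closed additive_subgroup.a_inv_closed ideal.axioms(1))

lemma (in ring) ideal_add: "ideal I R \<Longrightarrow> a \<in> I \<Longrightarrow> b \<in> I \<Longrightarrow> a \<oplus> b \<in> I"
  by (simp add: additive_subgroup.a_closed ideal.axioms(1))

text \<open>In a noetherian ring chains of ideals have a largest member, so Zorn's lemma applies to any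
  set of ideals.\<close>

lemma (in noetherian_ring) maximal_member:
  assumes "S \<subseteq> {I. ideal I R}" "S \<noteq> {}"
  shows "\<exists>M\<in>S. \<forall>I\<in>S. M \<subseteq> I \<longrightarrow> I = M"
proof (rule subset_Zorn)
  fix \<C> assume c: "subset.chain S \<C>"
  show "\<exists>U\<in>S. \<forall>X\<in>\<C>. X \<subseteq> U"
  proof (cases "\<C> = {}")
    case True then show ?thesis using assms(2) by auto
  next
    case False
    have "subset.chain {I. ideal I R} \<C>" using c assms(1) by (auto simp: subset.chain_def)
    then have "\<Union>\<C> \<in> \<C>" using ideal_chain_is_trivial False by blast
    moreover have "\<C> \<subseteq> S" using c by (auto simp: subset.chain_def)
    ultimately show ?thesis by blast
  qed
qed

subsection \<open>Saturation at a prime ideal\<close>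

text \<open>The saturation at \<open>Q\<close> is the contraction of the extension of an ideal to the localization
  at \<open>Q\<close>. Working with saturated ideals replaces the passage to the localization.\<close>

definition saturated :: "('a, 'b) ring_scheme \<Rightarrow> 'a set \<Rightarrow> 'a set \<Rightarrow> bool" where
  "saturated R Q I \<longleftrightarrow> (\<forall>s \<in> carrier R - Q. \<forall>r \<in> carrier R. s \<otimes>\<^bsub>R\<^esub> r \<in> I \<longrightarrow> r \<in> I)"

definition saturation :: "('a, 'b) ring_scheme \<Rightarrow> 'a set \<Rightarrow> 'a set \<Rightarrow> 'a set" where
  "saturation R Q I = {r \<in> carrier R. \<exists>s \<in> carrier R - Q. s \<otimes>\<^bsub>R\<^esub> r \<in> I}"

context cring
begin

lemma prime_compl_mult:
  assumes "primeideal Q R" "s \<in> carrier R - Q" "t \<in> carrier R - Q"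
  shows "s \<otimes> t \<in> carrier R - Q"
  using assms primeideal.I_prime[OF assms(1)] by auto

lemma prime_compl_one: "primeideal Q R \<Longrightarrow> \<one> \<in> carrier R - Q"
  using ideal.one_imp_carrier[of Q R] primeideal.I_notcarr[of Q R] primeideal.axioms(1) by auto

lemma ideal_saturation:
  assumes Q: "primeideal Q R" and I: "ideal I R"
  shows "ideal (saturation R Q I) R"
proof (rule idealI_cring)
  show "\<zero> \<in> saturation R Q I" unfolding saturation_def
    using prime_compl_one[OF Q] additive_subgroup.zero_closed[OF ideal.axioms(1)[OF I]] by force
next
  fix a b assume a: "a \<in> saturation R Q I" and b: "b \<in> saturation R Q I"
  then obtain s t where s: "s \<in> carrier R - Q" "s \<otimes> a \<in> I" and t: "t \<in> carrier R - Q" "t \<otimes> b \<in> I"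
    and ab: "a \<in> carrier R" "b \<in> carrier R" by (auto simp: saturation_def)
  have st: "s \<in> carrier R" "t \<in> carrier R" using s t by auto
  have "(s \<otimes> t) \<otimes> (a \<oplus> b) = t \<otimes> (s \<otimes> a) \<oplus> s \<otimes> (t \<otimes> b)" using st ab by algebra
  also have "\<dots> \<in> I" using s t ideal_add[OF I] ideal.I_l_closed[OF I] by auto
  finally show "a \<oplus> b \<in> saturation R Q I"
    unfolding saturation_def using prime_compl_mult[OF Q s(1) t(1)] ab by auto
next
  fix a r assume "a \<in> saturation R Q I" and r: "r \<in> carrier R"
  then obtain s where s: "s \<in> carrier R - Q" "s \<otimes> a \<in> I" and a: "a \<in> carrier R" by (auto simp: saturation_def)
  have "s \<otimes> (r \<otimes> a) = r \<otimes> (s \<otimes> a)" using DiffD1[OF s(1)] a r by algebra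
  also have "\<dots> \<in> I" using s r ideal.I_l_closed[OF I] by auto
  finally show "r \<otimes> a \<in> saturation R Q I" unfolding saturation_def using s a r by auto
qed (auto simp: saturation_def)

lemma subset_saturation: "primeideal Q R \<Longrightarrow> ideal I R \<Longrightarrow> I \<subseteq> saturation R Q I"
  unfolding saturation_def using prime_compl_one ideal.Icarr[of I R] by (force simp: )

lemma saturated_saturation:
  assumes Q: "primeideal Q R" and I: "ideal I R"
  shows "saturated R Q (saturation R Q I)"
  unfolding saturated_def
proof (intro ballI impI)
  fix s r assume s: "s \<in> carrier R - Q" and r: "r \<in> carrier R" and "s \<otimes> r \<in> saturation R Q I"
  then obtain t where t: "t \<in> carrier R - Q" "t \<otimes> (s \<otimes> r) \<in> I" by (auto simp: saturation_def)
  then have "(t \<otimes> s) \<otimes> r \<in> I" using s r by (simp add: m_assoc)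
  then show "r \<in> saturation R Q I" using prime_compl_mult[OF Q t(1) s] r by (auto simp: saturation_def)
qed

lemma saturatedD: "saturated R Q I \<Longrightarrow> s \<in> carrier R - Q \<Longrightarrow> r \<in> carrier R \<Longrightarrow> s \<otimes> r \<in> I \<Longrightarrow> r \<in> I"
  by (auto simp: saturated_def)

lemma saturated_subset_prime:
  assumes "saturated R Q I" "ideal I R" "I \<noteq> carrier R"
  shows "I \<subseteq> Q"
proof
  fix r assume r: "r \<in> I"
  show "r \<in> Q"
  proof (rule ccontr)
    assume "r \<notin> Q"
    then have "r \<in> carrier R - Q" using r ideal.Icarr[OF assms(2)] by auto
    then have "\<one> \<in> I" using saturatedD[OF assms(1), of r \<one>] r by auto
    then show False using ideal.one_imp_carrier[OF assms(2)] assms(3) by auto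
  qed
qed

lemma ideal_plus_principal:
  assumes "ideal I R" "b \<in> carrier R"
  shows "ideal {i \<oplus> r \<otimes> b | i r. i \<in> I \<and> r \<in> carrier R} R" (is "ideal ?J R")
proof (rule idealI_cring)
  note I = ideal.Icarr[OF assms(1)]
  show "?J \<subseteq> carrier R" using I assms(2) by auto
  have "\<zero> = \<zero> \<oplus> \<zero> \<otimes> b" using assms(2) by simp
  then show "\<zero> \<in> ?J" using additive_subgroup.zero_closed[OF ideal.axioms(1)[OF assms(1)]] by blast
  fix x y assume "x \<in> ?J" "y \<in> ?J"
  then obtain i r j s where *: "i \<in> I" "r \<in> carrier R" "x = i \<oplus> r \<otimes> b" "j \<in> I" "s \<in> carrier R" "y = j \<oplus> s \<otimes> b" by blast
  have "x \<oplus> y = (i \<oplus> j) \<oplus> (r \<oplus> s) \<otimes> b" using * I[of i] I[of j] assms(2) by algebra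
  then show "x \<oplus> y \<in> ?J" using * ideal_add[OF assms(1)] by blast
next
  note I = ideal.Icarr[OF assms(1)]
  fix x t assume "x \<in> ?J" and t: "t \<in> carrier R"
  then obtain i r where *: "i \<in> I" "r \<in> carrier R" "x = i \<oplus> r \<otimes> b" by blast
  have "t \<otimes> x = (t \<otimes> i) \<oplus> (t \<otimes> r) \<otimes> b" using * I[of i] assms(2) t by algebra
  then show "t \<otimes> x \<in> ?J" using * t ideal.I_l_closed[OF assms(1)] m_closed by blast
qed

lemma subset_plus_principal:
  assumes "ideal I R" "b \<in> carrier R"
  shows "I \<subseteq> {i \<oplus> r \<otimes> b | i r. i \<in> I \<and> r \<in> carrier R}" "b \<in> {i \<oplus> r \<otimes> b | i r. i \<in> I \<and> r \<in> carrier R}"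
proof -
  show "I \<subseteq> {i \<oplus> r \<otimes> b | i r. i \<in> I \<and> r \<in> carrier R}"
  proof
    fix i assume i: "i \<in> I"
    then have "i = i \<oplus> \<zero> \<otimes> b" using ideal.Icarr[OF assms(1)] assms(2) by simp
    then show "i \<in> {i \<oplus> r \<otimes> b | i r. i \<in> I \<and> r \<in> carrier R}" using i by blast
  qed
  have "b = \<zero> \<oplus> \<one> \<otimes> b" using assms(2) by simp
  then show "b \<in> {i \<oplus> r \<otimes> b | i r. i \<in> I \<and> r \<in> carrier R}"
    using additive_subgroup.zero_closed[OF ideal.axioms(1)[OF assms(1)]] by blast
qed

lemma ideal_colon:
  assumes "ideal I R" "b \<in> carrier R"
  shows "ideal {r \<in> carrier R. r \<otimes> b \<in> I} R"
proof (rule idealI_cring)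
  show "\<zero> \<in> {r \<in> carrier R. r \<otimes> b \<in> I}"
    using assms additive_subgroup.zero_closed[OF ideal.axioms(1)[OF assms(1)]] by simp
qed (use assms in \<open>auto simp: l_distr m_assoc ideal_add ideal.I_l_closed\<close>)

end

subsection \<open>Krull's principal ideal theorem\<close>

context cring
begin

text \<open>If \<open>Q\<close> is minimal over \<open>a\<close> then the localization at \<open>Q\<close> is artinian modulo \<open>a\<close>. Noetherian
  induction avoids lengths: if \<open>b c \<in> a\<close> with \<open>b, c \<notin> a\<close>, then an ideal \<open>J\<close> above \<open>a\<close> is determined
  by \<open>J + (b)\<close> and \<open>J : b\<close> among the ideals comparable with it, and both lie above strictly larger ideals than \<open>a\<close>.\<close>

lemma saturated_dcc:
  assumes "noetherian_ring R" and Q: "primeideal Q R"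
    and a: "ideal a R" "saturated R Q a" "\<And>p. primeideal p R \<Longrightarrow> a \<subseteq> p \<Longrightarrow> p \<subseteq> Q \<Longrightarrow> Q \<subseteq> p"
    and J: "\<And>n :: nat. ideal (J n) R" "\<And>n. saturated R Q (J n)" "\<And>n. a \<subseteq> J n" "\<And>n. J (Suc n) \<subseteq> J n"
  shows "\<exists>N. \<forall>n\<ge>N. J n = J N"
proof (rule ccontr)
  interpret N: noetherian_ring R by fact
  define desc where "desc a J \<longleftrightarrow>
      (\<forall>n :: nat. ideal (J n) R \<and> saturated R Q (J n) \<and> a \<subseteq> J n \<and> J (Suc n) \<subseteq> J n)" for a J
  define stops where "stops J \<longleftrightarrow> (\<exists>N :: nat. \<forall>n\<ge>N. J n = J N)" for J :: "nat \<Rightarrow> 'a set"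
  have stopsI: "stops J" if "\<forall>n\<ge>N. J n = J N" for J N using that unfolding stops_def by (rule exI)
  define Bad where "Bad = {a. ideal a R \<and> saturated R Q a \<and>
     (\<forall>p. primeideal p R \<and> a \<subseteq> p \<and> p \<subseteq> Q \<longrightarrow> Q \<subseteq> p) \<and> (\<exists>J. desc a J \<and> \<not> stops J)}"
  assume "\<nexists>N. \<forall>n\<ge>N. J n = J N"
  then have nJ: "\<not> stops J" unfolding stops_def .
  have "desc a J" unfolding desc_def using J(1,2,3,4) by (intro allI conjI)
  then have "\<exists>J. desc a J \<and> \<not> stops J" using nJ by blast
  moreover have "\<forall>p. primeideal p R \<and> a \<subseteq> p \<and> p \<subseteq> Q \<longrightarrow> Q \<subseteq> p" using a(3) by blast
  ultimately have "a \<in> Bad" unfolding Bad_def using a(1,2) by simp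
  then have "Bad \<noteq> {}" by (rule_tac notI) simp
  moreover have "Bad \<subseteq> {I. ideal I R}" by (auto simp: Bad_def)
  ultimately have "\<exists>M\<in>Bad. \<forall>I\<in>Bad. M \<subseteq> I \<longrightarrow> I = M" using N.maximal_member[of Bad] by simp
  then obtain M where M: "M \<in> Bad" and max: "\<forall>I\<in>Bad. M \<subseteq> I \<longrightarrow> I = M" by (elim bexE)
  have Mi: "ideal M R" and Ms: "saturated R Q M"
    and Mp': "\<forall>p. primeideal p R \<and> M \<subseteq> p \<and> p \<subseteq> Q \<longrightarrow> Q \<subseteq> p" and "\<exists>H. desc M H \<and> \<not> stops H"
    using M unfolding Bad_def by simp_all
  then obtain H where "desc M H" and nst: "\<not> stops H" by blast
  then have H: "\<And>n :: nat. ideal (H n) R" "\<And>n. saturated R Q (H n)" "\<And>n. M \<subseteq> H n" "\<And>n. H (Suc n) \<subseteq> H n"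
    unfolding desc_def by auto
  have dec: "H m \<subseteq> H n" if "n \<le> m" for m n using lift_Suc_antimono_le[of H] H(4) that by blast
  have Mp: "\<And>p. primeideal p R \<Longrightarrow> M \<subseteq> p \<Longrightarrow> p \<subseteq> Q \<Longrightarrow> Q \<subseteq> p" using Mp' by blast
  note Mc = ideal.Icarr[OF Mi]
  have stab: "\<exists>N. \<forall>n\<ge>N. G n = G N"
    if G: "\<And>n :: nat. ideal (G n) R" "\<And>n. saturated R Q (G n)" "\<And>n. I \<subseteq> G n" "\<And>n. G (Suc n) \<subseteq> G n"
      and I: "ideal I R" "saturated R Q I" "M \<subset> I" for G I
  proof (rule ccontr)
    assume "\<not> ?thesis"
    then have "\<not> stops G" by (simp add: stops_def)
    moreover have "\<forall>p. primeideal p R \<and> I \<subseteq> p \<and> p \<subseteq> Q \<longrightarrow> Q \<subseteq> p" using Mp I(3) by blast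
    moreover have "desc I G" using G by (simp add: desc_def)
    ultimately have "I \<in> Bad" unfolding Bad_def using I(1,2) \<open>\<not> stops G\<close> by (intro CollectI conjI exI[of _ G])
    then have "I = M" using max I(3) by (simp add: psubset_eq)
    then show False using I(3) by simp
  qed
  have Mne: "M \<noteq> carrier R"
  proof
    assume "M = carrier R"
    then have "carrier R \<subseteq> H n" "H n \<subseteq> carrier R" for n using H(3)[of n] ideal.Icarr[OF H(1)[of n]] by auto
    then have "H n = carrier R" for n by (rule subset_antisym[rotated])
    then have "\<forall>n\<ge>0. H n = H 0" by simp
    from nst stopsI[OF this] show False ..
  qed
  then have MQ: "M \<subseteq> Q" using saturated_subset_prime Ms Mi by blast
  show False
  proof (cases "\<exists>b c. b \<in> carrier R \<and> c \<in> carrier R \<and> b \<otimes> c \<in> M \<and> b \<notin> M \<and> c \<notin> M")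
    case False
    then have "primeideal M R" using Mi Mne cring_axioms by (intro primeidealI) auto
    then have "M = Q" using Mp MQ by auto
    then have cases: "H n = Q \<or> H n = carrier R" for n
      using H(3)[of n] saturated_subset_prime[OF H(2,1)[of n]] \<open>M = Q\<close> by auto
    show False
    proof (cases "\<exists>n. H n = Q")
      case True
      then obtain n where "H n = Q" by auto
      then have "\<forall>m\<ge>n. H m = H n" using dec[of n] H(3) \<open>M = Q\<close> by (intro allI impI subset_antisym) auto
      from nst stopsI[OF this] show False ..
    next
      case False
      then have "\<forall>n\<ge>0. H n = H 0" using cases by simp
      from nst stopsI[OF this] show False ..
    qed
  next
    case True
    then obtain b c where b: "b \<in> carrier R" and c: "c \<in> carrier R" and bc: "b \<otimes> c \<in> M" and bM: "b \<notin> M" and cM: "c \<notin> M" by blast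
    define A where "A I = saturation R Q {i \<oplus> r \<otimes> b | i r. i \<in> I \<and> r \<in> carrier R}" for I
    define B where "B I = {r \<in> carrier R. r \<otimes> b \<in> I}" for I
    have A: "ideal (A I) R" "saturated R Q (A I)" "I \<subseteq> A I" "b \<in> A I" if "ideal I R" for I
      unfolding A_def using subset_saturation[OF Q ideal_plus_principal[OF that b]] subset_plus_principal[OF that b]
      by (auto intro: ideal_saturation saturated_saturation Q ideal_plus_principal that b)
    have B: "ideal (B I) R" if "ideal I R" for I unfolding B_def using ideal_colon that b by blast
    have Bs: "saturated R Q (B I)" if "saturated R Q I" for I
      using that b unfolding saturated_def B_def by (auto simp: m_assoc)
    have A_mono: "A I \<subseteq> A I'" if "I \<subseteq> I'" for I I' using that unfolding A_def saturation_def by blast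
    have B_mono: "B I \<subseteq> B I'" if "I \<subseteq> I'" for I I' using that unfolding B_def by blast
    have "M \<subset> A M" using A[OF Mi] bM by blast
    from stab[of "\<lambda>n. A (H n)" "A M", OF A(1)[OF H(1)] A(2)[OF H(1)] A_mono[OF H(3)] A_mono[OF H(4)] A(1)[OF Mi] A(2)[OF Mi] this]
    obtain N1 where N1: "\<forall>n\<ge>N1. A (H n) = A (H N1)" ..
    have "M \<subseteq> B M" using Mc b ideal.I_r_closed[OF Mi] by (auto simp: B_def)
    moreover have "c \<in> B M" using c bc b m_comm by (simp add: B_def)
    ultimately have "M \<subset> B M" using cM by (metis psubsetI)
    from stab[of "\<lambda>n. B (H n)" "B M", OF B[OF H(1)] Bs[OF H(2)] B_mono[OF H(3)] B_mono[OF H(4)] B[OF Mi] Bs[OF Ms] this]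
    obtain N2 where N2: "\<forall>n\<ge>N2. B (H n) = B (H N2)" ..
    have "H n = H (max N1 N2)" if n: "n \<ge> max N1 N2" for n
    proof
      show "H n \<subseteq> H (max N1 N2)" using dec n by blast
      show "H (max N1 N2) \<subseteq> H n"
      proof
        fix z assume z: "z \<in> H (max N1 N2)"
        have zc: "z \<in> carrier R" using z ideal.Icarr[OF H(1)] by blast
        have "A (H (max N1 N2)) = A (H n)"
          using N1[rule_format, of n] N1[rule_format, of "max N1 N2"] n by simp
        then have "z \<in> A (H n)" using z A(3)[OF H(1)[of "max N1 N2"]] by auto
        then obtain s i r where s: "s \<in> carrier R - Q" and i: "i \<in> H n" and r: "r \<in> carrier R"
          and eq: "s \<otimes> z = i \<oplus> r \<otimes> b" unfolding A_def saturation_def by blast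
        have ic: "i \<in> carrier R" using i ideal.Icarr[OF H(1)] by blast
        have "r \<otimes> b = s \<otimes> z \<ominus> i" unfolding eq using ic r b by algebra
        moreover have "s \<otimes> z \<ominus> i \<in> H (max N1 N2)"
          using ideal_diff[OF H(1) ideal.I_l_closed[OF H(1) z] subsetD[OF dec[OF n] i]] s by simp
        ultimately have "r \<in> B (H (max N1 N2))" using r by (simp add: B_def)
        also have "B (H (max N1 N2)) = B (H n)"
          using N2[rule_format, of n] N2[rule_format, of "max N1 N2"] n by simp
        finally have "r \<otimes> b \<in> H n" by (simp add: B_def)
        then have "s \<otimes> z \<in> H n" using eq i ideal_add[OF H(1)] by simp
        then show "z \<in> H n" using saturatedD[OF H(2) s zc] by blast
      qed
    qed
    then have "\<forall>n\<ge>max N1 N2. H n = H (max N1 N2)" by blast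
    from nst stopsI[OF this] show False ..
  qed
qed

text \<open>Nakayama's lemma for \<open>N \<subseteq> K + x N\<close> in the localization at \<open>Q \<ni> x\<close>. Writing \<open>a = k + x a'\<close>
  gives \<open>K + (a) \<subseteq> K + (a')\<close>, and where such an ideal is maximal \<open>a'\<close> is a multiple of \<open>a\<close>
  modulo \<open>K\<close>, so that \<open>(1 - c x) a' \<in> K\<close>.\<close>

lemma saturated_nakayama:
  assumes "noetherian_ring R" and Q: "primeideal Q R" and K: "ideal K R" "saturated R Q K" and x: "x \<in> Q"
    and N: "N \<subseteq> carrier R"
    and step: "\<And>a. a \<in> N \<Longrightarrow> \<exists>s \<in> carrier R - Q. \<exists>k\<in>K. \<exists>a'\<in>N. s \<otimes> a = k \<oplus> x \<otimes> a'"
  shows "N \<subseteq> K"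
proof
  interpret N: noetherian_ring R by fact
  have Qi: "ideal Q R" using Q primeideal.axioms by blast
  define E where "E a = {i \<oplus> r \<otimes> a | i r. i \<in> K \<and> r \<in> carrier R}" for a
  define A where "A a = saturation R Q (E a)" for a
  note Kc = ideal.Icarr[OF K(1)]
  have xc: "x \<in> carrier R" using x ideal.Icarr[OF Qi] by blast
  have E: "ideal (E a) R" "K \<subseteq> E a" "a \<in> E a" if "a \<in> N" for a
    unfolding E_def using ideal_plus_principal[OF K(1)] subset_plus_principal[OF K(1)] that N by auto
  have A: "ideal (A a) R" "E a \<subseteq> A a" if "a \<in> N" for a
    unfolding A_def using ideal_saturation[OF Q E(1)[OF that]] subset_saturation[OF Q E(1)[OF that]] by auto
  fix a0 assume a0: "a0 \<in> N"
  define S where "S = {A a | a. a \<in> N \<and> A a0 \<subseteq> A a}"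
  have "S \<noteq> {}" using a0 by (auto simp: S_def)
  moreover have "S \<subseteq> {I. ideal I R}" using A by (auto simp: S_def)
  ultimately have "\<exists>M\<in>S. \<forall>I\<in>S. M \<subseteq> I \<longrightarrow> I = M" using N.maximal_member[of S] by simp
  then obtain M where "M \<in> S" and max: "\<forall>I\<in>S. M \<subseteq> I \<longrightarrow> I = M" by (elim bexE)
  then obtain a where a: "a \<in> N" "A a0 \<subseteq> A a" and M: "M = A a" by (auto simp: S_def)
  obtain s k a' where s: "s \<in> carrier R - Q" and k: "k \<in> K" and a': "a' \<in> N" and eq: "s \<otimes> a = k \<oplus> x \<otimes> a'"
    using step[OF a(1)] by blast
  have c: "s \<in> carrier R" "k \<in> carrier R" "a \<in> carrier R" "a' \<in> carrier R" using s k a a' N Kc by auto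
  have "A a \<subseteq> A a'"
  proof
    fix r assume "r \<in> A a"
    then obtain t i d where r: "r \<in> carrier R" and t: "t \<in> carrier R - Q" and i: "i \<in> K" and d: "d \<in> carrier R"
      and e: "t \<otimes> r = i \<oplus> d \<otimes> a" unfolding A_def saturation_def E_def by blast
    have c': "t \<in> carrier R" "i \<in> carrier R" using t i Kc by auto
    have "(s \<otimes> t) \<otimes> r = s \<otimes> (t \<otimes> r)" using c c' r by algebra
    also have "\<dots> = s \<otimes> i \<oplus> d \<otimes> (s \<otimes> a)" unfolding e using c c' r d by algebra
    also have "\<dots> = (s \<otimes> i \<oplus> d \<otimes> k) \<oplus> (d \<otimes> x) \<otimes> a'" unfolding eq using c c' r d xc by algebra
    finally have "(s \<otimes> t) \<otimes> r = (s \<otimes> i \<oplus> d \<otimes> k) \<oplus> (d \<otimes> x) \<otimes> a'" .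
    moreover have "s \<otimes> i \<oplus> d \<otimes> k \<in> K" using i k c d by (intro ideal_add[OF K(1)] ideal.I_l_closed[OF K(1)])
    ultimately have "(s \<otimes> t) \<otimes> r \<in> E a'" unfolding E_def using d xc m_closed by blast
    then show "r \<in> A a'" unfolding A_def saturation_def using r prime_compl_mult[OF Q s t] by blast
  qed
  moreover have "A a' \<in> S" using a(2) a' calculation by (auto simp: S_def)
  ultimately have "A a' = A a" using max M by simp
  then have "a' \<in> A a" using A(2)[OF a'] E(3)[OF a'] by blast
  then obtain t i d where t: "t \<in> carrier R - Q" and i: "i \<in> K" and d: "d \<in> carrier R"
      and e: "t \<otimes> a' = i \<oplus> d \<otimes> a" unfolding A_def saturation_def E_def by blast
  have c': "t \<in> carrier R" "i \<in> carrier R" using t i Kc by auto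
  have "(s \<otimes> t \<ominus> d \<otimes> x) \<otimes> a' = s \<otimes> (t \<otimes> a') \<ominus> (d \<otimes> x) \<otimes> a'" using c c' d xc by algebra
  also have "\<dots> = s \<otimes> i \<oplus> d \<otimes> (s \<otimes> a) \<ominus> (d \<otimes> x) \<otimes> a'" unfolding e using c c' d xc by algebra
  also have "\<dots> = s \<otimes> i \<oplus> d \<otimes> k" unfolding eq using c c' d xc by algebra
  also have "\<dots> \<in> K" using i k c d by (intro ideal_add[OF K(1)] ideal.I_l_closed[OF K(1)])
  finally have in_K: "(s \<otimes> t \<ominus> d \<otimes> x) \<otimes> a' \<in> K" .
  have "s \<otimes> t \<ominus> d \<otimes> x \<notin> Q"
  proof
    assume "s \<otimes> t \<ominus> d \<otimes> x \<in> Q"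
    then have "(s \<otimes> t \<ominus> d \<otimes> x) \<oplus> d \<otimes> x \<in> Q" using ideal_add[OF Qi] ideal.I_l_closed[OF Qi x d] by blast
    moreover have "(s \<otimes> t \<ominus> d \<otimes> x) \<oplus> d \<otimes> x = s \<otimes> t" using c c' d xc by algebra
    ultimately show False using prime_compl_mult[OF Q s t] by auto
  qed
  then have "a' \<in> K" using c c' d xc by (intro saturatedD[OF K(2) _ _ in_K]) auto
  then have "s \<otimes> a \<in> K" unfolding eq using xc k by (intro ideal_add[OF K(1)] ideal.I_l_closed[OF K(1)])
  then have aK: "a \<in> K" using saturatedD[OF K(2) s c(3)] by simp
  have "a0 \<in> A a" using a(2) A(2)[OF a0] E(3)[OF a0] by blast
  then obtain t i d where t: "t \<in> carrier R - Q" and a0c: "a0 \<in> carrier R" and i: "i \<in> K" and d: "d \<in> carrier R"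
      and e: "t \<otimes> a0 = i \<oplus> d \<otimes> a"
    unfolding A_def saturation_def E_def by blast
  have "t \<otimes> a0 \<in> K" unfolding e by (rule ideal_add[OF K(1) i ideal.I_l_closed[OF K(1) aK d]])
  then show "a0 \<in> K" by (rule saturatedD[OF K(2) t a0c])
qed

text \<open>Krull's principal ideal theorem, relative to a prime \<open>P\<close>: a prime \<open>Q\<close> that is minimal over
  \<open>P + (x)\<close> has height at most one over \<open>P\<close>. The ideals \<open>J n\<close> below are the symbolic powers of a
  principal ideal, for an element \<open>y\<close> that would separate an intermediate prime from \<open>P\<close>.\<close>

lemma prime_between_containing:
  assumes noeth: "noetherian_ring R" and P: "primeideal P R" and Q': "primeideal Q' R" and Q: "primeideal Q R"
    and PQ': "P \<subset> Q'" and Q'Q: "Q' \<subset> Q" and x: "x \<in> Q"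
  shows "\<exists>Q1. primeideal Q1 R \<and> x \<in> Q1 \<and> P \<subset> Q1 \<and> Q1 \<subset> Q"
proof (cases "x \<in> Q'")
  case True then show ?thesis using Q' PQ' Q'Q by blast
next
  case xQ': False
  show ?thesis
  proof (rule ccontr)
    assume none: "\<not> ?thesis"
    have Pi: "ideal P R" and Q'i: "ideal Q' R" and Qi: "ideal Q R" using P Q Q' primeideal.axioms by blast+
    have xc: "x \<in> carrier R" using x ideal.Icarr[OF Qi] by blast
    obtain y where y: "y \<in> Q'" "y \<notin> P" using PQ' by blast
    have yc: "y \<in> carrier R" using y ideal.Icarr[OF Q'i] by blast
    define plus where "plus I b = {i \<oplus> r \<otimes> b | i r. i \<in> I \<and> r \<in> carrier R}" for I b
    have plus: "ideal (plus I b) R" "I \<subseteq> plus I b" "b \<in> plus I b" if "ideal I R" "b \<in> carrier R" for I b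
      unfolding plus_def using ideal_plus_principal[OF that] subset_plus_principal[OF that] by auto
    define J where "J n = saturation R Q' (plus P (y [^] n))" for n :: nat
    define D where "D n = saturation R Q (plus (J n) x)" for n
    have ync: "y [^] n \<in> carrier R" for n :: nat using yc by simp
    have J: "ideal (J n) R" "saturated R Q' (J n)" "plus P (y [^] n) \<subseteq> J n" for n
      unfolding J_def using ideal_saturation[OF Q'] saturated_saturation[OF Q'] subset_saturation[OF Q'] plus(1)[OF Pi ync] by auto
    have JQ: "saturated R Q (J n)" for n using J(2) Q'Q unfolding saturated_def by blast
    have JS: "J (Suc n) \<subseteq> J n" for n
    proof
      fix r assume "r \<in> J (Suc n)"
      then obtain s i d where *: "r \<in> carrier R" "s \<in> carrier R - Q'" "i \<in> P" "d \<in> carrier R" "s \<otimes> r = i \<oplus> d \<otimes> (y [^] Suc n)"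
        unfolding J_def saturation_def plus_def by blast
      have "d \<otimes> (y [^] Suc n) = (d \<otimes> y) \<otimes> y [^] n" using * yc ync[of n] by (simp add: m_assoc m_comm)
      then show "r \<in> J n" unfolding J_def saturation_def plus_def using * yc by auto
    qed
    have D: "ideal (D n) R" "saturated R Q (D n)" "plus (J n) x \<subseteq> D n" for n
      unfolding D_def using ideal_saturation[OF Q] saturated_saturation[OF Q] subset_saturation[OF Q] plus(1)[OF J(1) xc] by auto
    have DS: "D (Suc n) \<subseteq> D n" for n using JS[of n] unfolding D_def saturation_def plus_def by blast
    define a where "a = saturation R Q (plus P x)"
    have a: "ideal a R" "saturated R Q a" "plus P x \<subseteq> a"
      unfolding a_def using ideal_saturation[OF Q] saturated_saturation[OF Q] subset_saturation[OF Q] plus(1)[OF Pi xc] by auto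
    have amin: "Q \<subseteq> p" if p: "primeideal p R" "a \<subseteq> p" "p \<subseteq> Q" for p
    proof (rule ccontr)
      assume "\<not> Q \<subseteq> p"
      moreover have "P \<subseteq> p" "x \<in> p" using plus(2,3)[OF Pi xc] a(3) p(2) by blast+
      ultimately show False using none p xQ' PQ' by blast
    qed
    have aD: "a \<subseteq> D n" for n
    proof -
      have "P \<subseteq> J n" using plus(2)[OF Pi ync] J(3) by blast
      then show ?thesis unfolding a_def D_def saturation_def plus_def by blast
    qed
    obtain n where n: "\<forall>m\<ge>n. D m = D n"
      using saturated_dcc[of Q a D, OF noeth Q a(1,2) amin D(1,2) aD DS] ..
    have "J n \<subseteq> J (Suc n)"
    proof (rule saturated_nakayama[OF noeth Q J(1) JQ x])
      show "J n \<subseteq> carrier R" using ideal.Icarr[OF J(1)] by blast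
      fix r assume r: "r \<in> J n"
      then have "r \<in> D n" using D(3)[of n] plus(2)[OF J(1) xc] by blast
      then have "r \<in> D (Suc n)" using n[rule_format, of "Suc n"] by simp
      then obtain s j d where s: "s \<in> carrier R - Q" and j: "j \<in> J (Suc n)" and d: "d \<in> carrier R" and rc: "r \<in> carrier R"
        and e: "s \<otimes> r = j \<oplus> d \<otimes> x" unfolding D_def saturation_def plus_def by blast
      have c: "s \<in> carrier R" "j \<in> carrier R" using s j ideal.Icarr[OF J(1)] by auto
      have "x \<otimes> d = (j \<oplus> d \<otimes> x) \<ominus> j" using c d xc by algebra
      also have "\<dots> = s \<otimes> r \<ominus> j" unfolding e ..
      also have "\<dots> \<in> J n" by (rule ideal_diff[OF J(1) ideal.I_l_closed[OF J(1) r c(1)] subsetD[OF JS j]])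
      finally have "d \<in> J n" using saturatedD[OF J(2), of x d] xc xQ' d by blast
      then show "\<exists>s\<in>carrier R - Q. \<exists>k\<in>J (Suc n). \<exists>a'\<in>J n. s \<otimes> r = k \<oplus> x \<otimes> a'"
        using s j e m_comm[OF d xc] by (intro bexI[of _ s] bexI[of _ j] bexI[of _ d]) simp_all
    qed
    moreover have "y [^] n \<in> J n" using plus(3)[OF Pi ync] J(3) by blast
    ultimately have "y [^] n \<in> J (Suc n)" by blast
    then obtain s i d where s: "s \<in> carrier R - Q'" and i: "i \<in> P" and d: "d \<in> carrier R"
      and e: "s \<otimes> y [^] n = i \<oplus> d \<otimes> (y [^] Suc n)" unfolding J_def saturation_def plus_def by blast
    have c: "s \<in> carrier R" "i \<in> carrier R" using s i ideal.Icarr[OF Pi] by auto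
    have "y [^] n \<otimes> (s \<ominus> d \<otimes> y) = s \<otimes> y [^] n \<ominus> d \<otimes> (y [^] n \<otimes> y)" using c d yc ync[of n] by algebra
    also have "\<dots> = (i \<oplus> d \<otimes> (y [^] n \<otimes> y)) \<ominus> d \<otimes> (y [^] n \<otimes> y)" unfolding e by simp
    also have "\<dots> = i" using c d yc ync[of n] by algebra
    finally have yi: "y [^] n \<otimes> (s \<ominus> d \<otimes> y) \<in> P" using i by simp
    have "y [^] n \<notin> P" for n :: nat
    proof (induction n)
      case 0 then show ?case using prime_compl_one[OF P] by simp
    next
      case (Suc n) then show ?case using y(2) primeideal.I_prime[OF P, of "y [^] n" y] yc by auto
    qed
    then have "s \<ominus> d \<otimes> y \<in> P" using primeideal.I_prime[OF P ync[of n] _ yi] c d yc by simp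
    then have "s \<ominus> d \<otimes> y \<in> Q'" using PQ' by auto
    then have "(s \<ominus> d \<otimes> y) \<oplus> d \<otimes> y \<in> Q'" by (rule ideal_add[OF Q'i _ ideal.I_l_closed[OF Q'i y(1) d]])
    moreover have "(s \<ominus> d \<otimes> y) \<oplus> d \<otimes> y = s" using c d yc by algebra
    ultimately show False using s by simp
  qed
qed

end
subsection \<open>Regular local rings are domains\<close>

context cring
begin

text \<open>The principal ideal theorem moves an element of the largest prime of a chain into its second
  prime, without shortening the chain.\<close>

lemma chain_through_element:
  assumes noeth: "noetherian_ring R"
    and "\<And>i. i \<le> Suc n \<Longrightarrow> primeideal (c i) R" "\<And>i. i < Suc n \<Longrightarrow> c i \<subset> c (Suc i)" "x \<in> c (Suc n)"
  shows "\<exists>c'. (\<forall>i\<le>n. primeideal (c' i) R) \<and> (\<forall>i<n. c' i \<subset> c' (Suc i)) \<and> c' n = c (Suc n) \<and>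
    c 0 \<subset> c' 0 \<and> x \<in> c' 0"
  using assms(2-)
proof (induction n arbitrary: c)
  case 0
  then show ?case by (intro exI[of _ "\<lambda>_. c 1"]) simp
next
  case (Suc n)
  have "\<exists>q. primeideal q R \<and> x \<in> q \<and> c n \<subset> q \<and> q \<subset> c (Suc (Suc n))"
    using prime_between_containing[OF noeth Suc.prems(1)[of n] Suc.prems(1)[of "Suc n"] Suc.prems(1)[of "Suc (Suc n)"]]
      Suc.prems(2)[of n] Suc.prems(2)[of "Suc n"] Suc.prems(3) by simp
  then obtain q where q: "primeideal q R" "x \<in> q" "c n \<subset> q" "q \<subset> c (Suc (Suc n))" by (elim exE conjE)
  let ?c = "\<lambda>i. if i = Suc n then q else c i"
  have p1: "primeideal (?c i) R" if "i \<le> Suc n" for i using Suc.prems(1)[of i] q(1) that by simp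
  have p2: "?c i \<subset> ?c (Suc i)" if "i < Suc n" for i
    using Suc.prems(2)[of i] q(3) that by (cases "i = n") simp_all
  have p3: "x \<in> ?c (Suc n)" using q(2) by simp
  obtain c' where c': "\<forall>i\<le>n. primeideal (c' i) R" "\<forall>i<n. c' i \<subset> c' (Suc i)" "c' n = q" "c 0 \<subset> c' 0" "x \<in> c' 0"
    using Suc.IH[of ?c, OF p1 p2 p3] by auto
  let ?d = "\<lambda>i. if i = Suc n then c (Suc (Suc n)) else c' i"
  have "primeideal (?d i) R" if "i \<le> Suc n" for i
    using c'(1) Suc.prems(1)[of "Suc (Suc n)"] that by (cases "i = Suc n") simp_all
  moreover have "?d i \<subset> ?d (Suc i)" if "i < Suc n" for i
    using c'(2) q(4) c'(3) that by (cases "i = n") simp_all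
  ultimately show ?case using c'(4,5) by (intro exI[of _ ?d]) simp
qed

text \<open>If the maximal ideal \<open>m\<close> is generated by \<open>J\<close> and \<open>n\<close> further elements then a chain of \<open>n + 1\<close>
  primes between \<open>J\<close> and \<open>m\<close> starts at \<open>J\<close>. One of the generators \<open>x\<close> avoids the smallest prime
  \<open>P\<close>. By induction \<open>J + (x)\<close> is the smallest prime of a chain through \<open>x\<close>, hence contains \<open>P\<close>, so
  \<open>P = J + x P\<close> and Nakayama's lemma applies.\<close>

lemma longest_prime_chain_start:
  assumes noeth: "noetherian_ring R" and m: "primeideal m R" and local: "carrier R - m \<subseteq> Units R"
    and "ideal J R" "J \<subseteq> m" "finite S" "card S = n" "S \<subseteq> m"
    and "\<And>I. ideal I R \<Longrightarrow> J \<subseteq> I \<Longrightarrow> S \<subseteq> I \<Longrightarrow> m \<subseteq> I"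
    and "\<And>i. i \<le> n \<Longrightarrow> primeideal (c i) R" "\<And>i. i < n \<Longrightarrow> c i \<subset> c (Suc i)" "c n = m" "J \<subseteq> c 0"
  shows "c 0 = J"
  using assms(4-)
proof (induction n arbitrary: J S c)
  case 0
  then have "m \<subseteq> J" by simp
  then show ?case using 0 by simp
next
  case (Suc n)
  have mi: "ideal m R" using m primeideal.axioms by blast
  have c0: "primeideal (c 0) R" using Suc.prems(7) by simp
  then have c0i: "ideal (c 0) R" using primeideal.axioms by blast
  have mono: "c 0 \<subseteq> c j" if "j \<le> Suc n" for j
    using that
  proof (induction j)
    case (Suc j) then show ?case using Suc.prems \<open>\<And>i. i < _ \<Longrightarrow> c i \<subset> c (Suc i)\<close>[of j] by simp
  qed simp
  have "\<exists>x\<in>S. x \<notin> c 0"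
  proof (rule ccontr)
    assume "\<not> (\<exists>x\<in>S. x \<notin> c 0)"
    then have "m \<subseteq> c 0" using Suc.prems(6)[OF c0i Suc.prems(10)] by auto
    moreover have "c 0 \<subset> c (Suc 0)" using Suc.prems(8) by simp
    moreover have "c (Suc 0) \<subseteq> m"
    proof -
      have "c (Suc 0) \<subseteq> c (Suc j)" if "j \<le> n" for j
        using that
      proof (induction j)
        case (Suc j) then show ?case using \<open>\<And>i. i < _ \<Longrightarrow> c i \<subset> c (Suc i)\<close>[of "Suc j"] by simp
      qed simp
      then show ?thesis using Suc.prems(9) by auto
    qed
    ultimately show False by auto
  qed
  then obtain x where x: "x \<in> S" "x \<notin> c 0" by auto
  have xm: "x \<in> m" and xc: "x \<in> carrier R" using x Suc.prems(5) ideal.Icarr[OF mi] by auto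
  have "x \<in> c (Suc n)" using xm Suc.prems(9) by simp
  from chain_through_element[of n c x, OF noeth Suc.prems(7,8) this]
  obtain c' where c': "\<forall>i\<le>n. primeideal (c' i) R" "\<forall>i<n. c' i \<subset> c' (Suc i)" "c' n = c (Suc n)"
    "c 0 \<subset> c' 0" "x \<in> c' 0" by auto
  have c'0i: "ideal (c' 0) R" using c'(1) primeideal.axioms by blast
  define J' where "J' = {i \<oplus> r \<otimes> x | i r. i \<in> J \<and> r \<in> carrier R}"
  have J': "ideal J' R" "J \<subseteq> J'" "x \<in> J'"
    unfolding J'_def using ideal_plus_principal[OF Suc.prems(1) xc] subset_plus_principal[OF Suc.prems(1) xc] by auto
  have J'_least: "J' \<subseteq> I" if "ideal I R" "J \<subseteq> I" "x \<in> I" for I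
    unfolding J'_def using that ideal_add[OF that(1)] ideal.I_l_closed[OF that(1)] by auto
  have "c' 0 = J'"
  proof (rule Suc.IH[of J' "S - {x}" c'])
    show "card (S - {x}) = n" using Suc.prems(3,4) x(1) by simp
    show "J' \<subseteq> m" using J'_least[OF mi Suc.prems(2) xm] .
    show "m \<subseteq> I" if I: "ideal I R" "J' \<subseteq> I" "S - {x} \<subseteq> I" for I
    proof (rule Suc.prems(6)[OF I(1)])
      show "J \<subseteq> I" using I(2) J'(2) by simp
      show "S \<subseteq> I" using I(2,3) J'(3) by auto
    qed
    show "J' \<subseteq> c' 0" using J'_least[OF c'0i _ c'(5)] Suc.prems(10) c'(4) by simp
  qed (use J' c' Suc.prems in auto)
  have sat: "saturated R m J"
    unfolding saturated_def
  proof (intro ballI impI)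
    fix s r assume s: "s \<in> carrier R - m" and r: "r \<in> carrier R" and sr: "s \<otimes> r \<in> J"
    have u: "s \<in> Units R" using local s by auto
    then have "inv s \<otimes> (s \<otimes> r) = r" using r s by (simp add: m_assoc[symmetric])
    then show "r \<in> J" using ideal.I_l_closed[OF Suc.prems(1) sr, of "inv s"] u by simp
  qed
  have "c 0 \<subseteq> J"
  proof (rule saturated_nakayama[OF noeth m Suc.prems(1) sat xm])
    show "c 0 \<subseteq> carrier R" using ideal.Icarr[OF c0i] by auto
    fix p assume p: "p \<in> c 0"
    then have "p \<in> J'" using c'(4) \<open>c' 0 = J'\<close> by auto
    then obtain j r where j: "j \<in> J" and r: "r \<in> carrier R" and e: "p = j \<oplus> r \<otimes> x" unfolding J'_def by blast
    have jc: "j \<in> carrier R" using j ideal.Icarr[OF Suc.prems(1)] by simp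
    have jc0: "j \<in> c 0" using j Suc.prems(10) by auto
    have "r \<otimes> x = p \<ominus> j" unfolding e using jc r xc by algebra
    then have "r \<otimes> x \<in> c 0" using ideal_diff[OF c0i p jc0] by simp
    then have "r \<in> c 0" using primeideal.I_prime[OF c0 r xc] x(2) by auto
    moreover have "\<one> \<otimes> p = j \<oplus> x \<otimes> r" unfolding e using jc r xc by algebra
    ultimately show "\<exists>s\<in>carrier R - m. \<exists>k\<in>J. \<exists>a'\<in>c 0. s \<otimes> p = k \<oplus> x \<otimes> a'"
      using j prime_compl_one[OF m] by (intro bexI[of _ \<one>] bexI[of _ j] bexI[of _ r]) simp_all
  qed
  then show ?case using Suc.prems(10) by (rule subset_antisym)
qed

end

lemma (in cring) maximal_ideal_above:
  assumes I: "ideal I R" "\<one> \<notin> I"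
  shows "\<exists>M. maximalideal M R \<and> I \<subseteq> M"
proof -
  define S where "S = {H. ideal H R \<and> \<one> \<notin> H \<and> I \<subseteq> H}"
  have "\<exists>M\<in>S. \<forall>H\<in>S. M \<subseteq> H \<longrightarrow> H = M"
  proof (rule subset_Zorn)
    fix \<C> assume c: "subset.chain S \<C>"
    show "\<exists>U\<in>S. \<forall>H\<in>\<C>. H \<subseteq> U"
    proof (cases "\<C> = {}")
      case True then show ?thesis using I by (auto simp: S_def)
    next
      case False
      have CS: "H \<in> S" if "H \<in> \<C>" for H using c that by (auto simp: subset.chain_def)
      have cmp: "H \<subseteq> H' \<or> H' \<subseteq> H" if "H \<in> \<C>" "H' \<in> \<C>" for H H' using c that by (auto simp: subset.chain_def)
      have "ideal (\<Union>\<C>) R"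
      proof (rule idealI_cring)
        show "\<Union>\<C> \<subseteq> carrier R" using CS ideal.Icarr by (fastforce simp: S_def)
        show "\<zero> \<in> \<Union>\<C>" using False CS additive_subgroup.zero_closed[OF ideal.axioms(1)] by (fastforce simp: S_def)
      next
        fix a b assume "a \<in> \<Union>\<C>" "b \<in> \<Union>\<C>"
        then obtain H H' where H: "H \<in> \<C>" "a \<in> H" "H' \<in> \<C>" "b \<in> H'" by auto
        have i: "ideal H R" "ideal H' R" using CS H by (auto simp: S_def)
        show "a \<oplus> b \<in> \<Union>\<C>"
        proof (cases "H \<subseteq> H'")
          case True then show ?thesis using ideal_add[OF i(2), of a b] H by auto
        next
          case False then show ?thesis using cmp[OF H(1,3)] ideal_add[OF i(1), of a b] H by auto
        qed
      next
        fix a r assume "a \<in> \<Union>\<C>" and r: "r \<in> carrier R"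
        then obtain H where H: "H \<in> \<C>" "a \<in> H" by auto
        have i: "ideal H R" using CS H by (auto simp: S_def)
        show "r \<otimes> a \<in> \<Union>\<C>" using ideal.I_l_closed[OF i H(2) r] H by auto
      qed
      moreover have "\<one> \<notin> \<Union>\<C>" "I \<subseteq> \<Union>\<C>" using CS False by (auto simp: S_def)
      ultimately have "\<Union>\<C> \<in> S" by (simp add: S_def)
      then show ?thesis by blast
    qed
  qed
  then obtain M where M: "M \<in> S" and max: "\<forall>H\<in>S. M \<subseteq> H \<longrightarrow> H = M" by (elim bexE)
  have "maximalideal M R"
  proof (rule maximalidealI)
    show "ideal M R" "carrier R \<noteq> M" using M by (auto simp: S_def)
    fix J assume J: "ideal J R" "M \<subseteq> J" "J \<subseteq> carrier R"
    show "J = M \<or> J = carrier R"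
    proof (cases "\<one> \<in> J")
      case True then show ?thesis using ideal.one_imp_carrier[OF J(1)] by simp
    next
      case False
      then have "J \<in> S" using J M by (auto simp: S_def)
      then show ?thesis using max J(2) by simp
    qed
  qed
  then show ?thesis using M by (auto simp: S_def)
qed

lemma local_ring_maximal_nonunits:
  fixes R :: "'a ring" (structure)
  assumes "local_ring R" and m: "maximalideal m R"
  shows "nonunits R = m"
proof -
  have cR: "cring R" and ex: "\<exists>!m. maximalideal m R" using assms(1) by (auto simp: local_ring_def)
  interpret cring R by fact
  have mi: "ideal m R" using m maximalideal.axioms by blast
  show ?thesis
  proof
    show "nonunits R \<subseteq> m"
    proof
      fix a assume "a \<in> nonunits R"
      then have a: "a \<in> carrier R" "a \<notin> Units R" by (auto simp: nonunits_def)
      have "\<one> \<notin> PIdl a"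
      proof
        assume "\<one> \<in> PIdl a"
        then obtain b where "b \<in> carrier R" "\<one> = b \<otimes> a" by (auto simp: cgenideal_def)
        then have "a \<in> Units R" using a(1) m_comm[of a b] by (auto simp: Units_def)
        then show False using a by simp
      qed
      then obtain M where "maximalideal M R" "PIdl a \<subseteq> M" using maximal_ideal_above cgenideal_ideal[OF a(1)] by auto
      then show "a \<in> m" using ex m cgenideal_self[OF a(1)] by auto
    qed
    show "m \<subseteq> nonunits R"
    proof
      fix a assume a: "a \<in> m"
      have "a \<notin> Units R"
      proof
        assume u: "a \<in> Units R"
        have "inv a \<otimes> a \<in> m" by (rule ideal.I_l_closed[OF mi a Units_inv_closed[OF u]])
        then have "\<one> \<in> m" using Units_l_inv[OF u] by simp
        then have "m = carrier R" by (rule ideal.one_imp_carrier[OF mi])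
        then show False using maximalideal.I_notcarr[OF m] by simp
      qed
      then show "a \<in> nonunits R" using a ideal.Icarr[OF mi] by (simp add: nonunits_def)
    qed
  qed
qed

lemma regular_local_ring_nonunits:
  fixes R :: "'a ring" (structure)
  assumes "regular_local_ring R"
  shows "maximalideal (nonunits R) R"
proof -
  have l: "local_ring R" using assms by (simp add: regular_local_ring_def)
  then obtain m where m: "maximalideal m R" by (auto simp: local_ring_def)
  then show ?thesis using local_ring_maximal_nonunits[OF l m] by simp
qed

theorem regular_local_ring_domain:
  fixes R :: "'a ring" (structure)
  assumes "regular_local_ring R"
  shows "domain R"
proof -
  have noeth: "noetherian_ring R" and "cring R"
    using assms by (auto simp: regular_local_ring_def local_ring_def)
  then interpret cring R by simp
  have mm: "maximalideal (nonunits R) R" by (rule regular_local_ring_nonunits[OF assms])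
  then have m: "primeideal (nonunits R) R" by (rule maximalideal_prime)
  have mi: "ideal (nonunits R) R" using mm maximalideal.axioms by blast
  obtain n S where n: "has_chain {P. primeideal P R} n" and S: "S \<subseteq> carrier R" "finite S" "card S = n"
    and gen: "maximalideal (genideal R S) R"
    using assms unfolding regular_local_ring_def chain_dim_def by blast
  have "\<exists>!m. maximalideal m R" using assms by (simp add: regular_local_ring_def local_ring_def)
  then have gen_eq: "genideal R S = nonunits R" using gen mm by auto
  obtain c where c: "\<And>i. i \<le> n \<Longrightarrow> primeideal (c i) R" "\<And>i. i < n \<Longrightarrow> c i \<subset> c (Suc i)"
    using n unfolding has_chain_def by auto
  have sub: "c i \<subseteq> nonunits R" if "i \<le> n" for i
  proof
    fix a assume a: "a \<in> c i"
    note ci = c(1)[OF that]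
    have cii: "ideal (c i) R" using ci primeideal.axioms by blast
    have "a \<notin> Units R"
    proof
      assume u: "a \<in> Units R"
      have "inv a \<otimes> a \<in> c i" by (rule ideal.I_l_closed[OF cii a Units_inv_closed[OF u]])
      then show False using Units_l_inv[OF u] prime_compl_one[OF ci] by simp
    qed
    then show "a \<in> nonunits R" using a ideal.Icarr[OF cii] by (simp add: nonunits_def)
  qed
  \<comment> \<open>the top of a longest chain may be replaced by the maximal ideal\<close>
  define d where "d i = (if i = n then nonunits R else c i)" for i
  have d1: "primeideal (d i) R" if "i \<le> n" for i using c(1)[OF that] m by (simp add: d_def)
  have d2: "d i \<subset> d (Suc i)" if "i < n" for i
    using c(2)[OF that] sub[of "Suc i"] that by (auto simp: d_def)
  have d3: "d n = nonunits R" by (simp add: d_def)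
  have d0: "ideal (d 0) R" using d1[of 0] primeideal.axioms by blast
  have "d 0 = {\<zero>}"
  proof (rule longest_prime_chain_start[of "nonunits R" "{\<zero>}" S n d, OF noeth m])
    show "carrier R - nonunits R \<subseteq> Units R" by (auto simp: nonunits_def)
    show "{\<zero>} \<subseteq> nonunits R" using additive_subgroup.zero_closed[OF ideal.axioms(1)[OF mi]] by simp
    show "S \<subseteq> nonunits R" using genideal_self[OF S(1)] gen_eq by simp
    show "{\<zero>} \<subseteq> d 0" using additive_subgroup.zero_closed[OF ideal.axioms(1)[OF d0]] by simp
    show "nonunits R \<subseteq> I" if "ideal I R" "{\<zero>} \<subseteq> I" "S \<subseteq> I" for I
      using genideal_minimal[OF that(1,3)] gen_eq by simp
  qed (use zeroideal S d1 d2 d3 in auto)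
  then have "primeideal {\<zero>} R" using d1[of 0] by simp
  then show ?thesis by (rule zeroprimeideal_domainI)
qed

subsection \<open>Ideals of local domains\<close>

text \<open>Krull's intersection theorem for powers of one element: cancelling \<open>w\<close> shows that the set \<open>N\<close> of all
  elements divisible by every power of \<open>w\<close> satisfies \<open>N \<subseteq> w N\<close>, so Nakayama's lemma applies.\<close>

lemma divisible_by_all_powers:
  fixes R :: "'a ring" (structure)
  assumes "domain R" and noeth: "noetherian_ring R" and m: "maximalideal (nonunits R) R"
    and w: "w \<in> nonunits R" and y: "y \<in> carrier R" and div: "\<And>q :: nat. \<exists>z\<in>carrier R. y = w [^] q \<otimes> z"
  shows "y = \<zero>"
proof -
  interpret domain R by fact
  have wc: "w \<in> carrier R" using w by (simp add: nonunits_def)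
  show ?thesis
proof (cases "w = \<zero>")
  case True
  then show ?thesis using div[of 1] by auto
next
  case w0: False
  have mp: "primeideal (nonunits R) R" by (rule maximalideal_prime[OF m])
  define N where "N = {y \<in> carrier R. \<forall>q :: nat. \<exists>z\<in>carrier R. y = w [^] q \<otimes> z}"
  have "N \<subseteq> {\<zero>}"
  proof (rule saturated_nakayama[OF noeth mp zeroideal _ w])
    show "saturated R (nonunits R) {\<zero>}"
      using prime_compl_one[OF mp] additive_subgroup.zero_closed[OF ideal.axioms(1)[OF primeideal.axioms(1)[OF mp]]]
        integral by (auto simp: saturated_def)
    show "N \<subseteq> carrier R" by (auto simp: N_def)
    fix a assume a: "a \<in> N"
    then have "\<exists>z\<in>carrier R. a = w [^] (1 :: nat) \<otimes> z" unfolding N_def by blast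
    then obtain b where b: "b \<in> carrier R" "a = w \<otimes> b" using wc by auto
    have "\<exists>z\<in>carrier R. b = w [^] q \<otimes> z" for q :: nat
    proof -
      obtain z where z: "z \<in> carrier R" "a = w [^] (Suc q) \<otimes> z" using a unfolding N_def by blast
      have "w \<otimes> b = w \<otimes> (w [^] q \<otimes> z)" using b(2) z wc by (simp add: m_ac)
      then have "b = w [^] q \<otimes> z" using m_lcancel[OF w0 wc b(1), of "w [^] q \<otimes> z"] z(1) wc by simp
      then show ?thesis using z(1) by auto
    qed
    then have "b \<in> N" using b(1) by (simp add: N_def)
    moreover have "\<one> \<otimes> a = \<zero> \<oplus> w \<otimes> b" using b wc by simp
    ultimately show "\<exists>s\<in>carrier R - nonunits R. \<exists>k\<in>{\<zero>}. \<exists>a'\<in>N. s \<otimes> a = k \<oplus> w \<otimes> a'"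
      using prime_compl_one[OF mp] by (rule_tac bexI[of _ \<one>], rule_tac bexI[of _ \<zero>], rule_tac bexI[of _ b]) simp_all
  qed
  moreover have "y \<in> N" using y div by (simp add: N_def)
  ultimately show ?thesis by auto
qed
qed

lemma unit_summand:
  fixes R :: "'a ring" (structure)
  assumes "cring R" and m: "maximalideal (nonunits R) R" and f: "f \<in> {..<n :: nat} \<rightarrow> carrier R"
    and sum: "(\<Oplus>i\<in>{..<n}. f i) = \<one>"
  shows "\<exists>i<n. f i \<in> Units R"
proof (rule ccontr)
  interpret cring R by fact
  assume no: "\<not> ?thesis"
  have mi: "ideal (nonunits R) R" using m maximalideal.axioms by blast
  have fi: "f i \<in> nonunits R" if "i < n" for i using no f that by (auto simp: nonunits_def)
  have part: "(\<Oplus>i\<in>{..<k}. f i) \<in> nonunits R" if "k \<le> n" for k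
    using that
  proof (induction k)
    case 0 then show ?case using additive_subgroup.zero_closed[OF ideal.axioms(1)[OF mi]] by simp
  next
    case (Suc k)
    have "f \<in> {..<k} \<rightarrow> carrier R" "f k \<in> carrier R" using f Suc.prems by auto
    then have "(\<Oplus>i\<in>{..<Suc k}. f i) = f k \<oplus> (\<Oplus>i\<in>{..<k}. f i)" by (simp add: lessThan_Suc)
    then show ?case using ideal_add[OF mi fi Suc.IH] Suc.prems by simp
  qed
  show False using part[of n] sum by (simp add: nonunits_def)
qed

text \<open>A factor of an invertible ideal is invertible, and invertible ideals of local rings are principal.\<close>

lemma principal_factor:
  fixes R :: "'a ring" (structure)
  assumes "domain R" and m: "maximalideal (nonunits R) R" and K: "ideal K R" and H: "ideal H R"
    and KH: "ideal_prod R K H = PIdl t" and t: "t \<in> carrier R" "t \<noteq> \<zero>"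
  shows "\<exists>w\<in>K. K = PIdl w"
proof -
  interpret domain R by fact
  have mi: "ideal (nonunits R) R" using m maximalideal.axioms by blast
  have "\<exists>a\<in>K. \<exists>b\<in>H. \<exists>c\<in>Units R. a \<otimes> b = c \<otimes> t"
  proof (rule ccontr)
    assume no: "\<not> ?thesis"
    \<comment> \<open>otherwise all products lie in \<open>m t\<close>, hence so does \<open>t\<close>\<close>
    have "\<exists>c\<in>nonunits R. s = c \<otimes> t" if "s \<in> ideal_prod R K H" for s
      using that
    proof (induction s rule: ideal_prod.induct)
      case (prod a b)
      then have "a \<otimes> b \<in> PIdl t" using ideal_prod.prod[of a K b H R] KH by simp
      then obtain c where c: "c \<in> carrier R" "a \<otimes> b = c \<otimes> t" by (auto simp: cgenideal_def)
      then have "c \<in> nonunits R" using no prod by (auto simp: nonunits_def)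
      then show ?case using c(2) by auto
    next
      case (sum s1 s2)
      then obtain c1 c2 where c: "c1 \<in> nonunits R" "s1 = c1 \<otimes> t" "c2 \<in> nonunits R" "s2 = c2 \<otimes> t" by auto
      then have "s1 \<oplus> s2 = (c1 \<oplus> c2) \<otimes> t" using t(1) ideal.Icarr[OF mi] by (simp add: l_distr)
      then show ?case using ideal_add[OF mi c(1,3)] by auto
    qed
    then obtain c where c: "c \<in> nonunits R" "t = c \<otimes> t" using KH cgenideal_self[OF t(1)] by auto
    have cc: "c \<in> carrier R" using c(1) by (simp add: nonunits_def)
    have "\<one> \<otimes> t = c \<otimes> t" using c(2) t(1) by simp
    then have "c = \<one>" using m_rcancel[OF t(2,1) one_closed cc] by simp
    then show False using c(1) by (simp add: nonunits_def)
  qed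
  then obtain a b c where a: "a \<in> K" and b: "b \<in> H" and c: "c \<in> Units R" and e: "a \<otimes> b = c \<otimes> t" by auto
  have cl: "a \<in> carrier R" "b \<in> carrier R" "c \<in> carrier R"
    using a b c ideal.Icarr[OF K] ideal.Icarr[OF H] by (auto simp: Units_closed)
  have b0: "b \<noteq> \<zero>"
  proof
    assume "b = \<zero>"
    then have "c \<otimes> t = \<zero>" using e cl by simp
    then have "c = \<zero>" using integral t cl by auto
    then show False using Units_r_inv[OF c] Units_inv_closed[OF c] l_null[of "inv c"] zero_not_one by metis
  qed
  have "K \<subseteq> PIdl a"
  proof
    fix k assume k: "k \<in> K"
    then have kc: "k \<in> carrier R" using ideal.Icarr[OF K] by simp
    have "k \<otimes> b \<in> PIdl t" using ideal_prod.prod[OF k b, of R] KH by simp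
    then obtain d where d: "d \<in> carrier R" "k \<otimes> b = d \<otimes> t" by (auto simp: cgenideal_def)
    have "k \<otimes> b = (d \<otimes> inv c) \<otimes> (c \<otimes> t)" using d c cl t(1) by (simp add: m_assoc[symmetric]) (simp add: m_assoc)
    also have "\<dots> = ((d \<otimes> inv c) \<otimes> a) \<otimes> b" unfolding e[symmetric] using d c cl by (simp add: m_assoc)
    finally have "k = (d \<otimes> inv c) \<otimes> a" using m_rcancel[OF b0 cl(2) kc] d(1) c cl by simp
    then show "k \<in> PIdl a" unfolding cgenideal_def using d(1) c by auto
  qed
  moreover have "PIdl a \<subseteq> K" by (rule cgenideal_minimal[OF K a])
  ultimately show ?thesis using a by auto
qed

section \<open>The tensor product of algebras\<close>

lemma frag_extend_fun_add: "frag_extend (\<lambda>x. f x + g x) c = frag_extend f c + frag_extend g c"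
  by (simp add: frag_extend_def frag_cmul_distrib2 sum.distrib)

lemma frag_extend_fun_diff: "frag_extend (\<lambda>x. f x - g x) c = frag_extend f c - frag_extend g c"
proof -
  have "frag_extend (\<lambda>x. (f x - g x) + g x) c = frag_extend (\<lambda>x. f x - g x) c + frag_extend g c"
    by (rule frag_extend_fun_add)
  then show ?thesis by simp
qed

abbreviation pair_mult :: "'a ring \<Rightarrow> 'b ring \<Rightarrow> ('a \<times> 'b \<Rightarrow>\<^sub>0 int) \<Rightarrow> ('a \<times> 'b \<Rightarrow>\<^sub>0 int) \<Rightarrow> ('a \<times> 'b \<Rightarrow>\<^sub>0 int)" where
  "pair_mult A B \<equiv> monoid.mult (pair_ring A B)"

abbreviation "fsums A B c \<equiv> Poly_Mapping.keys c \<subseteq> carrier A \<times> carrier B"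

abbreviation "emb B a \<equiv> frag_of (a, \<one>\<^bsub>B\<^esub>)"

lemma carrier_pair_ring [simp]: "c \<in> carrier (pair_ring A B) \<longleftrightarrow> fsums A B c"
  by (simp add: pair_ring_def)

lemma add_pair_ring [simp]: "c \<oplus>\<^bsub>pair_ring A B\<^esub> d = c + d"
  by (simp add: pair_ring_def)

lemma zero_pair_ring [simp]: "\<zero>\<^bsub>pair_ring A B\<^esub> = 0"
  by (simp add: pair_ring_def)

lemma one_pair_ring: "\<one>\<^bsub>pair_ring A B\<^esub> = frag_of (\<one>\<^bsub>A\<^esub>, \<one>\<^bsub>B\<^esub>)"
  by (simp add: pair_ring_def)

lemma pair_mult_add_left: "pair_mult A B (c + c') d = pair_mult A B c d + pair_mult A B c' d"
  by (simp add: pair_ring_def frag_extend_add)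

lemma pair_mult_diff_left: "pair_mult A B (c - c') d = pair_mult A B c d - pair_mult A B c' d"
  by (simp add: pair_ring_def frag_extend_diff)

lemma pair_mult_diff_right: "pair_mult A B c (d - d') = pair_mult A B c d - pair_mult A B c d'"
  by (simp add: pair_ring_def frag_extend_diff case_prod_unfold frag_extend_fun_diff)

lemma pair_mult_zero [simp]: "pair_mult A B 0 d = 0" "pair_mult A B c 0 = 0"
  using pair_mult_diff_left[of A B 0 0 d] pair_mult_diff_right[of A B c 0 0] by simp_all

lemma pair_mult_of: "pair_mult A B (frag_of (a, b)) (frag_of (a', b')) = frag_of (a \<otimes>\<^bsub>A\<^esub> a', b \<otimes>\<^bsub>B\<^esub> b')"
  by (simp add: pair_ring_def)

lemma keys_diff_subset: "Poly_Mapping.keys c \<subseteq> S \<Longrightarrow> Poly_Mapping.keys d \<subseteq> S \<Longrightarrow> Poly_Mapping.keys (c - d :: _ \<Rightarrow>\<^sub>0 int) \<subseteq> S"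
  using keys_diff[of c d] by blast

lemma keys_add_subset: "Poly_Mapping.keys c \<subseteq> S \<Longrightarrow> Poly_Mapping.keys d \<subseteq> S \<Longrightarrow> Poly_Mapping.keys (c + d :: _ \<Rightarrow>\<^sub>0 int) \<subseteq> S"
  using keys_add[of c d] by blast

locale two_crings = A: cring A + B: cring B for A :: "'a ring" (structure) and B :: "'b ring"
begin

lemma pair_induct [consumes 1, case_names zero one diff]:
  assumes "fsums A B c" "P 0"
    "\<And>a b. a \<in> carrier A \<Longrightarrow> b \<in> carrier B \<Longrightarrow> P (frag_of (a, b))"
    "\<And>c d. fsums A B c \<Longrightarrow> fsums A B d \<Longrightarrow>
      P c \<Longrightarrow> P d \<Longrightarrow> P (c - d)"
  shows "P c"
proof -
  have "fsums A B c \<and> P c"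
    using assms(1) by (induction c rule: frag_induction) (use assms in \<open>auto simp: keys_diff_subset\<close>)
  then show ?thesis by simp
qed

lemma pair_mult_closed:
  assumes "fsums A B c" "fsums A B d"
  shows "fsums A B (pair_mult A B c d)"
  using assms(1)
proof (induction c rule: pair_induct)
  case (one a b)
  show ?case
    using assms(2)
    by (induction d rule: pair_induct) (use one in \<open>simp_all add: pair_mult_of pair_mult_diff_right keys_diff_subset\<close>)
qed (simp_all add: pair_mult_diff_left keys_diff_subset)

lemma pair_mult_comm:
  assumes "fsums A B c" "fsums A B d"
  shows "pair_mult A B c d = pair_mult A B d c"
  using assms(1)
proof (induction c rule: pair_induct)
  case (one a b)
  show ?case
    using assms(2)
    by (induction d rule: pair_induct)
      (use one in \<open>auto simp: pair_mult_of pair_mult_diff_right pair_mult_diff_left A.m_comm B.m_comm\<close>)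
qed (auto simp: pair_mult_diff_left pair_mult_diff_right)

lemma pair_mult_assoc:
  assumes "fsums A B c" "fsums A B d"
    "fsums A B e"
  shows "pair_mult A B (pair_mult A B c d) e = pair_mult A B c (pair_mult A B d e)"
  using assms(1)
proof (induction c rule: pair_induct)
  case c: (one a b)
  show ?case
    using assms(2)
  proof (induction d rule: pair_induct)
    case (one a' b')
    show ?case
      using assms(3)
      by (induction e rule: pair_induct)
        (use c one in \<open>auto simp: pair_mult_of pair_mult_diff_right A.m_assoc B.m_assoc\<close>)
  qed (auto simp: pair_mult_diff_left pair_mult_diff_right)
qed (auto simp: pair_mult_diff_left)

lemma pair_mult_one:
  assumes "fsums A B c"
  shows "pair_mult A B (frag_of (\<one>, \<one>\<^bsub>B\<^esub>)) c = c"
  using assms by (induction c rule: pair_induct) (auto simp: pair_mult_of pair_mult_diff_right)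

lemma cring_pair_ring: "cring (pair_ring A B)"
proof (rule cringI)
  show "abelian_group (pair_ring A B)"
  proof (rule abelian_groupI)
    fix x assume "x \<in> carrier (pair_ring A B)"
    then show "\<exists>y\<in>carrier (pair_ring A B). y \<oplus>\<^bsub>pair_ring A B\<^esub> x = \<zero>\<^bsub>pair_ring A B\<^esub>"
      by (intro bexI[of _ "- x"]) auto
  qed (auto simp: keys_add_subset add_ac)
  show "comm_monoid (pair_ring A B)"
    by (rule comm_monoidI) (auto simp: pair_mult_closed one_pair_ring pair_mult_assoc pair_mult_one intro: pair_mult_comm)
qed (simp add: pair_mult_add_left)

sublocale pair: cring "pair_ring A B"
  by (rule cring_pair_ring)

lemma minus_pair_ring [simp]:
  assumes "fsums A B d"
  shows "c \<ominus>\<^bsub>pair_ring A B\<^esub> d = c - d"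
proof -
  have "\<ominus>\<^bsub>pair_ring A B\<^esub> d = - d" using pair.minus_equality[of "- d" d] assms by simp
  then show ?thesis by (simp add: pair.minus_eq)
qed

lemma pair_idealI:
  assumes "\<And>x. x \<in> J \<Longrightarrow> fsums A B x" "0 \<in> J"
    and diff: "\<And>x y. x \<in> J \<Longrightarrow> y \<in> J \<Longrightarrow> x - y \<in> J"
    and "\<And>a b x. a \<in> carrier A \<Longrightarrow> b \<in> carrier B \<Longrightarrow> x \<in> J \<Longrightarrow> pair_mult A B (frag_of (a, b)) x \<in> J"
  shows "ideal J (pair_ring A B)"
proof (rule pair.idealI_cring)
  show "J \<subseteq> carrier (pair_ring A B)" using assms(1) by auto
  fix x y assume x: "x \<in> J"
  { assume y: "y \<in> J"
    have "x - (0 - y) \<in> J" by (intro diff x y assms(2))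
    then show "x \<oplus>\<^bsub>pair_ring A B\<^esub> y \<in> J" by simp }
  { assume "y \<in> carrier (pair_ring A B)"
    then have "fsums A B y" by simp
    then show "pair_mult A B y x \<in> J"
      by (induction y rule: pair_induct) (use assms x in \<open>auto simp: pair_mult_diff_left\<close>) }
qed (use assms(2) in simp)

lemma pair_ring_universal:
  assumes "cring S" and f: "\<And>a b. a \<in> carrier A \<Longrightarrow> b \<in> carrier B \<Longrightarrow> f (a, b) \<in> carrier S"
    and mult: "\<And>a b a' b'. a \<in> carrier A \<Longrightarrow> b \<in> carrier B \<Longrightarrow> a' \<in> carrier A \<Longrightarrow> b' \<in> carrier B \<Longrightarrow>
      f (a \<otimes> a', b \<otimes>\<^bsub>B\<^esub> b') = f (a, b) \<otimes>\<^bsub>S\<^esub> f (a', b')"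
    and one: "f (\<one>, \<one>\<^bsub>B\<^esub>) = \<one>\<^bsub>S\<^esub>"
  shows "\<exists>h \<in> ring_hom (pair_ring A B) S. \<forall>a \<in> carrier A. \<forall>b \<in> carrier B. h (frag_of (a, b)) = f (a, b)"
proof -
  interpret S: cring S by fact
  have "f ` (carrier A \<times> carrier B) \<subseteq> carrier (add_monoid S)" using f by auto
  then obtain h where h: "h \<in> hom (free_Abelian_group (carrier A \<times> carrier B)) (add_monoid S)"
    and hf: "\<And>x. x \<in> carrier A \<times> carrier B \<Longrightarrow> h (frag_of x) = f x"
    using comm_group.free_Abelian_group_universal[OF S.a_comm_group] by blast
  have closed: "h c \<in> carrier S" if "fsums A B c" for c
    using h that by (auto simp: hom_def Pi_def)
  have add: "h (c + d) = h c \<oplus>\<^bsub>S\<^esub> h d"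
    if "fsums A B c" "fsums A B d" for c d
    using h that by (auto simp: hom_def)
  have zero: "h 0 = \<zero>\<^bsub>S\<^esub>" using add[of 0 0] closed[of 0] S.add.r_cancel_one[of "h 0" "h 0"] by simp
  have diff: "h (c - d) = h c \<ominus>\<^bsub>S\<^esub> h d"
    if "fsums A B c" "fsums A B d" for c d
  proof -
    have "h c = h (c - d) \<oplus>\<^bsub>S\<^esub> h d" using add[of "c - d" d] that keys_diff_subset[OF that] by simp
    moreover have "h (c - d) \<in> carrier S" "h d \<in> carrier S" using closed that keys_diff_subset[OF that] by auto
    ultimately show ?thesis by (simp add: S.minus_eq S.a_assoc S.r_neg)
  qed
  have "h (pair_mult A B c d) = h c \<otimes>\<^bsub>S\<^esub> h d"
    if c: "fsums A B c" and d: "fsums A B d" for c d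
    using c
  proof (induction c rule: pair_induct)
    case zero then show ?case using closed[OF d] \<open>h 0 = \<zero>\<^bsub>S\<^esub>\<close> by simp
  next
    case (one a b)
    note ab = this
    show ?case
      using d
    proof (induction d rule: pair_induct)
      case zero then show ?case using f[OF ab] \<open>h 0 = \<zero>\<^bsub>S\<^esub>\<close> hf[of "(a, b)"] ab by simp
    next
      case (one a' b')
      then show ?case using ab mult by (simp add: pair_mult_of hf)
    next
      case (diff c d)
      then show ?case using ab closed[of c] closed[of d] f[OF ab] hf[of "(a, b)"]
          \<open>\<And>c d. Poly_Mapping.keys c \<subseteq> _ \<Longrightarrow> _ \<Longrightarrow> h (c - d) = _\<close> pair_mult_closed[of "frag_of (a, b)"]
        by (simp add: pair_mult_diff_right S.minus_eq S.r_distr S.r_minus)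
    qed
  next
    case (diff c c')
    then show ?case using closed[of c] closed[of c'] closed[OF d]
        \<open>\<And>c d. Poly_Mapping.keys c \<subseteq> _ \<Longrightarrow> _ \<Longrightarrow> h (c - d) = _\<close> pair_mult_closed[OF _ d]
      by (simp add: pair_mult_diff_left S.minus_eq S.l_distr S.l_minus)
  qed
  then have "h \<in> ring_hom (pair_ring A B) S"
    using closed add hf[of "(\<one>, \<one>\<^bsub>B\<^esub>)"] one
    by (intro ring_hom_memI) (auto simp: one_pair_ring)
  then show ?thesis using hf by auto
qed

end

definition tensor_relations ::
    "'k ring \<Rightarrow> 'a ring \<Rightarrow> ('k \<Rightarrow> 'a) \<Rightarrow> 'b ring \<Rightarrow> ('k \<Rightarrow> 'b) \<Rightarrow> ('a \<times> 'b \<Rightarrow>\<^sub>0 int) set" where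
  "tensor_relations k A \<alpha> B \<beta> =
     {frag_of (a \<oplus>\<^bsub>A\<^esub> a', b) - frag_of (a, b) - frag_of (a', b) | a a' b.
         a \<in> carrier A \<and> a' \<in> carrier A \<and> b \<in> carrier B} \<union>
      {frag_of (a, b \<oplus>\<^bsub>B\<^esub> b') - frag_of (a, b) - frag_of (a, b') | a b b'.
         a \<in> carrier A \<and> b \<in> carrier B \<and> b' \<in> carrier B} \<union>
      {frag_of (\<alpha> c \<otimes>\<^bsub>A\<^esub> a, b) - frag_of (a, \<beta> c \<otimes>\<^bsub>B\<^esub> b) | a b c.
         a \<in> carrier A \<and> b \<in> carrier B \<and> c \<in> carrier k}"

locale two_algebras = two_crings A B for A :: "'a ring" (structure) and B :: "'b ring" +
  fixes k :: "'k ring" and \<alpha> :: "'k \<Rightarrow> 'a" and \<beta> :: "'k \<Rightarrow> 'b"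
  assumes alpha: "\<And>c. c \<in> carrier k \<Longrightarrow> \<alpha> c \<in> carrier A" and beta: "\<And>c. c \<in> carrier k \<Longrightarrow> \<beta> c \<in> carrier B"
begin

abbreviation "T \<equiv> tensor_ideal k A \<alpha> B \<beta>"
abbreviation "AB \<equiv> tensor_ring k A \<alpha> B \<beta>"
abbreviation "cl \<equiv> tensor_class k A \<alpha> B \<beta>"

lemma relations_carrier: "tensor_relations k A \<alpha> B \<beta> \<subseteq> carrier (pair_ring A B)"
  unfolding tensor_relations_def
  by (intro Un_least subsetI; elim CollectE exE conjE; simp add: keys_diff_subset alpha beta)

lemma T_eq: "T = genideal (pair_ring A B) (tensor_relations k A \<alpha> B \<beta>)"
  by (simp add: tensor_ideal_def tensor_relations_def)

lemma T_ideal: "ideal T (pair_ring A B)"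
  unfolding T_eq using pair.genideal_ideal[OF relations_carrier] .

lemma T_relations: "tensor_relations k A \<alpha> B \<beta> \<subseteq> T"
  unfolding T_eq using pair.genideal_self[OF relations_carrier] .

lemma T_add_left: "a \<in> carrier A \<Longrightarrow> a' \<in> carrier A \<Longrightarrow> b \<in> carrier B \<Longrightarrow>
    frag_of (a \<oplus> a', b) - frag_of (a, b) - frag_of (a', b) \<in> T"
  by (rule subsetD[OF T_relations]) (auto simp: tensor_relations_def)

lemma T_add_right: "a \<in> carrier A \<Longrightarrow> b \<in> carrier B \<Longrightarrow> b' \<in> carrier B \<Longrightarrow>
    frag_of (a, b \<oplus>\<^bsub>B\<^esub> b') - frag_of (a, b) - frag_of (a, b') \<in> T"
  by (rule subsetD[OF T_relations]) (auto simp: tensor_relations_def)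

lemma T_const: "a \<in> carrier A \<Longrightarrow> b \<in> carrier B \<Longrightarrow> c \<in> carrier k \<Longrightarrow>
    frag_of (\<alpha> c \<otimes> a, b) - frag_of (a, \<beta> c \<otimes>\<^bsub>B\<^esub> b) \<in> T"
  by (rule subsetD[OF T_relations]) (auto simp: tensor_relations_def)

lemma T_minimal: "ideal J (pair_ring A B) \<Longrightarrow> tensor_relations k A \<alpha> B \<beta> \<subseteq> J \<Longrightarrow> T \<subseteq> J"
  unfolding T_eq by (rule pair.genideal_minimal)

lemma cring_tensor_ring: "cring AB"
  unfolding tensor_ring_def by (rule ideal.quotient_is_cring[OF T_ideal cring_pair_ring])

sublocale AB: cring AB by (rule cring_tensor_ring)

lemma cl_hom: "cl \<in> ring_hom (pair_ring A B) AB"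
proof -
  have "cl = (+>\<^bsub>pair_ring A B\<^esub>) T" by (simp add: tensor_class_def fun_eq_iff)
  then show ?thesis unfolding tensor_ring_def using ideal.rcos_ring_hom[OF T_ideal] by simp
qed

lemma carrier_AB: "carrier AB = cl ` carrier (pair_ring A B)"
  by (auto simp: tensor_ring_def FactRing_def A_RCOSETS_def' tensor_class_def)

lemma cl_closed [simp]: "fsums A B c \<Longrightarrow> cl c \<in> carrier AB"
  by (simp add: carrier_AB)

lemma cl_add: "fsums A B c \<Longrightarrow> fsums A B d \<Longrightarrow>
    cl (c + d) = cl c \<oplus>\<^bsub>AB\<^esub> cl d"
  using ring_hom_add[OF cl_hom, of c d] by simp

lemma cl_mult: "fsums A B c \<Longrightarrow> fsums A B d \<Longrightarrow>
    cl (pair_mult A B c d) = cl c \<otimes>\<^bsub>AB\<^esub> cl d"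
  using ring_hom_mult[OF cl_hom, of c d] by simp

lemma cl_one: "cl (frag_of (\<one>, \<one>\<^bsub>B\<^esub>)) = \<one>\<^bsub>AB\<^esub>"
  using ring_hom_one[OF cl_hom] by (simp add: one_pair_ring)

lemma cl_eq_iff: "fsums A B c \<Longrightarrow> fsums A B d \<Longrightarrow>
    cl c = cl d \<longleftrightarrow> c - d \<in> T"
  using pair.quotient_eq_iff_same_a_r_cos[OF T_ideal, of c d] by (simp add: tensor_class_def)

lemma cl_zero: "cl 0 = \<zero>\<^bsub>AB\<^esub>"
  using cl_add[of 0 0] cl_closed[of 0] AB.add.r_cancel_one[of "cl 0" "cl 0"] by simp

lemma cl_zero_iff: "fsums A B c \<Longrightarrow> cl c = \<zero>\<^bsub>AB\<^esub> \<longleftrightarrow> c \<in> T"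
  using cl_eq_iff[of c 0] by (simp add: cl_zero)

lemma cl_add_left: "a \<in> carrier A \<Longrightarrow> a' \<in> carrier A \<Longrightarrow> b \<in> carrier B \<Longrightarrow>
    cl (frag_of (a \<oplus> a', b)) = cl (frag_of (a, b)) \<oplus>\<^bsub>AB\<^esub> cl (frag_of (a', b))"
proof -
  assume *: "a \<in> carrier A" "a' \<in> carrier A" "b \<in> carrier B"
  then have "frag_of (a \<oplus> a', b) - frag_of (a, b) - frag_of (a', b) \<in> T"
    using T_relations unfolding tensor_relations_def by blast
  then have "frag_of (a \<oplus> a', b) - (frag_of (a, b) + frag_of (a', b)) \<in> T" by (simp add: diff_diff_eq)
  then have "cl (frag_of (a \<oplus> a', b)) = cl (frag_of (a, b) + frag_of (a', b))"
    using * by (subst cl_eq_iff) (simp_all add: keys_add_subset)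
  then show ?thesis using * by (simp add: cl_add)
qed

end

section \<open>Localization at a prime ideal\<close>

lemma UN_pair_constant:
  assumes "(a, s) \<in> X" "\<And>a' s'. (a', s') \<in> X \<Longrightarrow> f a' s' = c"
  shows "(\<Union>(a, s)\<in>X. f a s) = c"
proof -
  have "(\<Union>(a, s)\<in>X. f a s) = (\<Union>x\<in>X. c)" by (rule SUP_cong) (use assms(2) in auto)
  then show ?thesis using assms(1) by auto
qed

lemma UN_pair2_constant:
  assumes "(a, s) \<in> X" "(b, t) \<in> Y" "\<And>a' s' b' t'. (a', s') \<in> X \<Longrightarrow> (b', t') \<in> Y \<Longrightarrow> f a' s' b' t' = c"
  shows "(\<Union>(a, s)\<in>X. \<Union>(b, t)\<in>Y. f a s b t) = c"
  by (rule UN_pair_constant[OF assms(1)], rule UN_pair_constant[OF assms(2)]) (rule assms(3))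

locale prime_localization = cring A for A :: "'a ring" (structure) +
  fixes P :: "'a set"
  assumes prime: "primeideal P A"
begin

lemma S_one: "\<one> \<in> carrier A - P" by (rule prime_compl_one[OF prime])

lemma S_mult: "s \<in> carrier A - P \<Longrightarrow> t \<in> carrier A - P \<Longrightarrow> s \<otimes> t \<in> carrier A - P"
  by (rule prime_compl_mult[OF prime])

lemma fraction_memI:
  assumes "b \<in> carrier A" "t \<in> carrier A - P" "u \<in> carrier A - P" "u \<otimes> (t \<otimes> a) = u \<otimes> (s \<otimes> b)"
  shows "(b, t) \<in> fraction A P a s"
  using assms by (auto simp: fraction_def)

lemma fraction_self: "a \<in> carrier A \<Longrightarrow> s \<in> carrier A - P \<Longrightarrow> (a, s) \<in> fraction A P a s"
  using S_one by (intro fraction_memI[of _ _ \<one>]) auto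

lemma fraction_trans:
  assumes c: "a \<in> carrier A" "s \<in> carrier A - P" "b \<in> carrier A" "t \<in> carrier A - P"
    and u: "u \<in> carrier A - P" "u \<otimes> (t \<otimes> a) = u \<otimes> (s \<otimes> b)"
  shows "fraction A P b t \<subseteq> fraction A P a s"
proof
  fix x assume "x \<in> fraction A P b t"
  then obtain d r v where x: "x = (d, r)" and d: "d \<in> carrier A" "r \<in> carrier A - P" "v \<in> carrier A - P"
    and v: "v \<otimes> (r \<otimes> b) = v \<otimes> (t \<otimes> d)" by (auto simp: fraction_def)
  have cl: "s \<in> carrier A" "t \<in> carrier A" "u \<in> carrier A" "r \<in> carrier A" "v \<in> carrier A" using c u d by auto
  have "((u \<otimes> v) \<otimes> t) \<otimes> (r \<otimes> a) = (v \<otimes> r) \<otimes> (u \<otimes> (t \<otimes> a))" using cl c(1) by algebra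
  also have "\<dots> = (u \<otimes> s) \<otimes> (v \<otimes> (r \<otimes> b))" unfolding u(2) using cl c(3) by algebra
  also have "\<dots> = ((u \<otimes> v) \<otimes> t) \<otimes> (s \<otimes> d)" unfolding v using cl d(1) by algebra
  finally show "x \<in> fraction A P a s"
    unfolding x using d S_mult[OF S_mult[OF u(1) d(3)] c(4)] by (intro fraction_memI) auto
qed

lemma fraction_eqI:
  assumes "a \<in> carrier A" "s \<in> carrier A - P" "b \<in> carrier A" "t \<in> carrier A - P"
    "u \<in> carrier A - P" "u \<otimes> (t \<otimes> a) = u \<otimes> (s \<otimes> b)"
  shows "fraction A P a s = fraction A P b t"
  using fraction_trans[OF assms] fraction_trans[OF assms(3,4,1,2,5) assms(6)[symmetric]] by blast

lemma fraction_eqD: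
  assumes "fraction A P a s = fraction A P b t" "b \<in> carrier A" "t \<in> carrier A - P"
  shows "\<exists>u \<in> carrier A - P. u \<otimes> (t \<otimes> a) = u \<otimes> (s \<otimes> b)"
  using fraction_self[OF assms(2,3)] unfolding assms(1)[symmetric] by (auto simp: fraction_def)

lemma fraction_memD:
  assumes "(b, t) \<in> fraction A P a s" "a \<in> carrier A" "s \<in> carrier A - P"
  shows "b \<in> carrier A" "t \<in> carrier A - P" "fraction A P b t = fraction A P a s"
    "\<exists>u \<in> carrier A - P. u \<otimes> (t \<otimes> a) = u \<otimes> (s \<otimes> b)"
proof -
  show *: "b \<in> carrier A" "t \<in> carrier A - P" "\<exists>u \<in> carrier A - P. u \<otimes> (t \<otimes> a) = u \<otimes> (s \<otimes> b)"
    using assms(1) by (auto simp: fraction_def)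
  then show "fraction A P b t = fraction A P a s" using fraction_eqI[OF assms(2,3) *(1,2)] by blast
qed

lemma localization_mult:
  assumes a: "a \<in> carrier A" "s \<in> carrier A - P" and b: "b \<in> carrier A" "t \<in> carrier A - P"
  shows "fraction A P a s \<otimes>\<^bsub>localization A P\<^esub> fraction A P b t = fraction A P (a \<otimes> b) (s \<otimes> t)"
proof -
  have "fraction A P (a' \<otimes> b') (s' \<otimes> t') = fraction A P (a \<otimes> b) (s \<otimes> t)"
    if "(a', s') \<in> fraction A P a s" "(b', t') \<in> fraction A P b t" for a' s' b' t'
  proof -
    note A = fraction_memD[OF that(1) a] and B = fraction_memD[OF that(2) b]
    obtain u v where u: "u \<in> carrier A - P" "u \<otimes> (s' \<otimes> a) = u \<otimes> (s \<otimes> a')"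
      and v: "v \<in> carrier A - P" "v \<otimes> (t' \<otimes> b) = v \<otimes> (t \<otimes> b')" using A(4) B(4) by blast
    have cl: "u \<in> carrier A" "v \<in> carrier A" "s \<in> carrier A" "t \<in> carrier A" "s' \<in> carrier A" "t' \<in> carrier A"
      using u v a b A B by auto
    have "(u \<otimes> v) \<otimes> ((s' \<otimes> t') \<otimes> (a \<otimes> b)) = (u \<otimes> (s' \<otimes> a)) \<otimes> (v \<otimes> (t' \<otimes> b))" using cl a(1) b(1) by algebra
    also have "\<dots> = (u \<otimes> v) \<otimes> ((s \<otimes> t) \<otimes> (a' \<otimes> b'))" unfolding u(2) v(2) using cl A(1) B(1) by algebra
    finally show ?thesis
      by (intro fraction_eqI[symmetric, OF _ _ _ _ S_mult[OF u(1) v(1)]]) (use a b A B S_mult in auto)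
  qed
  then show ?thesis unfolding localization_def ring_record_simps
    by (intro UN_pair2_constant[OF fraction_self[OF a] fraction_self[OF b]])
qed

lemma localization_add:
  assumes a: "a \<in> carrier A" "s \<in> carrier A - P" and b: "b \<in> carrier A" "t \<in> carrier A - P"
  shows "fraction A P a s \<oplus>\<^bsub>localization A P\<^esub> fraction A P b t = fraction A P ((a \<otimes> t) \<oplus> (b \<otimes> s)) (s \<otimes> t)"
proof -
  have "fraction A P ((a' \<otimes> t') \<oplus> (b' \<otimes> s')) (s' \<otimes> t') = fraction A P ((a \<otimes> t) \<oplus> (b \<otimes> s)) (s \<otimes> t)"
    if "(a', s') \<in> fraction A P a s" "(b', t') \<in> fraction A P b t" for a' s' b' t'
  proof -
    note A = fraction_memD[OF that(1) a] and B = fraction_memD[OF that(2) b]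
    obtain u v where u: "u \<in> carrier A - P" "u \<otimes> (s' \<otimes> a) = u \<otimes> (s \<otimes> a')"
      and v: "v \<in> carrier A - P" "v \<otimes> (t' \<otimes> b) = v \<otimes> (t \<otimes> b')" using A(4) B(4) by blast
    have cl: "u \<in> carrier A" "v \<in> carrier A" "s \<in> carrier A" "t \<in> carrier A" "s' \<in> carrier A" "t' \<in> carrier A"
      using u v a b A B by auto
    have "(u \<otimes> v) \<otimes> ((s' \<otimes> t') \<otimes> ((a \<otimes> t) \<oplus> (b \<otimes> s))) =
      (v \<otimes> (t' \<otimes> t)) \<otimes> (u \<otimes> (s' \<otimes> a)) \<oplus> (u \<otimes> (s' \<otimes> s)) \<otimes> (v \<otimes> (t' \<otimes> b))" using cl a(1) b(1) by algebra
    also have "\<dots> = (u \<otimes> v) \<otimes> ((s \<otimes> t) \<otimes> ((a' \<otimes> t') \<oplus> (b' \<otimes> s')))" unfolding u(2) v(2) using cl A(1) B(1) by algebra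
    finally show ?thesis
      by (intro fraction_eqI[symmetric, OF _ _ _ _ S_mult[OF u(1) v(1)]]) (use a b A B S_mult in auto)
  qed
  then show ?thesis unfolding localization_def ring_record_simps
    by (intro UN_pair2_constant[OF fraction_self[OF a] fraction_self[OF b]])
qed

lemma localization_zero: "\<zero>\<^bsub>localization A P\<^esub> = fraction A P \<zero> \<one>"
  by (simp add: localization_def)

lemma localization_one: "\<one>\<^bsub>localization A P\<^esub> = fraction A P \<one> \<one>"
  by (simp add: localization_def)

lemma carrier_localization:
  "carrier (localization A P) = {fraction A P a s | a s. a \<in> carrier A \<and> s \<in> carrier A - P}"
  by (simp add: localization_def)

lemma fraction_zero_iff:
  assumes "a \<in> carrier A" "s \<in> carrier A - P"
  shows "fraction A P a s = \<zero>\<^bsub>localization A P\<^esub> \<longleftrightarrow> (\<exists>u \<in> carrier A - P. u \<otimes> a = \<zero>)"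
proof
  assume "fraction A P a s = \<zero>\<^bsub>localization A P\<^esub>"
  then have "fraction A P a s = fraction A P \<zero> \<one>" by (simp add: localization_zero)
  from fraction_eqD[OF this zero_closed S_one]
  obtain u where "u \<in> carrier A - P" "u \<otimes> (\<one> \<otimes> a) = u \<otimes> (s \<otimes> \<zero>)" by auto
  then show "\<exists>u \<in> carrier A - P. u \<otimes> a = \<zero>" using assms by auto
next
  assume "\<exists>u \<in> carrier A - P. u \<otimes> a = \<zero>"
  then obtain u where "u \<in> carrier A - P" "u \<otimes> a = \<zero>" by auto
  then show "fraction A P a s = \<zero>\<^bsub>localization A P\<^esub>"
    unfolding localization_zero using assms S_one by (intro fraction_eqI[of _ _ _ _ u]) auto
qed

lemma fraction_add_one:
  assumes "a \<in> carrier A" "b \<in> carrier A"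
  shows "fraction A P a \<one> \<oplus>\<^bsub>localization A P\<^esub> fraction A P b \<one> = fraction A P (a \<oplus> b) \<one>"
  using localization_add[OF assms(1) S_one assms(2) S_one] assms by simp

lemma fraction_mult_one:
  assumes "a \<in> carrier A" "b \<in> carrier A"
  shows "fraction A P a \<one> \<otimes>\<^bsub>localization A P\<^esub> fraction A P b \<one> = fraction A P (a \<otimes> b) \<one>"
  using localization_mult[OF assms(1) S_one assms(2) S_one] by simp

lemma fraction_clear_denominator:
  assumes "a \<in> carrier A" "s \<in> carrier A - P"
  shows "fraction A P s \<one> \<otimes>\<^bsub>localization A P\<^esub> fraction A P a s = fraction A P a \<one>"
proof -
  have "fraction A P s \<one> \<otimes>\<^bsub>localization A P\<^esub> fraction A P a s = fraction A P (s \<otimes> a) (\<one> \<otimes> s)"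
    using localization_mult[of s \<one> a s] assms S_one by simp
  also have "\<dots> = fraction A P a \<one>"
    using assms S_one by (intro fraction_eqI[of _ _ _ _ \<one>]) auto
  finally show ?thesis .
qed

lemma fraction_mult_eq_one:
  assumes "a \<in> carrier A" "s \<in> carrier A - P" "z \<in> carrier (localization A P)"
    "fraction A P a s \<otimes>\<^bsub>localization A P\<^esub> z = \<one>\<^bsub>localization A P\<^esub>"
  shows "a \<notin> P"
proof
  assume aP: "a \<in> P"
  obtain b t where b: "b \<in> carrier A" "t \<in> carrier A - P" "z = fraction A P b t"
    using assms(3) by (auto simp: carrier_localization)
  have "fraction A P (a \<otimes> b) (s \<otimes> t) = fraction A P \<one> \<one>"
    using assms b localization_mult by (simp add: localization_one)
  then obtain u where u: "u \<in> carrier A - P" "u \<otimes> (\<one> \<otimes> (a \<otimes> b)) = u \<otimes> ((s \<otimes> t) \<otimes> \<one>)"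
    using fraction_eqD[OF _ one_closed S_one] by blast
  have Pi: "ideal P A" using prime primeideal.axioms by blast
  have "u \<otimes> (\<one> \<otimes> (a \<otimes> b)) \<in> P"
    using u(1) aP b assms(1) ideal.I_l_closed[OF Pi] ideal.I_r_closed[OF Pi aP] by auto
  then have "u \<otimes> (s \<otimes> t) \<in> P" using u(2) assms(2) b(2) by simp
  then show False using S_mult[OF u(1) S_mult[OF assms(2) b(2)]] by simp
qed

end

section \<open>Lifting relations in a tensor product\<close>

definition pair_map :: "('a \<Rightarrow> 'c) \<Rightarrow> ('a \<times> 'b \<Rightarrow>\<^sub>0 int) \<Rightarrow> ('c \<times> 'b \<Rightarrow>\<^sub>0 int)" where
  "pair_map g c = frag_extend (\<lambda>(a, e). frag_of (g a, e)) c"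

lemma pair_map_of [simp]: "pair_map g (frag_of (a, e)) = frag_of (g a, e)"
  by (simp add: pair_map_def)

lemma pair_map_zero [simp]: "pair_map g 0 = 0"
  by (simp add: pair_map_def)

lemma pair_map_diff: "pair_map g (c - d) = pair_map g c - pair_map g d"
  by (simp add: pair_map_def frag_extend_diff)

lemma pair_map_cong:
  "Poly_Mapping.keys c \<subseteq> A \<times> B \<Longrightarrow> (\<And>a. a \<in> A \<Longrightarrow> g a = h a) \<Longrightarrow> pair_map g c = pair_map h c"
  unfolding pair_map_def by (rule frag_extend_eq) auto

lemma pair_map_comp: "pair_map g (pair_map h c) = pair_map (\<lambda>a. g (h a)) c"
proof -
  have *: "pair_map h = frag_extend (frag_of \<circ> map_prod h id)" for h :: "'x \<Rightarrow> 'y"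
    by (simp add: pair_map_def fun_eq_iff comp_def case_prod_unfold map_prod_def)
  show ?thesis
    unfolding *[of h] pair_map_def[of g] frag_extend_compose
    by (simp add: pair_map_def comp_def case_prod_unfold)
qed

lemma keys_pair_map:
  assumes "Poly_Mapping.keys c \<subseteq> A \<times> B" "\<And>a. a \<in> A \<Longrightarrow> g a \<in> A'"
  shows "Poly_Mapping.keys (pair_map g c) \<subseteq> A' \<times> B"
proof
  fix x assume "x \<in> Poly_Mapping.keys (pair_map g c)"
  then obtain a b where "(a, b) \<in> Poly_Mapping.keys c" "x \<in> Poly_Mapping.keys (frag_of (g a, b))"
    using keys_frag_extend[of "\<lambda>(a, e). frag_of (g a, e)" c] unfolding pair_map_def by fastforce
  then show "x \<in> A' \<times> B" using assms by auto
qed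

lemma (in two_crings) pair_map_mult:
  assumes "cring A'" "g \<in> ring_hom A A'"
    and c: "fsums A B c" and d: "fsums A B d"
  shows "pair_map g (pair_mult A B c d) = pair_mult A' B (pair_map g c) (pair_map g d)"
  using c
proof (induction c rule: pair_induct)
  case ab: (one a b)
  show ?case
    using d
    by (induction d rule: pair_induct)
      (use ab assms(2) in \<open>simp_all add: pair_mult_of pair_mult_diff_right pair_map_diff ring_hom_mult\<close>)
qed (simp_all add: pair_mult_diff_left pair_map_diff)

lemma (in two_crings) pair_mult_scalar:
  assumes "fsums A B c" "s \<in> carrier A"
  shows "pair_mult A B (frag_of (s, \<one>\<^bsub>B\<^esub>)) c = pair_map (\<lambda>a. s \<otimes>\<^bsub>A\<^esub> a) c"
  using assms(1) by (induction c rule: pair_induct) (simp_all add: pair_mult_of pair_mult_diff_right pair_map_diff)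

text \<open>A ring \<open>A\<close> maps to rings \<open>O\<^sub>x\<close>, one of which, \<open>O\<^sub>z\<close>, is the localization of \<open>A\<close> at \<open>S\<close>, and
  the constants from \<open>k\<close> are fractions with numerator and denominator from \<open>A\<close>.\<close>

locale lifting_setup = two_crings A L for A :: "'a ring" (structure) and L :: "'l ring" +
  fixes k :: "'k ring" and \<beta> :: "'k \<Rightarrow> 'l" and N :: "'x set" and z :: 'x
    and Ox :: "'x \<Rightarrow> 'o ring" and \<theta> :: "'x \<Rightarrow> 'a \<Rightarrow> 'o" and \<alpha> :: "'x \<Rightarrow> 'k \<Rightarrow> 'o" and S :: "'a set"
  assumes z: "z \<in> N" and cring: "\<And>x. x \<in> N \<Longrightarrow> cring (Ox x)"
    and hom: "\<And>x. x \<in> N \<Longrightarrow> \<theta> x \<in> ring_hom A (Ox x)"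
    and const: "\<And>x c. x \<in> N \<Longrightarrow> c \<in> carrier k \<Longrightarrow> \<alpha> x c \<in> carrier (Ox x)"
    and \<beta>: "\<And>c. c \<in> carrier k \<Longrightarrow> \<beta> c \<in> carrier L"
    and S: "S \<subseteq> carrier A" "\<one> \<in> S" "\<And>s t. s \<in> S \<Longrightarrow> t \<in> S \<Longrightarrow> s \<otimes> t \<in> S"
    and surj: "\<And>e. e \<in> carrier (Ox z) \<Longrightarrow> \<exists>s\<in>S. \<exists>a\<in>carrier A. \<theta> z s \<otimes>\<^bsub>Ox z\<^esub> e = \<theta> z a"
    and inj: "\<And>a a'. a \<in> carrier A \<Longrightarrow> a' \<in> carrier A \<Longrightarrow> \<theta> z a = \<theta> z a' \<Longrightarrow> \<exists>s\<in>S. s \<otimes> a = s \<otimes> a'"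
    and frac: "\<And>c. c \<in> carrier k \<Longrightarrow> \<exists>g\<in>S. \<exists>a\<in>carrier A. \<forall>x\<in>N. \<theta> x a = \<alpha> x c \<otimes>\<^bsub>Ox x\<^esub> \<theta> x g"
begin

lemma algebras: "x \<in> N \<Longrightarrow> two_algebras (Ox x) L k (\<alpha> x) \<beta>"
  using cring const \<beta> by (auto simp: two_algebras_def two_crings_def two_algebras_axioms_def B.cring_axioms)

abbreviation "Tx x \<equiv> tensor_ideal k (Ox x) (\<alpha> x) L \<beta>"
abbreviation "scal s d \<equiv> pair_map (\<lambda>a. s \<otimes> a) d"

lemma hom_closed: "x \<in> N \<Longrightarrow> a \<in> carrier A \<Longrightarrow> \<theta> x a \<in> carrier (Ox x)"
  using hom ring_hom_closed by fast

lemma keys_scal: "fsums A L d \<Longrightarrow> s \<in> carrier A \<Longrightarrow>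
    fsums A L (scal s d)"
  by (rule keys_pair_map) auto

lemma map_scal:
  assumes "x \<in> N" "fsums A L d" "s \<in> carrier A"
  shows "pair_map (\<theta> x) (scal s d) = pair_mult (Ox x) L (emb L (\<theta> x s)) (pair_map (\<theta> x) d)"
  using pair_map_mult[OF cring hom, of x "emb L s" d] assms
  by (simp add: pair_mult_scalar)

lemma scal_scal:
  assumes "fsums A L d" "s \<in> carrier A" "t \<in> carrier A"
  shows "scal s (scal t d) = scal (s \<otimes> t) d"
  unfolding pair_map_comp by (rule pair_map_cong[OF assms(1)]) (use assms in \<open>simp add: A.m_assoc\<close>)

text \<open>Up to a denominator, the elements of \<open>K\<close> become relations in all \<open>O\<^sub>x \<otimes> L\<close> at once. The aim is that every element that
  becomes a relation at \<open>z\<close> lies in \<open>K\<close>.\<close>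

definition "K = {d. fsums A L d \<and> (\<exists>s\<in>S. \<forall>x\<in>N. pair_map (\<theta> x) (scal s d) \<in> Tx x)}"

lemma K_scal:
  assumes "fsums A L d" "s \<in> carrier A" "t \<in> carrier A"
    "\<forall>x\<in>N. pair_map (\<theta> x) (scal s d) \<in> Tx x"
  shows "\<forall>x\<in>N. pair_map (\<theta> x) (scal (t \<otimes> s) d) \<in> Tx x"
proof
  fix x assume x: "x \<in> N"
  interpret x: two_algebras "Ox x" L k "\<alpha> x" \<beta> by (rule algebras[OF x])
  have "pair_map (\<theta> x) (scal (t \<otimes> s) d) =
      pair_mult (Ox x) L (emb L (\<theta> x t)) (pair_map (\<theta> x) (scal s d))"
    using map_scal[OF x keys_scal[OF assms(1,2)] assms(3)] scal_scal[OF assms(1,3,2)] by simp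
  also have "\<dots> \<in> Tx x"
    using assms(4) x hom_closed[OF x assms(3)] by (intro ideal.I_l_closed[OF x.T_ideal]) auto
  finally show "pair_map (\<theta> x) (scal (t \<otimes> s) d) \<in> Tx x" .
qed

lemma K_I:
  assumes d: "fsums A L d" and T: "\<And>x. x \<in> N \<Longrightarrow> pair_map (\<theta> x) d \<in> Tx x"
  shows "d \<in> K"
proof -
  have "scal \<one> d = d"
    using pair_mult_scalar[OF d A.one_closed] pair_mult_one[OF d] by simp
  then show ?thesis unfolding K_def using assms S(2) by (intro CollectI conjI bexI[of _ "\<one>"]) auto
qed

lemma K_diff: "d \<in> K \<Longrightarrow> d' \<in> K \<Longrightarrow> d - d' \<in> K"
proof -
  assume "d \<in> K" "d' \<in> K"
  then obtain s s' where d: "fsums A L d" "s \<in> S" "\<forall>x\<in>N. pair_map (\<theta> x) (scal s d) \<in> Tx x"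
    and d': "fsums A L d'" "s' \<in> S" "\<forall>x\<in>N. pair_map (\<theta> x) (scal s' d') \<in> Tx x"
    unfolding K_def by blast
  have c: "s \<in> carrier A" "s' \<in> carrier A" using d d' S(1) by auto
  have 1: "\<forall>x\<in>N. pair_map (\<theta> x) (scal (s' \<otimes> s) d) \<in> Tx x" by (rule K_scal[OF d(1) c(1,2) d(3)])
  have 2: "\<forall>x\<in>N. pair_map (\<theta> x) (scal (s \<otimes> s') d') \<in> Tx x" by (rule K_scal[OF d'(1) c(2,1) d'(3)])
  have "pair_map (\<theta> x) (scal (s' \<otimes> s) (d - d')) \<in> Tx x" if x: "x \<in> N" for x
  proof -
    interpret x: two_algebras "Ox x" L k "\<alpha> x" \<beta> by (rule algebras[OF x])
    have e: "pair_map (\<theta> x) (scal (s' \<otimes> s) d') \<in> Tx x" using 2 x A.m_comm[OF c] by simp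
    have k: "Poly_Mapping.keys (pair_map (\<theta> x) (scal (s' \<otimes> s) d')) \<subseteq> carrier (Ox x) \<times> carrier L"
      using d'(1) c hom_closed[OF x] by (intro keys_pair_map[OF keys_scal]) auto
    show ?thesis using x.pair.ideal_diff[OF x.T_ideal 1[rule_format, OF x] e] k by (simp add: pair_map_diff)
  qed
  then show "d - d' \<in> K" unfolding K_def using d d' S(3)[of s' s] by (auto simp: keys_diff_subset simp del: subset_iff intro!: bexI[of _ "s' \<otimes> s"])
qed

lemma K_zero: "0 \<in> K"
proof (rule K_I)
  fix x assume x: "x \<in> N"
  interpret x: two_algebras "Ox x" L k "\<alpha> x" \<beta> by (rule algebras[OF x])
  show "pair_map (\<theta> x) 0 \<in> Tx x" using additive_subgroup.zero_closed[OF ideal.axioms(1)[OF x.T_ideal]] by simp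
qed simp

lemma K_mult:
  assumes d: "d \<in> K" and a: "a \<in> carrier A" and l: "l \<in> carrier L"
  shows "pair_mult A L (frag_of (a, l)) d \<in> K"
proof -
  obtain s where dk: "fsums A L d" and s: "s \<in> S" "\<forall>x\<in>N. pair_map (\<theta> x) (scal s d) \<in> Tx x"
    using d unfolding K_def by blast
  have sc: "s \<in> carrier A" using s S(1) by auto
  let ?d = "pair_mult A L (frag_of (a, l)) d"
  have k: "fsums A L (frag_of (a, l))" using a l by simp
  have ks: "fsums A L (emb L s)" using sc by simp
  have "scal s ?d = pair_mult A L (frag_of (a, l)) (scal s d)"
    unfolding pair_mult_scalar[OF pair_mult_closed[OF k dk] sc, symmetric] pair_mult_scalar[OF dk sc, symmetric]
      pair_mult_assoc[OF ks k dk, symmetric] pair_mult_assoc[OF k ks dk, symmetric] pair_mult_comm[OF ks k] ..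
  then have "pair_map (\<theta> x) (scal s ?d) \<in> Tx x" if x: "x \<in> N" for x
  proof -
    interpret x: two_algebras "Ox x" L k "\<alpha> x" \<beta> by (rule algebras[OF x])
    show ?thesis unfolding \<open>scal s ?d = _\<close> pair_map_mult[OF cring[OF x] hom[OF x] k keys_scal[OF dk sc]]
      using s(2) x hom_closed[OF x a] l by (intro ideal.I_l_closed[OF x.T_ideal]) auto
  qed
  then show ?thesis unfolding K_def using pair_mult_closed[OF k dk] s(1) by blast
qed

text \<open>The extension of \<open>K\<close> to \<open>\<int>[O\<^sub>z \<times> L]\<close>. It is an ideal that contains the generating relations, and therefore all
  relations at \<open>z\<close>.\<close>

definition "J = {c. Poly_Mapping.keys c \<subseteq> carrier (Ox z) \<times> carrier L \<and>
    (\<exists>s\<in>S. \<exists>d\<in>K. pair_map (\<theta> z) d = pair_mult (Ox z) L (emb L (\<theta> z s)) c)}"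

lemma scalar_keys: "s \<in> carrier A \<Longrightarrow> x \<in> N \<Longrightarrow>
    Poly_Mapping.keys (emb L (\<theta> x s)) \<subseteq> carrier (Ox x) \<times> carrier L"
  using hom_closed by simp

lemma scalar_mult:
  assumes "x \<in> N" "s \<in> carrier A" "t \<in> carrier A"
  shows "pair_mult (Ox x) L (emb L (\<theta> x s)) (emb L (\<theta> x t)) = emb L (\<theta> x (s \<otimes> t))"
  using ring_hom_mult[OF hom[OF assms(1)] assms(2,3)] by (simp add: pair_mult_of)

lemma J_ideal: "ideal J (pair_ring (Ox z) L)"
proof -
  interpret z: two_algebras "Ox z" L k "\<alpha> z" \<beta> by (rule algebras[OF z])
  show ?thesis
  proof (rule z.pair_idealI)
    show "0 \<in> J" unfolding J_def using S(2) K_zero by (auto intro!: bexI[of _ "\<one>"] bexI[of _ 0])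
  next
    fix c c' assume "c \<in> J" "c' \<in> J"
    then obtain s d s' d' where c: "Poly_Mapping.keys c \<subseteq> carrier (Ox z) \<times> carrier L" "s \<in> S" "d \<in> K"
        "pair_map (\<theta> z) d = pair_mult (Ox z) L (emb L (\<theta> z s)) c"
      and c': "Poly_Mapping.keys c' \<subseteq> carrier (Ox z) \<times> carrier L" "s' \<in> S" "d' \<in> K"
        "pair_map (\<theta> z) d' = pair_mult (Ox z) L (emb L (\<theta> z s')) c'"
      unfolding J_def by blast
    have sc: "s \<in> carrier A" "s' \<in> carrier A" using c(2) c'(2) S(1) by auto
    have dk: "fsums A L d" "fsums A L d'"
      using c(3) c'(3) unfolding K_def by blast+
    have "scal s' d - scal s d' \<in> K"
      unfolding pair_mult_scalar[OF dk(1) sc(2), symmetric] pair_mult_scalar[OF dk(2) sc(1), symmetric]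
      by (intro K_diff K_mult c c' sc) simp_all
    moreover have "pair_map (\<theta> z) (scal s' d - scal s d') =
        pair_mult (Ox z) L (emb L (\<theta> z (s' \<otimes> s))) (c - c')"
      unfolding pair_map_diff map_scal[OF z dk(1) sc(2)] map_scal[OF z dk(2) sc(1)] c(4) c'(4)
        z.pair_mult_assoc[OF scalar_keys[OF sc(2) z] scalar_keys[OF sc(1) z] c(1), symmetric]
        z.pair_mult_assoc[OF scalar_keys[OF sc(1) z] scalar_keys[OF sc(2) z] c'(1), symmetric]
        scalar_mult[OF z sc(2,1)] scalar_mult[OF z sc(1,2)] A.m_comm[OF sc] pair_mult_diff_right ..
    ultimately show "c - c' \<in> J"
      unfolding J_def using S(3)[OF c'(2) c(2)] keys_diff_subset[OF c(1) c'(1)] by blast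
  next
    fix e l c assume e: "e \<in> carrier (Ox z)" and l: "l \<in> carrier L" and "c \<in> J"
    then obtain s d where c: "Poly_Mapping.keys c \<subseteq> carrier (Ox z) \<times> carrier L" "s \<in> S" "d \<in> K"
        "pair_map (\<theta> z) d = pair_mult (Ox z) L (emb L (\<theta> z s)) c"
      unfolding J_def by blast
    obtain t a where t: "t \<in> S" and a: "a \<in> carrier A" and ta: "\<theta> z t \<otimes>\<^bsub>Ox z\<^esub> e = \<theta> z a" using surj[OF e] by blast
    have sc: "s \<in> carrier A" "t \<in> carrier A" using c(2) t S(1) by auto
    have dk: "fsums A L d" using c(3) unfolding K_def by blast
    have al: "fsums A L (frag_of (a, l))" using a l by simp
    have el: "Poly_Mapping.keys (frag_of (e, l)) \<subseteq> carrier (Ox z) \<times> carrier L" using e l by simp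
    have "pair_mult A L (frag_of (a, l)) d \<in> K" by (rule K_mult[OF c(3) a l])
    moreover have "pair_map (\<theta> z) (pair_mult A L (frag_of (a, l)) d) =
        pair_mult (Ox z) L (emb L (\<theta> z (t \<otimes> s))) (pair_mult (Ox z) L (frag_of (e, l)) c)"
    proof -
      have "pair_map (\<theta> z) (pair_mult A L (frag_of (a, l)) d) =
          pair_mult (Ox z) L (frag_of (\<theta> z a, l)) (pair_mult (Ox z) L (emb L (\<theta> z s)) c)"
        using pair_map_mult[OF cring[OF z] hom[OF z] al dk] c(4) by simp
      also have "frag_of (\<theta> z a, l) = pair_mult (Ox z) L (emb L (\<theta> z t)) (frag_of (e, l))"
        using ta l by (simp add: pair_mult_of)
      also have "pair_mult (Ox z) L (pair_mult (Ox z) L (emb L (\<theta> z t)) (frag_of (e, l)))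
            (pair_mult (Ox z) L (emb L (\<theta> z s)) c) =
          pair_mult (Ox z) L (pair_mult (Ox z) L (emb L (\<theta> z t)) (emb L (\<theta> z s)))
            (pair_mult (Ox z) L (frag_of (e, l)) c)"
        using z.pair.m_ac scalar_keys[OF sc(1) z] scalar_keys[OF sc(2) z] c(1) el z.pair_mult_closed
        by (simp only: carrier_pair_ring)
      finally show ?thesis unfolding scalar_mult[OF z sc(2,1)] .
    qed
    ultimately show "pair_mult (Ox z) L (frag_of (e, l)) c \<in> J"
      unfolding J_def using S(3)[OF t c(2)] z.pair_mult_closed[OF el c(1)] by blast
  qed (auto simp: J_def)
qed

lemma J_I:
  assumes "Poly_Mapping.keys c \<subseteq> carrier (Ox z) \<times> carrier L" "s \<in> S"
    "fsums A L d"
    "\<And>x. x \<in> N \<Longrightarrow> pair_map (\<theta> x) d \<in> Tx x"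
    "pair_map (\<theta> z) d = pair_mult (Ox z) L (emb L (\<theta> z s)) c"
  shows "c \<in> J"
  using assms K_I[OF assms(3,4)] unfolding J_def by blast

lemma J_relations: "tensor_relations k (Ox z) (\<alpha> z) L \<beta> \<subseteq> J"
proof -
  interpret z: two_algebras "Ox z" L k "\<alpha> z" \<beta> by (rule algebras[OF z])
  note zhom = hom[OF z]
  have 1: "frag_of (e \<oplus>\<^bsub>Ox z\<^esub> e', l) - frag_of (e, l) - frag_of (e', l) \<in> J"
    if e: "e \<in> carrier (Ox z)" "e' \<in> carrier (Ox z)" and l: "l \<in> carrier L" for e e' l
  proof -
    obtain s a where s: "s \<in> S" and a: "a \<in> carrier A" and sa: "\<theta> z s \<otimes>\<^bsub>Ox z\<^esub> e = \<theta> z a" using surj[OF e(1)] by blast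
    obtain s' a' where s': "s' \<in> S" and a': "a' \<in> carrier A" and sa': "\<theta> z s' \<otimes>\<^bsub>Ox z\<^esub> e' = \<theta> z a'" using surj[OF e(2)] by blast
    have sc: "s \<in> carrier A" "s' \<in> carrier A" using s s' S(1) by auto
    let ?a = "s' \<otimes> a" and ?a' = "s \<otimes> a'"
    have h: "\<theta> z (s \<otimes> s') \<otimes>\<^bsub>Ox z\<^esub> e = \<theta> z ?a" "\<theta> z (s \<otimes> s') \<otimes>\<^bsub>Ox z\<^esub> e' = \<theta> z ?a'"
      using sa sa' e a a' sc hom_closed[OF z sc(1)] hom_closed[OF z sc(2)]
      by (simp_all add: ring_hom_mult[OF zhom] z.A.m_assoc[symmetric] z.A.m_comm[of "\<theta> z s'" "\<theta> z s"] flip: sa sa')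
    show ?thesis
    proof (rule J_I[of _ "s \<otimes> s'" "frag_of (?a \<oplus> ?a', l) - frag_of (?a, l) - frag_of (?a', l)"])
      show "pair_map (\<theta> x) (frag_of (?a \<oplus> ?a', l) - frag_of (?a, l) - frag_of (?a', l)) \<in> Tx x" if x: "x \<in> N" for x
      proof -
        interpret x: two_algebras "Ox x" L k "\<alpha> x" \<beta> by (rule algebras[OF x])
        have add: "\<theta> x (?a \<oplus> ?a') = \<theta> x ?a \<oplus>\<^bsub>Ox x\<^esub> \<theta> x ?a'" using a a' sc by (intro ring_hom_add[OF hom[OF x]]) simp_all
        have "\<theta> x ?a \<in> carrier (Ox x)" "\<theta> x ?a' \<in> carrier (Ox x)" using a a' sc by (simp_all add: hom_closed[OF x])
        then show ?thesis unfolding pair_map_diff pair_map_of add by (rule x.T_add_left[OF _ _ l])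
      qed
      have "\<theta> z (s \<otimes> s') \<otimes>\<^bsub>Ox z\<^esub> (e \<oplus>\<^bsub>Ox z\<^esub> e') = \<theta> z (?a \<oplus> ?a')"
        using e sc a a' by (simp add: z.A.r_distr hom_closed[OF z] h ring_hom_add[OF zhom])
      then show "pair_map (\<theta> z) (frag_of (?a \<oplus> ?a', l) - frag_of (?a, l) - frag_of (?a', l)) =
          pair_mult (Ox z) L (emb L (\<theta> z (s \<otimes> s'))) (frag_of (e \<oplus>\<^bsub>Ox z\<^esub> e', l) - frag_of (e, l) - frag_of (e', l))"
        using h l by (simp add: pair_map_diff pair_mult_diff_right pair_mult_of)
    qed (use e l sc a a' s s' S(3) in \<open>simp_all add: keys_diff_subset\<close>)
  qed
  have 2: "frag_of (e, l \<oplus>\<^bsub>L\<^esub> l') - frag_of (e, l) - frag_of (e, l') \<in> J"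
    if e: "e \<in> carrier (Ox z)" and l: "l \<in> carrier L" "l' \<in> carrier L" for e l l'
  proof -
    obtain s a where s: "s \<in> S" and a: "a \<in> carrier A" and sa: "\<theta> z s \<otimes>\<^bsub>Ox z\<^esub> e = \<theta> z a" using surj[OF e] by blast
    show ?thesis
    proof (rule J_I[of _ s "frag_of (a, l \<oplus>\<^bsub>L\<^esub> l') - frag_of (a, l) - frag_of (a, l')"])
      show "pair_map (\<theta> x) (frag_of (a, l \<oplus>\<^bsub>L\<^esub> l') - frag_of (a, l) - frag_of (a, l')) \<in> Tx x" if x: "x \<in> N" for x
      proof -
        interpret x: two_algebras "Ox x" L k "\<alpha> x" \<beta> by (rule algebras[OF x])
        show ?thesis unfolding pair_map_diff pair_map_of by (rule x.T_add_right[OF hom_closed[OF x a] l])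
      qed
      show "pair_map (\<theta> z) (frag_of (a, l \<oplus>\<^bsub>L\<^esub> l') - frag_of (a, l) - frag_of (a, l')) =
          pair_mult (Ox z) L (emb L (\<theta> z s)) (frag_of (e, l \<oplus>\<^bsub>L\<^esub> l') - frag_of (e, l) - frag_of (e, l'))"
        using l sa by (simp add: pair_map_diff pair_mult_diff_right pair_mult_of)
    qed (use e l a s in \<open>simp_all add: keys_diff_subset\<close>)
  qed
  have 3: "frag_of (\<alpha> z c \<otimes>\<^bsub>Ox z\<^esub> e, l) - frag_of (e, \<beta> c \<otimes>\<^bsub>L\<^esub> l) \<in> J"
    if e: "e \<in> carrier (Ox z)" and l: "l \<in> carrier L" and c: "c \<in> carrier k" for e l c
  proof -
    obtain s a where s: "s \<in> S" and a: "a \<in> carrier A" and sa: "\<theta> z s \<otimes>\<^bsub>Ox z\<^esub> e = \<theta> z a" using surj[OF e] by blast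
    obtain g b where g: "g \<in> S" and b: "b \<in> carrier A" and gb: "\<And>x. x \<in> N \<Longrightarrow> \<theta> x b = \<alpha> x c \<otimes>\<^bsub>Ox x\<^esub> \<theta> x g"
      using frac[OF c] by blast
    have sc: "s \<in> carrier A" "g \<in> carrier A" using s g S(1) by auto
    show ?thesis
    proof (rule J_I[of _ "g \<otimes> s" "frag_of (b \<otimes> a, l) - frag_of (g \<otimes> a, \<beta> c \<otimes>\<^bsub>L\<^esub> l)"])
      show "pair_map (\<theta> x) (frag_of (b \<otimes> a, l) - frag_of (g \<otimes> a, \<beta> c \<otimes>\<^bsub>L\<^esub> l)) \<in> Tx x" if x: "x \<in> N" for x
      proof -
        interpret x: two_algebras "Ox x" L k "\<alpha> x" \<beta> by (rule algebras[OF x])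
        have "\<theta> x (b \<otimes> a) = \<alpha> x c \<otimes>\<^bsub>Ox x\<^esub> \<theta> x (g \<otimes> a)"
          using gb[OF x] ring_hom_mult[OF hom[OF x]] a b sc const[OF x c] hom_closed[OF x] by (simp add: x.A.m_assoc)
        moreover have "\<theta> x (g \<otimes> a) \<in> carrier (Ox x)" using a sc by (simp add: hom_closed[OF x])
        ultimately show ?thesis unfolding pair_map_diff pair_map_of using x.T_const[OF _ l c] by simp
      qed
      have "\<theta> z (g \<otimes> s) \<otimes>\<^bsub>Ox z\<^esub> (\<alpha> z c \<otimes>\<^bsub>Ox z\<^esub> e) = \<theta> z (b \<otimes> a)" "\<theta> z (g \<otimes> s) \<otimes>\<^bsub>Ox z\<^esub> e = \<theta> z (g \<otimes> a)"
        using gb[OF z] sa[symmetric] ring_hom_mult[OF zhom] a b sc e const[OF z c] hom_closed[OF z sc(1)] hom_closed[OF z sc(2)]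
        by (simp_all add: z.A.m_ac)
      then show "pair_map (\<theta> z) (frag_of (b \<otimes> a, l) - frag_of (g \<otimes> a, \<beta> c \<otimes>\<^bsub>L\<^esub> l)) =
          pair_mult (Ox z) L (emb L (\<theta> z (g \<otimes> s))) (frag_of (\<alpha> z c \<otimes>\<^bsub>Ox z\<^esub> e, l) - frag_of (e, \<beta> c \<otimes>\<^bsub>L\<^esub> l))"
        using l \<beta>[OF c] by (simp add: pair_map_diff pair_mult_diff_right pair_mult_of)
    qed (use e l a b s g sc c \<beta> const[OF z] S(3) in \<open>simp_all add: keys_diff_subset\<close>)
  qed
  show ?thesis unfolding tensor_relations_def
    by (intro Un_least subsetI; elim CollectE exE conjE) (use 1 2 3 in simp_all)
qed

text \<open>An element of \<open>\<int>[A \<times> L]\<close> that vanishes in \<open>\<int>[O\<^sub>z \<times> L]\<close> is killed by an element of \<open>S\<close>, because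
  only finitely many elements of \<open>A\<close> occur in it.\<close>

lemma kernel_killed:
  assumes k: "fsums A L e" and zero: "pair_map (\<theta> z) e = 0"
  shows "\<exists>t\<in>S. scal t e = 0"
proof -
  define E where "E = fst ` Poly_Mapping.keys e"
  have E: "finite E" "E \<subseteq> carrier A" using k by (auto simp: E_def)
  have common: "\<exists>t\<in>S. \<forall>(a, a')\<in>F. t \<otimes> a = t \<otimes> a'"
    if "finite F" "F \<subseteq> {(a, a'). a \<in> carrier A \<and> a' \<in> carrier A \<and> \<theta> z a = \<theta> z a'}" for F
    using that
  proof (induction F rule: finite_induct)
    case empty then show ?case using S(2) by auto
  next
    case (insert p F)
    obtain t where t: "t \<in> S" "\<forall>(a, a')\<in>F. t \<otimes> a = t \<otimes> a'" using insert by auto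
    obtain a a' where p: "p = (a, a')" "a \<in> carrier A" "a' \<in> carrier A" "\<theta> z a = \<theta> z a'" using insert(4) by auto
    obtain s where s: "s \<in> S" "s \<otimes> a = s \<otimes> a'" using inj p by blast
    have c: "s \<in> carrier A" "t \<in> carrier A" using s t S(1) by auto
    have "(t \<otimes> s) \<otimes> b = (t \<otimes> s) \<otimes> b'" if "(b, b') \<in> insert p F" for b b'
    proof (cases "(b, b') = p")
      case True then show ?thesis using p s(2) c by (simp add: A.m_assoc)
    next
      case False
      then have bF: "(b, b') \<in> F" using that by simp
      then have bc: "b \<in> carrier A" "b' \<in> carrier A" using insert(4) by auto
      have "(t \<otimes> s) \<otimes> b = s \<otimes> (t \<otimes> b)" using c bc by (simp add: A.m_ac)
      also have "\<dots> = s \<otimes> (t \<otimes> b')" using t(2) bF by auto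
      also have "\<dots> = (t \<otimes> s) \<otimes> b'" using c bc by (simp add: A.m_ac)
      finally show ?thesis .
    qed
    then show ?case using S(3)[OF t(1) s(1)] by auto
  qed
  have "finite {(a, a'). a \<in> E \<and> a' \<in> E \<and> \<theta> z a = \<theta> z a'}"
    by (rule finite_subset[of _ "E \<times> E"]) (use E in auto)
  then obtain t where t: "t \<in> S" and tt: "\<forall>(a, a')\<in>{(a, a'). a \<in> E \<and> a' \<in> E \<and> \<theta> z a = \<theta> z a'}. t \<otimes> a = t \<otimes> a'"
    using common[of "{(a, a'). a \<in> E \<and> a' \<in> E \<and> \<theta> z a = \<theta> z a'}"] E(2) by auto
  \<comment> \<open>multiplication by \<open>t\<close> factors through \<open>O\<^sub>z\<close> on the elements that occur in \<open>e\<close>\<close>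
  define h where "h o' = t \<otimes> (SOME a. a \<in> E \<and> \<theta> z a = o')" for o'
  have "h (\<theta> z a) = t \<otimes> a" if a: "a \<in> E" for a
  proof -
    define b where "b = (SOME a'. a' \<in> E \<and> \<theta> z a' = \<theta> z a)"
    have "b \<in> E \<and> \<theta> z b = \<theta> z a" unfolding b_def by (rule someI[of _ a]) (use a in simp)
    then have "t \<otimes> b = t \<otimes> a" using bspec[OF tt, of "(b, a)"] a by simp
    then show ?thesis unfolding h_def b_def .
  qed
  moreover have "Poly_Mapping.keys e \<subseteq> E \<times> UNIV" by (force simp: E_def)
  ultimately have "scal t e = pair_map (\<lambda>a. h (\<theta> z a)) e" by (intro pair_map_cong) auto
  also have "\<dots> = 0" using pair_map_comp[of h "\<theta> z" e] zero by simp
  finally show ?thesis using t by auto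
qed

theorem tensor_relation_lifts:
  assumes d: "fsums A L d" and zero: "pair_map (\<theta> z) d \<in> Tx z"
  shows "\<exists>s\<in>S. \<forall>x\<in>N. pair_map (\<theta> x) (scal s d) \<in> Tx x"
proof -
  interpret z: two_algebras "Ox z" L k "\<alpha> z" \<beta> by (rule algebras[OF z])
  have "pair_map (\<theta> z) d \<in> J" using z.T_minimal[OF J_ideal J_relations] zero by auto
  then obtain s d' where s: "s \<in> S" and d': "d' \<in> K"
    and e: "pair_map (\<theta> z) d' = pair_mult (Ox z) L (emb L (\<theta> z s)) (pair_map (\<theta> z) d)"
    unfolding J_def by blast
  have sc: "s \<in> carrier A" using s S(1) by auto
  have d'k: "fsums A L d'" using d' unfolding K_def by blast
  have "pair_map (\<theta> z) (scal s d - d') = 0" using e map_scal[OF z d sc] by (simp add: pair_map_diff)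
  then obtain t where t: "t \<in> S" "scal t (scal s d - d') = 0"
    using kernel_killed[OF keys_diff_subset[OF keys_scal[OF d sc] d'k]] by blast
  have tc: "t \<in> carrier A" using t S(1) by auto
  have "scal (t \<otimes> s) d = scal t d'" using t(2) scal_scal[OF d tc sc] by (simp add: pair_map_diff)
  also have "\<dots> \<in> K" using K_mult[OF d' tc B.one_closed] pair_mult_scalar[OF d'k tc] by simp
  finally obtain u where u: "u \<in> S" "\<forall>x\<in>N. pair_map (\<theta> x) (scal u (scal (t \<otimes> s) d)) \<in> Tx x"
    unfolding K_def by blast
  have uc: "u \<in> carrier A" using u S(1) by auto
  have "\<forall>x\<in>N. pair_map (\<theta> x) (scal (u \<otimes> (t \<otimes> s)) d) \<in> Tx x"
    using u(2) scal_scal[OF d uc, of "t \<otimes> s"] tc sc by simp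
  then show ?thesis using S(3)[OF u(1) S(3)[OF t(1) s]] by blast
qed

end

section \<open>Germs and stalks\<close>

abbreviation "sec X U \<equiv> carrier (sect X U)"
abbreviation "msec F U \<equiv> carrier (msect F U)"

locale set_presheaf =
  fixes T :: "'p topology" and S :: "'p set \<Rightarrow> 's set" and \<rho> :: "'p set \<Rightarrow> 'p set \<Rightarrow> 's \<Rightarrow> 's"
  assumes closed: "openin T U \<Longrightarrow> openin T V \<Longrightarrow> V \<subseteq> U \<Longrightarrow> s \<in> S U \<Longrightarrow> \<rho> U V s \<in> S V"
    and ident: "openin T U \<Longrightarrow> s \<in> S U \<Longrightarrow> \<rho> U U s = s"
    and comp: "openin T U \<Longrightarrow> openin T V \<Longrightarrow> openin T W \<Longrightarrow> W \<subseteq> V \<Longrightarrow> V \<subseteq> U \<Longrightarrow> s \<in> S U \<Longrightarrow>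
      \<rho> V W (\<rho> U V s) = \<rho> U W s"
begin

lemma germ_self: "openin T U \<Longrightarrow> x \<in> U \<Longrightarrow> s \<in> S U \<Longrightarrow> (U, s) \<in> germ T S \<rho> x U s"
  unfolding germ_def by auto

lemma germ_subset:
  assumes U: "openin T U" "s \<in> S U" and V: "openin T V" "t \<in> S V"
    and W: "openin T W" "x \<in> W" "W \<subseteq> U \<inter> V" "\<rho> U W s = \<rho> V W t"
  shows "germ T S \<rho> x V t \<subseteq> germ T S \<rho> x U s"
proof
  fix p assume "p \<in> germ T S \<rho> x V t"
  then obtain V' t' W' where p: "p = (V', t')" "openin T V'" "x \<in> V'" "t' \<in> S V'"
    and W': "openin T W'" "x \<in> W'" "W' \<subseteq> V \<inter> V'" "\<rho> V W' t = \<rho> V' W' t'"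
    unfolding germ_def by blast
  have o: "openin T (W \<inter> W')" using W(1) W'(1) by (rule openin_Int)
  have "\<rho> U (W \<inter> W') s = \<rho> W (W \<inter> W') (\<rho> U W s)" using comp[OF U(1) W(1) o] W(3) U(2) by simp
  also have "\<dots> = \<rho> V (W \<inter> W') t" using comp[OF V(1) W(1) o] W(3,4) V(2) by simp
  also have "\<dots> = \<rho> W' (W \<inter> W') (\<rho> V W' t)" using comp[OF V(1) W'(1) o] W'(3) V(2) by simp
  also have "\<dots> = \<rho> V' (W \<inter> W') t'" using comp[OF p(2) W'(1) o] W'(3,4) p(4) by simp
  finally show "p \<in> germ T S \<rho> x U s"
    unfolding germ_def p(1) using p W W' o by blast
qed

lemma germ_eqI:
  assumes "openin T U" "s \<in> S U" "openin T V" "t \<in> S V"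
    and "openin T W" "x \<in> W" "W \<subseteq> U" "W \<subseteq> V" "\<rho> U W s = \<rho> V W t"
  shows "germ T S \<rho> x U s = germ T S \<rho> x V t"
  using germ_subset[of U s V t W x] germ_subset[of V t U s W x] assms by (intro subset_antisym) auto

lemma germ_eqD:
  assumes "germ T S \<rho> x U s = germ T S \<rho> x V t" "openin T V" "x \<in> V" "t \<in> S V"
  shows "\<exists>W. openin T W \<and> x \<in> W \<and> W \<subseteq> U \<and> W \<subseteq> V \<and> \<rho> U W s = \<rho> V W t"
  using germ_self[OF assms(2-4)] unfolding assms(1)[symmetric] by (auto simp: germ_def)

lemma germ_memD:
  assumes "(V, t) \<in> germ T S \<rho> x U s" "openin T U" "s \<in> S U"
  shows "openin T V" "x \<in> V" "t \<in> S V" "germ T S \<rho> x V t = germ T S \<rho> x U s"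
proof -
  obtain W where *: "openin T V" "x \<in> V" "t \<in> S V" "openin T W" "x \<in> W" "W \<subseteq> U \<inter> V" "\<rho> U W s = \<rho> V W t"
    using assms(1) unfolding germ_def by auto
  then show "openin T V" "x \<in> V" "t \<in> S V" by auto
  show "germ T S \<rho> x V t = germ T S \<rho> x U s"
    by (rule germ_eqI[symmetric, of _ _ _ _ W]) (use * assms in auto)
qed

lemma germ_res:
  assumes "openin T U" "s \<in> S U" "openin T W" "x \<in> W" "W \<subseteq> U"
  shows "germ T S \<rho> x W (\<rho> U W s) = germ T S \<rho> x U s"
  by (rule germ_eqI[of _ _ _ _ W]) (use assms closed ident in auto)

end

lemma set_sheaf_presheaf:
  assumes "set_sheaf T S \<rho>"
  shows "set_presheaf T S \<rho>"
proof
  note s = assms[unfolded set_sheaf_def]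
  show "\<rho> U V s \<in> S V" if "openin T U" "openin T V" "V \<subseteq> U" "s \<in> S U" for U V s
    using funcset_mem[OF conjunct1[OF s, rule_format, of U V]] that by simp
  show "\<rho> U U s = s" if "openin T U" "s \<in> S U" for U s
    using conjunct1[OF conjunct2[OF s], rule_format, of U s] that by simp
  show "\<rho> V W (\<rho> U V s) = \<rho> U W s"
    if "openin T U" "openin T V" "openin T W" "W \<subseteq> V" "V \<subseteq> U" "s \<in> S U" for U V W s
    using conjunct1[OF conjunct2[OF conjunct2[OF s]], rule_format, of U V W s] that by simp
qed

lemma set_sheaf_separated:
  assumes "set_sheaf T S \<rho>" "\<And>V. V \<in> \<V> \<Longrightarrow> openin T V" "s \<in> S (\<Union>\<V>)" "t \<in> S (\<Union>\<V>)"
    "\<And>V. V \<in> \<V> \<Longrightarrow> \<rho> (\<Union>\<V>) V s = \<rho> (\<Union>\<V>) V t"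
  shows "s = t"
  using conjunct1[OF conjunct2[OF conjunct2[OF conjunct2[OF assms(1)[unfolded set_sheaf_def]]]], rule_format, of \<V> s t] assms(2-)
  by simp

text \<open>Addition, multiplication and scalar multiplication of germs are all instances of one construction:
  an operation that commutes with restriction is evaluated on a common neighbourhood.\<close>

lemma germ_operation:
  assumes "set_presheaf T S1 \<rho>1" "set_presheaf T S2 \<rho>2" "set_presheaf T S3 \<rho>3"
    and closed: "\<And>V a b. openin T V \<Longrightarrow> a \<in> S1 V \<Longrightarrow> b \<in> S2 V \<Longrightarrow> f V a b \<in> S3 V"
    and res: "\<And>V W a b. openin T V \<Longrightarrow> openin T W \<Longrightarrow> W \<subseteq> V \<Longrightarrow> a \<in> S1 V \<Longrightarrow> b \<in> S2 V \<Longrightarrow>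
      \<rho>3 V W (f V a b) = f W (\<rho>1 V W a) (\<rho>2 V W b)"
    and U: "openin T U" "x \<in> U" and s: "s \<in> S1 U" and t: "t \<in> S2 U"
  shows "(\<Union>(V, a)\<in>germ T S1 \<rho>1 x U s. \<Union>(W, b)\<in>germ T S2 \<rho>2 x U t.
    germ T S3 \<rho>3 x (V \<inter> W) (f (V \<inter> W) (\<rho>1 V (V \<inter> W) a) (\<rho>2 W (V \<inter> W) b))) = germ T S3 \<rho>3 x U (f U s t)"
proof -
  interpret A: set_presheaf T S1 \<rho>1 by fact
  interpret B: set_presheaf T S2 \<rho>2 by fact
  interpret C: set_presheaf T S3 \<rho>3 by fact
  show ?thesis
  proof (rule UN_pair2_constant[OF A.germ_self[OF U s] B.germ_self[OF U t]])
    fix U' s' V' t' assume m: "(U', s') \<in> germ T S1 \<rho>1 x U s" "(V', t') \<in> germ T S2 \<rho>2 x U t"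
    note A = A.germ_memD[OF m(1) U(1) s] and B = B.germ_memD[OF m(2) U(1) t]
    obtain W where W: "openin T W" "x \<in> W" "W \<subseteq> U'" "W \<subseteq> U" "\<rho>1 U' W s' = \<rho>1 U W s"
      using A.germ_eqD[OF A(4) U s] by blast
    obtain W' where W': "openin T W'" "x \<in> W'" "W' \<subseteq> V'" "W' \<subseteq> U" "\<rho>2 V' W' t' = \<rho>2 U W' t"
      using B.germ_eqD[OF B(4) U t] by blast
    let ?I = "U' \<inter> V'" and ?J = "W \<inter> W'"
    have o: "openin T ?I" "openin T ?J" using A(1) B(1) W(1) W'(1) by auto
    have c: "\<rho>1 U' ?I s' \<in> S1 ?I" "\<rho>2 V' ?I t' \<in> S2 ?I" using A.closed A(1,3) B.closed B(1,3) o(1) by auto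
    have r: "\<rho>1 U' ?J s' = \<rho>1 U ?J s" "\<rho>2 V' ?J t' = \<rho>2 U ?J t"
      using A.comp[OF A(1) W(1) o(2) _ W(3) A(3)] A.comp[OF U(1) W(1) o(2) _ W(4) s] W(5)
        B.comp[OF B(1) W'(1) o(2) _ W'(3) B(3)] B.comp[OF U(1) W'(1) o(2) _ W'(4) t] W'(5) by auto
    have JI: "?J \<subseteq> ?I" "?J \<subseteq> U" using W W' by auto
    show "germ T S3 \<rho>3 x ?I (f ?I (\<rho>1 U' ?I s') (\<rho>2 V' ?I t')) = germ T S3 \<rho>3 x U (f U s t)"
    proof (rule C.germ_eqI[of _ _ _ _ ?J])
      show "\<rho>3 ?I ?J (f ?I (\<rho>1 U' ?I s') (\<rho>2 V' ?I t')) = \<rho>3 U ?J (f U s t)"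
        unfolding res[OF o JI(1) c] res[OF U(1) o(2) JI(2) s t]
          A.comp[OF A(1) o JI(1) Int_lower1 A(3)] B.comp[OF B(1) o JI(1) Int_lower2 B(3)] r ..
    qed (use o W W' U closed c s t JI in auto)
  qed
qed

lemma finsum_lessThan_hom:
  assumes "abelian_monoid G" "abelian_monoid H"
    and h: "\<And>a. a \<in> carrier G \<Longrightarrow> h a \<in> carrier H"
      "\<And>a b. a \<in> carrier G \<Longrightarrow> b \<in> carrier G \<Longrightarrow> h (a \<oplus>\<^bsub>G\<^esub> b) = h a \<oplus>\<^bsub>H\<^esub> h b" "h \<zero>\<^bsub>G\<^esub> = \<zero>\<^bsub>H\<^esub>"
    and f: "\<And>j. j < n \<Longrightarrow> f j \<in> carrier G"
  shows "h (\<Oplus>\<^bsub>G\<^esub>j\<in>{..<n :: nat}. f j) = (\<Oplus>\<^bsub>H\<^esub>j\<in>{..<n}. h (f j))"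
  using f
proof (induction n)
  case 0
  show ?case by (simp add: abelian_monoid.finsum_empty[OF assms(1)] abelian_monoid.finsum_empty[OF assms(2)] h(3))
next
  case (Suc n)
  have G: "f \<in> {..<n} \<rightarrow> carrier G" "f n \<in> carrier G" using Suc.prems by auto
  have H: "(\<lambda>j. h (f j)) \<in> {..<n} \<rightarrow> carrier H" "h (f n) \<in> carrier H" using G h(1) by auto
  have "(\<Oplus>\<^bsub>G\<^esub>j\<in>{..<Suc n}. f j) = f n \<oplus>\<^bsub>G\<^esub> (\<Oplus>\<^bsub>G\<^esub>j\<in>{..<n}. f j)"
    unfolding lessThan_Suc using abelian_monoid.finsum_insert[OF assms(1), of "{..<n}" n f] G by simp
  moreover have "(\<Oplus>\<^bsub>H\<^esub>j\<in>{..<Suc n}. h (f j)) = h (f n) \<oplus>\<^bsub>H\<^esub> (\<Oplus>\<^bsub>H\<^esub>j\<in>{..<n}. h (f j))"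
    unfolding lessThan_Suc using abelian_monoid.finsum_insert[OF assms(2), of "{..<n}" n "\<lambda>j. h (f j)"] H by simp
  ultimately show ?case using Suc h(2) G abelian_monoid.finsum_closed[OF assms(1) G(1)] by simp
qed

subsection \<open>Stalks of rings\<close>

locale ringed_presheaf =
  fixes X :: "('p, 's) ringed_space"
  assumes sect_cring: "opn X U \<Longrightarrow> cring (sect X U)"
    and res_hom: "opn X U \<Longrightarrow> opn X V \<Longrightarrow> V \<subseteq> U \<Longrightarrow> res X U V \<in> ring_hom (sect X U) (sect X V)"
    and res_id: "opn X U \<Longrightarrow> s \<in> sec X U \<Longrightarrow> res X U U s = s"
    and res_comp: "opn X U \<Longrightarrow> opn X V \<Longrightarrow> opn X W \<Longrightarrow> W \<subseteq> V \<Longrightarrow> V \<subseteq> U \<Longrightarrow> s \<in> sec X U \<Longrightarrow>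
      res X V W (res X U V s) = res X U W s"
begin

lemma res_closed: "opn X U \<Longrightarrow> opn X V \<Longrightarrow> V \<subseteq> U \<Longrightarrow> s \<in> sec X U \<Longrightarrow> res X U V s \<in> sec X V"
  using res_hom ring_hom_closed by fast

sublocale R: set_presheaf "space X" "\<lambda>U. sec X U" "res X"
  by unfold_locales (use res_closed res_id res_comp in auto)

lemmas rgerm_self = R.germ_self[folded rgerm_def] and rgerm_eqI = R.germ_eqI[folded rgerm_def]
  and rgerm_eqD = R.germ_eqD[folded rgerm_def] and rgerm_memD = R.germ_memD[folded rgerm_def]
  and rgerm_res = R.germ_res[folded rgerm_def]

lemma carrier_stalk: "carrier (stalk X x) = {rgerm X x U s | U s. opn X U \<and> x \<in> U \<and> s \<in> sec X U}"
  by (simp add: stalk_def)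

lemma rgerm_closed: "opn X U \<Longrightarrow> x \<in> U \<Longrightarrow> s \<in> sec X U \<Longrightarrow> rgerm X x U s \<in> carrier (stalk X x)"
  by (auto simp: carrier_stalk)

lemma stalk_cases:
  assumes "a \<in> carrier (stalk X x)"
  obtains U s where "opn X U" "x \<in> U" "s \<in> sec X U" "a = rgerm X x U s"
  using assms by (auto simp: carrier_stalk)

lemma rgerm_mult:
  assumes U: "opn X U" "x \<in> U" and s: "s \<in> sec X U" "t \<in> sec X U"
  shows "rgerm X x U s \<otimes>\<^bsub>stalk X x\<^esub> rgerm X x U t = rgerm X x U (s \<otimes>\<^bsub>sect X U\<^esub> t)"
  unfolding stalk_def ring_record_simps rgerm_def
  by (rule germ_operation[OF R.set_presheaf_axioms R.set_presheaf_axioms R.set_presheaf_axioms _ _ U s])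
    (use cring.cring_simprules(5)[OF sect_cring] ring_hom_mult[OF res_hom] in auto)

lemma rgerm_add:
  assumes U: "opn X U" "x \<in> U" and s: "s \<in> sec X U" "t \<in> sec X U"
  shows "rgerm X x U s \<oplus>\<^bsub>stalk X x\<^esub> rgerm X x U t = rgerm X x U (s \<oplus>\<^bsub>sect X U\<^esub> t)"
  unfolding stalk_def ring_record_simps rgerm_def
  by (rule germ_operation[OF R.set_presheaf_axioms R.set_presheaf_axioms R.set_presheaf_axioms _ _ U s])
    (use cring.cring_simprules(1)[OF sect_cring] ring_hom_add[OF res_hom] in auto)

lemma rgerm_one:
  assumes U: "opn X U" "x \<in> U"
  shows "rgerm X x U \<one>\<^bsub>sect X U\<^esub> = \<one>\<^bsub>stalk X x\<^esub>"
proof -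
  have "U \<subseteq> pts X" using U(1) by (rule openin_subset)
  have "rgerm X x U (res X (pts X) U \<one>\<^bsub>sect X (pts X)\<^esub>) = rgerm X x (pts X) \<one>\<^bsub>sect X (pts X)\<^esub>"
    by (rule rgerm_res) (use U \<open>U \<subseteq> pts X\<close> cring.cring_simprules(6)[OF sect_cring] in auto)
  then show ?thesis using ring_hom_one[OF res_hom[OF _ U(1) \<open>U \<subseteq> pts X\<close>]] by (simp add: stalk_def)
qed

lemma rgerm_zero:
  assumes U: "opn X U" "x \<in> U"
  shows "rgerm X x U \<zero>\<^bsub>sect X U\<^esub> = \<zero>\<^bsub>stalk X x\<^esub>"
proof -
  have "U \<subseteq> pts X" using U(1) by (rule openin_subset)
  have "rgerm X x U (res X (pts X) U \<zero>\<^bsub>sect X (pts X)\<^esub>) = rgerm X x (pts X) \<zero>\<^bsub>sect X (pts X)\<^esub>"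
    by (rule rgerm_res) (use U \<open>U \<subseteq> pts X\<close> cring.cring_simprules(2)[OF sect_cring] in auto)
  moreover have "res X (pts X) U \<zero>\<^bsub>sect X (pts X)\<^esub> = \<zero>\<^bsub>sect X U\<^esub>"
    using ring_hom_zero[OF res_hom[OF _ U(1) \<open>U \<subseteq> pts X\<close>]] sect_cring U(1) by (simp add: cring.axioms(1))
  ultimately show ?thesis by (simp add: stalk_def)
qed

lemma rgerm_hom: "opn X U \<Longrightarrow> x \<in> U \<Longrightarrow> rgerm X x U \<in> ring_hom (sect X U) (stalk X x)"
  by (rule ring_hom_memI) (auto simp: rgerm_closed rgerm_mult rgerm_add rgerm_one)

lemma rgerm_zero_iff:
  assumes U: "opn X U" "x \<in> U" and s: "s \<in> sec X U"
  shows "rgerm X x U s = \<zero>\<^bsub>stalk X x\<^esub> \<longleftrightarrow> (\<exists>W. opn X W \<and> x \<in> W \<and> W \<subseteq> U \<and> res X U W s = \<zero>\<^bsub>sect X W\<^esub>)"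
proof -
  have z: "res X U W \<zero>\<^bsub>sect X U\<^esub> = \<zero>\<^bsub>sect X W\<^esub>" if "opn X W" "W \<subseteq> U" for W
    using ring_hom_zero[OF res_hom[OF U(1) that]] sect_cring U(1) that(1) by (simp add: cring.axioms(1))
  have zc: "\<zero>\<^bsub>sect X U\<^esub> \<in> sec X U" using cring.cring_simprules(2)[OF sect_cring[OF U(1)]] .
  show ?thesis
  proof
    assume "rgerm X x U s = \<zero>\<^bsub>stalk X x\<^esub>"
    then have "rgerm X x U s = rgerm X x U \<zero>\<^bsub>sect X U\<^esub>" using rgerm_zero[OF U] by simp
    from rgerm_eqD[OF this U zc] z show "\<exists>W. opn X W \<and> x \<in> W \<and> W \<subseteq> U \<and> res X U W s = \<zero>\<^bsub>sect X W\<^esub>" by auto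
  next
    assume "\<exists>W. opn X W \<and> x \<in> W \<and> W \<subseteq> U \<and> res X U W s = \<zero>\<^bsub>sect X W\<^esub>"
    then obtain W where W: "opn X W" "x \<in> W" "W \<subseteq> U" "res X U W s = \<zero>\<^bsub>sect X W\<^esub>" by auto
    have "rgerm X x U s = rgerm X x U \<zero>\<^bsub>sect X U\<^esub>" by (rule rgerm_eqI[of _ _ _ _ W]) (use U s W zc z in auto)
    then show "rgerm X x U s = \<zero>\<^bsub>stalk X x\<^esub>" using rgerm_zero[OF U] by simp
  qed
qed

end

lemma sheaf_of_rings_presheaf:
  assumes "sheaf_of_rings X"
  shows "ringed_presheaf X"
proof -
  interpret set_presheaf "space X" "\<lambda>U. sec X U" "res X"
    by (rule set_sheaf_presheaf) (use assms in \<open>simp add: sheaf_of_rings_def\<close>)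
  show ?thesis by (rule ringed_presheaf.intro) (use assms ident comp in \<open>simp_all add: sheaf_of_rings_def\<close>)
qed

subsection \<open>Stalks of modules\<close>

locale module_presheaf = ringed_presheaf X for X :: "('p, 's) ringed_space" +
  fixes F :: "('p, 's, 'm) module_sheaf"
  assumes msect_module: "opn X U \<Longrightarrow> module (sect X U) (msect F U)"
    and mres_closed: "opn X U \<Longrightarrow> opn X V \<Longrightarrow> V \<subseteq> U \<Longrightarrow> s \<in> msec F U \<Longrightarrow> mres F U V s \<in> msec F V"
    and mres_add: "opn X U \<Longrightarrow> opn X V \<Longrightarrow> V \<subseteq> U \<Longrightarrow> s \<in> msec F U \<Longrightarrow> t \<in> msec F U \<Longrightarrow>
      mres F U V (s \<oplus>\<^bsub>msect F U\<^esub> t) = mres F U V s \<oplus>\<^bsub>msect F V\<^esub> mres F U V t"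
    and mres_smult: "opn X U \<Longrightarrow> opn X V \<Longrightarrow> V \<subseteq> U \<Longrightarrow> a \<in> sec X U \<Longrightarrow> s \<in> msec F U \<Longrightarrow>
      mres F U V (a \<odot>\<^bsub>msect F U\<^esub> s) = res X U V a \<odot>\<^bsub>msect F V\<^esub> mres F U V s"
    and mres_id: "opn X U \<Longrightarrow> s \<in> msec F U \<Longrightarrow> mres F U U s = s"
    and mres_comp: "opn X U \<Longrightarrow> opn X V \<Longrightarrow> opn X W \<Longrightarrow> W \<subseteq> V \<Longrightarrow> V \<subseteq> U \<Longrightarrow> s \<in> msec F U \<Longrightarrow>
      mres F V W (mres F U V s) = mres F U W s"
begin

abbreviation "mst \<equiv> mstalk X F"
abbreviation "mg \<equiv> mgerm X F"

sublocale M: set_presheaf "space X" "\<lambda>U. msec F U" "mres F"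
  by unfold_locales (use mres_closed mres_id mres_comp in auto)

lemmas mgerm_self = M.germ_self[folded mgerm_def] and mgerm_eqI = M.germ_eqI[folded mgerm_def]
  and mgerm_eqD = M.germ_eqD[folded mgerm_def] and mgerm_memD = M.germ_memD[folded mgerm_def]
  and mgerm_res = M.germ_res[folded mgerm_def]

lemma carrier_mstalk: "carrier (mst x) = {mg x U s | U s. opn X U \<and> x \<in> U \<and> s \<in> msec F U}"
  by (simp add: mstalk_def)

lemma mgerm_closed: "opn X U \<Longrightarrow> x \<in> U \<Longrightarrow> s \<in> msec F U \<Longrightarrow> mg x U s \<in> carrier (mst x)"
  by (auto simp: carrier_mstalk)

lemma mstalk_cases:
  assumes "a \<in> carrier (mst x)"
  obtains U s where "opn X U" "x \<in> U" "s \<in> msec F U" "a = mg x U s"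
  using assms by (auto simp: carrier_mstalk)

lemma mres_zero: "opn X U \<Longrightarrow> opn X V \<Longrightarrow> V \<subseteq> U \<Longrightarrow> mres F U V \<zero>\<^bsub>msect F U\<^esub> = \<zero>\<^bsub>msect F V\<^esub>"
proof -
  assume *: "opn X U" "opn X V" "V \<subseteq> U"
  interpret U: module "sect X U" "msect F U" using msect_module[OF *(1)] .
  interpret V: module "sect X V" "msect F V" using msect_module[OF *(2)] .
  have c: "mres F U V \<zero>\<^bsub>msect F U\<^esub> \<in> msec F V" using mres_closed[OF *] by simp
  have "mres F U V \<zero>\<^bsub>msect F U\<^esub> \<oplus>\<^bsub>msect F V\<^esub> mres F U V \<zero>\<^bsub>msect F U\<^esub> = mres F U V \<zero>\<^bsub>msect F U\<^esub>"
    using mres_add[OF *, of "\<zero>\<^bsub>msect F U\<^esub>" "\<zero>\<^bsub>msect F U\<^esub>"] by simp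
  then show ?thesis using V.M.add.r_cancel_one[OF c c] by simp
qed

lemma mgerm_add:
  assumes U: "opn X U" "x \<in> U" and s: "s \<in> msec F U" "t \<in> msec F U"
  shows "mg x U s \<oplus>\<^bsub>mst x\<^esub> mg x U t = mg x U (s \<oplus>\<^bsub>msect F U\<^esub> t)"
  unfolding mstalk_def ring_record_simps mgerm_def
  by (rule germ_operation[OF M.set_presheaf_axioms M.set_presheaf_axioms M.set_presheaf_axioms _ _ U s])
    (use abelian_monoid.a_closed[OF abelian_group.axioms(1)[OF module.axioms(2)[OF msect_module]]] mres_add in auto)

lemma mgerm_smult:
  assumes U: "opn X U" "x \<in> U" and a: "a \<in> sec X U" and s: "s \<in> msec F U"
  shows "rgerm X x U a \<odot>\<^bsub>mst x\<^esub> mg x U s = mg x U (a \<odot>\<^bsub>msect F U\<^esub> s)"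
  unfolding mstalk_def module.simps rgerm_def mgerm_def
  by (rule germ_operation[OF R.set_presheaf_axioms M.set_presheaf_axioms M.set_presheaf_axioms _ _ U a s])
    (use module.smult_closed[OF msect_module] mres_smult in auto)

lemma mgerm_zero:
  assumes U: "opn X U" "x \<in> U"
  shows "mg x U \<zero>\<^bsub>msect F U\<^esub> = \<zero>\<^bsub>mst x\<^esub>"
proof -
  have UX: "U \<subseteq> pts X" using U(1) by (rule openin_subset)
  interpret X: module "sect X (pts X)" "msect F (pts X)" by (rule msect_module) simp
  have "mg x U (mres F (pts X) U \<zero>\<^bsub>msect F (pts X)\<^esub>) = mg x (pts X) \<zero>\<^bsub>msect F (pts X)\<^esub>"
    by (rule mgerm_res) (use U UX in auto)
  then show ?thesis using mres_zero[OF _ U(1) UX] by (simp add: mstalk_def)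
qed

lemma mgerm_zero_iff:
  assumes U: "opn X U" "x \<in> U" and s: "s \<in> msec F U"
  shows "mg x U s = \<zero>\<^bsub>mst x\<^esub> \<longleftrightarrow> (\<exists>W. opn X W \<and> x \<in> W \<and> W \<subseteq> U \<and> mres F U W s = \<zero>\<^bsub>msect F W\<^esub>)"
proof -
  interpret U: module "sect X U" "msect F U" using msect_module[OF U(1)] .
  show ?thesis
  proof
    assume "mg x U s = \<zero>\<^bsub>mst x\<^esub>"
    then have "mg x U s = mg x U \<zero>\<^bsub>msect F U\<^esub>" using mgerm_zero[OF U] by simp
    from mgerm_eqD[OF this U] mres_zero[OF U(1)] show "\<exists>W. opn X W \<and> x \<in> W \<and> W \<subseteq> U \<and> mres F U W s = \<zero>\<^bsub>msect F W\<^esub>" by auto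
  next
    assume "\<exists>W. opn X W \<and> x \<in> W \<and> W \<subseteq> U \<and> mres F U W s = \<zero>\<^bsub>msect F W\<^esub>"
    then obtain W where W: "opn X W" "x \<in> W" "W \<subseteq> U" "mres F U W s = \<zero>\<^bsub>msect F W\<^esub>" by auto
    have "mg x U s = mg x U \<zero>\<^bsub>msect F U\<^esub>" by (rule mgerm_eqI[of _ _ _ _ W]) (use U s W mres_zero in auto)
    then show "mg x U s = \<zero>\<^bsub>mst x\<^esub>" using mgerm_zero[OF U] by simp
  qed
qed

text \<open>The module laws of a stalk involve at most five germs, and are inherited from sections over a common
  neighbourhood.\<close>

lemma common_neighbourhood:
  assumes "a \<in> carrier (stalk X x)" "b \<in> carrier (stalk X x)"
    "u \<in> carrier (mst x)" "v \<in> carrier (mst x)" "w \<in> carrier (mst x)"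
  obtains W a' b' u' v' w' where "opn X W" "x \<in> W" "a' \<in> sec X W" "b' \<in> sec X W"
    "u' \<in> msec F W" "v' \<in> msec F W" "w' \<in> msec F W"
    "a = rgerm X x W a'" "b = rgerm X x W b'" "u = mg x W u'" "v = mg x W v'" "w = mg x W w'"
proof -
  obtain A a' where a: "opn X A" "x \<in> A" "a' \<in> sec X A" "a = rgerm X x A a'" using stalk_cases[OF assms(1)] .
  obtain B b' where b: "opn X B" "x \<in> B" "b' \<in> sec X B" "b = rgerm X x B b'" using stalk_cases[OF assms(2)] .
  obtain U u' where u: "opn X U" "x \<in> U" "u' \<in> msec F U" "u = mg x U u'" using mstalk_cases[OF assms(3)] .
  obtain V v' where v: "opn X V" "x \<in> V" "v' \<in> msec F V" "v = mg x V v'" using mstalk_cases[OF assms(4)] .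
  obtain W w' where w: "opn X W" "x \<in> W" "w' \<in> msec F W" "w = mg x W w'" using mstalk_cases[OF assms(5)] .
  define W0 where "W0 = A \<inter> B \<inter> U \<inter> V \<inter> W"
  have sub: "W0 \<subseteq> A" "W0 \<subseteq> B" "W0 \<subseteq> U" "W0 \<subseteq> V" "W0 \<subseteq> W" by (auto simp: W0_def)
  have o: "opn X W0" "x \<in> W0" using a b u v w by (auto simp: W0_def)
  show ?thesis
    by (rule that[of W0 "res X A W0 a'" "res X B W0 b'" "mres F U W0 u'" "mres F V W0 v'" "mres F W W0 w'"])
      (use o sub a b u v w in \<open>simp_all add: res_closed mres_closed rgerm_res mgerm_res\<close>)
qed

lemma mstalk_module:
  assumes "cring (stalk X x)" and x: "x \<in> pts X"
  shows "module (stalk X x) (mst x)"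
proof -
  interpret A: cring "stalk X x" by fact
  note cn = common_neighbourhood[where x = x]
  have z: "\<zero>\<^bsub>mst x\<^esub> \<in> carrier (mst x)"
  proof -
    interpret X: module "sect X (pts X)" "msect F (pts X)" by (rule msect_module) simp
    show ?thesis using mgerm_zero[of "pts X" x] mgerm_closed[of "pts X" x "\<zero>\<^bsub>msect F (pts X)\<^esub>"] x by simp
  qed
  show ?thesis
  proof (rule moduleI)
    show "abelian_group (mst x)"
    proof (rule abelian_groupI)
      fix u v w assume u: "u \<in> carrier (mst x)" and v: "v \<in> carrier (mst x)"
      obtain W u' v' where W: "opn X W" "x \<in> W" "u' \<in> msec F W" "v' \<in> msec F W"
        "u = mg x W u'" "v = mg x W v'" using cn[OF A.one_closed A.one_closed u v v] by metis
      interpret W: module "sect X W" "msect F W" using msect_module[OF W(1)] .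
      show "u \<oplus>\<^bsub>mst x\<^esub> v \<in> carrier (mst x)" using W mgerm_add mgerm_closed by simp
      show "u \<oplus>\<^bsub>mst x\<^esub> v = v \<oplus>\<^bsub>mst x\<^esub> u" using W mgerm_add W.M.a_comm by simp
    next
      fix u v w assume u: "u \<in> carrier (mst x)" and v: "v \<in> carrier (mst x)" and w: "w \<in> carrier (mst x)"
      obtain W u' v' w' where W: "opn X W" "x \<in> W" "u' \<in> msec F W" "v' \<in> msec F W" "w' \<in> msec F W"
        "u = mg x W u'" "v = mg x W v'" "w = mg x W w'" using cn[OF A.one_closed A.one_closed u v w] by metis
      interpret W: module "sect X W" "msect F W" using msect_module[OF W(1)] .
      show "u \<oplus>\<^bsub>mst x\<^esub> v \<oplus>\<^bsub>mst x\<^esub> w = u \<oplus>\<^bsub>mst x\<^esub> (v \<oplus>\<^bsub>mst x\<^esub> w)"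
        using W mgerm_add W.M.a_assoc by simp
    next
      fix u assume u: "u \<in> carrier (mst x)"
      obtain W u' where W: "opn X W" "x \<in> W" "u' \<in> msec F W" "u = mg x W u'" using mstalk_cases[OF u] .
      interpret W: module "sect X W" "msect F W" using msect_module[OF W(1)] .
      show "\<zero>\<^bsub>mst x\<^esub> \<oplus>\<^bsub>mst x\<^esub> u = u"
        using W mgerm_add[of W x "\<zero>\<^bsub>msect F W\<^esub>" u'] mgerm_zero[of W x] by simp
      show "\<exists>v\<in>carrier (mst x). v \<oplus>\<^bsub>mst x\<^esub> u = \<zero>\<^bsub>mst x\<^esub>"
        using W mgerm_add[of W x "\<ominus>\<^bsub>msect F W\<^esub> u'" u'] mgerm_zero[of W x] mgerm_closed[of W x "\<ominus>\<^bsub>msect F W\<^esub> u'"]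
          W.M.l_neg by (intro bexI[of _ "mg x W (\<ominus>\<^bsub>msect F W\<^esub> u')"]) auto
    qed (rule z)
  next
    fix a b u v assume *: "a \<in> carrier (stalk X x)" "b \<in> carrier (stalk X x)" "u \<in> carrier (mst x)"
    obtain W a' b' u' where W: "opn X W" "x \<in> W" "a' \<in> sec X W" "b' \<in> sec X W" "u' \<in> msec F W"
        "a = rgerm X x W a'" "b = rgerm X x W b'" "u = mg x W u'" using cn[OF *(1,2,3,3,3)] by metis
    interpret W: module "sect X W" "msect F W" using msect_module[OF W(1)] .
    show "(a \<oplus>\<^bsub>stalk X x\<^esub> b) \<odot>\<^bsub>mst x\<^esub> u = a \<odot>\<^bsub>mst x\<^esub> u \<oplus>\<^bsub>mst x\<^esub> b \<odot>\<^bsub>mst x\<^esub> u"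
      using W by (simp add: rgerm_add mgerm_smult mgerm_add W.smult_l_distr)
    show "(a \<otimes>\<^bsub>stalk X x\<^esub> b) \<odot>\<^bsub>mst x\<^esub> u = a \<odot>\<^bsub>mst x\<^esub> (b \<odot>\<^bsub>mst x\<^esub> u)"
      using W by (simp add: rgerm_mult mgerm_smult W.smult_assoc1)
  next
    fix a u v assume *: "a \<in> carrier (stalk X x)" "u \<in> carrier (mst x)" "v \<in> carrier (mst x)"
    obtain W a' u' v' where W: "opn X W" "x \<in> W" "a' \<in> sec X W" "u' \<in> msec F W" "v' \<in> msec F W"
        "a = rgerm X x W a'" "u = mg x W u'" "v = mg x W v'" using cn[OF *(1,1,2,3,3)] by metis
    interpret W: module "sect X W" "msect F W" using msect_module[OF W(1)] .
    show "a \<odot>\<^bsub>mst x\<^esub> (u \<oplus>\<^bsub>mst x\<^esub> v) = a \<odot>\<^bsub>mst x\<^esub> u \<oplus>\<^bsub>mst x\<^esub> a \<odot>\<^bsub>mst x\<^esub> v"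
      using W by (simp add: mgerm_smult mgerm_add W.smult_r_distr)
  next
    fix a u assume *: "a \<in> carrier (stalk X x)" "u \<in> carrier (mst x)"
    obtain W a' u' where W: "opn X W" "x \<in> W" "a' \<in> sec X W" "u' \<in> msec F W"
        "a = rgerm X x W a'" "u = mg x W u'" using cn[OF *(1,1,2,2,2)] by metis
    interpret W: module "sect X W" "msect F W" using msect_module[OF W(1)] .
    show "a \<odot>\<^bsub>mst x\<^esub> u \<in> carrier (mst x)" using W by (simp add: mgerm_smult mgerm_closed)
  next
    fix u assume u: "u \<in> carrier (mst x)"
    obtain W u' where W: "opn X W" "x \<in> W" "u' \<in> msec F W" "u = mg x W u'" using mstalk_cases[OF u] .
    interpret W: module "sect X W" "msect F W" using msect_module[OF W(1)] .
    show "\<one>\<^bsub>stalk X x\<^esub> \<odot>\<^bsub>mst x\<^esub> u = u" using W mgerm_smult[of W x "\<one>\<^bsub>sect X W\<^esub>" u'] by (simp add: rgerm_one)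
  qed (rule assms(1))
qed

lemma mgerm_finsum:
  assumes "cring (stalk X x)" and U: "opn X U" "x \<in> U"
    and a: "\<And>j. j < n \<Longrightarrow> a j \<in> sec X U" and t: "\<And>j. j < n \<Longrightarrow> t j \<in> msec F U"
  shows "mg x U (\<Oplus>\<^bsub>msect F U\<^esub>j\<in>{..<n :: nat}. a j \<odot>\<^bsub>msect F U\<^esub> t j) =
    (\<Oplus>\<^bsub>mst x\<^esub>j\<in>{..<n}. rgerm X x U (a j) \<odot>\<^bsub>mst x\<^esub> mg x U (t j))"
proof -
  have x: "x \<in> pts X" using U openin_subset by blast
  interpret U: module "sect X U" "msect F U" using msect_module[OF U(1)] .
  interpret M: module "stalk X x" "mst x" using mstalk_module[OF assms(1) x] .
  have "mg x U (\<Oplus>\<^bsub>msect F U\<^esub>j\<in>{..<n :: nat}. a j \<odot>\<^bsub>msect F U\<^esub> t j) =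
      (\<Oplus>\<^bsub>mst x\<^esub>j\<in>{..<n}. mg x U (a j \<odot>\<^bsub>msect F U\<^esub> t j))"
    by (rule finsum_lessThan_hom) (use U a t in \<open>auto simp: mgerm_add mgerm_zero mgerm_closed U.M.abelian_monoid_axioms M.M.abelian_monoid_axioms\<close>)
  also have "\<dots> = (\<Oplus>\<^bsub>mst x\<^esub>j\<in>{..<n}. rgerm X x U (a j) \<odot>\<^bsub>mst x\<^esub> mg x U (t j))"
    by (rule M.M.finsum_cong') (use U a t in \<open>auto simp: mgerm_smult rgerm_closed mgerm_closed\<close>)
  finally show ?thesis .
qed

end

lemma sheaf_of_modules_presheaf:
  assumes "ringed_presheaf X" "sheaf_of_modules X F"
  shows "module_presheaf X F"
proof -
  interpret ringed_presheaf X by fact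
  note F = assms(2)[unfolded sheaf_of_modules_def]
  interpret M: set_presheaf "space X" "\<lambda>U. msec F U" "mres F"
    by (rule set_sheaf_presheaf) (rule conjunct2[OF conjunct2[OF F]])
  note F2 = conjunct1[OF conjunct2[OF F], rule_format]
  show ?thesis
  proof (intro module_presheaf.intro module_presheaf_axioms.intro ringed_presheaf_axioms)
    show "module (sect X U) (msect F U)" if "opn X U" for U using F that by simp
    show "mres F U V (s \<oplus>\<^bsub>msect F U\<^esub> t) = mres F U V s \<oplus>\<^bsub>msect F V\<^esub> mres F U V t"
      if "opn X U" "opn X V" "V \<subseteq> U" "s \<in> msec F U" "t \<in> msec F U" for U V s t
      using F2[of U V] that by simp
    show "mres F U V (a \<odot>\<^bsub>msect F U\<^esub> s) = res X U V a \<odot>\<^bsub>msect F V\<^esub> mres F U V s"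
      if "opn X U" "opn X V" "V \<subseteq> U" "a \<in> sec X U" "s \<in> msec F U" for U V a s
      using F2[of U V] that by simp
  qed (use M.closed M.ident M.comp in auto)
qed

subsection \<open>Free stalks\<close>

context module_presheaf
begin

lemma stalk_family:
  assumes U: "opn X U" "x \<in> U" and a: "\<And>j. j < n \<Longrightarrow> a j \<in> carrier (stalk X x)"
  shows "\<exists>V. opn X V \<and> x \<in> V \<and> V \<subseteq> U \<and>
    (\<exists>b. \<forall>j < (n :: nat). b j \<in> sec X V \<and> a j = rgerm X x V (b j))"
  using a
proof (induction n)
  case 0 then show ?case using U by auto
next
  case (Suc n)
  have "\<exists>V. opn X V \<and> x \<in> V \<and> V \<subseteq> U \<and> (\<exists>b. \<forall>j<n. b j \<in> sec X V \<and> a j = rgerm X x V (b j))"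
    by (rule Suc.IH) (use Suc.prems in simp)
  then obtain V b where V: "opn X V" "x \<in> V" "V \<subseteq> U"
    and b: "\<forall>j<n. b j \<in> sec X V \<and> a j = rgerm X x V (b j)" by (elim exE conjE)
  obtain W s where W: "opn X W" "x \<in> W" "s \<in> sec X W" "a n = rgerm X x W s" using stalk_cases[OF Suc.prems[OF lessI]] .
  define V' where "V' = V \<inter> W"
  have sub: "V' \<subseteq> V" "V' \<subseteq> W" "opn X V'" "x \<in> V'" using V W by (auto simp: V'_def)
  define b' where "b' j = (if j = n then res X W V' s else res X V V' (b j))" for j
  have "\<forall>j<Suc n. b' j \<in> sec X V' \<and> a j = rgerm X x V' (b' j)"
  proof (intro allI impI)
    fix j assume "j < Suc n"
    show "b' j \<in> sec X V' \<and> a j = rgerm X x V' (b' j)"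
    proof (cases "j = n")
      case True then show ?thesis using W sub by (simp add: b'_def res_closed rgerm_res)
    next
      case False
      then show ?thesis using \<open>j < Suc n\<close> b V sub by (simp add: b'_def res_closed rgerm_res)
    qed
  qed
  then show ?case using sub(3,4) subset_trans[OF sub(1) V(3)] by (intro exI[of _ V'] exI[of _ b'] conjI)
qed

text \<open>The germs span because a section near \<open>x\<close> is a combination over a smaller neighbourhood, and coordinates are
  unique because an equality of germs holds over some neighbourhood.\<close>

lemma mstalk_basis:
  assumes A: "cring (stalk X x)" and U: "opn X U" "x \<in> U" and e: "e \<in> {..<r} \<rightarrow> msec F U"
    and basis: "\<And>V. opn X V \<Longrightarrow> V \<subseteq> U \<Longrightarrow> is_basis (sect X V) (msect F V) r (\<lambda>j. mres F U V (e j))"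
  shows "is_basis (stalk X x) (mst x) r (\<lambda>j. mg x U (e j))"
proof -
  have x: "x \<in> pts X" using U openin_subset by blast
  interpret A: cring "stalk X x" by fact
  interpret M: module "stalk X x" "mst x" using mstalk_module[OF A x] .
  have ej: "e j \<in> msec F U" if "j < r" for j using e that by auto
  let ?E = "\<lambda>j. mg x U (e j)"
  have Ec: "?E j \<in> carrier (mst x)" if "j < r" for j using mgerm_closed[OF U ej[OF that]] .
  let ?f = "\<lambda>a. \<Oplus>\<^bsub>mst x\<^esub>j\<in>{..<r}. a j \<odot>\<^bsub>mst x\<^esub> ?E j"
  have eval: "?f a = mg x V (\<Oplus>\<^bsub>msect F V\<^esub>j\<in>{..<r}. b j \<odot>\<^bsub>msect F V\<^esub> mres F U V (e j))"
    if V: "opn X V" "x \<in> V" "V \<subseteq> U" and b: "\<And>j. j < r \<Longrightarrow> b j \<in> sec X V" "\<And>j. j < r \<Longrightarrow> a j = rgerm X x V (b j)" for a b V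
  proof -
    have "mg x V (\<Oplus>\<^bsub>msect F V\<^esub>j\<in>{..<r}. b j \<odot>\<^bsub>msect F V\<^esub> mres F U V (e j)) =
        (\<Oplus>\<^bsub>mst x\<^esub>j\<in>{..<r}. rgerm X x V (b j) \<odot>\<^bsub>mst x\<^esub> mg x V (mres F U V (e j)))"
      by (rule mgerm_finsum[OF A V(1,2)]) (use V b ej U mres_closed in auto)
    also have "\<dots> = ?f a"
      by (rule M.M.finsum_cong') (use V b ej U Ec in \<open>auto simp: mgerm_res rgerm_closed\<close>)
    finally show ?thesis ..
  qed
  show ?thesis
    unfolding is_basis_def
  proof (intro conjI)
    show "?E \<in> {..<r} \<rightarrow> carrier (mst x)" using Ec by auto
    show "bij_betw ?f ({..<r} \<rightarrow>\<^sub>E carrier (stalk X x)) (carrier (mst x))"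
      unfolding bij_betw_def
    proof
      show "inj_on ?f ({..<r} \<rightarrow>\<^sub>E carrier (stalk X x))"
      proof (rule inj_onI)
        fix a a' assume a: "a \<in> {..<r} \<rightarrow>\<^sub>E carrier (stalk X x)" and a': "a' \<in> {..<r} \<rightarrow>\<^sub>E carrier (stalk X x)" and eq: "?f a = ?f a'"
        obtain V b where V: "opn X V" "x \<in> V" "V \<subseteq> U" and b: "\<forall>j<r. b j \<in> sec X V \<and> a j = rgerm X x V (b j)"
        proof -
          have "\<exists>V. opn X V \<and> x \<in> V \<and> V \<subseteq> U \<and> (\<exists>b. \<forall>j<r. b j \<in> sec X V \<and> a j = rgerm X x V (b j))"
            by (rule stalk_family[OF U]) (use a in auto)
          then show ?thesis using that by (elim exE conjE)
        qed
        obtain W b' where W: "opn X W" "x \<in> W" "W \<subseteq> V" and b': "\<forall>j<r. b' j \<in> sec X W \<and> a' j = rgerm X x W (b' j)"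
        proof -
          have "\<exists>W. opn X W \<and> x \<in> W \<and> W \<subseteq> V \<and> (\<exists>b. \<forall>j<r. b j \<in> sec X W \<and> a' j = rgerm X x W (b j))"
            by (rule stalk_family[OF V(1,2)]) (use a' in auto)
          then show ?thesis using that by (elim exE conjE)
        qed
        have WU: "W \<subseteq> U" using W V by blast
        define c where "c j = res X V W (b j)" for j
        have c: "c j \<in> sec X W" "a j = rgerm X x W (c j)" if "j < r" for j
          using b that V W by (auto simp: c_def res_closed rgerm_res)
        interpret W: module "sect X W" "msect F W" using msect_module[OF W(1)] .
        let ?s = "\<lambda>b. \<Oplus>\<^bsub>msect F W\<^esub>j\<in>{..<r}. b j \<odot>\<^bsub>msect F W\<^esub> mres F U W (e j)"
        have eW: "mres F U W (e j) \<in> msec F W" if "j < r" for j using mres_closed[OF U(1) W(1) WU ej[OF that]] .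
        have sc: "?s c \<in> msec F W" "?s b' \<in> msec F W"
          by (rule W.M.finsum_closed; use c b' eW in auto)+
        have "mg x W (?s c) = mg x W (?s b')"
          using eval[of W c a] eval[of W b' a'] eq W WU c b' by simp
        from mgerm_eqD[OF this W(1,2) sc(2)] obtain V' where V': "opn X V'" "x \<in> V'" "V' \<subseteq> W"
          "mres F W V' (?s c) = mres F W V' (?s b')" by auto
        have V'U: "V' \<subseteq> U" using V' WU by blast
        interpret V': module "sect X V'" "msect F V'" using msect_module[OF V'(1)] .
        have ress: "mres F W V' (?s g) = (\<Oplus>\<^bsub>msect F V'\<^esub>j\<in>{..<r}. res X W V' (g j) \<odot>\<^bsub>msect F V'\<^esub> mres F U V' (e j))"
          if g: "\<And>j. j < r \<Longrightarrow> g j \<in> sec X W" for g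
        proof -
          have "mres F W V' (?s g) = (\<Oplus>\<^bsub>msect F V'\<^esub>j\<in>{..<r}. mres F W V' (g j \<odot>\<^bsub>msect F W\<^esub> mres F U W (e j)))"
            by (rule finsum_lessThan_hom)
              (use g eW W(1) V' in \<open>auto simp: mres_closed mres_add mres_zero W.M.abelian_monoid_axioms V'.M.abelian_monoid_axioms\<close>)
          also have "\<dots> = (\<Oplus>\<^bsub>msect F V'\<^esub>j\<in>{..<r}. res X W V' (g j) \<odot>\<^bsub>msect F V'\<^esub> mres F U V' (e j))"
            by (rule V'.M.finsum_cong')
              (use g eW ej U W(1) V' WU V'U in \<open>auto simp: mres_smult mres_comp res_closed mres_closed\<close>)
          finally show ?thesis .
        qed
        have inj: "inj_on (\<lambda>a. \<Oplus>\<^bsub>msect F V'\<^esub>j\<in>{..<r}. a j \<odot>\<^bsub>msect F V'\<^esub> mres F U V' (e j)) ({..<r} \<rightarrow>\<^sub>E sec X V')"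
          using basis[OF V'(1) V'U] by (simp add: is_basis_def bij_betw_def)
        have sumrestr: "(\<Oplus>\<^bsub>msect F V'\<^esub>j\<in>{..<r}. (restrict (\<lambda>j. res X W V' (g j)) {..<r}) j \<odot>\<^bsub>msect F V'\<^esub> mres F U V' (e j)) =
            (\<Oplus>\<^bsub>msect F V'\<^esub>j\<in>{..<r}. res X W V' (g j) \<odot>\<^bsub>msect F V'\<^esub> mres F U V' (e j))"
          if g: "\<And>j. j < r \<Longrightarrow> g j \<in> sec X W" for g
          by (rule V'.M.finsum_cong') (use g ej U W(1) V' V'U in \<open>auto simp: res_closed mres_closed\<close>)
        have "restrict (\<lambda>j. res X W V' (c j)) {..<r} = restrict (\<lambda>j. res X W V' (b' j)) {..<r}"
          by (rule inj_onD[OF inj]) (use sumrestr[of c] sumrestr[of b'] ress[of c] ress[of b'] V' W c b' in \<open>auto simp: res_closed\<close>)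
        then have cb: "res X W V' (c j) = res X W V' (b' j)" if "j < r" for j
          using that by (metis lessThan_iff restrict_apply')
        show "a = a'"
        proof (rule PiE_ext[OF a a'])
          fix j assume "j \<in> {..<r}"
          then have j: "j < r" by simp
          show "a j = a' j"
            using rgerm_eqI[of W "c j" W "b' j" V' x] cb[OF j] c[OF j] b' j W V' by simp
        qed
      qed
      show "?f ` ({..<r} \<rightarrow>\<^sub>E carrier (stalk X x)) = carrier (mst x)"
      proof
        show "?f ` ({..<r} \<rightarrow>\<^sub>E carrier (stalk X x)) \<subseteq> carrier (mst x)"
        proof (rule image_subsetI, rule M.M.finsum_closed)
          fix a assume "a \<in> {..<r} \<rightarrow>\<^sub>E carrier (stalk X x)"
          then show "(\<lambda>j. a j \<odot>\<^bsub>mst x\<^esub> ?E j) \<in> {..<r} \<rightarrow> carrier (mst x)" using Ec by auto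
        qed
        show "carrier (mst x) \<subseteq> ?f ` ({..<r} \<rightarrow>\<^sub>E carrier (stalk X x))"
        proof
          fix u assume u: "u \<in> carrier (mst x)"
          obtain V s where V: "opn X V" "x \<in> V" "s \<in> msec F V" "u = mg x V s" using mstalk_cases[OF u] .
          define W where "W = U \<inter> V"
          have W: "opn X W" "x \<in> W" "W \<subseteq> U" "W \<subseteq> V" using U V by (auto simp: W_def)
          have "mres F V W s \<in> msec F W" using mres_closed[OF V(1) W(1,4) V(3)] .
          then have "mres F V W s \<in> (\<lambda>a. \<Oplus>\<^bsub>msect F W\<^esub>j\<in>{..<r}. a j \<odot>\<^bsub>msect F W\<^esub> mres F U W (e j)) ` ({..<r} \<rightarrow>\<^sub>E sec X W)"
            using basis[OF W(1,3)] by (simp add: is_basis_def bij_betw_def)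
          then obtain b where b: "b \<in> {..<r} \<rightarrow>\<^sub>E sec X W"
            "mres F V W s = (\<Oplus>\<^bsub>msect F W\<^esub>j\<in>{..<r}. b j \<odot>\<^bsub>msect F W\<^esub> mres F U W (e j))" by auto
          define a where "a = restrict (\<lambda>j. rgerm X x W (b j)) {..<r}"
          have bc: "b j \<in> sec X W" if "j < r" for j using b(1) that by auto
          have "?f a = mg x W (mres F V W s)"
            unfolding b(2) by (rule eval) (use W bc in \<open>auto simp: a_def\<close>)
          also have "\<dots> = u" using mgerm_res[OF V(1,3) W(1,2,4)] V(4) by simp
          finally have "u = ?f a" ..
          moreover have "a \<in> {..<r} \<rightarrow>\<^sub>E carrier (stalk X x)" using W bc by (auto simp: a_def rgerm_closed)
          ultimately show "u \<in> ?f ` ({..<r} \<rightarrow>\<^sub>E carrier (stalk X x))" by blast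
        qed
      qed
    qed
  qed
qed

end

subsection \<open>Stalks of homomorphisms\<close>

locale module_hom_presheaf = F: module_presheaf X F + G: module_presheaf X G
  for X :: "('p, 's) ringed_space" and F :: "('p, 's, 'm) module_sheaf" and G :: "('p, 's, 'n) module_sheaf" +
  fixes f :: "'p set \<Rightarrow> 'm \<Rightarrow> 'n"
  assumes f: "sheaf_hom X F G f"
begin

lemma hom_closed: "opn X U \<Longrightarrow> s \<in> msec F U \<Longrightarrow> f U s \<in> msec G U"
  using f by (auto simp: sheaf_hom_def)

lemma hom_add: "opn X U \<Longrightarrow> s \<in> msec F U \<Longrightarrow> t \<in> msec F U \<Longrightarrow>
    f U (s \<oplus>\<^bsub>msect F U\<^esub> t) = f U s \<oplus>\<^bsub>msect G U\<^esub> f U t"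
  using f by (simp add: sheaf_hom_def)

lemma hom_smult: "opn X U \<Longrightarrow> a \<in> sec X U \<Longrightarrow> s \<in> msec F U \<Longrightarrow>
    f U (a \<odot>\<^bsub>msect F U\<^esub> s) = a \<odot>\<^bsub>msect G U\<^esub> f U s"
  using f by (simp add: sheaf_hom_def)

lemma hom_res: "opn X U \<Longrightarrow> opn X V \<Longrightarrow> V \<subseteq> U \<Longrightarrow> s \<in> msec F U \<Longrightarrow>
    f V (mres F U V s) = mres G U V (f U s)"
  using f by (simp add: sheaf_hom_def)

lemma mstalk_map_germ:
  assumes U: "opn X U" "x \<in> U" and s: "s \<in> msec F U"
  shows "mstalk_map X G f x (mgerm X F x U s) = mgerm X G x U (f U s)"
  unfolding mstalk_map_def
proof (rule UN_pair_constant[OF F.mgerm_self[OF U s]])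
  fix V t assume m: "(V, t) \<in> mgerm X F x U s"
  note V = F.mgerm_memD[OF m U(1) s]
  obtain W where W: "opn X W" "x \<in> W" "W \<subseteq> V" "W \<subseteq> U" "mres F V W t = mres F U W s"
    using F.mgerm_eqD[OF V(4) U s] by blast
  show "mgerm X G x V (f V t) = mgerm X G x U (f U s)"
    by (rule G.mgerm_eqI[of _ _ _ _ W]) (use U s V W hom_closed hom_res[symmetric] in auto)
qed

lemma mstalk_map_closed: "u \<in> carrier (mstalk X F x) \<Longrightarrow> mstalk_map X G f x u \<in> carrier (mstalk X G x)"
  by (erule F.mstalk_cases) (simp add: mstalk_map_germ G.mgerm_closed hom_closed)

lemma mstalk_map_add:
  assumes "cring (stalk X x)" "u \<in> carrier (mstalk X F x)" "v \<in> carrier (mstalk X F x)"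
  shows "mstalk_map X G f x (u \<oplus>\<^bsub>mstalk X F x\<^esub> v) = mstalk_map X G f x u \<oplus>\<^bsub>mstalk X G x\<^esub> mstalk_map X G f x v"
proof -
  interpret A: cring "stalk X x" by fact
  obtain W u' v' where W: "opn X W" "x \<in> W" "u' \<in> msec F W" "v' \<in> msec F W"
    "u = mgerm X F x W u'" "v = mgerm X F x W v'"
    using F.common_neighbourhood[OF A.one_closed A.one_closed assms(2,3,3)] by metis
  interpret W: module "sect X W" "msect F W" using F.msect_module[OF W(1)] .
  show ?thesis using W by (simp add: F.mgerm_add mstalk_map_germ hom_add G.mgerm_add hom_closed)
qed

lemma mstalk_map_smult:
  assumes "a \<in> carrier (stalk X x)" "u \<in> carrier (mstalk X F x)"
  shows "mstalk_map X G f x (a \<odot>\<^bsub>mstalk X F x\<^esub> u) = a \<odot>\<^bsub>mstalk X G x\<^esub> mstalk_map X G f x u"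
proof -
  obtain W a' u' where W: "opn X W" "x \<in> W" "a' \<in> sec X W" "u' \<in> msec F W"
    "a = rgerm X x W a'" "u = mgerm X F x W u'"
    using F.common_neighbourhood[OF assms(1,1,2,2,2)] by metis
  interpret W: module "sect X W" "msect F W" using F.msect_module[OF W(1)] .
  show ?thesis using W by (simp add: F.mgerm_smult mstalk_map_germ hom_smult G.mgerm_smult hom_closed)
qed

lemma mstalk_map_inj:
  assumes inj: "sheaf_inj X F f" and "cring (stalk X x)"
  shows "inj_on (mstalk_map X G f x) (carrier (mstalk X F x))"
proof (rule inj_onI)
  interpret A: cring "stalk X x" by fact
  fix u v assume u: "u \<in> carrier (mstalk X F x)" and v: "v \<in> carrier (mstalk X F x)"
    and eq: "mstalk_map X G f x u = mstalk_map X G f x v"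
  obtain W u' v' where W: "opn X W" "x \<in> W" "u' \<in> msec F W" "v' \<in> msec F W"
    "u = mgerm X F x W u'" "v = mgerm X F x W v'"
    using F.common_neighbourhood[OF A.one_closed A.one_closed u v v] by metis
  have "mgerm X G x W (f W u') = mgerm X G x W (f W v')" using eq W by (simp add: mstalk_map_germ)
  from G.mgerm_eqD[OF this W(1,2) hom_closed[OF W(1,4)]] obtain V where V: "opn X V" "x \<in> V" "V \<subseteq> W"
    "mres G W V (f W u') = mres G W V (f W v')" by auto
  have "f V (mres F W V u') = f V (mres F W V v')" using hom_res W V by simp
  then have "mres F W V u' = mres F W V v'"
    using inj V(1) F.mres_closed[OF W(1) V(1,3)] W(3,4) unfolding sheaf_inj_def by (auto dest: inj_onD)
  then show "u = v" unfolding W(5,6) by (intro F.mgerm_eqI[of _ _ _ _ V]) (use W V in auto)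
qed

end

section \<open>Affine open subsets\<close>

lemma openin_generated: "S \<in> \<S> \<Longrightarrow> openin (topology_generated_by \<S>) S"
  by (rule topology_generated_by_Basis)

lemma topspace_generated: "topspace (topology_generated_by \<S>) = \<Union>\<S>"
  by (rule topology_generated_by_topspace)

lemma function_space_simps [simp]:
  "space (function_space T R B) = T" "res (function_space T R B) U V s = restrict s V"
  "sec (function_space T R B) W = local_sections T (\<lambda>p. carrier (R p)) B W"
  "s \<otimes>\<^bsub>sect (function_space T R B) W\<^esub> t = (\<lambda>p\<in>W. s p \<otimes>\<^bsub>R p\<^esub> t p)"
  "s \<oplus>\<^bsub>sect (function_space T R B) W\<^esub> t = (\<lambda>p\<in>W. s p \<oplus>\<^bsub>R p\<^esub> t p)"
  "\<one>\<^bsub>sect (function_space T R B) W\<^esub> = (\<lambda>p\<in>W. \<one>\<^bsub>R p\<^esub>)"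
  "\<zero>\<^bsub>sect (function_space T R B) W\<^esub> = (\<lambda>p\<in>W. \<zero>\<^bsub>R p\<^esub>)"
  by (simp_all add: function_space_def)

lemma local_sections_PiE: "s \<in> local_sections T S B W \<Longrightarrow> s \<in> (\<Pi>\<^sub>E p\<in>W. S p)"
  by (simp add: local_sections_def)

lemma local_sectionsD:
  assumes "s \<in> local_sections T S B W" "p \<in> W"
  obtains V b where "openin T V" "p \<in> V" "V \<subseteq> W" "b \<in> B V" "\<forall>x\<in>V. s x = b x"
proof -
  have "\<exists>V. openin T V \<and> p \<in> V \<and> V \<subseteq> W \<and> (\<exists>b \<in> B V. \<forall>x\<in>V. s x = b x)"
    using assms by (simp add: local_sections_def)
  then obtain V b where "openin T V" "p \<in> V" "V \<subseteq> W" "b \<in> B V" "\<forall>x\<in>V. s x = b x" by (elim exE bexE conjE)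
  then show thesis by (intro that[of V b]) simp_all
qed

lemma local_sections_restrict:
  assumes s: "s \<in> local_sections T S B W" and V: "openin T V" "V \<subseteq> W"
    and B: "\<And>V V' b. b \<in> B V \<Longrightarrow> V' \<subseteq> V \<Longrightarrow> b \<in> B V'"
  shows "restrict s V \<in> local_sections T S B V"
  unfolding local_sections_def
proof (intro CollectI conjI ballI)
  show "restrict s V \<in> (\<Pi>\<^sub>E p\<in>V. S p)" using local_sections_PiE[OF s] V(2) by auto
  fix p assume p: "p \<in> V"
  obtain V' b where V': "openin T V'" "p \<in> V'" "V' \<subseteq> W" "b \<in> B V'" "\<forall>x\<in>V'. s x = b x"
    using local_sectionsD[OF s subsetD[OF V(2) p]] .
  show "\<exists>V'. openin T V' \<and> p \<in> V' \<and> V' \<subseteq> V \<and> (\<exists>b\<in>B V'. \<forall>x\<in>V'. restrict s V x = b x)"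
    using V(1) V' p B[OF V'(4), of "V' \<inter> V"] by (intro exI[of _ "V' \<inter> V"]) auto
qed

lemma local_sectionsI:
  assumes "openin T W" "b \<in> B W" "\<And>p. p \<in> W \<Longrightarrow> b p \<in> S p"
  shows "restrict b W \<in> local_sections T S B W"
  unfolding local_sections_def
proof (intro CollectI conjI ballI)
  show "restrict b W \<in> (\<Pi>\<^sub>E p\<in>W. S p)" using assms(3) by auto
  fix p assume "p \<in> W"
  then show "\<exists>V. openin T V \<and> p \<in> V \<and> V \<subseteq> W \<and> (\<exists>b'\<in>B V. \<forall>x\<in>V. restrict b W x = b' x)"
    using assms(1,2) by (intro exI[of _ W] conjI bexI[of _ b]) auto
qed

definition spec_topology :: "'a ring \<Rightarrow> 'a set topology" where
  "spec_topology A = topology_generated_by ((\<lambda>f. {P. primeideal P A \<and> f \<notin> P}) ` carrier A)"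

definition spec_fractions :: "'a ring \<Rightarrow> 'a set set \<Rightarrow> ('a set \<Rightarrow> ('a \<times> 'a) set) set" where
  "spec_fractions A V = {\<lambda>P. fraction A P a f | a f. a \<in> carrier A \<and> f \<in> carrier A \<and> (\<forall>P\<in>V. f \<notin> P)}"

lemma Spec_eq: "Spec A = function_space (spec_topology A) (localization A) (spec_fractions A)"
  by (simp add: Spec_def spec_topology_def spec_fractions_def[abs_def])

locale spectrum = A: cring A for A :: "'a ring"
begin

lemma loc: "primeideal P A \<Longrightarrow> prime_localization A P"
  by (simp add: prime_localization_def prime_localization_axioms_def A.cring_axioms)

lemma D_open: "g \<in> carrier A \<Longrightarrow> opn (Spec A) {P. primeideal P A \<and> g \<notin> P}"
  unfolding Spec_eq spec_topology_def by (simp add: openin_generated)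

lemma pts_Spec: "pts (Spec A) = {P. primeideal P A}"
proof -
  have "\<one>\<^bsub>A\<^esub> \<notin> P" if "primeideal P A" for P using A.prime_compl_one[OF that] by simp
  then show ?thesis unfolding Spec_eq spec_topology_def function_space_simps topspace_generated
    using A.one_closed by blast
qed

lemma opn_primes: "opn (Spec A) V \<Longrightarrow> P \<in> V \<Longrightarrow> primeideal P A"
  using openin_subset[of "space (Spec A)" V] pts_Spec by blast

lemma fraction_section:
  assumes V: "opn (Spec A) V" and a: "a \<in> carrier A" "f \<in> carrier A" "\<And>P. P \<in> V \<Longrightarrow> f \<notin> P"
  shows "(\<lambda>P\<in>V. fraction A P a f) \<in> sec (Spec A) V"
  unfolding Spec_eq function_space_simps
proof (rule local_sectionsI)
  show "openin (spec_topology A) V" using V by (simp add: Spec_eq)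
  show "(\<lambda>P. fraction A P a f) \<in> spec_fractions A V" using a by (auto simp: spec_fractions_def)
  fix P assume P: "P \<in> V"
  interpret prime_localization A P using loc opn_primes[OF V P] .
  show "fraction A P a f \<in> carrier (localization A P)" using a P by (auto simp: carrier_localization)
qed

abbreviation "const_on V a \<equiv> \<lambda>P\<in>V. fraction A P a \<one>\<^bsub>A\<^esub>"

lemma one_notin: "primeideal P A \<Longrightarrow> \<one>\<^bsub>A\<^esub> \<notin> P"
  using A.prime_compl_one by simp

lemma const_section: "opn (Spec A) V \<Longrightarrow> a \<in> carrier A \<Longrightarrow> const_on V a \<in> sec (Spec A) V"
  by (rule fraction_section) (auto simp: one_notin opn_primes)

lemma const_mult:
  assumes "opn (Spec A) V" "a \<in> carrier A" "b \<in> carrier A"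
  shows "const_on V a \<otimes>\<^bsub>sect (Spec A) V\<^esub> const_on V b = const_on V (a \<otimes>\<^bsub>A\<^esub> b)"
  unfolding Spec_eq function_space_simps
proof (rule restrict_ext)
  fix P assume P: "P \<in> V"
  interpret prime_localization A P using loc opn_primes[OF assms(1) P] .
  show "const_on V a P \<otimes>\<^bsub>localization A P\<^esub> const_on V b P = fraction A P (a \<otimes>\<^bsub>A\<^esub> b) \<one>\<^bsub>A\<^esub>"
    using P assms by (simp add: fraction_mult_one)
qed

lemma const_add:
  assumes "opn (Spec A) V" "a \<in> carrier A" "b \<in> carrier A"
  shows "const_on V a \<oplus>\<^bsub>sect (Spec A) V\<^esub> const_on V b = const_on V (a \<oplus>\<^bsub>A\<^esub> b)"
  unfolding Spec_eq function_space_simps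
proof (rule restrict_ext)
  fix P assume P: "P \<in> V"
  interpret prime_localization A P using loc opn_primes[OF assms(1) P] .
  show "const_on V a P \<oplus>\<^bsub>localization A P\<^esub> const_on V b P = fraction A P (a \<oplus>\<^bsub>A\<^esub> b) \<one>\<^bsub>A\<^esub>"
    using P assms by (simp add: fraction_add_one)
qed

lemma const_one: "const_on V \<one>\<^bsub>A\<^esub> = \<one>\<^bsub>sect (Spec A) V\<^esub>"
  by (simp add: Spec_eq localization_def)

lemma const_fraction:
  assumes "opn (Spec A) V" "a \<in> carrier A" "f \<in> carrier A" "\<And>P. P \<in> V \<Longrightarrow> f \<notin> P"
    and c: "\<And>P. P \<in> V \<Longrightarrow> c P = fraction A P a f"
  shows "const_on V f \<otimes>\<^bsub>sect (Spec A) V\<^esub> c = const_on V a"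
  unfolding Spec_eq function_space_simps
proof (rule restrict_ext)
  fix P assume P: "P \<in> V"
  interpret prime_localization A P using loc opn_primes[OF assms(1) P] .
  show "const_on V f P \<otimes>\<^bsub>localization A P\<^esub> c P = fraction A P a \<one>\<^bsub>A\<^esub>"
    using P assms by (simp add: fraction_clear_denominator)
qed

end

text \<open>An affine open subset \<open>U\<close> of a ringed space, with its identification \<open>\<phi>\<close> with \<open>Spec A\<close>. The
  map \<open>\<theta>\<close> sends an element of \<open>A\<close> to the corresponding function on \<open>U\<close>.\<close>

locale affine_chart = C: ringed_presheaf C + spectrum A
  for C :: "('p, 's) ringed_space" and A :: "'a ring" +
  fixes U :: "'p set" and \<phi> :: "('p, 's, 'a set, 'a set \<Rightarrow> ('a \<times> 'a) set) rs_map"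
  assumes U: "opn C U" and iso: "lrs_isomorphism (open_subspace C U) (Spec A) \<phi>"
begin

definition "\<theta> a = comor \<phi> (pts (Spec A)) (const_on (pts (Spec A)) a)"

abbreviation "preim V \<equiv> pre (open_subspace C U) \<phi> V"

lemma space_sub: "space (open_subspace C U) = subtopology (space C) U" "sect (open_subspace C U) = sect C"
  "res (open_subspace C U) = res C"
  by (simp_all add: open_subspace_def)

lemma pts_sub: "pts (open_subspace C U) = U"
  using openin_subset[OF U] by (auto simp: space_sub)

lemma morphism: "lrs_morphism (open_subspace C U) (Spec A) \<phi>"
  using iso by (simp add: lrs_isomorphism_def)

lemma homeo: "homeomorphic_map (subtopology (space C) U) (space (Spec A)) (on_pts \<phi>)"
  using iso by (simp add: lrs_isomorphism_def space_sub)

lemma preim_eq: "preim V = {x \<in> U. on_pts \<phi> x \<in> V}"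
  by (simp add: pre_def pts_sub)

lemma on_pts_prime: "x \<in> U \<Longrightarrow> primeideal (on_pts \<phi> x) A"
  using homeomorphic_imp_surjective_map[OF homeo] pts_Spec pts_sub by (auto simp: space_sub)

lemma preim_pts: "preim (pts (Spec A)) = U"
  using on_pts_prime by (auto simp: preim_eq pts_Spec)

lemma preim_open: "opn (Spec A) V \<Longrightarrow> opn C (preim V)"
proof -
  assume V: "opn (Spec A) V"
  have "openin (subtopology (space C) U) {x \<in> topspace (subtopology (space C) U). on_pts \<phi> x \<in> V}"
    using openin_continuous_map_preimage[OF homeomorphic_imp_continuous_map[OF homeo] V] .
  moreover have "{x \<in> topspace (subtopology (space C) U). on_pts \<phi> x \<in> V} = preim V"
    using pts_sub by (auto simp: preim_eq space_sub)
  ultimately show ?thesis using U openin_trans_full by metis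
qed

lemma image_open:
  assumes "opn C W" "W \<subseteq> U"
  shows "opn (Spec A) (on_pts \<phi> ` W)" "preim (on_pts \<phi> ` W) = W"
proof -
  have "openin (subtopology (space C) U) W" using assms U by (simp add: openin_open_subtopology)
  then show "opn (Spec A) (on_pts \<phi> ` W)" using homeomorphic_imp_open_map[OF homeo] by (simp add: open_map_def)
  have "inj_on (on_pts \<phi>) U" using homeomorphic_imp_injective_map[OF homeo] pts_sub by (simp add: space_sub)
  then show "preim (on_pts \<phi> ` W) = W" using assms(2) by (auto simp: preim_eq inj_on_def)
qed

lemma comor_hom: "opn (Spec A) V \<Longrightarrow> comor \<phi> V \<in> ring_hom (sect (Spec A) V) (sect C (preim V))"
  using morphism by (simp add: lrs_morphism_def space_sub)

lemma comor_closed: "opn (Spec A) V \<Longrightarrow> s \<in> sec (Spec A) V \<Longrightarrow> comor \<phi> V s \<in> sec C (preim V)"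
  using comor_hom ring_hom_closed by fast

lemma comor_res: "opn (Spec A) V \<Longrightarrow> opn (Spec A) W \<Longrightarrow> W \<subseteq> V \<Longrightarrow> s \<in> sec (Spec A) V \<Longrightarrow>
    comor \<phi> W (res (Spec A) V W s) = res C (preim V) (preim W) (comor \<phi> V s)"
  using morphism by (simp add: lrs_morphism_def space_sub)

lemma comor_bij: "opn (Spec A) V \<Longrightarrow> bij_betw (comor \<phi> V) (sec (Spec A) V) (sec C (preim V))"
  using iso by (simp add: lrs_isomorphism_def space_sub)

lemma pts_open: "opn (Spec A) (pts (Spec A))"
  by simp

lemma const_res: "V \<subseteq> W \<Longrightarrow> res (Spec A) W V (const_on W a) = const_on V a"
  by (auto simp: Spec_eq restrict_def fun_eq_iff)

lemma \<theta>_res: "opn (Spec A) V \<Longrightarrow> a \<in> carrier A \<Longrightarrow> comor \<phi> V (const_on V a) = res C U (preim V) (\<theta> a)"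
  using comor_res[OF pts_open, of V "const_on (pts (Spec A)) a"] const_section[OF pts_open]
    const_res[of V "pts (Spec A)" a] openin_subset[of "space (Spec A)" V] by (simp add: \<theta>_def preim_pts)

lemma \<theta>_hom: "\<theta> \<in> ring_hom A (sect C U)"
proof (rule ring_hom_memI)
  note h = comor_hom[OF pts_open, unfolded preim_pts]
  fix a b assume a: "a \<in> carrier A" and b: "b \<in> carrier A"
  note s = const_section[OF pts_open a] const_section[OF pts_open b]
  show "\<theta> a \<in> sec C U" using comor_closed[OF pts_open s(1)] by (simp add: \<theta>_def preim_pts)
  show "\<theta> (a \<otimes>\<^bsub>A\<^esub> b) = \<theta> a \<otimes>\<^bsub>sect C U\<^esub> \<theta> b"
    using ring_hom_mult[OF h s] const_mult[OF pts_open a b] by (simp add: \<theta>_def)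
  show "\<theta> (a \<oplus>\<^bsub>A\<^esub> b) = \<theta> a \<oplus>\<^bsub>sect C U\<^esub> \<theta> b"
    using ring_hom_add[OF h s] const_add[OF pts_open a b] by (simp add: \<theta>_def)
next
  show "\<theta> \<one>\<^bsub>A\<^esub> = \<one>\<^bsub>sect C U\<^esub>"
    using ring_hom_one[OF comor_hom[OF pts_open, unfolded preim_pts]] const_one[of "pts (Spec A)"] by (simp add: \<theta>_def)
qed

lemma \<theta>_closed: "a \<in> carrier A \<Longrightarrow> \<theta> a \<in> sec C U"
  using \<theta>_hom ring_hom_closed by fast

abbreviation "\<theta>g x a \<equiv> rgerm C x U (\<theta> a)"

lemma \<theta>g_hom: "x \<in> U \<Longrightarrow> \<theta>g x \<in> ring_hom A (stalk C x)"
  using ring_hom_trans[OF \<theta>_hom C.rgerm_hom[OF U]] by (simp add: comp_def)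

lemma \<theta>g_unit:
  assumes x: "x \<in> U" and g: "g \<in> carrier A" "g \<notin> on_pts \<phi> x"
  shows "\<theta>g x g \<in> Units (stalk C x)"
proof -
  let ?D = "{P. primeideal P A \<and> g \<notin> P}"
  have D: "opn (Spec A) ?D" using D_open g(1) .
  let ?t = "\<lambda>P\<in>?D. fraction A P \<one>\<^bsub>A\<^esub> g"
  have t: "?t \<in> sec (Spec A) ?D" by (rule fraction_section[OF D]) (use g in auto)
  have "const_on ?D g \<otimes>\<^bsub>sect (Spec A) ?D\<^esub> ?t = const_on ?D \<one>\<^bsub>A\<^esub>"
    by (rule const_fraction[OF D]) (use g in auto)
  then have "comor \<phi> ?D (const_on ?D g) \<otimes>\<^bsub>sect C (preim ?D)\<^esub> comor \<phi> ?D ?t = \<one>\<^bsub>sect C (preim ?D)\<^esub>"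
    using ring_hom_mult[OF comor_hom[OF D] const_section[OF D g(1)] t] ring_hom_one[OF comor_hom[OF D]]
    by (simp add: const_one)
  then have e: "res C U (preim ?D) (\<theta> g) \<otimes>\<^bsub>sect C (preim ?D)\<^esub> comor \<phi> ?D ?t = \<one>\<^bsub>sect C (preim ?D)\<^esub>"
    using \<theta>_res[OF D g(1)] by simp
  have o: "opn C (preim ?D)" "x \<in> preim ?D" "preim ?D \<subseteq> U"
    using preim_open[OF D] x g(2) on_pts_prime[OF x] by (auto simp: preim_eq)
  interpret S: cring "sect C (preim ?D)" using C.sect_cring[OF o(1)] .
  have c: "res C U (preim ?D) (\<theta> g) \<in> sec C (preim ?D)" "comor \<phi> ?D ?t \<in> sec C (preim ?D)"
    using C.res_closed[OF U o(1,3) \<theta>_closed[OF g(1)]] comor_closed[OF D t] by auto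
  have 1: "\<theta>g x g \<otimes>\<^bsub>stalk C x\<^esub> rgerm C x (preim ?D) (comor \<phi> ?D ?t) = \<one>\<^bsub>stalk C x\<^esub>"
    using C.rgerm_mult[OF o(1,2) c] e C.rgerm_one[OF o(1,2)] C.rgerm_res[OF U \<theta>_closed[OF g(1)] o] by simp
  have 2: "rgerm C x (preim ?D) (comor \<phi> ?D ?t) \<otimes>\<^bsub>stalk C x\<^esub> \<theta>g x g = \<one>\<^bsub>stalk C x\<^esub>"
    using C.rgerm_mult[OF o(1,2) c(2,1)] e S.m_comm[OF c] C.rgerm_one[OF o(1,2)] C.rgerm_res[OF U \<theta>_closed[OF g(1)] o] by simp
  show ?thesis unfolding Units_def
    using 1 2 C.rgerm_closed[OF U x \<theta>_closed[OF g(1)]] C.rgerm_closed[OF o(1,2) c(2)] by blast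
qed

lemma \<theta>g_inj:
  assumes x: "x \<in> U" and a: "a \<in> carrier A" "a' \<in> carrier A" and eq: "\<theta>g x a = \<theta>g x a'"
  shows "\<exists>g \<in> carrier A - on_pts \<phi> x. g \<otimes>\<^bsub>A\<^esub> a = g \<otimes>\<^bsub>A\<^esub> a'"
proof -
  obtain W where W: "opn C W" "x \<in> W" "W \<subseteq> U" "res C U W (\<theta> a) = res C U W (\<theta> a')"
    using C.rgerm_eqD[OF eq U x \<theta>_closed[OF a(2)]] by auto
  let ?W = "on_pts \<phi> ` W"
  note o = image_open[OF W(1,3)]
  have "comor \<phi> ?W (const_on ?W a) = comor \<phi> ?W (const_on ?W a')"
    using \<theta>_res[OF o(1) a(1)] \<theta>_res[OF o(1) a(2)] W(4) by (simp add: o(2))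
  then have "const_on ?W a = const_on ?W a'"
    using comor_bij[OF o(1)] const_section[OF o(1)] a by (auto simp: bij_betw_def dest: inj_onD)
  from fun_cong[OF this, of "on_pts \<phi> x"]
  have e: "fraction A (on_pts \<phi> x) a \<one>\<^bsub>A\<^esub> = fraction A (on_pts \<phi> x) a' \<one>\<^bsub>A\<^esub>" using W(2) by simp
  interpret prime_localization A "on_pts \<phi> x" using loc on_pts_prime[OF x] .
  show ?thesis using fraction_eqD[OF e a(2) S_one] a by auto
qed

lemma \<theta>g_surj:
  assumes x: "x \<in> U" "x \<in> U'" and U': "opn C U'" and c: "c \<in> sec C U'"
  shows "\<exists>N g a. opn C N \<and> x \<in> N \<and> N \<subseteq> U \<and> N \<subseteq> U' \<and> g \<in> carrier A \<and> a \<in> carrier A \<and>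
    (\<forall>x'\<in>N. g \<notin> on_pts \<phi> x' \<and> \<theta>g x' g \<otimes>\<^bsub>stalk C x'\<^esub> rgerm C x' U' c = \<theta>g x' a)"
proof -
  define W where "W = U' \<inter> U"
  have W: "opn C W" "x \<in> W" "W \<subseteq> U" "W \<subseteq> U'" using U U' x by (auto simp: W_def)
  let ?W = "on_pts \<phi> ` W"
  note o = image_open[OF W(1,3)]
  have "res C U' W c \<in> sec C (preim ?W)" using C.res_closed[OF U' W(1,4) c] o(2) by simp
  then have "res C U' W c \<in> comor \<phi> ?W ` sec (Spec A) ?W" using comor_bij[OF o(1)] by (simp add: bij_betw_def)
  then obtain c' where c': "c' \<in> sec (Spec A) ?W" "res C U' W c = comor \<phi> ?W c'" by auto
  have "c' \<in> local_sections (spec_topology A) (\<lambda>p. carrier (localization A p)) (spec_fractions A) ?W"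
    using c'(1) by (simp add: Spec_eq)
  note c'l = this
  obtain V b where V: "openin (spec_topology A) V" "on_pts \<phi> x \<in> V" "V \<subseteq> ?W" "b \<in> spec_fractions A V"
    "\<forall>P\<in>V. c' P = b P" using local_sectionsD[OF c'l imageI[OF W(2)]] .
  from V(4) obtain a f where a: "a \<in> carrier A" "f \<in> carrier A" "\<And>P. P \<in> V \<Longrightarrow> f \<notin> P" "b = (\<lambda>P. fraction A P a f)"
    unfolding spec_fractions_def by blast
  have oV: "opn (Spec A) V" using V(1) by (simp add: Spec_eq)
  let ?N = "preim V"
  have N: "opn C ?N" "x \<in> ?N" "?N \<subseteq> W"
    using preim_open[OF oV] V(2,3) x o(2) by (auto simp: preim_eq)
  have NU: "?N \<subseteq> U" "?N \<subseteq> U'" using N W by auto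
  have c'V: "res (Spec A) ?W V c' P = fraction A P a f" if "P \<in> V" for P
    using bspec[OF V(5) that] a(4) that by (simp add: Spec_eq)
  have c'c: "res (Spec A) ?W V c' \<in> sec (Spec A) V"
  proof -
    have "restrict c' V \<in> local_sections (spec_topology A) (\<lambda>p. carrier (localization A p)) (spec_fractions A) V"
      by (rule local_sections_restrict[OF _ V(1,3)]) (use c'(1) in \<open>auto simp: Spec_eq spec_fractions_def\<close>)
    then show ?thesis by (simp add: Spec_eq)
  qed
  have "const_on V f \<otimes>\<^bsub>sect (Spec A) V\<^esub> res (Spec A) ?W V c' = const_on V a"
    by (rule const_fraction[OF oV a(1,2,3) c'V])
  then have "comor \<phi> V (const_on V f) \<otimes>\<^bsub>sect C ?N\<^esub> comor \<phi> V (res (Spec A) ?W V c') = comor \<phi> V (const_on V a)"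
    using ring_hom_mult[OF comor_hom[OF oV] const_section[OF oV a(2)] c'c] by simp
  moreover have "comor \<phi> V (res (Spec A) ?W V c') = res C U' ?N c"
    using comor_res[OF o(1) oV V(3) c'(1)] o(2) c'(2) C.res_comp[OF U' W(1) N(1) N(3) W(4) c] by simp
  ultimately have e: "res C U ?N (\<theta> f) \<otimes>\<^bsub>sect C ?N\<^esub> res C U' ?N c = res C U ?N (\<theta> a)"
    using \<theta>_res[OF oV] a by simp
  have "f \<notin> on_pts \<phi> x' \<and> \<theta>g x' f \<otimes>\<^bsub>stalk C x'\<^esub> rgerm C x' U' c = \<theta>g x' a" if x': "x' \<in> ?N" for x'
  proof
    show "f \<notin> on_pts \<phi> x'" using x' a(3) by (auto simp: preim_eq)
    have "rgerm C x' ?N (res C U ?N (\<theta> f)) \<otimes>\<^bsub>stalk C x'\<^esub> rgerm C x' ?N (res C U' ?N c) = rgerm C x' ?N (res C U ?N (\<theta> a))"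
      using C.rgerm_mult[OF N(1) x' C.res_closed[OF U N(1) NU(1) \<theta>_closed[OF a(2)]] C.res_closed[OF U' N(1) NU(2) c]] e by simp
    then show "\<theta>g x' f \<otimes>\<^bsub>stalk C x'\<^esub> rgerm C x' U' c = \<theta>g x' a"
      using C.rgerm_res[OF U \<theta>_closed N(1) x' NU(1)] C.rgerm_res[OF U' c N(1) x' NU(2)] a by simp
  qed
  then show ?thesis using N NU a(1,2) by blast
qed

text \<open>The common denominator of the functions in \<open>F\<close> is the product of their denominators.\<close>

lemma common_denominator:
  assumes "finite F" and x: "x \<in> U" "x \<in> U'" and U': "opn C U'" and "F \<subseteq> sec C U'"
    and stalks: "\<forall>x\<in>U. cring (stalk C x)"
  shows "\<exists>N g h. opn C N \<and> x \<in> N \<and> N \<subseteq> U \<and> N \<subseteq> U' \<and> g \<in> carrier A \<and> h \<in> F \<rightarrow> carrier A \<and>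
    (\<forall>x'\<in>N. g \<notin> on_pts \<phi> x' \<and> (\<forall>c\<in>F. \<theta>g x' g \<otimes>\<^bsub>stalk C x'\<^esub> rgerm C x' U' c = \<theta>g x' (h c)))"
  using assms(1,5)
proof (induction F rule: finite_induct)
  case empty
  show ?case
    using U U' x one_notin on_pts_prime by (intro exI[of _ "U \<inter> U'"] exI[of _ "\<one>\<^bsub>A\<^esub>"]) auto
next
  case (insert c F)
  then obtain N g h where N: "opn C N" "x \<in> N" "N \<subseteq> U" "N \<subseteq> U'" "g \<in> carrier A" "h \<in> F \<rightarrow> carrier A"
    and h: "\<forall>x'\<in>N. g \<notin> on_pts \<phi> x' \<and> (\<forall>c\<in>F. \<theta>g x' g \<otimes>\<^bsub>stalk C x'\<^esub> rgerm C x' U' c = \<theta>g x' (h c))" by auto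
  have c: "c \<in> sec C U'" using insert by simp
  from \<theta>g_surj[OF x U' c] obtain N' g' a where N': "opn C N'" "x \<in> N'" "N' \<subseteq> U" "N' \<subseteq> U'" "g' \<in> carrier A" "a \<in> carrier A"
    and a: "\<forall>x'\<in>N'. g' \<notin> on_pts \<phi> x' \<and> \<theta>g x' g' \<otimes>\<^bsub>stalk C x'\<^esub> rgerm C x' U' c = \<theta>g x' a" by (elim exE conjE)
  define h' where "h' d = (if d = c then g \<otimes>\<^bsub>A\<^esub> a else g' \<otimes>\<^bsub>A\<^esub> h d)" for d
  have "g \<otimes>\<^bsub>A\<^esub> g' \<notin> on_pts \<phi> x' \<and> (\<forall>d\<in>insert c F. \<theta>g x' (g \<otimes>\<^bsub>A\<^esub> g') \<otimes>\<^bsub>stalk C x'\<^esub> rgerm C x' U' d = \<theta>g x' (h' d))"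
    if x': "x' \<in> N \<inter> N'" for x'
  proof
    have xU: "x' \<in> U" "x' \<in> U'" using x' N by auto
    interpret S: cring "stalk C x'" using bspec[OF stalks xU(1)] .
    show "g \<otimes>\<^bsub>A\<^esub> g' \<notin> on_pts \<phi> x'"
      using A.prime_compl_mult[OF on_pts_prime[OF xU(1)], of g g'] h a x' N(5) N'(5) by auto
    note hm = ring_hom_mult[OF \<theta>g_hom[OF xU(1)]] and hc = ring_hom_closed[OF \<theta>g_hom[OF xU(1)]]
    show "\<forall>d\<in>insert c F. \<theta>g x' (g \<otimes>\<^bsub>A\<^esub> g') \<otimes>\<^bsub>stalk C x'\<^esub> rgerm C x' U' d = \<theta>g x' (h' d)"
    proof
      fix d assume d: "d \<in> insert c F"
      have dc: "d \<in> sec C U'" using d insert by auto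
      have gd: "rgerm C x' U' d \<in> carrier (stalk C x')" using C.rgerm_closed[OF U' xU(2) dc] .
      show "\<theta>g x' (g \<otimes>\<^bsub>A\<^esub> g') \<otimes>\<^bsub>stalk C x'\<^esub> rgerm C x' U' d = \<theta>g x' (h' d)"
      proof (cases "d = c")
        case True
        have "\<theta>g x' g' \<otimes>\<^bsub>stalk C x'\<^esub> rgerm C x' U' d = \<theta>g x' a" using a x' True by auto
        then show ?thesis using True N(5) N'(5,6) gd by (simp add: h'_def hm hc S.m_assoc)
      next
        case False
        then have hd: "h d \<in> carrier A" "\<theta>g x' g \<otimes>\<^bsub>stalk C x'\<^esub> rgerm C x' U' d = \<theta>g x' (h d)" using h x' d N(6) by auto
        have "\<theta>g x' (g \<otimes>\<^bsub>A\<^esub> g') \<otimes>\<^bsub>stalk C x'\<^esub> rgerm C x' U' d =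
            \<theta>g x' g' \<otimes>\<^bsub>stalk C x'\<^esub> (\<theta>g x' g \<otimes>\<^bsub>stalk C x'\<^esub> rgerm C x' U' d)"
          using N(5) N'(5) gd by (simp add: hm hc S.m_ac)
        then show ?thesis unfolding hd(2) using hd(1) False N'(5) by (simp add: h'_def hm)
      qed
    qed
  qed
  moreover have "h' \<in> insert c F \<rightarrow> carrier A" using N(5,6) N'(5,6) by (auto simp: h'_def Pi_iff)
  ultimately show ?case
    using N(1-5) N'(1-5) by (intro exI[of _ "N \<inter> N'"] exI[of _ "g \<otimes>\<^bsub>A\<^esub> g'"] exI[of _ h']) auto
qed

end

section \<open>Functions on a base change\<close>

locale base_change_setup = K: field k + L: field L
  for k :: "'k ring" and C :: "('p, 's) ringed_space" and \<gamma> :: "'k \<Rightarrow> 's" and L :: "'l ring" and \<iota> :: "'k \<Rightarrow> 'l" +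
  assumes fin: "finite (carrier k)" and scheme: "scheme C"
    and gamma: "\<gamma> \<in> ring_hom k (sect C (pts C))" and iota: "\<iota> \<in> ring_hom k L"
begin

abbreviation "X \<equiv> base_change k C \<gamma> L \<iota>"
abbreviation "OC \<equiv> stalk C"
abbreviation "kO \<equiv> stalk_algebra C \<gamma>"
abbreviation "B \<equiv> fib_ring k C \<gamma> L \<iota>"
abbreviation "cls \<equiv> fib_class k C \<gamma> L \<iota>"
abbreviation "val \<equiv> fib_value k C \<gamma> L \<iota>"
abbreviation "points \<equiv> bc_pts k C \<gamma> L \<iota>"
abbreviation "germs U x \<equiv> pair_map (rgerm C x U)"
abbreviation "schains U c \<equiv> Poly_Mapping.keys c \<subseteq> sec C U \<times> carrier L"
abbreviation "ochains x c \<equiv> Poly_Mapping.keys c \<subseteq> carrier (OC x) \<times> carrier L"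

lemma C_lrs: "locally_ringed_space C"
  using scheme by (simp add: scheme_def)

sublocale C: ringed_presheaf C
  using C_lrs by (intro sheaf_of_rings_presheaf) (simp add: locally_ringed_space_def)

lemma O_cring: "x \<in> pts C \<Longrightarrow> cring (OC x)"
  using C_lrs by (simp add: locally_ringed_space_def local_ring_def)

lemma gamma_closed: "c \<in> carrier k \<Longrightarrow> \<gamma> c \<in> sec C (pts C)"
  using gamma ring_hom_closed by fast

lemma kO_closed: "x \<in> pts C \<Longrightarrow> c \<in> carrier k \<Longrightarrow> kO x c \<in> carrier (OC x)"
  unfolding stalk_algebra_def by (intro C.rgerm_closed gamma_closed) simp_all

lemma iota_closed: "c \<in> carrier k \<Longrightarrow> \<iota> c \<in> carrier L"
  using iota ring_hom_closed by fast

lemma fiber: "x \<in> pts C \<Longrightarrow> two_algebras (OC x) L k (kO x) \<iota>"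
  using O_cring kO_closed iota_closed
  by (simp add: two_algebras_def two_crings_def two_algebras_axioms_def L.cring_axioms)

lemma cls_eq: "cls x = tensor_class k (OC x) (kO x) L \<iota>"
  by (simp add: fib_class_def fun_eq_iff)

lemma B_eq: "B x = tensor_ring k (OC x) (kO x) L \<iota>"
  by (simp add: fib_ring_def)

lemma val_eq: "val U c x = cls x (germs U x c)"
  by (simp add: fib_value_def pair_map_def)

lemma B_cring: "x \<in> pts C \<Longrightarrow> cring (B x)"
  unfolding B_eq using two_algebras.cring_tensor_ring[OF fiber] .

lemma opn_pts: "opn C U \<Longrightarrow> x \<in> U \<Longrightarrow> x \<in> pts C"
  using openin_subset by blast

lemma germs_ochains: "opn C U \<Longrightarrow> x \<in> U \<Longrightarrow> schains U c \<Longrightarrow> ochains x (germs U x c)"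
  by (rule keys_pair_map[where A = "sec C U"]) (auto simp: C.rgerm_closed)

lemma cls_closed: "x \<in> pts C \<Longrightarrow> ochains x c \<Longrightarrow> cls x c \<in> carrier (B x)"
  unfolding cls_eq B_eq using two_algebras.cl_closed[OF fiber] .

lemma cls_mult: "x \<in> pts C \<Longrightarrow> ochains x c \<Longrightarrow> ochains x d \<Longrightarrow>
    cls x (pair_mult (OC x) L c d) = cls x c \<otimes>\<^bsub>B x\<^esub> cls x d"
  unfolding cls_eq B_eq using two_algebras.cl_mult[OF fiber] .

lemma cls_one: "x \<in> pts C \<Longrightarrow> cls x (emb L (\<one>\<^bsub>OC x\<^esub>)) = \<one>\<^bsub>B x\<^esub>"
  unfolding cls_eq B_eq using two_algebras.cl_one[OF fiber] .

lemma cls_zero_iff: "x \<in> pts C \<Longrightarrow> ochains x c \<Longrightarrow> cls x c = \<zero>\<^bsub>B x\<^esub> \<longleftrightarrow> c \<in> tensor_ideal k (OC x) (kO x) L \<iota>"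
  unfolding cls_eq B_eq using two_algebras.cl_zero_iff[OF fiber] .

lemma carrier_B: "x \<in> pts C \<Longrightarrow> b \<in> carrier (B x) \<Longrightarrow> \<exists>c. ochains x c \<and> b = cls x c"
  unfolding cls_eq B_eq two_algebras.carrier_AB[OF fiber] by (elim imageE, rule exI, rule conjI) simp_all

lemma val_closed: "opn C U \<Longrightarrow> x \<in> U \<Longrightarrow> schains U c \<Longrightarrow> val U c x \<in> carrier (B x)"
  unfolding val_eq by (intro cls_closed germs_ochains opn_pts)

lemma pointD:
  assumes "(x, P) \<in> points"
  shows "x \<in> pts C" "primeideal P (B x)" "a \<in> carrier (OC x) \<Longrightarrow> cls x (emb L a) \<in> P \<longleftrightarrow> a \<in> nonunits (OC x)"
  using assms unfolding bc_pts_def by blast+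

lemma loc_point: "(x, P) \<in> points \<Longrightarrow> prime_localization (B x) P"
  using pointD(1,2) B_cring by (simp add: prime_localization_def prime_localization_axioms_def)

text \<open>The ingredients of the definition of the base change.\<close>

definition "bc_top = topology_generated_by
        {{(x, P) \<in> points. x \<in> U \<and> val U c x \<notin> P} | U c. opn C U \<and> schains U c}"

definition "bc_loc = (\<lambda>(x, P). localization (B x) P)"

definition "bc_fractions V = {\<lambda>(x, P). fraction (B x) P (val U a x) (val U f x) | U a f.
           opn C U \<and> schains U a \<and> schains U f \<and> (\<forall>(x, P) \<in> V. x \<in> U \<and> val U f x \<notin> P)}"

lemma X_eq: "X = function_space bc_top bc_loc bc_fractions"
  by (simp add: base_change_def bc_top_def bc_loc_def bc_fractions_def[abs_def])

lemma D_open: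
  assumes "opn C U" "schains U c"
  shows "opn X {(x, P) \<in> points. x \<in> U \<and> val U c x \<notin> P}"
  unfolding X_eq bc_top_def function_space_simps by (rule openin_generated) (use assms in blast)

lemma chains_one: "opn C U \<Longrightarrow> schains U (emb L (\<one>\<^bsub>sect C U\<^esub>))"
  using cring.cring_simprules(6)[OF C.sect_cring] by simp

lemma val_one: "opn C U \<Longrightarrow> x \<in> U \<Longrightarrow> val U (emb L (\<one>\<^bsub>sect C U\<^esub>)) x = \<one>\<^bsub>B x\<^esub>"
  unfolding val_eq by (simp add: C.rgerm_one cls_one opn_pts)

lemma one_notin: "(x, P) \<in> points \<Longrightarrow> \<one>\<^bsub>B x\<^esub> \<notin> P"
  using prime_localization.S_one[OF loc_point] by blast

lemma preimage_open:
  assumes "opn C U"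
  shows "opn X {(x, P) \<in> points. x \<in> U}"
proof -
  have "{(x, P) \<in> points. x \<in> U} = {(x, P) \<in> points. x \<in> U \<and> val U (emb L (\<one>\<^bsub>sect C U\<^esub>)) x \<notin> P}"
    using val_one[OF assms] one_notin by auto
  then show ?thesis using D_open[OF assms chains_one[OF assms]] by simp
qed

lemma pts_X: "pts X = points"
proof
  show "pts X \<subseteq> points" unfolding X_eq bc_top_def function_space_simps topspace_generated by auto
  have "opn X {(x, P) \<in> points. x \<in> pts C}" by (rule preimage_open) simp
  from openin_subset[OF this] show "points \<subseteq> pts X" using pointD(1) by auto
qed

lemma opn_points: "opn X V \<Longrightarrow> p \<in> V \<Longrightarrow> p \<in> points"
  using openin_subset pts_X by blast

lemma carrier_X: "sec X V = local_sections bc_top (\<lambda>p. carrier (bc_loc p)) bc_fractions V"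
  by (simp add: X_eq)

lemma res_X: "res X V W s = restrict s W"
  by (simp add: X_eq)

lemma mult_X: "p \<in> V \<Longrightarrow> (s \<otimes>\<^bsub>sect X V\<^esub> t) p = s p \<otimes>\<^bsub>bc_loc p\<^esub> t p"
  by (simp add: X_eq)

lemma zero_X: "\<zero>\<^bsub>sect X V\<^esub> = (\<lambda>p\<in>V. \<zero>\<^bsub>bc_loc p\<^esub>)"
  by (simp add: X_eq)

lemma one_X: "\<one>\<^bsub>sect X V\<^esub> = (\<lambda>p\<in>V. \<one>\<^bsub>bc_loc p\<^esub>)"
  by (simp add: X_eq)

lemma section_PiE: "s \<in> sec X V \<Longrightarrow> s \<in> (\<Pi>\<^sub>E p\<in>V. carrier (bc_loc p))"
  unfolding carrier_X by (rule local_sections_PiE)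

lemma section_extensional: "s \<in> sec X V \<Longrightarrow> s \<in> extensional V"
  using section_PiE by (auto simp: PiE_def)

lemma section_closed: "s \<in> sec X V \<Longrightarrow> p \<in> V \<Longrightarrow> s p \<in> carrier (bc_loc p)"
  by (rule PiE_mem[OF section_PiE])

lemma bc_fractions_mono:
  assumes "b \<in> bc_fractions V" "V' \<subseteq> V"
  shows "b \<in> bc_fractions V'"
proof -
  obtain U a f where *: "b = (\<lambda>(x, P). fraction (B x) P (val U a x) (val U f x))" "opn C U" "schains U a" "schains U f"
    "\<forall>(x, P)\<in>V. x \<in> U \<and> val U f x \<notin> P" using assms(1) unfolding bc_fractions_def by blast
  have "\<forall>(x, P)\<in>V'. x \<in> U \<and> val U f x \<notin> P" using *(5) assms(2) by blast
  then show ?thesis unfolding bc_fractions_def using *(1-4) by blast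
qed

lemma section_local:
  assumes "s \<in> sec X V" "y \<in> V"
  obtains W U a f where "opn X W" "y \<in> W" "W \<subseteq> V" "opn C U" "schains U a" "schains U f"
    "\<forall>(x, P)\<in>W. x \<in> U \<and> val U f x \<notin> P \<and> s (x, P) = fraction (B x) P (val U a x) (val U f x)"
proof -
  have s: "s \<in> local_sections bc_top (\<lambda>p. carrier (bc_loc p)) bc_fractions V" using assms(1) by (simp add: carrier_X)
  obtain W b where W: "openin bc_top W" "y \<in> W" "W \<subseteq> V" "b \<in> bc_fractions W" "\<forall>p\<in>W. s p = b p"
    using local_sectionsD[OF s assms(2)] .
  obtain U a f where *: "b = (\<lambda>(x, P). fraction (B x) P (val U a x) (val U f x))" "opn C U" "schains U a" "schains U f"
    "\<forall>(x, P)\<in>W. x \<in> U \<and> val U f x \<notin> P"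
    using W(4) unfolding bc_fractions_def by blast
  have "\<forall>(x, P)\<in>W. x \<in> U \<and> val U f x \<notin> P \<and> s (x, P) = fraction (B x) P (val U a x) (val U f x)"
    using W(5) *(1,5) by auto
  then show thesis using that[of W U a f] W(1-3) *(2-4) by (simp add: X_eq)
qed

lemma fraction_section:
  assumes "opn X V" "opn C U" "schains U a" "schains U f" "\<forall>(x, P)\<in>V. x \<in> U \<and> val U f x \<notin> P"
  shows "(\<lambda>(x, P)\<in>V. fraction (B x) P (val U a x) (val U f x)) \<in> sec X V"
  unfolding carrier_X
proof (rule local_sectionsI)
  show "openin bc_top V" using assms(1) by (simp add: X_eq)
  show "(\<lambda>(x, P). fraction (B x) P (val U a x) (val U f x)) \<in> bc_fractions V"
    unfolding bc_fractions_def using assms by blast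
  fix p assume p: "p \<in> V"
  obtain x P where xP: "p = (x, P)" by (cases p)
  interpret prime_localization "B x" P using loc_point opn_points[OF assms(1) p] xP by simp
  have "x \<in> U" "val U f x \<notin> P" using assms(5) p xP by auto
  then show "(case p of (x, P) \<Rightarrow> fraction (B x) P (val U a x) (val U f x)) \<in> carrier (bc_loc p)"
    using val_closed[OF assms(2) _ assms(3)] val_closed[OF assms(2) _ assms(4)] xP
    by (auto simp: bc_loc_def carrier_localization)
qed

lemma X_presheaf:
  assumes cr: "\<And>U. opn X U \<Longrightarrow> cring (sect X U)"
  shows "ringed_presheaf X"
proof (rule ringed_presheaf.intro)
  fix U V assume U: "opn X U" and V: "opn X V" and VU: "V \<subseteq> U"
  have c: "res X U V s \<in> sec X V" if "s \<in> sec X U" for s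
    unfolding res_X carrier_X
    by (rule local_sections_restrict[OF _ _ VU]) (use that V bc_fractions_mono in \<open>auto simp: carrier_X X_eq\<close>)
  show "res X U V \<in> ring_hom (sect X U) (sect X V)"
    by (rule ring_hom_memI) (use c VU in \<open>auto simp: X_eq fun_eq_iff restrict_def\<close>)
next
  fix U s assume "opn X U" "s \<in> sec X U"
  then show "res X U U s = s" using section_extensional by (simp add: res_X extensional_restrict)
next
  fix U V W :: "('p, 's, 'l) bc_point set" and s :: "('p, 's, 'l) bc_fun"
  assume "W \<subseteq> V"
  then show "res X V W (res X U V s) = res X U W s" by (auto simp: res_X restrict_def fun_eq_iff)
qed (rule cr)

end

lemma irreducible_open_meet:
  assumes "irreducible_in T (topspace T)" "openin T V" "openin T W" "V \<noteq> {}" "W \<noteq> {}"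
  shows "V \<inter> W \<noteq> {}"
proof
  assume e: "V \<inter> W = {}"
  have VW: "V \<subseteq> topspace T" "W \<subseteq> topspace T" using assms(2,3) openin_subset by auto
  have irr: "\<forall>A B. closedin T A \<and> closedin T B \<and> topspace T \<subseteq> A \<union> B \<longrightarrow> topspace T \<subseteq> A \<or> topspace T \<subseteq> B"
    using assms(1) by (simp add: irreducible_in_def)
  have "closedin T (topspace T - V)" "closedin T (topspace T - W)" using assms(2,3) by auto
  moreover have "topspace T \<subseteq> (topspace T - V) \<union> (topspace T - W)" using e by auto
  ultimately have "topspace T \<subseteq> topspace T - V \<or> topspace T \<subseteq> topspace T - W" using irr by metis
  then show False using VW assms(4,5) by blast
qed

subsection \<open>Functions that vanish on an open subset\<close>

locale integral_base_change = base_change_setup k C \<gamma> L \<iota>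
  for k :: "'k ring" and C :: "('p, 's) ringed_space" and \<gamma> :: "'k \<Rightarrow> 's" and L :: "'l ring" and \<iota> :: "'k \<Rightarrow> 'l" +
  assumes irreducible: "irreducible_in (space X) (pts X)"
    and stalk_domain: "\<And>y. y \<in> pts X \<Longrightarrow> domain (stalk X y)"
    and X_cring: "\<And>U. opn X U \<Longrightarrow> cring (sect X U)"
begin

sublocale X: ringed_presheaf X by (rule X_presheaf[OF X_cring])

lemma meet: "opn X V \<Longrightarrow> opn X W \<Longrightarrow> V \<noteq> {} \<Longrightarrow> W \<noteq> {} \<Longrightarrow> V \<inter> W \<noteq> {}"
  using irreducible_open_meet[OF irreducible] .

text \<open>If \<open>h s = 0\<close> near \<open>y\<close>, where \<open>h\<close> is a global element that does not vanish on some nonempty open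
  set, then the germ of \<open>h\<close> at \<open>y\<close> is not zero, by irreducibility, so that \<open>s\<close> vanishes near \<open>y\<close>.\<close>

lemma annihilated_germ_zero:
  assumes V: "opn X V" "y \<in> V" and s: "s \<in> sec X V"
    and N: "opn C N" and h: "schains N h" and VN: "\<forall>(x, P)\<in>V. x \<in> N"
    and z: "(x0, P0) \<in> points" "x0 \<in> N" "val N h x0 \<notin> P0"
    and rep: "\<And>x P. (x, P) \<in> V \<Longrightarrow> \<exists>a \<in> carrier (B x). \<exists>f \<in> carrier (B x) - P.
      s (x, P) = fraction (B x) P a f \<and> val N h x \<otimes>\<^bsub>B x\<^esub> a = \<zero>\<^bsub>B x\<^esub>"
  shows "rgerm X y V s = \<zero>\<^bsub>stalk X y\<^esub>"
proof -
  have y: "y \<in> pts X" using V pts_X opn_points by blast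
  interpret A: domain "stalk X y" using stalk_domain[OF y] .
  let ?one = "emb L (\<one>\<^bsub>sect C N\<^esub>)"
  define H where "H = (\<lambda>(x, P)\<in>V. fraction (B x) P (val N h x) (val N ?one x))"
  have one: "val N ?one x = \<one>\<^bsub>B x\<^esub>" "val N ?one x \<notin> P" if "(x, P) \<in> V" for x P
    using val_one[OF N] one_notin[OF opn_points[OF V(1) that]] VN that by auto
  have H: "H \<in> sec X V"
    unfolding H_def by (rule fraction_section[OF V(1) N h chains_one[OF N]]) (use one VN in auto)
  have "(H \<otimes>\<^bsub>sect X V\<^esub> s) p = \<zero>\<^bsub>bc_loc p\<^esub>" if p: "p \<in> V" for p
  proof -
    obtain x P where xP: "p = (x, P)" by (cases p)
    have pt: "(x, P) \<in> points" using opn_points[OF V(1) p] xP by simp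
    interpret prime_localization "B x" P using loc_point[OF pt] .
    have xN: "x \<in> N" using VN p xP by auto
    have hc: "val N h x \<in> carrier (B x)" using val_closed[OF N xN h] .
    obtain a f where af: "a \<in> carrier (B x)" "f \<in> carrier (B x) - P" "s (x, P) = fraction (B x) P a f"
      "val N h x \<otimes>\<^bsub>B x\<^esub> a = \<zero>\<^bsub>B x\<^esub>" using rep p xP by blast
    have "(H \<otimes>\<^bsub>sect X V\<^esub> s) p = H p \<otimes>\<^bsub>bc_loc p\<^esub> s p" using mult_X[OF p] .
    also have "\<dots> = fraction (B x) P (val N h x) \<one>\<^bsub>B x\<^esub> \<otimes>\<^bsub>localization (B x) P\<^esub> fraction (B x) P a f"
      using p xP one af(3) by (simp add: H_def bc_loc_def)
    also have "\<dots> = fraction (B x) P \<zero>\<^bsub>B x\<^esub> (\<one>\<^bsub>B x\<^esub> \<otimes>\<^bsub>B x\<^esub> f)"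
      using localization_mult[OF hc S_one af(1,2)] af(4) by simp
    also have "\<dots> = \<zero>\<^bsub>localization (B x) P\<^esub>"
      using fraction_zero_iff[of "\<zero>\<^bsub>B x\<^esub>" "\<one>\<^bsub>B x\<^esub> \<otimes>\<^bsub>B x\<^esub> f"] S_mult[OF S_one af(2)] S_one by auto
    finally show ?thesis by (simp add: xP bc_loc_def)
  qed
  moreover have "H \<otimes>\<^bsub>sect X V\<^esub> s \<in> sec X V"
    using cring.cring_simprules(5)[OF X_cring[OF V(1)] H s] .
  ultimately have "H \<otimes>\<^bsub>sect X V\<^esub> s = \<zero>\<^bsub>sect X V\<^esub>"
    unfolding zero_X by (intro extensionalityI[OF section_extensional]) auto
  then have "rgerm X y V H \<otimes>\<^bsub>stalk X y\<^esub> rgerm X y V s = \<zero>\<^bsub>stalk X y\<^esub>"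
    using X.rgerm_mult[OF V H s] X.rgerm_zero[OF V] by simp
  then have "rgerm X y V H = \<zero>\<^bsub>stalk X y\<^esub> \<or> rgerm X y V s = \<zero>\<^bsub>stalk X y\<^esub>"
    using A.integral X.rgerm_closed[OF V H] X.rgerm_closed[OF V s] by simp
  moreover have "rgerm X y V H \<noteq> \<zero>\<^bsub>stalk X y\<^esub>"
  proof
    assume "rgerm X y V H = \<zero>\<^bsub>stalk X y\<^esub>"
    then obtain W where W: "opn X W" "y \<in> W" "W \<subseteq> V" "res X V W H = \<zero>\<^bsub>sect X W\<^esub>"
      using X.rgerm_zero_iff[OF V H] by blast
    have "W \<inter> {(x, P) \<in> points. x \<in> N \<and> val N h x \<notin> P} \<noteq> {}"
      by (rule meet[OF W(1) D_open[OF N h]]) (use W(2) z in auto)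
    then obtain x P where xP: "(x, P) \<in> W" "(x, P) \<in> points" "x \<in> N" "val N h x \<notin> P" by auto
    interpret prime_localization "B x" P using loc_point[OF xP(2)] .
    have hc: "val N h x \<in> carrier (B x)" using val_closed[OF N xP(3) h] .
    have "fraction (B x) P (val N h x) \<one>\<^bsub>B x\<^esub> = \<zero>\<^bsub>localization (B x) P\<^esub>"
      using fun_cong[OF W(4), of "(x, P)"] xP(1) W(3) one[of x P] by (auto simp: res_X zero_X H_def bc_loc_def)
    then obtain u where u: "u \<in> carrier (B x) - P" "u \<otimes>\<^bsub>B x\<^esub> val N h x = \<zero>\<^bsub>B x\<^esub>"
      using fraction_zero_iff[OF hc S_one] by auto
    have "\<zero>\<^bsub>B x\<^esub> \<in> P" using additive_subgroup.zero_closed[OF ideal.axioms(1)[OF primeideal.axioms(1)[OF prime]]] .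
    moreover have "u \<otimes>\<^bsub>B x\<^esub> val N h x \<notin> P" using S_mult[OF u(1)] hc xP(4) by simp
    ultimately show False using u(2) by simp
  qed
  ultimately show ?thesis by simp
qed

text \<open>A function that vanishes on a nonempty open set vanishes. Near \<open>y\<close> it is \<open>a / f\<close>, and up to a
  denominator \<open>a\<close> comes from \<open>A \<otimes> L\<close> for an affine neighbourhood \<open>Spec A\<close>. At a point \<open>z\<close> where the function
  vanishes \<open>a\<close> is annihilated by an element that does not vanish at \<open>z\<close>, and which
  lifts to \<open>A \<otimes> L\<close>.\<close>

theorem germ_zero_everywhere:
  assumes V: "opn X V" "y \<in> V" and s: "s \<in> sec X V"
    and W: "opn X W" "W \<noteq> {}" "W \<subseteq> V" "\<And>p. p \<in> W \<Longrightarrow> s p = \<zero>\<^bsub>bc_loc p\<^esub>"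
  shows "rgerm X y V s = \<zero>\<^bsub>stalk X y\<^esub>"
proof -
  obtain V1 U a f where V1: "opn X V1" "y \<in> V1" "V1 \<subseteq> V" and U: "opn C U" and a: "schains U a" and f: "schains U f"
    and rep: "\<forall>(x, P)\<in>V1. x \<in> U \<and> val U f x \<notin> P \<and> s (x, P) = fraction (B x) P (val U a x) (val U f x)"
    using section_local[OF s V(2)] .
  obtain xy Py where y: "y = (xy, Py)" by (cases y)
  have xyU: "xy \<in> U" using rep V1(2) y by auto
  have xyC: "xy \<in> pts C" using opn_pts[OF U xyU] .
  \<comment> \<open>an affine neighbourhood\<close>
  obtain U0 where U0: "affine_open C U0" "xy \<in> U0" using scheme xyC by (auto simp: scheme_def)
  then obtain R :: "'s ring" and \<phi> where R: "cring R" and iso: "lrs_isomorphism (open_subspace C U0) (Spec R) \<phi>"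
    and oU0: "opn C U0" by (auto simp: affine_open_def)
  interpret R: cring R by fact
  interpret chart: affine_chart C R U0 \<phi>
    by (intro affine_chart.intro affine_chart_axioms.intro spectrum.intro R C.ringed_presheaf_axioms oU0 iso)
  have U0C: "x \<in> U0 \<Longrightarrow> x \<in> pts C" for x using opn_pts[OF oU0] .
  have stalks: "\<forall>x\<in>U0. cring (OC x)" using O_cring[OF U0C] by simp
  \<comment> \<open>common denominators for the numerator and for the constants\<close>
  have "finite (fst ` Poly_Mapping.keys a)" "fst ` Poly_Mapping.keys a \<subseteq> sec C U" using a by auto
  from chart.common_denominator[OF this(1) U0(2) xyU U this(2) stalks]
  obtain N1 g1 h1 where N1: "opn C N1" "xy \<in> N1" "N1 \<subseteq> U0" "N1 \<subseteq> U" and g1: "g1 \<in> carrier R"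
    and h1: "h1 \<in> fst ` Poly_Mapping.keys a \<rightarrow> carrier R"
    and e1: "\<forall>x\<in>N1. g1 \<notin> on_pts \<phi> x \<and> (\<forall>c\<in>fst ` Poly_Mapping.keys a. chart.\<theta>g x g1 \<otimes>\<^bsub>OC x\<^esub> rgerm C x U c = chart.\<theta>g x (h1 c))"
    by (elim exE conjE)
  have "finite (\<gamma> ` carrier k)" "\<gamma> ` carrier k \<subseteq> sec C (pts C)" using fin gamma_closed by auto
  from chart.common_denominator[OF this(1) U0(2) xyC openin_topspace this(2) stalks]
  obtain N2 g2 h2 where N2: "opn C N2" "xy \<in> N2" "N2 \<subseteq> U0" and g2: "g2 \<in> carrier R"
    and h2: "h2 \<in> \<gamma> ` carrier k \<rightarrow> carrier R"
    and e2: "\<forall>x\<in>N2. g2 \<notin> on_pts \<phi> x \<and> (\<forall>c\<in>\<gamma> ` carrier k. chart.\<theta>g x g2 \<otimes>\<^bsub>OC x\<^esub> rgerm C x (pts C) c = chart.\<theta>g x (h2 c))"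
    by (elim exE conjE)
  define N where "N = N1 \<inter> N2"
  have N: "opn C N" "xy \<in> N" "N \<subseteq> U0" "N \<subseteq> U" "N \<subseteq> N1" "N \<subseteq> N2" using N1 N2 by (auto simp: N_def)
  have NC: "x \<in> N \<Longrightarrow> x \<in> pts C" for x using opn_pts[OF N(1)] .
  \<comment> \<open>a point near \<open>y\<close> where the function vanishes\<close>
  define V2 where "V2 = V1 \<inter> {(x, P) \<in> points. x \<in> N}"
  have V2: "opn X V2" "y \<in> V2" "V2 \<subseteq> V1" "V2 \<subseteq> V" "\<forall>(x, P)\<in>V2. x \<in> N"
    using V1 preimage_open[OF N(1)] y N(2) opn_points[OF V1(1,2)] by (auto simp: V2_def)
  have "V2 \<inter> W \<noteq> {}" by (rule meet[OF V2(1) W(1)]) (use V2(2) W(2) in auto)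
  then obtain z Pz where z: "(z, Pz) \<in> V2" "(z, Pz) \<in> W" by auto
  have zN: "z \<in> N" using V2(5) z by auto
  have zp: "(z, Pz) \<in> points" using opn_points[OF V2(1) z(1)] .
  have zU0: "z \<in> U0" using zN N by auto
  interpret z: two_algebras "OC z" L k "kO z" \<iota> using fiber[OF NC[OF zN]] .
  interpret Lz: prime_localization "B z" Pz using loc_point[OF zp] .
  define S where "S = carrier R - on_pts \<phi> z"
  note primez = chart.on_pts_prime[OF zU0]
  have S: "S \<subseteq> carrier R" "\<one>\<^bsub>R\<^esub> \<in> S" "\<And>s t. s \<in> S \<Longrightarrow> t \<in> S \<Longrightarrow> s \<otimes>\<^bsub>R\<^esub> t \<in> S"
    using R.prime_compl_one[OF primez] R.prime_compl_mult[OF primez] by (auto simp: S_def)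
  interpret lift: lifting_setup R L k \<iota> N z OC chart.\<theta>g kO S
  proof (intro lifting_setup.intro lifting_setup_axioms.intro two_crings.intro R L.cring_axioms)
    show "z \<in> N" by fact
    show "cring (OC x)" if "x \<in> N" for x using O_cring[OF NC[OF that]] .
    show "chart.\<theta>g x \<in> ring_hom R (OC x)" if "x \<in> N" for x using chart.\<theta>g_hom N that by auto
    show "kO x c \<in> carrier (OC x)" if "x \<in> N" "c \<in> carrier k" for x c using kO_closed NC that by auto
    show "\<exists>s\<in>S. \<exists>a\<in>carrier R. chart.\<theta>g z s \<otimes>\<^bsub>OC z\<^esub> e = chart.\<theta>g z a" if e: "e \<in> carrier (OC z)" for e
    proof -
      obtain U' c where U': "opn C U'" "z \<in> U'" "c \<in> sec C U'" "e = rgerm C z U' c" using C.stalk_cases[OF e] .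
      from chart.\<theta>g_surj[OF zU0 U'(2,1,3)] obtain M g b where "z \<in> M" "g \<in> carrier R" "b \<in> carrier R"
        "\<forall>x'\<in>M. g \<notin> on_pts \<phi> x' \<and> chart.\<theta>g x' g \<otimes>\<^bsub>OC x'\<^esub> rgerm C x' U' c = chart.\<theta>g x' b" by auto
      then show ?thesis using U'(4) by (intro bexI[of _ g] bexI[of _ b]) (auto simp: S_def)
    qed
    show "\<exists>s\<in>S. s \<otimes>\<^bsub>R\<^esub> a = s \<otimes>\<^bsub>R\<^esub> a'" if "a \<in> carrier R" "a' \<in> carrier R" "chart.\<theta>g z a = chart.\<theta>g z a'" for a a'
      using chart.\<theta>g_inj[OF zU0 that] by (simp add: S_def)
    show "\<exists>g\<in>S. \<exists>a\<in>carrier R. \<forall>x\<in>N. chart.\<theta>g x a = kO x c \<otimes>\<^bsub>OC x\<^esub> chart.\<theta>g x g" if c: "c \<in> carrier k" for c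
    proof (rule bexI[of _ g2], rule bexI[of _ "h2 (\<gamma> c)"], rule ballI)
      show "g2 \<in> S" using g2 e2 zN N by (auto simp: S_def)
      show "h2 (\<gamma> c) \<in> carrier R" using h2 c by auto
      fix x assume x: "x \<in> N"
      interpret x: cring "OC x" using O_cring[OF NC[OF x]] .
      have "chart.\<theta>g x g2 \<otimes>\<^bsub>OC x\<^esub> kO x c = chart.\<theta>g x (h2 (\<gamma> c))"
        using e2 x N(6) c by (auto simp: stalk_algebra_def)
      moreover have "chart.\<theta>g x g2 \<in> carrier (OC x)" using ring_hom_closed[OF chart.\<theta>g_hom g2] x N by auto
      ultimately show "chart.\<theta>g x (h2 (\<gamma> c)) = kO x c \<otimes>\<^bsub>OC x\<^esub> chart.\<theta>g x g2"
        using x.m_comm kO_closed[OF NC[OF x] c] by simp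
    qed
  qed (use S iota_closed in auto)
  have theta_c: "chart.\<theta>g x r \<in> carrier (OC x)" if "x \<in> N" "r \<in> carrier R" for x r using lift.hom_closed[OF that] .
  \<comment> \<open>the numerator, multiplied by \<open>g1\<close>, comes from \<open>R\<close>\<close>
  define \<alpha> where "\<alpha> = pair_map h1 a"
  have \<alpha>: "Poly_Mapping.keys \<alpha> \<subseteq> carrier R \<times> carrier L"
    unfolding \<alpha>_def by (rule keys_pair_map[of _ "fst ` Poly_Mapping.keys a"]) (use a h1 in force)+
  have gac: "ochains x (germs U x a)" if "x \<in> N" for x using germs_ochains[OF U _ a] that N by auto
  have \<alpha>x: "pair_map (chart.\<theta>g x) \<alpha> = pair_mult (OC x) L (emb L (chart.\<theta>g x g1)) (germs U x a)" if x: "x \<in> N" for x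
  proof -
    interpret x: two_algebras "OC x" L k "kO x" \<iota> using fiber[OF NC[OF x]] .
    have sub: "Poly_Mapping.keys a \<subseteq> fst ` Poly_Mapping.keys a \<times> UNIV" by force
    have "pair_map (chart.\<theta>g x) \<alpha> = pair_map (\<lambda>c. chart.\<theta>g x (h1 c)) a" by (simp add: \<alpha>_def pair_map_comp)
    also have "\<dots> = pair_map (\<lambda>c. chart.\<theta>g x g1 \<otimes>\<^bsub>OC x\<^esub> rgerm C x U c) a"
      by (rule pair_map_cong[OF sub]) (use e1 x N(5) in auto)
    also have "\<dots> = pair_map (\<lambda>e. chart.\<theta>g x g1 \<otimes>\<^bsub>OC x\<^esub> e) (germs U x a)" by (simp add: pair_map_comp)
    also have "\<dots> = pair_mult (OC x) L (emb L (chart.\<theta>g x g1)) (germs U x a)"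
      using x.pair_mult_scalar[OF gac[OF x] theta_c[OF x g1]] by simp
    finally show ?thesis .
  qed
  \<comment> \<open>an annihilator of the numerator at \<open>z\<close>\<close>
  have zU: "z \<in> U" "val U f z \<notin> Pz" "s (z, Pz) = fraction (B z) Pz (val U a z) (val U f z)" using rep z(1) V2(3) by auto
  have "fraction (B z) Pz (val U a z) (val U f z) = \<zero>\<^bsub>localization (B z) Pz\<^esub>"
    using W(4)[OF z(2)] zU(3) by (simp add: bc_loc_def)
  then obtain u where u: "u \<in> carrier (B z) - Pz" "u \<otimes>\<^bsub>B z\<^esub> val U a z = \<zero>\<^bsub>B z\<^esub>"
    using Lz.fraction_zero_iff[OF val_closed[OF U zU(1) a]] val_closed[OF U zU(1) f] zU(2) by auto
  obtain u' where u': "ochains z u'" "u = cls z u'" using carrier_B[OF NC[OF zN] DiffD1[OF u(1)]] by (elim exE conjE)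
  \<comment> \<open>it comes from \<open>R\<close> after multiplication with some \<open>t\<close>\<close>
  have "\<exists>t\<in>S. \<exists>w. fsums R L w \<and>
      pair_map (chart.\<theta>g z) w = pair_mult (OC z) L (emb L (chart.\<theta>g z t)) u'"
    using u'(1)
  proof (induction u' rule: z.pair_induct)
    case zero
    then show ?case using S(2) by (intro bexI[of _ "\<one>\<^bsub>R\<^esub>"] exI[of _ 0]) auto
  next
    case (one e l)
    obtain t b where "t \<in> S" "b \<in> carrier R" "chart.\<theta>g z t \<otimes>\<^bsub>OC z\<^esub> e = chart.\<theta>g z b" using lift.surj[OF one(1)] by auto
    then show ?case using one(2) by (intro bexI[of _ t] exI[of _ "frag_of (b, l)"]) (auto simp: pair_mult_of)
  next
    case (diff c d)
    obtain t w where t: "t \<in> S" and w: "fsums R L w"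
      "pair_map (chart.\<theta>g z) w = pair_mult (OC z) L (emb L (chart.\<theta>g z t)) c" using diff.IH(1) by (elim bexE exE conjE)
    obtain t' w' where t': "t' \<in> S" and w': "fsums R L w'"
      "pair_map (chart.\<theta>g z) w' = pair_mult (OC z) L (emb L (chart.\<theta>g z t')) d" using diff.IH(2) by (elim bexE exE conjE)
    have tc: "t \<in> carrier R" "t' \<in> carrier R" using t t' S(1) by auto
    have "pair_map (chart.\<theta>g z) (lift.scal t' w - lift.scal t w') =
        pair_mult (OC z) L (emb L (chart.\<theta>g z (t' \<otimes>\<^bsub>R\<^esub> t))) (c - d)"
      unfolding pair_map_diff lift.map_scal[OF zN w(1) tc(2)] lift.map_scal[OF zN w'(1) tc(1)] w(2) w'(2)
        z.pair_mult_assoc[OF lift.scalar_keys[OF tc(2) zN] lift.scalar_keys[OF tc(1) zN] diff.hyps(1), symmetric]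
        z.pair_mult_assoc[OF lift.scalar_keys[OF tc(1) zN] lift.scalar_keys[OF tc(2) zN] diff.hyps(2), symmetric]
        lift.scalar_mult[OF zN tc(2,1)] lift.scalar_mult[OF zN tc(1,2)] R.m_comm[OF tc] pair_mult_diff_right ..
    moreover have "fsums R L (lift.scal t' w - lift.scal t w')"
      by (intro keys_diff_subset lift.keys_scal w(1) w'(1) tc)
    ultimately show ?case using S(3)[OF t' t] by blast
  qed
  then obtain t w where t: "t \<in> S" and w: "fsums R L w"
    "pair_map (chart.\<theta>g z) w = pair_mult (OC z) L (emb L (chart.\<theta>g z t)) u'" by (elim bexE exE conjE)
  have tc: "t \<in> carrier R" using t S(1) by auto
  define d where "d = pair_mult R L w \<alpha>"
  have d: "fsums R L d" unfolding d_def by (rule lift.pair_mult_closed[OF w(1) \<alpha>])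
  note scz = lift.scalar_keys[OF _ zN]
  have mz: "ochains z (pair_map (chart.\<theta>g z) w)" unfolding w(2) by (rule z.pair_mult_closed[OF scz[OF tc] u'(1)])
  have "cls z (pair_map (chart.\<theta>g z) d) = cls z (pair_map (chart.\<theta>g z) w) \<otimes>\<^bsub>B z\<^esub> cls z (pair_map (chart.\<theta>g z) \<alpha>)"
    unfolding d_def lift.pair_map_mult[OF lift.cring[OF zN] lift.hom[OF zN] w(1) \<alpha>]
    by (rule cls_mult[OF NC[OF zN] mz]) (simp only: \<alpha>x[OF zN] z.pair_mult_closed[OF scz[OF g1] gac[OF zN]])
  also have "\<dots> = (cls z (emb L (chart.\<theta>g z t)) \<otimes>\<^bsub>B z\<^esub> u) \<otimes>\<^bsub>B z\<^esub>
      (cls z (emb L (chart.\<theta>g z g1)) \<otimes>\<^bsub>B z\<^esub> val U a z)"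
    unfolding w(2) \<alpha>x[OF zN] cls_mult[OF NC[OF zN] scz[OF tc] u'(1)] cls_mult[OF NC[OF zN] scz[OF g1] gac[OF zN]]
      u'(2)[symmetric] val_eq[symmetric] ..
  also have "\<dots> = (cls z (emb L (chart.\<theta>g z t)) \<otimes>\<^bsub>B z\<^esub> cls z (emb L (chart.\<theta>g z g1))) \<otimes>\<^bsub>B z\<^esub> (u \<otimes>\<^bsub>B z\<^esub> val U a z)"
    using cls_closed[OF NC[OF zN] scz[OF tc]] cls_closed[OF NC[OF zN] scz[OF g1]] u(1) val_closed[OF U zU(1) a]
    by (simp only: Lz.m_ac Lz.m_closed DiffD1)
  also have "\<dots> = \<zero>\<^bsub>B z\<^esub>"
    unfolding u(2) using cls_closed[OF NC[OF zN] scz[OF tc]] cls_closed[OF NC[OF zN] scz[OF g1]] by simp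
  finally have "pair_map (chart.\<theta>g z) d \<in> tensor_ideal k (OC z) (kO z) L \<iota>"
    using cls_zero_iff[OF NC[OF zN] keys_pair_map[OF d theta_c[OF zN]]] by simp
  from lift.tensor_relation_lifts[OF d this]
  obtain v where v: "v \<in> S" "\<forall>x\<in>N. pair_map (chart.\<theta>g x) (lift.scal v d) \<in> tensor_ideal k (OC x) (kO x) L \<iota>" by (elim bexE)
  have vc: "v \<in> carrier R" using v S(1) by auto
  \<comment> \<open>the annihilator near \<open>y\<close>\<close>
  define h0 where "h0 = lift.scal g1 (lift.scal v w)"
  have h0: "Poly_Mapping.keys h0 \<subseteq> carrier R \<times> carrier L" unfolding h0_def by (intro lift.keys_scal w(1) vc g1)
  define h where "h = pair_map (\<lambda>r. res C U0 N (chart.\<theta> r)) h0"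
  have h: "schains N h"
    unfolding h_def by (rule keys_pair_map[OF h0]) (use C.res_closed[OF oU0 N(1,3) chart.\<theta>_closed] in auto)
  have hx: "germs N x h = pair_map (chart.\<theta>g x) h0" if x: "x \<in> N" for x
    unfolding h_def pair_map_comp
    by (rule pair_map_cong[OF h0]) (use C.rgerm_res[OF oU0 chart.\<theta>_closed N(1) x N(3)] in auto)
  show ?thesis
  proof -
    have "rgerm X y V2 (res X V V2 s) = \<zero>\<^bsub>stalk X y\<^esub>"
    proof (rule annihilated_germ_zero[OF V2(1,2) _ N(1) h V2(5) zp zN])
      show "res X V V2 s \<in> sec X V2" by (rule X.res_closed[OF V(1) V2(1) V2(4) s])
      have unit: "cls z (emb L (chart.\<theta>g z r)) \<in> carrier (B z) - Pz" if r: "r \<in> S" for r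
      proof -
        have rc: "r \<in> carrier R" using r S(1) by auto
        have "chart.\<theta>g z r \<in> Units (OC z)" using chart.\<theta>g_unit[OF zU0 rc] r by (simp add: S_def)
        then show ?thesis using pointD(3)[OF zp theta_c[OF zN rc]] cls_closed[OF NC[OF zN] scz[OF rc]] by (simp add: nonunits_def)
      qed
      have g1S: "g1 \<in> S" using e1 zN N(5) g1 by (auto simp: S_def)
      have vw: "fsums R L (lift.scal v w)" by (rule lift.keys_scal[OF w(1) vc])
      have mz2: "ochains z (pair_map (chart.\<theta>g z) (lift.scal v w))" by (rule keys_pair_map[OF vw theta_c[OF zN]])
      have "cls z (pair_map (chart.\<theta>g z) (lift.scal v w)) =
          cls z (emb L (chart.\<theta>g z v)) \<otimes>\<^bsub>B z\<^esub> (cls z (emb L (chart.\<theta>g z t)) \<otimes>\<^bsub>B z\<^esub> u)"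
        unfolding lift.map_scal[OF zN w(1) vc] cls_mult[OF NC[OF zN] scz[OF vc] mz]
        unfolding w(2) cls_mult[OF NC[OF zN] scz[OF tc] u'(1)] u'(2) ..
      then have "val N h z = cls z (emb L (chart.\<theta>g z g1)) \<otimes>\<^bsub>B z\<^esub>
          (cls z (emb L (chart.\<theta>g z v)) \<otimes>\<^bsub>B z\<^esub> (cls z (emb L (chart.\<theta>g z t)) \<otimes>\<^bsub>B z\<^esub> u))"
        unfolding val_eq hx[OF zN] h0_def lift.map_scal[OF zN vw g1] cls_mult[OF NC[OF zN] scz[OF g1] mz2] by (rule arg_cong)
      also have "\<dots> \<in> carrier (B z) - Pz"
        using Lz.S_mult[OF unit[OF g1S] Lz.S_mult[OF unit[OF v(1)] Lz.S_mult[OF unit[OF t] u(1)]]] .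
      finally show "val N h z \<notin> Pz" by simp
      fix x P assume xP: "(x, P) \<in> V2"
      have xN: "x \<in> N" using V2(5) xP by auto
      have xp: "(x, P) \<in> points" using opn_points[OF V2(1) xP] .
      interpret x: two_algebras "OC x" L k "kO x" \<iota> using fiber[OF NC[OF xN]] .
      interpret Bx: cring "B x" using B_cring[OF NC[OF xN]] .
      have xU: "x \<in> U" "val U f x \<notin> P" "s (x, P) = fraction (B x) P (val U a x) (val U f x)" using rep xP V2(3) by auto
      note scx = lift.scalar_keys[OF _ xN]
      have vwx: "ochains x (pair_map (chart.\<theta>g x) (lift.scal v w))" by (rule keys_pair_map[OF vw theta_c[OF xN]])
      have wx: "ochains x (pair_map (chart.\<theta>g x) w)" by (rule keys_pair_map[OF w(1) theta_c[OF xN]])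
      have ax: "ochains x (pair_map (chart.\<theta>g x) \<alpha>)" by (rule keys_pair_map[OF \<alpha> theta_c[OF xN]])
      have dx: "ochains x (pair_map (chart.\<theta>g x) d)" by (rule keys_pair_map[OF d theta_c[OF xN]])
      let ?g = "cls x (emb L (chart.\<theta>g x g1))" and ?v = "cls x (emb L (chart.\<theta>g x v))"
        and ?w = "cls x (pair_map (chart.\<theta>g x) w)"
      have cc: "?g \<in> carrier (B x)" "?v \<in> carrier (B x)" "?w \<in> carrier (B x)" "val U a x \<in> carrier (B x)"
        using cls_closed[OF NC[OF xN]] scx g1 vc wx val_closed[OF U xU(1) a] by simp_all
      have "cls x (pair_map (chart.\<theta>g x) (lift.scal v w)) = ?v \<otimes>\<^bsub>B x\<^esub> ?w"
        unfolding lift.map_scal[OF xN w(1) vc] cls_mult[OF NC[OF xN] scx[OF vc] wx] ..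
      then have "val N h x = ?g \<otimes>\<^bsub>B x\<^esub> (?v \<otimes>\<^bsub>B x\<^esub> ?w)"
        unfolding val_eq hx[OF xN] h0_def lift.map_scal[OF xN vw g1] cls_mult[OF NC[OF xN] scx[OF g1] vwx] by (rule arg_cong)
      then have "val N h x \<otimes>\<^bsub>B x\<^esub> val U a x = ?v \<otimes>\<^bsub>B x\<^esub> (?w \<otimes>\<^bsub>B x\<^esub> (?g \<otimes>\<^bsub>B x\<^esub> val U a x))"
        using cc by (simp only: Bx.m_ac Bx.m_closed)
      also have "?g \<otimes>\<^bsub>B x\<^esub> val U a x = cls x (pair_map (chart.\<theta>g x) \<alpha>)"
        unfolding \<alpha>x[OF xN] val_eq cls_mult[OF NC[OF xN] scx[OF g1] gac[OF xN]] ..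
      also have "?w \<otimes>\<^bsub>B x\<^esub> cls x (pair_map (chart.\<theta>g x) \<alpha>) = cls x (pair_map (chart.\<theta>g x) d)"
        unfolding d_def lift.pair_map_mult[OF lift.cring[OF xN] lift.hom[OF xN] w(1) \<alpha>] cls_mult[OF NC[OF xN] wx ax] ..
      also have "?v \<otimes>\<^bsub>B x\<^esub> cls x (pair_map (chart.\<theta>g x) d) = cls x (pair_map (chart.\<theta>g x) (lift.scal v d))"
        unfolding lift.map_scal[OF xN d vc] cls_mult[OF NC[OF xN] scx[OF vc] dx] ..
      also have "\<dots> = \<zero>\<^bsub>B x\<^esub>"
        using cls_zero_iff[OF NC[OF xN] keys_pair_map[OF lift.keys_scal[OF d vc] theta_c[OF xN]]] v(2) xN by simp
      finally have "val N h x \<otimes>\<^bsub>B x\<^esub> val U a x = \<zero>\<^bsub>B x\<^esub>" .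
      moreover have "val U f x \<in> carrier (B x) - P" using val_closed[OF U xU(1) f] xU(2) by simp
      ultimately show "\<exists>a\<in>carrier (B x). \<exists>f\<in>carrier (B x) - P.
          res X V V2 s (x, P) = fraction (B x) P a f \<and> val N h x \<otimes>\<^bsub>B x\<^esub> a = \<zero>\<^bsub>B x\<^esub>"
        using xU(3) xP cc(4) by (intro bexI[of _ "val U a x"] bexI[of _ "val U f x"]) (auto simp: res_X)
    qed
    then show ?thesis using X.rgerm_res[OF V(1) s V2(1,2,4)] by simp
  qed
qed

end

section \<open>The point at infinity of the base change\<close>

locale pointed_base_change = base_change_setup +
  fixes pinf
  assumes pinf: "morphism_over k (Spec k) (spec_const k) C \<gamma> pinf"
begin

sublocale Sk: spectrum k by (rule spectrum.intro) (rule K.is_cring)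

text \<open>The point of \<open>Spec k\<close> and its image in \<open>C\<close>.\<close>

definition "oo = {\<zero>\<^bsub>k\<^esub>}"
definition "xi = on_pts pinf oo"

lemma oo_prime: "primeideal oo k"
  unfolding oo_def by (rule K.zeroprimeideal)

sublocale Lo: prime_localization k oo by (rule Sk.loc[OF oo_prime])

lemma oo_pts: "oo \<in> pts (Spec k)"
  using oo_prime by (simp add: Sk.pts_Spec)

lemma morphism: "lrs_morphism (Spec k) C pinf"
  using pinf by (simp add: morphism_over_def)

lemma xi_pts: "xi \<in> pts C"
  using morphism oo_pts unfolding lrs_morphism_def continuous_map_def xi_def by (auto simp: Pi_iff)

lemma comor_pinf_hom: "opn C V \<Longrightarrow> comor pinf V \<in> ring_hom (sect C V) (sect (Spec k) (pre (Spec k) pinf V))"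
  using morphism by (simp add: lrs_morphism_def)

lemma comor_pinf_res: "opn C V \<Longrightarrow> opn C W \<Longrightarrow> W \<subseteq> V \<Longrightarrow> a \<in> sec C V \<Longrightarrow>
    comor pinf W (res C V W a) = res (Spec k) (pre (Spec k) pinf V) (pre (Spec k) pinf W) (comor pinf V a)"
  using morphism by (simp add: lrs_morphism_def)

lemma oo_pre: "xi \<in> V \<Longrightarrow> oo \<in> pre (Spec k) pinf V"
  using oo_pts by (simp add: pre_def xi_def)

text \<open>The residue field of \<open>Spec k\<close> is \<open>k\<close> itself.\<close>

definition "cval z = (THE c. c \<in> carrier k \<and> z = fraction k oo c \<one>\<^bsub>k\<^esub>)"

lemma nonzero_unit: "s \<in> carrier k - oo \<Longrightarrow> s \<in> Units k"
  using K.field_Units by (auto simp: oo_def)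

lemma loc_oo_cases:
  assumes "z \<in> carrier (localization k oo)"
  shows "\<exists>c\<in>carrier k. z = fraction k oo c \<one>\<^bsub>k\<^esub>"
proof -
  obtain a s where a: "a \<in> carrier k" "s \<in> carrier k - oo" "z = fraction k oo a s"
    using assms by (auto simp: Lo.carrier_localization)
  have u: "s \<in> Units k" by (rule nonzero_unit[OF a(2)])
  have ic: "inv\<^bsub>k\<^esub> s \<in> carrier k" using K.Units_inv_closed[OF u] .
  have "s \<otimes>\<^bsub>k\<^esub> (a \<otimes>\<^bsub>k\<^esub> inv\<^bsub>k\<^esub> s) = a \<otimes>\<^bsub>k\<^esub> (s \<otimes>\<^bsub>k\<^esub> inv\<^bsub>k\<^esub> s)"
    using a(1) DiffD1[OF a(2)] ic by (rule_tac K.m_lcomm)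
  then have "s \<otimes>\<^bsub>k\<^esub> (a \<otimes>\<^bsub>k\<^esub> inv\<^bsub>k\<^esub> s) = a" using K.Units_r_inv[OF u] a(1) by simp
  then have "fraction k oo a s = fraction k oo (a \<otimes>\<^bsub>k\<^esub> inv\<^bsub>k\<^esub> s) \<one>\<^bsub>k\<^esub>"
    by (intro Lo.fraction_eqI[of _ _ _ _ "\<one>\<^bsub>k\<^esub>"]) (use a ic Lo.S_one in auto)
  then show ?thesis using a ic by auto
qed

lemma cval_fraction: "c \<in> carrier k \<Longrightarrow> cval (fraction k oo c \<one>\<^bsub>k\<^esub>) = c"
  unfolding cval_def
proof (rule the_equality)
  fix c' assume c: "c \<in> carrier k" and c': "c' \<in> carrier k \<and> fraction k oo c \<one>\<^bsub>k\<^esub> = fraction k oo c' \<one>\<^bsub>k\<^esub>"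
  from Lo.fraction_eqD[OF conjunct2[OF c'] conjunct1[OF c'] Lo.S_one]
  obtain u where u: "u \<in> carrier k - oo" "u \<otimes>\<^bsub>k\<^esub> (\<one>\<^bsub>k\<^esub> \<otimes>\<^bsub>k\<^esub> c) = u \<otimes>\<^bsub>k\<^esub> (\<one>\<^bsub>k\<^esub> \<otimes>\<^bsub>k\<^esub> c')" by auto
  then have "u \<otimes>\<^bsub>k\<^esub> c = u \<otimes>\<^bsub>k\<^esub> c'" "u \<noteq> \<zero>\<^bsub>k\<^esub>" using c c' by (auto simp: oo_def)
  then show "c' = c" using K.m_lcancel[of u c c'] u(1) c c' by simp
qed simp

lemma cval_closed: "z \<in> carrier (localization k oo) \<Longrightarrow> cval z \<in> carrier k"
  using loc_oo_cases[of z] cval_fraction by auto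

lemma cval_mult: "z \<in> carrier (localization k oo) \<Longrightarrow> z' \<in> carrier (localization k oo) \<Longrightarrow>
    cval (z \<otimes>\<^bsub>localization k oo\<^esub> z') = cval z \<otimes>\<^bsub>k\<^esub> cval z'"
  using loc_oo_cases[of z] loc_oo_cases[of z'] Lo.fraction_mult_one cval_fraction by auto

lemma cval_add: "z \<in> carrier (localization k oo) \<Longrightarrow> z' \<in> carrier (localization k oo) \<Longrightarrow>
    cval (z \<oplus>\<^bsub>localization k oo\<^esub> z') = cval z \<oplus>\<^bsub>k\<^esub> cval z'"
  using loc_oo_cases[of z] loc_oo_cases[of z'] Lo.fraction_add_one cval_fraction by auto

lemma Spec_section_value:
  assumes "s \<in> sec (Spec k) V" "oo \<in> V"
  shows "s oo \<in> carrier (localization k oo)"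
proof -
  have "s \<in> local_sections (spec_topology k) (\<lambda>p. carrier (localization k p)) (spec_fractions k) V"
    using assms(1) by (simp add: Spec_eq)
  from PiE_mem[OF local_sections_PiE[OF this] assms(2)] show ?thesis .
qed

text \<open>The value at \<open>\<infinity>\<close> of a germ is read off from any representative, by pulling it back to \<open>Spec k\<close>.\<close>

definition "ev e = (let (V, b) = (SOME p. p \<in> e) in cval (comor pinf V b oo))"

lemma comor_value: "opn C V \<Longrightarrow> xi \<in> V \<Longrightarrow> b \<in> sec C V \<Longrightarrow> comor pinf V b oo \<in> carrier (localization k oo)"
  by (rule Spec_section_value[OF ring_hom_closed[OF comor_pinf_hom] oo_pre])

lemma ev_germ:
  assumes V: "opn C V" "xi \<in> V" and b: "b \<in> sec C V"
  shows "ev (rgerm C xi V b) = cval (comor pinf V b oo)"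
proof -
  have "(SOME p. p \<in> rgerm C xi V b) \<in> rgerm C xi V b"
    by (rule someI[of "\<lambda>p. p \<in> rgerm C xi V b"]) (rule C.rgerm_self[OF V b])
  moreover obtain V' b' where vb: "(SOME p. p \<in> rgerm C xi V b) = (V', b')" by (cases "SOME p. p \<in> rgerm C xi V b")
  ultimately have m: "(V', b') \<in> rgerm C xi V b" by simp
  note V' = C.rgerm_memD[OF m V(1) b]
  obtain W where W: "opn C W" "xi \<in> W" "W \<subseteq> V'" "W \<subseteq> V" "res C V' W b' = res C V W b"
    using C.rgerm_eqD[OF V'(4) V b] by blast
  have "res (Spec k) (pre (Spec k) pinf V') (pre (Spec k) pinf W) (comor pinf V' b') =
      res (Spec k) (pre (Spec k) pinf V) (pre (Spec k) pinf W) (comor pinf V b)"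
    using comor_pinf_res[OF V'(1) W(1,3) V'(3)] comor_pinf_res[OF V(1) W(1,4) b] W(5) by simp
  from fun_cong[OF this, of oo] have "comor pinf V' b' oo = comor pinf V b oo"
    using oo_pre[OF W(2)] by (simp add: Spec_eq)
  then show ?thesis by (simp add: ev_def vb)
qed

lemma two_germs:
  assumes "e \<in> carrier (OC xi)" "e' \<in> carrier (OC xi)"
  obtains W b b' where "opn C W" "xi \<in> W" "b \<in> sec C W" "b' \<in> sec C W"
    "e = rgerm C xi W b" "e' = rgerm C xi W b'"
proof -
  obtain U b where U: "opn C U" "xi \<in> U" "b \<in> sec C U" "e = rgerm C xi U b" using C.stalk_cases[OF assms(1)] .
  obtain V b' where V: "opn C V" "xi \<in> V" "b' \<in> sec C V" "e' = rgerm C xi V b'" using C.stalk_cases[OF assms(2)] .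
  define W where "W = U \<inter> V"
  have W: "opn C W" "xi \<in> W" "W \<subseteq> U" "W \<subseteq> V" using U V by (auto simp: W_def)
  show thesis
    by (rule that[of W "res C U W b" "res C V W b'"]) (use U V W in \<open>simp_all add: C.res_closed C.rgerm_res\<close>)
qed

lemma ev_hom: "ev \<in> ring_hom (OC xi) k"
proof (rule ring_hom_memI)
  fix e assume "e \<in> carrier (OC xi)"
  then obtain U b where U: "opn C U" "xi \<in> U" "b \<in> sec C U" "e = rgerm C xi U b" using C.stalk_cases by metis
  show "ev e \<in> carrier k" using U ev_germ[OF U(1-3)] cval_closed[OF comor_value[OF U(1-3)]] by simp
next
  fix e e' assume e: "e \<in> carrier (OC xi)" "e' \<in> carrier (OC xi)"
  obtain W b b' where W: "opn C W" "xi \<in> W" and b: "b \<in> sec C W" "b' \<in> sec C W"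
    "e = rgerm C xi W b" "e' = rgerm C xi W b'" using two_germs[OF e] .
  interpret W: cring "sect C W" using C.sect_cring[OF W(1)] .
  have "comor pinf W (b \<otimes>\<^bsub>sect C W\<^esub> b') oo = comor pinf W b oo \<otimes>\<^bsub>localization k oo\<^esub> comor pinf W b' oo"
    using ring_hom_mult[OF comor_pinf_hom[OF W(1)] b(1,2)] oo_pre[OF W(2)] by (simp add: Spec_eq)
  then show "ev (e \<otimes>\<^bsub>OC xi\<^esub> e') = ev e \<otimes>\<^bsub>k\<^esub> ev e'"
    using C.rgerm_mult[OF W b(1,2)] b ev_germ[OF W] cval_mult[OF comor_value[OF W b(1)] comor_value[OF W b(2)]] by simp
  have "comor pinf W (b \<oplus>\<^bsub>sect C W\<^esub> b') oo = comor pinf W b oo \<oplus>\<^bsub>localization k oo\<^esub> comor pinf W b' oo"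
    using ring_hom_add[OF comor_pinf_hom[OF W(1)] b(1,2)] oo_pre[OF W(2)] by (simp add: Spec_eq)
  then show "ev (e \<oplus>\<^bsub>OC xi\<^esub> e') = ev e \<oplus>\<^bsub>k\<^esub> ev e'"
    using C.rgerm_add[OF W b(1,2)] b ev_germ[OF W] cval_add[OF comor_value[OF W b(1)] comor_value[OF W b(2)]] by simp
next
  have o: "opn C (pts C)" by simp
  interpret W: cring "sect C (pts C)" using C.sect_cring[OF o] .
  have "comor pinf (pts C) \<one>\<^bsub>sect C (pts C)\<^esub> oo = fraction k oo \<one>\<^bsub>k\<^esub> \<one>\<^bsub>k\<^esub>"
    using ring_hom_one[OF comor_pinf_hom[OF o]] oo_pre[OF xi_pts] by (simp add: Spec_eq Lo.localization_one)
  then show "ev \<one>\<^bsub>OC xi\<^esub> = \<one>\<^bsub>k\<^esub>"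
    using ev_germ[OF o xi_pts W.one_closed] C.rgerm_one[OF o xi_pts] cval_fraction[of "\<one>\<^bsub>k\<^esub>"] by simp
qed

lemma ev_const: "c \<in> carrier k \<Longrightarrow> ev (kO xi c) = c"
proof -
  assume c: "c \<in> carrier k"
  have "comor pinf (pts C) (\<gamma> c) = spec_const k c" using pinf c by (simp add: morphism_over_def)
  then have "comor pinf (pts C) (\<gamma> c) oo = fraction k oo c \<one>\<^bsub>k\<^esub>" using oo_prime by (simp add: spec_const_def)
  then show ?thesis unfolding stalk_algebra_def
    using ev_germ[OF _ xi_pts gamma_closed[OF c]] cval_fraction[OF c] by simp
qed

lemma O_local: "x \<in> pts C \<Longrightarrow> local_ring (OC x)"
  using C_lrs by (simp add: locally_ringed_space_def)

text \<open>Since \<open>\<infinity>\<close> is a \<open>k\<close>-rational point, evaluation is surjective, so its kernel is maximal.\<close>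

lemma nonunits_xi: "nonunits (OC xi) = {e \<in> carrier (OC xi). ev e = \<zero>\<^bsub>k\<^esub>}" (is "_ = ?m")
proof (rule local_ring_maximal_nonunits[OF O_local[OF xi_pts]])
  interpret O: cring "OC xi" using O_cring[OF xi_pts] .
  have ev: "ev e \<in> carrier k" if "e \<in> carrier (OC xi)" for e using ring_hom_closed[OF ev_hom that] .
  have ev0: "ev \<zero>\<^bsub>OC xi\<^esub> = \<zero>\<^bsub>k\<^esub>" by (rule ring_hom_zero[OF ev_hom O.ring_axioms K.ring_axioms])
  have i: "ideal ?m (OC xi)"
    by (rule O.idealI_cring) (use ev ev0 in \<open>auto simp: ring_hom_add[OF ev_hom] ring_hom_mult[OF ev_hom]\<close>)
  show "maximalideal ?m (OC xi)"
  proof (rule maximalidealI[OF i])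
    have "\<one>\<^bsub>OC xi\<^esub> \<notin> ?m" using ring_hom_one[OF ev_hom] by simp
    then show "carrier (OC xi) \<noteq> ?m" using O.one_closed by metis
    fix J assume J: "ideal J (OC xi)" "?m \<subseteq> J" "J \<subseteq> carrier (OC xi)"
    show "J = ?m \<or> J = carrier (OC xi)"
    proof (cases "J \<subseteq> ?m")
      case True then show ?thesis using J(2) by auto
    next
      case False
      then obtain e where e: "e \<in> J" "ev e \<noteq> \<zero>\<^bsub>k\<^esub>" using J(3) by auto
      have ec: "e \<in> carrier (OC xi)" using e J(3) by auto
      have u: "ev e \<in> Units k" using K.field_Units ev[OF ec] e(2) by auto
      let ?i = "kO xi (inv\<^bsub>k\<^esub> ev e)"
      have ic: "?i \<in> carrier (OC xi)" using kO_closed[OF xi_pts] u by simp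
      let ?d = "\<one>\<^bsub>OC xi\<^esub> \<ominus>\<^bsub>OC xi\<^esub> ?i \<otimes>\<^bsub>OC xi\<^esub> e"
      have ie: "?i \<otimes>\<^bsub>OC xi\<^esub> e \<in> carrier (OC xi)" using ic ec by simp
      have dc: "?d \<in> carrier (OC xi)" using ie by simp
      have sum: "?d \<oplus>\<^bsub>OC xi\<^esub> ?i \<otimes>\<^bsub>OC xi\<^esub> e = \<one>\<^bsub>OC xi\<^esub>" using ie by (simp add: O.minus_eq O.a_assoc O.l_neg)
      have "ev (?i \<otimes>\<^bsub>OC xi\<^esub> e) = \<one>\<^bsub>k\<^esub>"
        using ring_hom_mult[OF ev_hom ic ec] ev_const[of "inv\<^bsub>k\<^esub> ev e"] u by simp
      then have "ev ?d \<oplus>\<^bsub>k\<^esub> \<one>\<^bsub>k\<^esub> = \<one>\<^bsub>k\<^esub>" using ring_hom_add[OF ev_hom dc ie] sum ring_hom_one[OF ev_hom] by simp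
      then have "ev ?d = \<zero>\<^bsub>k\<^esub>" using K.add.r_cancel_one[OF K.one_closed ev[OF dc]] K.a_comm[OF K.one_closed ev[OF dc]] by simp
      then have "?d \<in> J" using J(2) dc by auto
      then have "?d \<oplus>\<^bsub>OC xi\<^esub> ?i \<otimes>\<^bsub>OC xi\<^esub> e \<in> J"
        by (rule O.ideal_add[OF J(1) _ ideal.I_l_closed[OF J(1) e(1) ic]])
      then have "\<one>\<^bsub>OC xi\<^esub> \<in> J" using sum by simp
      then show ?thesis using ideal.one_imp_carrier[OF J(1)] by simp
    qed
  qed
qed

lemma iota_inj: "c \<in> carrier k \<Longrightarrow> \<iota> c = \<zero>\<^bsub>L\<^esub> \<longleftrightarrow> c = \<zero>\<^bsub>k\<^esub>"
proof
  assume c: "c \<in> carrier k" "\<iota> c = \<zero>\<^bsub>L\<^esub>"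
  show "c = \<zero>\<^bsub>k\<^esub>"
  proof (rule ccontr)
    assume "c \<noteq> \<zero>\<^bsub>k\<^esub>"
    then have u: "c \<in> Units k" using K.field_Units c by auto
    have "\<iota> c \<otimes>\<^bsub>L\<^esub> \<iota> (inv\<^bsub>k\<^esub> c) = \<one>\<^bsub>L\<^esub>"
      using ring_hom_mult[OF iota c(1) K.Units_inv_closed[OF u]] K.Units_r_inv[OF u] ring_hom_one[OF iota] by simp
    then show False using c(2) iota_closed[OF K.Units_inv_closed[OF u]] by simp
  qed
next
  assume "c = \<zero>\<^bsub>k\<^esub>"
  then show "\<iota> c = \<zero>\<^bsub>L\<^esub>" using ring_hom_zero[OF iota K.ring_axioms L.ring_axioms] by simp
qed

text \<open>The evaluation extends to \<open>O \<otimes> L \<rightarrow> L\<close>, whose kernel is a point of the base change over \<open>\<infinity>\<close>.\<close>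

lemma point_over_infinity: "\<exists>P. (xi, P) \<in> points"
proof -
  interpret xi: two_algebras "OC xi" L k "kO xi" \<iota> using fiber[OF xi_pts] .
  interpret Bxi: cring "B xi" using B_cring[OF xi_pts] .
  have ev: "ev e \<in> carrier k" if "e \<in> carrier (OC xi)" for e using ring_hom_closed[OF ev_hom that] .
  have iev: "\<iota> (ev e) \<in> carrier L" if "e \<in> carrier (OC xi)" for e using iota_closed[OF ev[OF that]] .
  have "\<exists>h\<in>ring_hom (pair_ring (OC xi) L) L. \<forall>a\<in>carrier (OC xi). \<forall>b\<in>carrier L. h (frag_of (a, b)) = (\<lambda>(e, l). \<iota> (ev e) \<otimes>\<^bsub>L\<^esub> l) (a, b)"
  proof (rule xi.pair_ring_universal)
    fix a b a' b' assume *: "a \<in> carrier (OC xi)" "b \<in> carrier L" "a' \<in> carrier (OC xi)" "b' \<in> carrier L"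
    show "(\<lambda>(e, l). \<iota> (ev e) \<otimes>\<^bsub>L\<^esub> l) (a \<otimes>\<^bsub>OC xi\<^esub> a', b \<otimes>\<^bsub>L\<^esub> b') =
        (\<lambda>(e, l). \<iota> (ev e) \<otimes>\<^bsub>L\<^esub> l) (a, b) \<otimes>\<^bsub>L\<^esub> (\<lambda>(e, l). \<iota> (ev e) \<otimes>\<^bsub>L\<^esub> l) (a', b')"
      using * iev ev by (simp add: ring_hom_mult[OF ev_hom] ring_hom_mult[OF iota] L.m_ac)
  qed (use iev in \<open>auto simp: L.is_cring ring_hom_one[OF ev_hom] ring_hom_one[OF iota]\<close>)
  then obtain h where h: "h \<in> ring_hom (pair_ring (OC xi) L) L"
    and hf: "\<And>e l. e \<in> carrier (OC xi) \<Longrightarrow> l \<in> carrier L \<Longrightarrow> h (frag_of (e, l)) = \<iota> (ev e) \<otimes>\<^bsub>L\<^esub> l" by auto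
  have hc: "h d \<in> carrier L" if "ochains xi d" for d using ring_hom_closed[OF h, of d] that by simp
  have hadd: "h (c + d) = h c \<oplus>\<^bsub>L\<^esub> h d" if "ochains xi c" "ochains xi d" for c d using ring_hom_add[OF h, of c d] that by simp
  have hmult: "h (pair_mult (OC xi) L c d) = h c \<otimes>\<^bsub>L\<^esub> h d" if "ochains xi c" "ochains xi d" for c d
    using ring_hom_mult[OF h, of c d] that by simp
  have h0: "h 0 = \<zero>\<^bsub>L\<^esub>" using ring_hom_zero[OF h xi.pair.ring_axioms L.ring_axioms] by simp
  have hdiff: "h (c - d) = h c \<ominus>\<^bsub>L\<^esub> h d" if "ochains xi c" "ochains xi d" for c d
  proof -
    have "h c = h (c - d) \<oplus>\<^bsub>L\<^esub> h d" using hadd[of "c - d" d] that keys_diff_subset[OF that] by simp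
    then show ?thesis using hc[OF keys_diff_subset[OF that]] hc[OF that(2)] by (simp add: L.minus_eq L.a_assoc L.r_neg)
  qed
  define Ker where "Ker = {d. ochains xi d \<and> h d = \<zero>\<^bsub>L\<^esub>}"
  have TKer: "tensor_ideal k (OC xi) (kO xi) L \<iota> \<subseteq> Ker"
  proof (rule xi.T_minimal)
    show "ideal Ker (pair_ring (OC xi) L)"
    proof (rule xi.pair_idealI)
      show "pair_mult (OC xi) L (frag_of (a, b)) x \<in> Ker" if "a \<in> carrier (OC xi)" "b \<in> carrier L" "x \<in> Ker" for a b x
        using that hmult[of "frag_of (a, b)" x] hf[of a b] iev[of a] xi.pair_mult_closed[of "frag_of (a, b)" x] by (simp add: Ker_def)
    qed (simp_all add: Ker_def h0 hdiff keys_diff_subset)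
    have 1: "frag_of (a \<oplus>\<^bsub>OC xi\<^esub> a', b) - frag_of (a, b) - frag_of (a', b) \<in> Ker"
      if "a \<in> carrier (OC xi)" "a' \<in> carrier (OC xi)" "b \<in> carrier L" for a a' b
    proof -
      let ?u = "\<iota> (ev a) \<otimes>\<^bsub>L\<^esub> b" and ?v = "\<iota> (ev a') \<otimes>\<^bsub>L\<^esub> b"
      have c: "?u \<in> carrier L" "?v \<in> carrier L" using that iev by auto
      have "h (frag_of (a \<oplus>\<^bsub>OC xi\<^esub> a', b)) = ?u \<oplus>\<^bsub>L\<^esub> ?v"
        using that iev ev by (simp add: hf ring_hom_add[OF ev_hom] ring_hom_add[OF iota] L.l_distr)
      moreover have "(?u \<oplus>\<^bsub>L\<^esub> ?v) \<ominus>\<^bsub>L\<^esub> ?u \<ominus>\<^bsub>L\<^esub> ?v = \<zero>\<^bsub>L\<^esub>" using c by algebra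
      ultimately show ?thesis using that by (simp add: Ker_def hdiff keys_diff_subset hf)
    qed
    have 2: "frag_of (a, b \<oplus>\<^bsub>L\<^esub> b') - frag_of (a, b) - frag_of (a, b') \<in> Ker"
      if "a \<in> carrier (OC xi)" "b \<in> carrier L" "b' \<in> carrier L" for a b b'
    proof -
      let ?u = "\<iota> (ev a) \<otimes>\<^bsub>L\<^esub> b" and ?v = "\<iota> (ev a) \<otimes>\<^bsub>L\<^esub> b'"
      have c: "?u \<in> carrier L" "?v \<in> carrier L" using that iev by auto
      have "h (frag_of (a, b \<oplus>\<^bsub>L\<^esub> b')) = ?u \<oplus>\<^bsub>L\<^esub> ?v" using that iev by (simp add: hf L.r_distr)
      moreover have "(?u \<oplus>\<^bsub>L\<^esub> ?v) \<ominus>\<^bsub>L\<^esub> ?u \<ominus>\<^bsub>L\<^esub> ?v = \<zero>\<^bsub>L\<^esub>" using c by algebra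
      ultimately show ?thesis using that by (simp add: Ker_def hdiff keys_diff_subset hf)
    qed
    have 3: "frag_of (kO xi c \<otimes>\<^bsub>OC xi\<^esub> a, b) - frag_of (a, \<iota> c \<otimes>\<^bsub>L\<^esub> b) \<in> Ker"
      if "a \<in> carrier (OC xi)" "b \<in> carrier L" "c \<in> carrier k" for a b c
    proof -
      have "h (frag_of (kO xi c \<otimes>\<^bsub>OC xi\<^esub> a, b)) = h (frag_of (a, \<iota> c \<otimes>\<^bsub>L\<^esub> b))"
        using that iev ev kO_closed[OF xi_pts that(3)] iota_closed
        by (simp add: hf ring_hom_mult[OF ev_hom] ring_hom_mult[OF iota] ev_const L.m_ac)
      then show ?thesis using that kO_closed[OF xi_pts that(3)] iota_closed[OF that(3)] hc[of "frag_of (a, \<iota> c \<otimes>\<^bsub>L\<^esub> b)"]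
        by (simp add: Ker_def hdiff keys_diff_subset L.r_right_minus_eq)
    qed
    show "tensor_relations k (OC xi) (kO xi) L \<iota> \<subseteq> Ker" unfolding tensor_relations_def
      by (intro Un_least subsetI; elim CollectE exE conjE) (use 1 2 3 in simp_all)
  qed
  have hT: "h c = h d" if "ochains xi c" "ochains xi d" "cls xi c = cls xi d" for c d
  proof -
    have "c - d \<in> Ker" using subsetD[OF TKer] xi.cl_eq_iff[OF that(1,2)] that(3) unfolding cls_eq by simp
    then have "h c \<ominus>\<^bsub>L\<^esub> h d = \<zero>\<^bsub>L\<^esub>" using hdiff[OF that(1,2)] by (simp add: Ker_def)
    then show ?thesis using L.r_right_minus_eq[OF hc[OF that(1)] hc[OF that(2)]] by simp
  qed
  define P where "P = {cls xi d | d. ochains xi d \<and> h d = \<zero>\<^bsub>L\<^esub>}"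
  have P_iff: "cls xi d \<in> P \<longleftrightarrow> h d = \<zero>\<^bsub>L\<^esub>" if d: "ochains xi d" for d
  proof
    assume "cls xi d \<in> P"
    then obtain e where e: "cls xi d = cls xi e" "ochains xi e" "h e = \<zero>\<^bsub>L\<^esub>" unfolding P_def by (elim CollectE exE conjE)
    show "h d = \<zero>\<^bsub>L\<^esub>" using hT[OF d e(2,1)] e(3) by simp
  next
    assume z: "h d = \<zero>\<^bsub>L\<^esub>"
    show "cls xi d \<in> P" unfolding P_def by (rule CollectI, rule exI[of _ d], intro conjI refl d z)
  qed
  have clsB: "\<exists>d. ochains xi d \<and> b = cls xi d" if "b \<in> carrier (B xi)" for b using carrier_B[OF xi_pts that] .
  have Pi: "ideal P (B xi)"
  proof (rule Bxi.idealI_cring)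
    show "P \<subseteq> carrier (B xi)" using cls_closed[OF xi_pts] by (auto simp: P_def)
    have "cls xi 0 = \<zero>\<^bsub>B xi\<^esub>" using xi.cl_zero by (simp add: cls_eq B_eq)
    then show "\<zero>\<^bsub>B xi\<^esub> \<in> P" using P_iff[of 0] h0 by simp
  next
    fix a b assume "a \<in> P" "b \<in> P"
    then obtain c d where c: "ochains xi c" "h c = \<zero>\<^bsub>L\<^esub>" "a = cls xi c" and d: "ochains xi d" "h d = \<zero>\<^bsub>L\<^esub>" "b = cls xi d"
      unfolding P_def by (elim CollectE exE conjE)
    have "a \<oplus>\<^bsub>B xi\<^esub> b = cls xi (c + d)" using xi.cl_add[OF c(1) d(1)] c(3) d(3) by (simp add: cls_eq B_eq)
    then show "a \<oplus>\<^bsub>B xi\<^esub> b \<in> P" using P_iff[OF keys_add_subset[OF c(1) d(1)]] hadd[OF c(1) d(1)] c(2) d(2) by simp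
  next
    fix a r assume "a \<in> P" "r \<in> carrier (B xi)"
    then obtain c where c: "ochains xi c" "h c = \<zero>\<^bsub>L\<^esub>" "a = cls xi c" unfolding P_def by (elim CollectE exE conjE)
    obtain d where d: "ochains xi d" "r = cls xi d" using clsB[OF \<open>r \<in> carrier (B xi)\<close>] by (elim exE conjE)
    have "r \<otimes>\<^bsub>B xi\<^esub> a = cls xi (pair_mult (OC xi) L d c)" using cls_mult[OF xi_pts d(1) c(1)] c(3) d(2) by simp
    then show "r \<otimes>\<^bsub>B xi\<^esub> a \<in> P" using P_iff[OF xi.pair_mult_closed[OF d(1) c(1)]] hmult[OF d(1) c(1)] c(2) hc[OF d(1)] by simp
  qed
  have prime: "primeideal P (B xi)"
  proof (rule primeidealI[OF Pi Bxi.is_cring])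
    have "h (emb L (\<one>\<^bsub>OC xi\<^esub>)) = \<one>\<^bsub>L\<^esub>" using ring_hom_one[OF h] by (simp add: one_pair_ring)
    then have "\<one>\<^bsub>B xi\<^esub> \<notin> P" using P_iff[of "emb L (\<one>\<^bsub>OC xi\<^esub>)"] cls_one[OF xi_pts] by simp
    then show "carrier (B xi) \<noteq> P" using Bxi.one_closed by auto
    fix a b assume a: "a \<in> carrier (B xi)" and b: "b \<in> carrier (B xi)" and ab: "a \<otimes>\<^bsub>B xi\<^esub> b \<in> P"
    obtain c where c: "ochains xi c" "a = cls xi c" using clsB[OF a] by (elim exE conjE)
    obtain d where d: "ochains xi d" "b = cls xi d" using clsB[OF b] by (elim exE conjE)
    have "h c \<otimes>\<^bsub>L\<^esub> h d = \<zero>\<^bsub>L\<^esub>"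
      using ab P_iff[OF xi.pair_mult_closed[OF c(1) d(1)]] cls_mult[OF xi_pts c(1) d(1)] hmult[OF c(1) d(1)] c(2) d(2) by simp
    then have "h c = \<zero>\<^bsub>L\<^esub> \<or> h d = \<zero>\<^bsub>L\<^esub>" by (rule L.integral[OF _ hc[OF c(1)] hc[OF d(1)]])
    then show "a \<in> P \<or> b \<in> P" unfolding c(2) d(2) P_iff[OF c(1)] P_iff[OF d(1)] .
  qed
  have "{a \<in> carrier (OC xi). cls xi (emb L a) \<in> P} = nonunits (OC xi)"
    unfolding nonunits_xi
  proof (rule Collect_cong, rule conj_cong[OF refl])
    fix a assume a: "a \<in> carrier (OC xi)"
    have "h (emb L a) = \<iota> (ev a)" using hf[OF a L.one_closed] iev[OF a] by simp
    then show "cls xi (emb L a) \<in> P \<longleftrightarrow> ev a = \<zero>\<^bsub>k\<^esub>"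
      using P_iff[of "emb L a"] iota_inj[OF ev[OF a]] a by simp
  qed
  then show ?thesis unfolding bc_pts_def using prime xi_pts by (intro exI[of _ P]) simp
qed

end

section \<open>Germs of the ideal sheaves of multiples of \<open>\<infinity>\<close>\<close>

lemma (in ring) ideal_finsum:
  assumes I: "ideal I R" and f: "\<And>j. j < (n :: nat) \<Longrightarrow> f j \<in> I"
  shows "(\<Oplus>j\<in>{..<n}. f j) \<in> I"
  using f
proof (induction n)
  case 0
  show ?case using additive_subgroup.zero_closed[OF ideal.axioms(1)[OF I]] by simp
next
  case (Suc n)
  have c: "f j \<in> carrier R" if "j < Suc n" for j using Suc.prems[OF that] ideal.Icarr[OF I] by blast
  have "(\<Oplus>j\<in>{..<Suc n}. f j) = f n \<oplus> (\<Oplus>j\<in>{..<n}. f j)"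
    unfolding lessThan_Suc by (rule finsum_insert) (use c in auto)
  then show ?case using ideal_add[OF I Suc.prems[OF lessI] Suc.IH] Suc.prems by simp
qed

lemma (in cring) ideal_prod_genideal_subset:
  assumes S: "S \<subseteq> carrier R" and T: "T \<subseteq> carrier R" and J: "ideal J R"
    and ST: "\<And>s t. s \<in> S \<Longrightarrow> t \<in> T \<Longrightarrow> s \<otimes> t \<in> J"
  shows "ideal_prod R (Idl S) (Idl T) \<subseteq> J"
proof
  have 1: "s \<otimes> t \<in> J" if "s \<in> Idl S" "t \<in> T" for s t
  proof -
    have "Idl S \<subseteq> {r \<in> carrier R. r \<otimes> t \<in> J}"
      by (rule genideal_minimal[OF ideal_colon[OF J]]) (use ST S T that(2) in auto)
    then show ?thesis using that(1) by blast
  qed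
  have SC: "Idl S \<subseteq> carrier R" using ideal.Icarr[OF genideal_ideal[OF S]] by blast
  have 2: "s \<otimes> t \<in> J" if s: "s \<in> Idl S" and t: "t \<in> Idl T" for s t
  proof -
    have sc: "s \<in> carrier R" using s SC by blast
    have "t' \<otimes> s \<in> J" if "t' \<in> T" for t' using 1[OF s that] m_comm[OF sc, of t'] T that by auto
    then have "Idl T \<subseteq> {r \<in> carrier R. r \<otimes> s \<in> J}"
      by (intro genideal_minimal[OF ideal_colon[OF J sc]]) (use T in auto)
    then show ?thesis using t sc m_comm[of t s] by auto
  qed
  fix x assume "x \<in> ideal_prod R (Idl S) (Idl T)"
  then show "x \<in> J" by (induction rule: ideal_prod.induct) (use 2 ideal_add[OF J] in auto)
qed

lemma finsum_structure_module:
  "(\<Oplus>\<^bsub>msect (structure_module Y) V\<^esub>j\<in>N. g j \<odot>\<^bsub>msect (structure_module Y) V\<^esub> t j) = (\<Oplus>\<^bsub>sect Y V\<^esub>j\<in>N. g j \<otimes>\<^bsub>sect Y V\<^esub> t j)"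
  by (simp add: finsum_def finprod_def structure_module_def)

locale germs_at_infinity = integral_base_change + pointed_base_change +
  fixes P
  assumes point: "(xi, P) \<in> points"
    and stalk_noetherian: "noetherian_ring (stalk X (xi, P))"
    and stalk_local: "maximalideal (nonunits (stalk X (xi, P))) (stalk X (xi, P))"
begin

abbreviation "y \<equiv> (xi, P)"
abbreviation "A \<equiv> stalk X y"
abbreviation "cover V \<equiv> {(x, P) \<in> points. x \<in> V}"
abbreviation "pb \<equiv> comor (bc_proj k C \<gamma> L \<iota>)"

sublocale A: domain A by (rule stalk_domain) (simp add: pts_X point)

lemma up_eq: "pb V b = (\<lambda>(x, P)\<in>cover V. fraction (B x) P (cls x (emb L (rgerm C x V b))) \<one>\<^bsub>B x\<^esub>)"
  by (simp add: bc_proj_def)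

lemma pre_proj: "pre X (bc_proj k C \<gamma> L \<iota>) V = cover V"
  by (auto simp: pre_def pts_X bc_proj_def)

lemma y_pi: "xi \<in> V \<Longrightarrow> y \<in> cover V"
  using point by simp

lemma pi_mono: "W \<subseteq> V \<Longrightarrow> cover W \<subseteq> cover V"
  by auto

lemma germ_class: "opn C V \<Longrightarrow> (x, Q) \<in> cover V \<Longrightarrow> b \<in> sec C V \<Longrightarrow>
    cls x (emb L (rgerm C x V b)) \<in> carrier (B x)"
  by (rule cls_closed) (auto simp: C.rgerm_closed dest: opn_pts)

lemma up_closed:
  assumes V: "opn C V" and b: "b \<in> sec C V"
  shows "pb V b \<in> sec X (cover V)"
proof -
  have 1: "schains V (emb L b)" using b by simp
  have vb: "val V (emb L b) x = cls x (emb L (rgerm C x V b))" for x by (simp add: val_eq)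
  have v1: "val V (emb L (\<one>\<^bsub>sect C V\<^esub>)) x = \<one>\<^bsub>B x\<^esub>" if "x \<in> V" for x by (rule val_one[OF V that])
  have ne: "\<forall>(x, P)\<in>cover V. x \<in> V \<and> val V (emb L (\<one>\<^bsub>sect C V\<^esub>)) x \<notin> P"
    using v1 one_notin by auto
  have "pb V b = (\<lambda>(x, P)\<in>cover V. fraction (B x) P (val V (emb L b) x) (val V (emb L (\<one>\<^bsub>sect C V\<^esub>)) x))"
    unfolding up_eq vb by (rule restrict_ext) (use v1 in auto)
  then show ?thesis
    using fraction_section[OF preimage_open[OF V] V 1 chains_one[OF V] ne] by simp
qed

lemma up_hom:
  assumes V: "opn C V"
  shows "pb V \<in> ring_hom (sect C V) (sect X (cover V))"
proof (rule ring_hom_memI)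
  interpret V: cring "sect C V" using C.sect_cring[OF V] .
  show "pb V b \<in> sec X (cover V)" if "b \<in> sec C V" for b by (rule up_closed[OF V that])
  fix b b' assume b: "b \<in> sec C V" "b' \<in> sec C V"
  have *: "pb V (b \<otimes>\<^bsub>sect C V\<^esub> b') (x, Q) = pb V b (x, Q) \<otimes>\<^bsub>localization (B x) Q\<^esub> pb V b' (x, Q) \<and>
      pb V (b \<oplus>\<^bsub>sect C V\<^esub> b') (x, Q) = pb V b (x, Q) \<oplus>\<^bsub>localization (B x) Q\<^esub> pb V b' (x, Q)" if xQ: "(x, Q) \<in> cover V" for x Q
  proof -
    have x: "x \<in> pts C" "x \<in> V" "(x, Q) \<in> points" using xQ opn_pts[OF V] by auto
    interpret prime_localization "B x" Q using loc_point[OF x(3)] .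
    interpret x: two_algebras "OC x" L k "kO x" \<iota> using fiber[OF x(1)] .
    note gc = C.rgerm_closed[OF V x(2) b(1)] C.rgerm_closed[OF V x(2) b(2)]
    have oc: "ochains x (emb L (rgerm C x V b))" "ochains x (emb L (rgerm C x V b'))" using gc by simp_all
    have "cls x (emb L (rgerm C x V (b \<otimes>\<^bsub>sect C V\<^esub> b'))) =
        cls x (emb L (rgerm C x V b)) \<otimes>\<^bsub>B x\<^esub> cls x (emb L (rgerm C x V b'))"
      unfolding cls_mult[OF x(1) oc, symmetric] pair_mult_of C.rgerm_mult[OF V x(2) b] by simp
    moreover have "cls x (emb L (rgerm C x V (b \<oplus>\<^bsub>sect C V\<^esub> b'))) =
        cls x (emb L (rgerm C x V b)) \<oplus>\<^bsub>B x\<^esub> cls x (emb L (rgerm C x V b'))"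
      using x.cl_add_left[OF gc L.one_closed] C.rgerm_add[OF V x(2) b] by (simp add: cls_eq B_eq)
    ultimately show ?thesis
      using fraction_mult_one[OF germ_class[OF V xQ b(1)] germ_class[OF V xQ b(2)]]
        fraction_add_one[OF germ_class[OF V xQ b(1)] germ_class[OF V xQ b(2)]] xQ by (simp add: up_eq)
  qed
  have e: "pb V c \<in> extensional (cover V)" for c by (simp add: up_eq)
  show "pb V (b \<otimes>\<^bsub>sect C V\<^esub> b') = pb V b \<otimes>\<^bsub>sect X (cover V)\<^esub> pb V b'"
    by (rule extensionalityI[OF e]) (use * in \<open>auto simp: X_eq bc_loc_def\<close>)
  show "pb V (b \<oplus>\<^bsub>sect C V\<^esub> b') = pb V b \<oplus>\<^bsub>sect X (cover V)\<^esub> pb V b'"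
    by (rule extensionalityI[OF e]) (use * in \<open>auto simp: X_eq bc_loc_def\<close>)
next
  have "pb V \<one>\<^bsub>sect C V\<^esub> (x, Q) = \<one>\<^bsub>bc_loc (x, Q)\<^esub>" if xQ: "(x, Q) \<in> cover V" for x Q
  proof -
    have x: "x \<in> pts C" "x \<in> V" "(x, Q) \<in> points" using xQ opn_pts[OF V] by auto
    interpret prime_localization "B x" Q using loc_point[OF x(3)] .
    show ?thesis using xQ C.rgerm_one[OF V x(2)] cls_one[OF x(1)] by (simp add: up_eq bc_loc_def localization_one)
  qed
  then show "pb V \<one>\<^bsub>sect C V\<^esub> = \<one>\<^bsub>sect X (cover V)\<^esub>"
    by (intro extensionalityI[of _ "cover V"]) (auto simp: up_eq one_X)
qed

lemma up_res:
  assumes V: "opn C V" and W: "opn C W" "W \<subseteq> V" and b: "b \<in> sec C V"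
  shows "pb W (res C V W b) = res X (cover V) (cover W) (pb V b)"
  by (rule extensionalityI[of _ "cover W"]) (use W in \<open>auto simp: up_eq res_X C.rgerm_res[OF V b W(1)]\<close>)

definition "pr V b = rgerm X y (cover V) (pb V b)"

lemma pr_hom:
  assumes V: "opn C V" "xi \<in> V"
  shows "pr V \<in> ring_hom (sect C V) A"
proof -
  have "pr V = rgerm X y (cover V) \<circ> pb V" by (simp add: pr_def fun_eq_iff)
  then show ?thesis using ring_hom_trans[OF up_hom[OF V(1)] X.rgerm_hom[OF preimage_open[OF V(1)] y_pi[OF V(2)]]] by simp
qed

lemmas pr_closed = ring_hom_closed[OF pr_hom]

lemma pr_res:
  assumes V: "opn C V" and W: "opn C W" "W \<subseteq> V" "xi \<in> W" and b: "b \<in> sec C V"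
  shows "pr W (res C V W b) = pr V b"
  unfolding pr_def up_res[OF V W(1,2) b]
  by (rule X.rgerm_res[OF preimage_open[OF V] up_closed[OF V b] preimage_open[OF W(1)] y_pi[OF W(3)] pi_mono[OF W(2)]])

text \<open>The stalk at \<open>y\<close> of the inverse image of an ideal sheaf \<open>I\<close> on \<open>C\<close>.\<close>

definition "pr_germs I = {pr V b | V b. opn C V \<and> xi \<in> V \<and> b \<in> I V}"
definition "stalk_ideal I = genideal A (pr_germs I)"

definition "subpresheaf I \<longleftrightarrow> (\<forall>V. opn C V \<longrightarrow> I V \<subseteq> sec C V) \<and>
  (\<forall>V W. opn C V \<and> opn C W \<and> W \<subseteq> V \<longrightarrow> (\<forall>b\<in>I V. res C V W b \<in> I W))"

lemma subpresheafD:
  assumes "subpresheaf I" "opn C V" "b \<in> I V"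
  shows "b \<in> sec C V" "opn C W \<Longrightarrow> W \<subseteq> V \<Longrightarrow> res C V W b \<in> I W"
  using assms unfolding subpresheaf_def by blast+

lemma pr_germs_carrier: "subpresheaf I \<Longrightarrow> pr_germs I \<subseteq> carrier A"
  unfolding pr_germs_def using subpresheafD(1) pr_closed by blast

lemma stalk_ideal: "subpresheaf I \<Longrightarrow> ideal (stalk_ideal I) A"
  unfolding stalk_ideal_def by (rule A.genideal_ideal[OF pr_germs_carrier])

lemma pr_stalk_ideal: "subpresheaf I \<Longrightarrow> opn C V \<Longrightarrow> xi \<in> V \<Longrightarrow> b \<in> I V \<Longrightarrow> pr V b \<in> stalk_ideal I"
  unfolding stalk_ideal_def by (rule subsetD[OF A.genideal_self[OF pr_germs_carrier]]) (auto simp: pr_germs_def)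

abbreviation "kappa \<equiv> kernel_ideal (Spec k) C pinf"
abbreviation "kpow \<equiv> ideal_pow C kappa"

lemma kappaD:
  assumes "b \<in> kappa V"
  shows "b \<in> sec C V" "comor pinf V b = \<zero>\<^bsub>sect (Spec k) (pre (Spec k) pinf V)\<^esub>"
  using assms by (simp_all add: kernel_ideal_def a_kernel_def kernel_def)

lemma subpresheaf_kappa: "subpresheaf kappa"
  unfolding subpresheaf_def
proof (intro conjI allI impI ballI subsetI)
  show "b \<in> sec C V" if "b \<in> kappa V" for b V using kappaD(1)[OF that] .
  fix V W b assume *: "opn C V \<and> opn C W \<and> W \<subseteq> V" and b: "b \<in> kappa V"
  then have VW: "opn C V" "opn C W" "W \<subseteq> V" by auto
  have "pre (Spec k) pinf W \<subseteq> pre (Spec k) pinf V" using VW(3) by (auto simp: pre_def)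
  then have "comor pinf W (res C V W b) = \<zero>\<^bsub>sect (Spec k) (pre (Spec k) pinf W)\<^esub>"
    unfolding comor_pinf_res[OF VW kappaD(1)[OF b]] kappaD(2)[OF b] by (auto simp: Spec_eq restrict_def fun_eq_iff)
  then show "res C V W b \<in> kappa W"
    using C.res_closed[OF VW kappaD(1)[OF b]] by (simp add: kernel_ideal_def a_kernel_def kernel_def)
qed

lemma power_Suc_local:
  assumes "s \<in> kpow (Suc n) V" "x \<in> V"
  obtains W N a t where "opn C W" "x \<in> W" "W \<subseteq> V" "\<forall>j<(N::nat). a j \<in> kappa W \<and> t j \<in> kpow n W"
    "res C V W s = (\<Oplus>\<^bsub>sect C W\<^esub>j\<in>{..<N}. a j \<otimes>\<^bsub>sect C W\<^esub> t j)"
proof -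
  have "\<exists>W. opn C W \<and> x \<in> W \<and> W \<subseteq> V \<and>
     (\<exists>(N :: nat) a t. a \<in> {..<N} \<rightarrow> kappa W \<and> t \<in> {..<N} \<rightarrow> kpow n W \<and>
        res C V W s = (\<Oplus>\<^bsub>sect C W\<^esub>j\<in>{..<N}. a j \<otimes>\<^bsub>sect C W\<^esub> t j))"
    using assms unfolding ideal_pow.simps ideal_times_def finsum_structure_module by (simp add: structure_module_def)
  then obtain W N a t where *: "opn C W" "x \<in> W" "W \<subseteq> V" "a \<in> {..<(N::nat)} \<rightarrow> kappa W" "t \<in> {..<N} \<rightarrow> kpow n W"
    "res C V W s = (\<Oplus>\<^bsub>sect C W\<^esub>j\<in>{..<N}. a j \<otimes>\<^bsub>sect C W\<^esub> t j)" by (elim exE conjE)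
  show thesis by (rule that[of W N a t]) (use * in auto)
qed

lemma power_SucI:
  assumes "s \<in> sec C V"
    and "\<And>x. x \<in> V \<Longrightarrow> \<exists>W. opn C W \<and> x \<in> W \<and> W \<subseteq> V \<and> (\<exists>(N :: nat) a t. (\<forall>j<N. a j \<in> kappa W \<and> t j \<in> kpow n W) \<and>
        res C V W s = (\<Oplus>\<^bsub>sect C W\<^esub>j\<in>{..<N}. a j \<otimes>\<^bsub>sect C W\<^esub> t j))"
  shows "s \<in> kpow (Suc n) V"
proof -
  have Pi: "(\<forall>j<N. a j \<in> S \<and> t j \<in> S') \<longleftrightarrow> a \<in> {..<N} \<rightarrow> S \<and> t \<in> {..<N} \<rightarrow> S'" for N :: nat and a t S S' by auto
  show ?thesis
    unfolding ideal_pow.simps ideal_times_def finsum_structure_module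
    using assms unfolding Pi conj_assoc by (simp add: structure_module_def)
qed

lemma subpresheaf_power: "subpresheaf (kpow n)"
proof (induction n)
  case 0
  show ?case by (auto simp: subpresheaf_def C.res_closed)
next
  case (Suc n)
  have sc: "s \<in> sec C V" if "s \<in> kpow (Suc n) V" for s V
    using that by (simp add: ideal_times_def structure_module_def)
  have "res C V W s \<in> kpow (Suc n) W" if V: "opn C V" and W: "opn C W" "W \<subseteq> V" and s: "s \<in> kpow (Suc n) V" for V W s
  proof (rule power_SucI)
    show "res C V W s \<in> sec C W" by (rule C.res_closed[OF V W sc[OF s]])
    fix x assume x: "x \<in> W"
    obtain Z N a t where Z: "opn C Z" "x \<in> Z" "Z \<subseteq> V" "\<forall>j<(N::nat). a j \<in> kappa Z \<and> t j \<in> kpow n Z"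
      "res C V Z s = (\<Oplus>\<^bsub>sect C Z\<^esub>j\<in>{..<N}. a j \<otimes>\<^bsub>sect C Z\<^esub> t j)"
      using power_Suc_local[OF s subsetD[OF W(2) x]] .
    let ?I = "Z \<inter> W"
    have I: "opn C ?I" "x \<in> ?I" "?I \<subseteq> W" "?I \<subseteq> Z" using Z W x by auto
    interpret Z: cring "sect C Z" using C.sect_cring[OF Z(1)] .
    interpret I: cring "sect C ?I" using C.sect_cring[OF I(1)] .
    note h = C.res_hom[OF Z(1) I(1,4)]
    have c: "a j \<in> sec C Z" "t j \<in> sec C Z" if "j < N" for j
      using Z(4) that subpresheafD(1)[OF subpresheaf_kappa Z(1)] subpresheafD(1)[OF Suc Z(1)] by auto
    have "res C W ?I (res C V W s) = res C Z ?I (res C V Z s)"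
      using C.res_comp[OF V W(1) I(1,3) W(2) sc[OF s]] C.res_comp[OF V Z(1) I(1,4) Z(3) sc[OF s]] by simp
    also have "\<dots> = (\<Oplus>\<^bsub>sect C ?I\<^esub>j\<in>{..<N}. res C Z ?I (a j \<otimes>\<^bsub>sect C Z\<^esub> t j))"
      unfolding Z(5)
      by (rule finsum_lessThan_hom[OF Z.abelian_monoid_axioms I.abelian_monoid_axioms])
        (use c ring_hom_closed[OF h] ring_hom_add[OF h] ring_hom_zero[OF h Z.ring_axioms I.ring_axioms] in auto)
    also have "\<dots> = (\<Oplus>\<^bsub>sect C ?I\<^esub>j\<in>{..<N}. res C Z ?I (a j) \<otimes>\<^bsub>sect C ?I\<^esub> res C Z ?I (t j))"
      by (rule I.finsum_cong') (use c ring_hom_closed[OF h] ring_hom_mult[OF h] in auto)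
    finally have eq: "res C W ?I (res C V W s) = (\<Oplus>\<^bsub>sect C ?I\<^esub>j\<in>{..<N}. res C Z ?I (a j) \<otimes>\<^bsub>sect C ?I\<^esub> res C Z ?I (t j))" .
    have "\<forall>j<N. res C Z ?I (a j) \<in> kappa ?I \<and> res C Z ?I (t j) \<in> kpow n ?I"
      using Z(4) subpresheafD(2)[OF subpresheaf_kappa Z(1) _ I(1,4)] subpresheafD(2)[OF Suc Z(1) _ I(1,4)] by blast
    then show "\<exists>Z. opn C Z \<and> x \<in> Z \<and> Z \<subseteq> W \<and> (\<exists>(N :: nat) a t. (\<forall>j<N. a j \<in> kappa Z \<and> t j \<in> kpow n Z) \<and>
        res C W Z (res C V W s) = (\<Oplus>\<^bsub>sect C Z\<^esub>j\<in>{..<N}. a j \<otimes>\<^bsub>sect C Z\<^esub> t j))"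
      using eq by (intro exI[of _ ?I] conjI I(1-3) exI[of _ N] exI[of _ "\<lambda>j. res C Z ?I (a j)"] exI[of _ "\<lambda>j. res C Z ?I (t j)"])
  qed
  then show ?case using sc by (auto simp: subpresheaf_def)
qed

lemmas kpow_sec = subpresheafD(1)[OF subpresheaf_power]

definition "Kinf = stalk_ideal kappa"
definition "D n = stalk_ideal (kpow n)"

lemma K_ideal: "ideal Kinf A" unfolding Kinf_def by (rule stalk_ideal[OF subpresheaf_kappa])
lemma D_ideal: "ideal (D n) A" unfolding D_def by (rule stalk_ideal[OF subpresheaf_power])

lemma D_0: "D 0 = carrier A"
proof (rule ideal.one_imp_carrier[OF D_ideal])
  have o: "opn C (pts C)" by simp
  interpret c: cring "sect C (pts C)" using C.sect_cring[OF o] .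
  have "pr (pts C) \<one>\<^bsub>sect C (pts C)\<^esub> \<in> D 0"
    unfolding D_def by (rule pr_stalk_ideal[OF subpresheaf_power o xi_pts]) simp
  then show "\<one>\<^bsub>A\<^esub> \<in> D 0" using ring_hom_one[OF pr_hom[OF o xi_pts]] by simp
qed

text \<open>A product of sections of the ideal sheaf and of its power over different neighbourhoods is formed over their
  intersection, where both restrictions still belong to these subsheaves.\<close>

lemma D_Suc: "D (Suc n) = ideal_prod A Kinf (D n)"
proof
  have pi: "ideal (ideal_prod A Kinf (D n)) A" by (rule A.ideal_prod_is_ideal[OF K_ideal D_ideal])
  have "pr_germs (kpow (Suc n)) \<subseteq> ideal_prod A Kinf (D n)"
  proof
    fix g assume "g \<in> pr_germs (kpow (Suc n))"
    then obtain V b where V: "opn C V" "xi \<in> V" and b: "b \<in> kpow (Suc n) V" and g: "g = pr V b"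
      unfolding pr_germs_def by (elim CollectE exE conjE)
    obtain W N a t where W: "opn C W" "xi \<in> W" "W \<subseteq> V" "\<forall>j<(N::nat). a j \<in> kappa W \<and> t j \<in> kpow n W"
      "res C V W b = (\<Oplus>\<^bsub>sect C W\<^esub>j\<in>{..<N}. a j \<otimes>\<^bsub>sect C W\<^esub> t j)" using power_Suc_local[OF b V(2)] .
    interpret W: cring "sect C W" using C.sect_cring[OF W(1)] .
    note h = pr_hom[OF W(1,2)]
    have c: "a j \<in> sec C W" "t j \<in> sec C W" if "j < N" for j
      using W(4) that subpresheafD(1)[OF subpresheaf_kappa W(1)] kpow_sec[OF W(1)] by auto
    have "g = pr W (res C V W b)" unfolding g by (rule pr_res[OF V(1) W(1,3,2) kpow_sec[OF V(1) b], symmetric])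
    also have "\<dots> = (\<Oplus>\<^bsub>A\<^esub>j\<in>{..<N}. pr W (a j \<otimes>\<^bsub>sect C W\<^esub> t j))"
      unfolding W(5)
      by (rule finsum_lessThan_hom[OF W.abelian_monoid_axioms A.abelian_monoid_axioms])
        (use c ring_hom_closed[OF h] ring_hom_add[OF h] ring_hom_zero[OF h W.ring_axioms A.ring_axioms] in auto)
    also have "\<dots> \<in> ideal_prod A Kinf (D n)"
    proof (rule A.ideal_finsum[OF pi])
      fix j assume j: "j < N"
      have "pr W (a j) \<in> Kinf" unfolding Kinf_def by (rule pr_stalk_ideal[OF subpresheaf_kappa W(1,2)]) (use W(4) j in simp)
      moreover have "pr W (t j) \<in> D n" unfolding D_def by (rule pr_stalk_ideal[OF subpresheaf_power W(1,2)]) (use W(4) j in simp)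
      ultimately show "pr W (a j \<otimes>\<^bsub>sect C W\<^esub> t j) \<in> ideal_prod A Kinf (D n)"
        unfolding ring_hom_mult[OF h c[OF j]] by (rule ideal_prod.prod)
    qed
    finally show "g \<in> ideal_prod A Kinf (D n)" .
  qed
  then show "D (Suc n) \<subseteq> ideal_prod A Kinf (D n)" unfolding D_def[of "Suc n"] stalk_ideal_def by (rule A.genideal_minimal[OF pi])
  show "ideal_prod A Kinf (D n) \<subseteq> D (Suc n)"
    unfolding Kinf_def D_def[of n] stalk_ideal_def
  proof (rule A.ideal_prod_genideal_subset[OF pr_germs_carrier[OF subpresheaf_kappa] pr_germs_carrier[OF subpresheaf_power] D_ideal])
    fix s t assume "s \<in> pr_germs kappa" "t \<in> pr_germs (kpow n)"
    then obtain V a W b where V: "opn C V" "xi \<in> V" and a: "a \<in> kappa V" and s: "s = pr V a"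
      and W: "opn C W" "xi \<in> W" and b: "b \<in> kpow n W" and t: "t = pr W b"
      unfolding pr_germs_def by (elim CollectE exE conjE)
    let ?I = "V \<inter> W"
    have I: "opn C ?I" "xi \<in> ?I" "?I \<subseteq> V" "?I \<subseteq> W" using V W by auto
    interpret I: cring "sect C ?I" using C.sect_cring[OF I(1)] .
    let ?a = "res C V ?I a" and ?b = "res C W ?I b"
    have a': "?a \<in> kappa ?I" by (rule subpresheafD(2)[OF subpresheaf_kappa V(1) a I(1,3)])
    have b': "?b \<in> kpow n ?I" by (rule subpresheafD(2)[OF subpresheaf_power W(1) b I(1,4)])
    have c: "?a \<in> sec C ?I" "?b \<in> sec C ?I"
      using subpresheafD(1)[OF subpresheaf_kappa I(1) a'] kpow_sec[OF I(1) b'] by auto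
    have ab: "?a \<otimes>\<^bsub>sect C ?I\<^esub> ?b \<in> kpow (Suc n) ?I"
    proof (rule power_SucI)
      show abc: "?a \<otimes>\<^bsub>sect C ?I\<^esub> ?b \<in> sec C ?I" using c by simp
      fix x assume x: "x \<in> ?I"
      have "res C ?I ?I (?a \<otimes>\<^bsub>sect C ?I\<^esub> ?b) = (\<Oplus>\<^bsub>sect C ?I\<^esub>j\<in>{..<1::nat}. ?a \<otimes>\<^bsub>sect C ?I\<^esub> ?b)"
        using C.res_id[OF I(1) abc] abc by (simp add: lessThan_Suc)
      then show "\<exists>Z. opn C Z \<and> x \<in> Z \<and> Z \<subseteq> ?I \<and> (\<exists>(N :: nat) a t. (\<forall>j<N. a j \<in> kappa Z \<and> t j \<in> kpow n Z) \<and>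
          res C ?I Z (?a \<otimes>\<^bsub>sect C ?I\<^esub> ?b) = (\<Oplus>\<^bsub>sect C Z\<^esub>j\<in>{..<N}. a j \<otimes>\<^bsub>sect C Z\<^esub> t j))"
        using a' b' by (intro exI[of _ ?I] conjI I(1) x subset_refl exI[of _ "1::nat"] exI[of _ "\<lambda>_. ?a"] exI[of _ "\<lambda>_. ?b"]) simp_all
    qed
    have "s \<otimes>\<^bsub>A\<^esub> t = pr ?I (?a \<otimes>\<^bsub>sect C ?I\<^esub> ?b)"
      unfolding s t ring_hom_mult[OF pr_hom[OF I(1,2)] c]
        pr_res[OF V(1) I(1,3,2) kappaD(1)[OF a]] pr_res[OF W(1) I(1,4,2) kpow_sec[OF W(1) b]] ..
    then show "s \<otimes>\<^bsub>A\<^esub> t \<in> D (Suc n)" unfolding D_def using pr_stalk_ideal[OF subpresheaf_power I(1,2) ab] by simp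
  qed
qed

text \<open>A function that vanishes at \<open>\<infinity>\<close> lies in every prime over the maximal ideal at \<open>\<infinity>\<close>, so its
  pullback is not invertible at \<open>y\<close>.\<close>

lemma K_nonunits: "Kinf \<subseteq> nonunits A"
  unfolding Kinf_def stalk_ideal_def
proof (rule A.genideal_minimal[OF maximalideal.axioms(1)[OF stalk_local]], rule subsetI)
  fix g assume "g \<in> pr_germs kappa"
  then obtain V a where V: "opn C V" "xi \<in> V" and a: "a \<in> kappa V" and g: "g = pr V a"
    unfolding pr_germs_def by (elim CollectE exE conjE)
  note ac = kappaD(1)[OF a]
  have "comor pinf V a oo = fraction k oo \<zero>\<^bsub>k\<^esub> \<one>\<^bsub>k\<^esub>"
    unfolding kappaD(2)[OF a] using oo_pre[OF V(2)] by (simp add: Spec_eq Lo.localization_zero)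
  then have "ev (rgerm C xi V a) = \<zero>\<^bsub>k\<^esub>" using ev_germ[OF V ac] cval_fraction[OF K.zero_closed] by simp
  then have "rgerm C xi V a \<in> nonunits (OC xi)" unfolding nonunits_xi using C.rgerm_closed[OF V ac] by simp
  then have inP: "cls xi (emb L (rgerm C xi V a)) \<in> P"
    using pointD(3)[OF point C.rgerm_closed[OF V ac]] by simp
  interpret Lp: prime_localization "B xi" P using loc_point[OF point] .
  have gc: "g \<in> carrier A" unfolding g by (rule pr_closed[OF V ac])
  have "g \<notin> Units A"
  proof
    assume u: "g \<in> Units A"
    obtain U t where U: "opn X U" "y \<in> U" and t: "t \<in> sec X U" "inv\<^bsub>A\<^esub> g = rgerm X y U t"
      using X.stalk_cases[OF A.Units_inv_closed[OF u]] .
    let ?W = "cover V \<inter> U"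
    have W: "opn X ?W" "y \<in> ?W" "?W \<subseteq> cover V" "?W \<subseteq> U" using preimage_open[OF V(1)] y_pi[OF V(2)] U by auto
    interpret W: cring "sect X ?W" using X_cring[OF W(1)] .
    let ?s = "res X (cover V) ?W (pb V a)" and ?t = "res X U ?W t"
    have c: "?s \<in> sec X ?W" "?t \<in> sec X ?W"
      using X.res_closed[OF preimage_open[OF V(1)] W(1,3) up_closed[OF V(1) ac]] X.res_closed[OF U(1) W(1,4) t(1)] by auto
    have "rgerm X y ?W (?s \<otimes>\<^bsub>sect X ?W\<^esub> ?t) = rgerm X y ?W ?s \<otimes>\<^bsub>A\<^esub> rgerm X y ?W ?t" by (rule X.rgerm_mult[OF W(1,2) c, symmetric])
    also have "\<dots> = g \<otimes>\<^bsub>A\<^esub> inv\<^bsub>A\<^esub> g"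
      unfolding g pr_def[symmetric] t(2) X.rgerm_res[OF preimage_open[OF V(1)] up_closed[OF V(1) ac] W(1,2,3)] X.rgerm_res[OF U(1) t(1) W(1,2,4)]
      by (simp only: g[symmetric] t(2))
    also have "\<dots> = rgerm X y ?W \<one>\<^bsub>sect X ?W\<^esub>" using A.Units_r_inv[OF u] X.rgerm_one[OF W(1,2)] by simp
    finally have eq: "rgerm X y ?W (?s \<otimes>\<^bsub>sect X ?W\<^esub> ?t) = rgerm X y ?W \<one>\<^bsub>sect X ?W\<^esub>" .
    from X.rgerm_eqD[OF eq W(1,2) W.one_closed] obtain Z where Z: "opn X Z" "y \<in> Z" "Z \<subseteq> ?W"
      "res X ?W Z (?s \<otimes>\<^bsub>sect X ?W\<^esub> ?t) = res X ?W Z \<one>\<^bsub>sect X ?W\<^esub>" by (elim exE conjE)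
    from fun_cong[OF Z(4), of y] have "(?s \<otimes>\<^bsub>sect X ?W\<^esub> ?t) y = \<one>\<^bsub>bc_loc y\<^esub>"
      using Z(2) W(2) by (simp add: res_X one_X)
    then have "pb V a y \<otimes>\<^bsub>bc_loc y\<^esub> t y = \<one>\<^bsub>bc_loc y\<^esub>" using mult_X[OF W(2)] W(2) by (simp add: res_X)
    then have "fraction (B xi) P (cls xi (emb L (rgerm C xi V a))) \<one>\<^bsub>B xi\<^esub> \<otimes>\<^bsub>localization (B xi) P\<^esub> t y = \<one>\<^bsub>localization (B xi) P\<^esub>"
      using y_pi[OF V(2)] by (simp add: up_eq bc_loc_def)
    moreover have "t y \<in> carrier (localization (B xi) P)" using section_closed[OF t(1) U(2)] by (simp add: bc_loc_def)
    ultimately have "cls xi (emb L (rgerm C xi V a)) \<notin> P"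
      using Lp.fraction_mult_eq_one[OF germ_class[OF V(1) y_pi[OF V(2)] ac] Lp.S_one] by blast
    then show False using inP by simp
  qed
  then show "g \<in> nonunits A" using gc by (simp add: nonunits_def)
qed

text \<open>In the local domain \<open>A\<close> a factor of a nonzero principal ideal is principal, so as soon as one
  \<open>D n\<close> is principal, so is \<open>K\<close>, and hence all its powers.\<close>

lemma D_principal:
  assumes n: "0 < n" and m: "D n = PIdl\<^bsub>A\<^esub> m" "m \<in> carrier A" "m \<noteq> \<zero>\<^bsub>A\<^esub>"
  shows "\<exists>w\<in>nonunits A. \<forall>q. D q = PIdl\<^bsub>A\<^esub> (w [^]\<^bsub>A\<^esub> q)"
proof -
  obtain n' where n': "n = Suc n'" using n gr0_implies_Suc by blast
  have "ideal_prod A Kinf (D n') = PIdl\<^bsub>A\<^esub> m" using m(1) unfolding n' D_Suc .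
  from principal_factor[OF A.domain_axioms stalk_local K_ideal D_ideal this m(2,3)]
  obtain w where w: "w \<in> Kinf" "Kinf = PIdl\<^bsub>A\<^esub> w" by (elim bexE)
  have wc: "w \<in> carrier A" using w(1) ideal.Icarr[OF K_ideal] by blast
  have "D q = PIdl\<^bsub>A\<^esub> (w [^]\<^bsub>A\<^esub> q)" for q
  proof (induction q)
    case 0
    show ?case unfolding D_0 using ideal.one_imp_carrier[OF A.cgenideal_ideal[OF A.one_closed] A.cgenideal_self[OF A.one_closed]] by simp
  next
    case (Suc q)
    let ?v = "w [^]\<^bsub>A\<^esub> q"
    have vc: "?v \<in> carrier A" using wc by simp
    have e: "w [^]\<^bsub>A\<^esub> Suc q = w \<otimes>\<^bsub>A\<^esub> ?v" using A.m_comm[OF wc vc] by simp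
    have wv: "w \<otimes>\<^bsub>A\<^esub> ?v \<in> carrier A" using wc vc by simp
    show ?case unfolding D_Suc w(2) Suc e
    proof
      show "ideal_prod A (PIdl\<^bsub>A\<^esub> w) (PIdl\<^bsub>A\<^esub> ?v) \<subseteq> PIdl\<^bsub>A\<^esub> (w \<otimes>\<^bsub>A\<^esub> ?v)"
        unfolding A.cgenideal_eq_genideal[OF wc] A.cgenideal_eq_genideal[OF vc]
        by (rule A.ideal_prod_genideal_subset) (use wc vc A.cgenideal_ideal[OF wv] A.cgenideal_self[OF wv] in auto)
      show "PIdl\<^bsub>A\<^esub> (w \<otimes>\<^bsub>A\<^esub> ?v) \<subseteq> ideal_prod A (PIdl\<^bsub>A\<^esub> w) (PIdl\<^bsub>A\<^esub> ?v)"
        by (rule A.cgenideal_minimal[OF A.ideal_prod_is_ideal[OF A.cgenideal_ideal[OF wc] A.cgenideal_ideal[OF vc]]])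
          (rule ideal_prod.prod[OF A.cgenideal_self[OF wc] A.cgenideal_self[OF vc]])
    qed
  qed
  then show ?thesis using w(1) K_nonunits by blast
qed

abbreviation "OM \<equiv> O_minus k C \<gamma> L \<iota> pinf"

lemma OM_closed: "s \<in> OM n U \<Longrightarrow> s \<in> sec X U"
  by (simp add: O_minus_def inverse_image_ideal_def)

lemma OM_germ:
  assumes U: "opn X U" "y \<in> U" and s: "s \<in> OM n U"
  shows "rgerm X y U s \<in> D n"
proof -
  obtain W V N a b where W: "opn X W" "y \<in> W" "W \<subseteq> U" and V: "opn C V" "W \<subseteq> cover V"
    and a: "a \<in> {..<(N::nat)} \<rightarrow> sec X W" and b: "b \<in> {..<N} \<rightarrow> kpow n V"
    and eq: "res X U W s = (\<Oplus>\<^bsub>sect X W\<^esub>j\<in>{..<N}. a j \<otimes>\<^bsub>sect X W\<^esub> res X (cover V) W (pb V (b j)))"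
  proof -
    have "\<forall>x\<in>U. \<exists>W V. opn X W \<and> x \<in> W \<and> W \<subseteq> U \<and> opn C V \<and> W \<subseteq> cover V \<and>
     (\<exists>(N :: nat) a b. a \<in> {..<N} \<rightarrow> sec X W \<and> b \<in> {..<N} \<rightarrow> kpow n V \<and>
        res X U W s = (\<Oplus>\<^bsub>sect X W\<^esub>j\<in>{..<N}. a j \<otimes>\<^bsub>sect X W\<^esub> res X (cover V) W (pb V (b j))))"
      using s unfolding O_minus_def inverse_image_ideal_def pre_proj by (rule CollectE) (erule conjunct2)
    from bspec[OF this U(2)] show thesis using that by (elim exE conjE)
  qed
  have xi: "xi \<in> V" using W(2) V(2) by auto
  note oV = preimage_open[OF V(1)]
  have bc: "pb V (b j) \<in> sec X (cover V)" if "j < N" for j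
    by (rule up_closed[OF V(1) kpow_sec[OF V(1)]]) (use b that in auto)
  have rc: "res X (cover V) W (pb V (b j)) \<in> sec X W" if "j < N" for j by (rule X.res_closed[OF oV W(1) V(2) bc[OF that]])
  have ac: "a j \<in> sec X W" if "j < N" for j using a that by auto
  interpret W: cring "sect X W" using X_cring[OF W(1)] .
  note h = X.rgerm_hom[OF W(1,2)]
  have "rgerm X y U s = rgerm X y W (res X U W s)" by (rule X.rgerm_res[OF U(1) OM_closed[OF s] W, symmetric])
  also have "\<dots> = (\<Oplus>\<^bsub>A\<^esub>j\<in>{..<N}. rgerm X y W (a j \<otimes>\<^bsub>sect X W\<^esub> res X (cover V) W (pb V (b j))))"
    unfolding eq
    by (rule finsum_lessThan_hom[OF W.abelian_monoid_axioms A.abelian_monoid_axioms])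
      (use ac rc ring_hom_closed[OF h] ring_hom_add[OF h] ring_hom_zero[OF h W.ring_axioms A.ring_axioms] in auto)
  also have "\<dots> \<in> D n"
  proof (rule A.ideal_finsum[OF D_ideal])
    fix j assume j: "j < N"
    have "pr V (b j) \<in> D n" unfolding D_def by (rule pr_stalk_ideal[OF subpresheaf_power V(1) xi]) (use b j in auto)
    then have "rgerm X y W (res X (cover V) W (pb V (b j))) \<in> D n"
      unfolding X.rgerm_res[OF oV bc[OF j] W(1,2) V(2)] pr_def .
    from ideal.I_l_closed[OF D_ideal this ring_hom_closed[OF h ac[OF j]]]
    show "rgerm X y W (a j \<otimes>\<^bsub>sect X W\<^esub> res X (cover V) W (pb V (b j))) \<in> D n"
      unfolding ring_hom_mult[OF h ac[OF j] rc[OF j]] .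
  qed
  finally show ?thesis .
qed

lemma OM_up:
  assumes V: "opn C V" and b: "b \<in> kpow n V" and W: "opn X W" "W \<subseteq> cover V"
  shows "res X (cover V) W (pb V b) \<in> OM n W"
proof -
  interpret W: cring "sect X W" using X_cring[OF W(1)] .
  have rc: "res X (cover V) W (pb V b) \<in> sec X W"
    by (rule X.res_closed[OF preimage_open[OF V] W up_closed[OF V kpow_sec[OF V b]]])
  have eq: "res X W W (res X (cover V) W (pb V b)) = (\<Oplus>\<^bsub>sect X W\<^esub>j\<in>{..<1::nat}. \<one>\<^bsub>sect X W\<^esub> \<otimes>\<^bsub>sect X W\<^esub> res X (cover V) W (pb V b))"
    using rc X.res_id[OF W(1) rc] by (simp add: lessThan_Suc)
  show ?thesis unfolding O_minus_def inverse_image_ideal_def pre_proj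
  proof (rule CollectI, rule conjI[OF rc], rule ballI)
    fix x assume x: "x \<in> W"
    show "\<exists>W' V'. opn X W' \<and> x \<in> W' \<and> W' \<subseteq> W \<and> opn C V' \<and> W' \<subseteq> cover V' \<and>
     (\<exists>(N :: nat) a b'. a \<in> {..<N} \<rightarrow> sec X W' \<and> b' \<in> {..<N} \<rightarrow> kpow n V' \<and>
        res X W W' (res X (cover V) W (pb V b)) = (\<Oplus>\<^bsub>sect X W'\<^esub>j\<in>{..<N}. a j \<otimes>\<^bsub>sect X W'\<^esub> res X (cover V') W' (pb V' (b' j))))"
      by (rule exI[of _ W], rule exI[of _ V], intro conjI W x subset_refl V, rule exI[of _ "1::nat"], rule exI[of _ "\<lambda>_. \<one>\<^bsub>sect X W\<^esub>"],
          rule exI[of _ "\<lambda>_. b"]) (use eq b in auto)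
  qed
qed

end

section \<open>Periodic systems of free modules\<close>

subsection \<open>Coordinates\<close>

locale free_module = module R M for R :: "'a ring" (structure) and M :: "('a, 'm) module" +
  fixes r :: nat and e :: "nat \<Rightarrow> 'm"
  assumes basis: "is_basis R M r e"
begin

abbreviation "combination a \<equiv> \<Oplus>\<^bsub>M\<^esub>j\<in>{..<r}. a j \<odot>\<^bsub>M\<^esub> e j"

definition "coord m = the_inv_into ({..<r} \<rightarrow>\<^sub>E carrier R) (\<lambda>a. combination a) m"

lemma e_closed: "j < r \<Longrightarrow> e j \<in> carrier M"
  using basis by (auto simp: is_basis_def)

lemma bij: "bij_betw (\<lambda>a. combination a) ({..<r} \<rightarrow>\<^sub>E carrier R) (carrier M)"
  using basis by (simp add: is_basis_def)

lemma coord_PiE: "m \<in> carrier M \<Longrightarrow> coord m \<in> {..<r} \<rightarrow>\<^sub>E carrier R"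
  unfolding coord_def using bij_betw_the_inv_into[OF bij] by (rule bij_betwE[rule_format])

lemma coord_closed: "m \<in> carrier M \<Longrightarrow> j < r \<Longrightarrow> coord m j \<in> carrier R"
  using coord_PiE by auto

lemma coord_expand: "m \<in> carrier M \<Longrightarrow> combination (coord m) = m"
  unfolding coord_def by (rule f_the_inv_into_f_bij_betw[OF bij])

lemma coord_combination:
  assumes a: "\<And>j. j < r \<Longrightarrow> a j \<in> carrier R" and i: "i < r"
  shows "coord (combination a) i = a i"
proof -
  have "combination (restrict a {..<r}) = combination a"
    by (rule M.finsum_cong') (use a e_closed in auto)
  then have "coord (combination a) = restrict a {..<r}"
    unfolding coord_def using the_inv_into_f_f[OF bij_betw_imp_inj_on[OF bij], of "restrict a {..<r}"] a by simp
  then show ?thesis using i by simp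
qed

lemma coord_add:
  assumes m: "m \<in> carrier M" "m' \<in> carrier M" and i: "i < r"
  shows "coord (m \<oplus>\<^bsub>M\<^esub> m') i = coord m i \<oplus> coord m' i"
proof -
  have "combination (\<lambda>j. coord m j \<oplus> coord m' j) = (\<Oplus>\<^bsub>M\<^esub>j\<in>{..<r}. coord m j \<odot>\<^bsub>M\<^esub> e j \<oplus>\<^bsub>M\<^esub> coord m' j \<odot>\<^bsub>M\<^esub> e j)"
    by (rule M.finsum_cong') (use m coord_closed e_closed in \<open>auto simp: smult_l_distr\<close>)
  also have "\<dots> = combination (coord m) \<oplus>\<^bsub>M\<^esub> combination (coord m')"
    by (rule M.finsum_addf) (use m coord_closed e_closed in auto)
  also have "\<dots> = m \<oplus>\<^bsub>M\<^esub> m'" using m by (simp add: coord_expand)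
  finally have eq: "m \<oplus>\<^bsub>M\<^esub> m' = combination (\<lambda>j. coord m j \<oplus> coord m' j)" ..
  show ?thesis unfolding eq by (rule coord_combination) (use m coord_closed i in auto)
qed

lemma coord_smult:
  assumes a: "a \<in> carrier R" and m: "m \<in> carrier M" and i: "i < r"
  shows "coord (a \<odot>\<^bsub>M\<^esub> m) i = a \<otimes> coord m i"
proof -
  have "combination (\<lambda>j. a \<otimes> coord m j) = (\<Oplus>\<^bsub>M\<^esub>j\<in>{..<r}. a \<odot>\<^bsub>M\<^esub> (coord m j \<odot>\<^bsub>M\<^esub> e j))"
    by (rule M.finsum_cong') (use a m coord_closed e_closed in \<open>auto simp: smult_assoc1\<close>)
  also have "\<dots> = a \<odot>\<^bsub>M\<^esub> combination (coord m)"
    by (rule finsum_smult_ldistr[symmetric]) (use a m coord_closed e_closed in auto)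
  also have "\<dots> = a \<odot>\<^bsub>M\<^esub> m" using m by (simp add: coord_expand)
  finally have eq: "a \<odot>\<^bsub>M\<^esub> m = combination (\<lambda>j. a \<otimes> coord m j)" ..
  show ?thesis unfolding eq by (rule coord_combination) (use a m coord_closed i in auto)
qed

lemma coord_zero: "i < r \<Longrightarrow> coord \<zero>\<^bsub>M\<^esub> i = \<zero>"
  using coord_smult[of "\<zero>" "\<zero>\<^bsub>M\<^esub>" i] coord_closed[of "\<zero>\<^bsub>M\<^esub>" i] by simp

lemma coord_basis:
  assumes i: "i < r"
  shows "coord (e i) i = \<one>"
proof -
  have "combination (\<lambda>j. if i = j then \<one> else \<zero>) = (\<Oplus>\<^bsub>M\<^esub>j\<in>{..<r}. if i = j then e j else \<zero>\<^bsub>M\<^esub>)"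
    by (rule M.finsum_cong') (use e_closed in auto)
  also have "\<dots> = e i" by (rule M.finsum_singleton) (use i e_closed in auto)
  finally have eq: "e i = combination (\<lambda>j. if i = j then \<one> else \<zero>)" ..
  show ?thesis unfolding eq using coord_combination[of "\<lambda>j. if i = j then \<one> else \<zero>" i] i by simp
qed

lemma coord_eqI:
  assumes "m \<in> carrier M" "m' \<in> carrier M" "\<And>j. j < r \<Longrightarrow> coord m j = coord m' j"
  shows "m = m'"
proof -
  have "combination (coord m) = combination (coord m')"
    by (rule M.finsum_cong') (use assms coord_closed e_closed in auto)
  then show ?thesis using assms by (simp add: coord_expand)
qed

lemma coord_finsum:
  assumes "\<And>j. j < (N :: nat) \<Longrightarrow> t j \<in> carrier M" and i: "i < r"
  shows "coord (\<Oplus>\<^bsub>M\<^esub>j\<in>{..<N}. t j) i = (\<Oplus>j\<in>{..<N}. coord (t j) i)"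
  by (rule finsum_lessThan_hom[of M R "\<lambda>m. coord m i"])
    (use assms in \<open>auto simp: coord_closed coord_add coord_zero M.abelian_monoid_axioms R.abelian_monoid_axioms\<close>)

lemma smult_cancel:
  assumes R: "domain R" and a: "a \<in> carrier R" "a \<noteq> \<zero>" and m: "m \<in> carrier M" "m' \<in> carrier M"
    and eq: "a \<odot>\<^bsub>M\<^esub> m = a \<odot>\<^bsub>M\<^esub> m'"
  shows "m = m'"
proof (rule coord_eqI[OF m])
  interpret R': domain R by fact
  fix j assume j: "j < r"
  have "a \<otimes> coord m j = a \<otimes> coord m' j"
    using coord_smult[OF a(1) m(1) j] coord_smult[OF a(1) m(2) j] eq by simp
  then show "coord m j = coord m' j" using R'.m_lcancel[OF a(2,1)] coord_closed m j by simp
qed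

end

subsection \<open>Ideals \<open>I\<close> such that \<open>I M'\<close> is free\<close>

text \<open>If an injective linear map \<open>\<phi>\<close> from a free module of positive rank has image \<open>I M'\<close> with \<open>M'\<close>
  free, then \<open>I\<close> is a nonzero principal ideal. Writing \<open>m e'\<^sub>0 = \<phi> (v\<^sub>m)\<close> for \<open>m \<in> I\<close>, and \<open>m\<^sub>c \<in> I\<close> for
  the zeroth coordinate of \<open>\<phi> (e\<^sub>c)\<close>, the coordinates \<open>v\<^sub>m c\<close> satisfy \<open>m = \<Sum>\<^sub>c v\<^sub>m c \<cdot> m\<^sub>c\<close>. Since also
  \<open>m\<^sub>c v\<^sub>m = m v\<^sub>m\<^sub>c\<close>, cancelling \<open>m\<close> yields a partition of unity. One of its summands is a unit, and the
  corresponding \<open>m\<^sub>c\<close> generates \<open>I\<close>.\<close>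

lemma principal_of_free_image:
  fixes R :: "'a ring" (structure)
  assumes M: "free_module R M r e" and M': "free_module R M' r e'" and r: "0 < r"
    and R: "domain R" and mx: "maximalideal (nonunits R) R" and I: "ideal I R"
    and \<phi>: "\<And>u. u \<in> carrier M \<Longrightarrow> \<phi> u \<in> carrier M'"
      "\<And>u v. u \<in> carrier M \<Longrightarrow> v \<in> carrier M \<Longrightarrow> \<phi> (u \<oplus>\<^bsub>M\<^esub> v) = \<phi> u \<oplus>\<^bsub>M'\<^esub> \<phi> v"
      "\<And>a u. a \<in> carrier R \<Longrightarrow> u \<in> carrier M \<Longrightarrow> \<phi> (a \<odot>\<^bsub>M\<^esub> u) = a \<odot>\<^bsub>M'\<^esub> \<phi> u"
    and inj: "inj_on \<phi> (carrier M)"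
    and sub: "\<And>u. u \<in> carrier M \<Longrightarrow> \<exists>(N :: nat) g t. (\<forall>j<N. g j \<in> I \<and> t j \<in> carrier M') \<and>
        \<phi> u = (\<Oplus>\<^bsub>M'\<^esub>j\<in>{..<N}. g j \<odot>\<^bsub>M'\<^esub> t j)"
    and sup: "\<And>g v. g \<in> I \<Longrightarrow> v \<in> carrier M' \<Longrightarrow> \<exists>u\<in>carrier M. \<phi> u = g \<odot>\<^bsub>M'\<^esub> v"
  shows "\<exists>m\<in>I. m \<noteq> \<zero> \<and> I = PIdl m"
proof -
  interpret R: domain R by fact
  interpret M: free_module R M r e by fact
  interpret M': free_module R M' r e' by fact
  have Ic: "g \<in> carrier R" if "g \<in> I" for g using ideal.Icarr[OF I that] .
  have coordI: "M'.coord (\<phi> u) 0 \<in> I" if u: "u \<in> carrier M" for u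
  proof -
    obtain N g t where g: "\<forall>j<(N::nat). g j \<in> I \<and> t j \<in> carrier M'" "\<phi> u = (\<Oplus>\<^bsub>M'\<^esub>j\<in>{..<N}. g j \<odot>\<^bsub>M'\<^esub> t j)"
      using sub[OF u] by (elim exE conjE)
    have c: "g j \<in> carrier R" "t j \<in> carrier M'" if "j < N" for j using g(1) that Ic by auto
    have "M'.coord (\<phi> u) 0 = (\<Oplus>j\<in>{..<N}. M'.coord (g j \<odot>\<^bsub>M'\<^esub> t j) 0)"
      unfolding g(2) by (rule M'.coord_finsum) (use c r in auto)
    also have "\<dots> \<in> I"
    proof (rule R.ideal_finsum[OF I])
      fix j assume j: "j < N"
      have gI: "g j \<in> I" using g(1) j by simp
      show "M'.coord (g j \<odot>\<^bsub>M'\<^esub> t j) 0 \<in> I"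
        unfolding M'.coord_smult[OF c[OF j] r] by (rule ideal.I_r_closed[OF I gI M'.coord_closed[OF c(2)[OF j] r]])
    qed
    finally show ?thesis .
  qed
  have \<phi>0: "\<phi> \<zero>\<^bsub>M\<^esub> = \<zero>\<^bsub>M'\<^esub>" using \<phi>(3)[of "\<zero>" "\<zero>\<^bsub>M\<^esub>"] \<phi>(1)[of "\<zero>\<^bsub>M\<^esub>"] by simp
  define mc where "mc c = M'.coord (\<phi> (e c)) 0" for c
  have mcI: "mc c \<in> I" if "c < r" for c unfolding mc_def by (rule coordI[OF M.e_closed[OF that]])
  define v where "v m = (SOME u. u \<in> carrier M \<and> \<phi> u = m \<odot>\<^bsub>M'\<^esub> e' 0)" for m
  have v: "v m \<in> carrier M" "\<phi> (v m) = m \<odot>\<^bsub>M'\<^esub> e' 0" if m: "m \<in> I" for m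
  proof -
    have "\<exists>u. u \<in> carrier M \<and> \<phi> u = m \<odot>\<^bsub>M'\<^esub> e' 0" using sup[OF m M'.e_closed[OF r]] by blast
    from someI_ex[OF this] show "v m \<in> carrier M" "\<phi> (v m) = m \<odot>\<^bsub>M'\<^esub> e' 0" unfolding v_def by auto
  qed
  have sum: "m = (\<Oplus>c\<in>{..<r}. M.coord (v m) c \<otimes> mc c)" if m: "m \<in> I" for m
  proof -
    have cc: "M.coord (v m) c \<in> carrier R" if "c < r" for c by (rule M.coord_closed[OF v(1)[OF m] that])
    have "\<phi> (v m) = \<phi> (M.combination (M.coord (v m)))" using M.coord_expand[OF v(1)[OF m]] by simp
    also have "\<dots> = (\<Oplus>\<^bsub>M'\<^esub>c\<in>{..<r}. \<phi> (M.coord (v m) c \<odot>\<^bsub>M\<^esub> e c))"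
      by (rule finsum_lessThan_hom[OF M.M.abelian_monoid_axioms M'.M.abelian_monoid_axioms])
        (use \<phi> \<phi>0 cc M.e_closed in auto)
    finally have "M'.coord (\<phi> (v m)) 0 = (\<Oplus>c\<in>{..<r}. M'.coord (\<phi> (M.coord (v m) c \<odot>\<^bsub>M\<^esub> e c)) 0)"
      using M'.coord_finsum[of r "\<lambda>c. \<phi> (M.coord (v m) c \<odot>\<^bsub>M\<^esub> e c)" 0] \<phi>(1) cc M.e_closed r by simp
    also have "\<dots> = (\<Oplus>c\<in>{..<r}. M.coord (v m) c \<otimes> mc c)"
      by (rule R.finsum_cong')
        (use \<phi> cc M.e_closed r mcI Ic in \<open>auto simp: mc_def M'.coord_smult\<close>)
    finally show ?thesis
      unfolding v(2)[OF m] M'.coord_smult[OF Ic[OF m] M'.e_closed[OF r] r] M'.coord_basis[OF r] using Ic[OF m] by simp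
  qed
  have sym: "mc c \<otimes> M.coord (v m) d = m \<otimes> M.coord (v (mc c)) d" if m: "m \<in> I" and c: "c < r" and d: "d < r" for m c d
  proof -
    note mI = mcI[OF c]
    have "\<phi> (mc c \<odot>\<^bsub>M\<^esub> v m) = \<phi> (m \<odot>\<^bsub>M\<^esub> v (mc c))"
      using \<phi>(3)[OF Ic[OF mI] v(1)[OF m]] \<phi>(3)[OF Ic[OF m] v(1)[OF mI]] v(2)[OF m] v(2)[OF mI]
        M'.smult_assoc1[OF Ic[OF mI] Ic[OF m] M'.e_closed[OF r]] M'.smult_assoc1[OF Ic[OF m] Ic[OF mI] M'.e_closed[OF r]]
        R.m_comm[OF Ic[OF m] Ic[OF mI]] by simp
    then have "mc c \<odot>\<^bsub>M\<^esub> v m = m \<odot>\<^bsub>M\<^esub> v (mc c)"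
      by (rule inj_onD[OF inj]) (use Ic[OF m] Ic[OF mI] v(1)[OF m] v(1)[OF mI] in auto)
    then show ?thesis
      using M.coord_smult[OF Ic[OF mI] v(1)[OF m] d] M.coord_smult[OF Ic[OF m] v(1)[OF mI] d] by simp
  qed
  have "\<exists>m\<in>I. m \<noteq> \<zero>"
  proof (rule ccontr)
    assume "\<not> ?thesis"
    then have I0: "g = \<zero>" if "g \<in> I" for g using that by blast
    obtain N g t where g: "\<forall>j<(N::nat). g j \<in> I \<and> t j \<in> carrier M'" "\<phi> (e 0) = (\<Oplus>\<^bsub>M'\<^esub>j\<in>{..<N}. g j \<odot>\<^bsub>M'\<^esub> t j)"
      using sub[OF M.e_closed[OF r]] by (elim exE conjE)
    have "(\<Oplus>\<^bsub>M'\<^esub>j\<in>{..<N}. g j \<odot>\<^bsub>M'\<^esub> t j) = (\<Oplus>\<^bsub>M'\<^esub>j\<in>{..<N}. \<zero>\<^bsub>M'\<^esub>)"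
    proof (rule M'.M.finsum_cong')
      fix j assume "j \<in> {..<N}"
      then have j: "g j \<in> I" "t j \<in> carrier M'" using g(1) by auto
      show "g j \<odot>\<^bsub>M'\<^esub> t j = \<zero>\<^bsub>M'\<^esub>" unfolding I0[OF j(1)] using j(2) by simp
    qed auto
    then have "\<phi> (e 0) = \<phi> \<zero>\<^bsub>M\<^esub>" using g(2) \<phi>0 by simp
    then have "e 0 = \<zero>\<^bsub>M\<^esub>" by (rule inj_onD[OF inj]) (use M.e_closed r in auto)
    then show False using M.coord_basis[OF r] M.coord_zero[OF r] by simp
  qed
  then obtain m where m: "m \<in> I" "m \<noteq> \<zero>" by (elim bexE)
  have cc: "M.coord (v (mc c)) c \<in> carrier R" if "c < r" for c by (rule M.coord_closed[OF v(1)[OF mcI[OF that]] that])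
  let ?s = "\<Oplus>c\<in>{..<r}. M.coord (v (mc c)) c"
  have sc: "?s \<in> carrier R" by (rule R.finsum_closed) (use cc in auto)
  have "m = (\<Oplus>c\<in>{..<r}. M.coord (v m) c \<otimes> mc c)" by (rule sum[OF m(1)])
  also have "\<dots> = (\<Oplus>c\<in>{..<r}. m \<otimes> M.coord (v (mc c)) c)"
  proof (rule R.finsum_cong')
    fix c assume "c \<in> {..<r}"
    then have c: "c < r" by simp
    show "M.coord (v m) c \<otimes> mc c = m \<otimes> M.coord (v (mc c)) c"
      using sym[OF m(1) c c] R.m_comm[OF M.coord_closed[OF v(1)[OF m(1)] c] Ic[OF mcI[OF c]]] by simp
  qed (use Ic[OF m(1)] cc in auto)
  also have "\<dots> = m \<otimes> ?s" by (rule R.finsum_rdistr[symmetric]) (use Ic[OF m(1)] cc in auto)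
  finally have "m \<otimes> ?s = m \<otimes> \<one>" using Ic[OF m(1)] by simp
  then have "?s = \<one>" using R.m_lcancel[OF m(2) Ic[OF m(1)] sc R.one_closed] by simp
  then obtain c where c: "c < r" "M.coord (v (mc c)) c \<in> Units R"
    using unit_summand[OF R.is_cring mx, of "\<lambda>c. M.coord (v (mc c)) c" r] cc by auto
  let ?u = "M.coord (v (mc c)) c"
  have uc: "?u \<in> carrier R" "inv ?u \<in> carrier R" "?u \<otimes> inv ?u = \<one>" using c(2) by auto
  have mem: "g \<in> PIdl (mc c)" if g: "g \<in> I" for g
  proof -
    have vc: "M.coord (v g) c \<in> carrier R" by (rule M.coord_closed[OF v(1)[OF g] c(1)])
    have "g = g \<otimes> (?u \<otimes> inv ?u)" using uc Ic[OF g] by simp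
    also have "\<dots> = (g \<otimes> ?u) \<otimes> inv ?u" using uc(1,2) Ic[OF g] by (simp only: R.m_assoc)
    also have "\<dots> = (mc c \<otimes> M.coord (v g) c) \<otimes> inv ?u" using sym[OF g c(1) c(1)] by simp
    also have "\<dots> = (M.coord (v g) c \<otimes> inv ?u) \<otimes> mc c"
      using uc(2) vc Ic[OF mcI[OF c(1)]] by (simp only: R.m_ac R.m_closed)
    finally have "g = (M.coord (v g) c \<otimes> inv ?u) \<otimes> mc c" .
    moreover have "M.coord (v g) c \<otimes> inv ?u \<in> carrier R" using vc uc(2) by simp
    ultimately show ?thesis unfolding cgenideal_def by blast
  qed
  have "I = PIdl (mc c)"
    using mem R.cgenideal_minimal[OF I mcI[OF c(1)]] by blast
  moreover have "mc c \<noteq> \<zero>"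
  proof
    assume z: "mc c = \<zero>"
    have "PIdl (mc c) \<subseteq> {\<zero>}" unfolding z by (auto simp: cgenideal_def)
    then show False using mem[OF m(1)] m(2) by blast
  qed
  ultimately show ?thesis using mcI[OF c(1)] by blast
qed

subsection \<open>Slopes\<close>

primrec iter_map :: "(int \<Rightarrow> 'm \<Rightarrow> 'm) \<Rightarrow> int \<Rightarrow> nat \<Rightarrow> 'm \<Rightarrow> 'm" where
  "iter_map p i 0 u = u"
| "iter_map p i (Suc n) u = p (i + int n) (iter_map p i n u)"

lemma iter_map_add: "iter_map p i (a + b) u = iter_map p (i + int a) b (iter_map p i a u)"
  by (induction b) (simp_all add: add.assoc)

locale linear_system = domain R for R :: "'a ring" (structure) +
  fixes M :: "int \<Rightarrow> ('a, 'm) module" and p :: "int \<Rightarrow> 'm \<Rightarrow> 'm"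
  assumes module: "module R (M i)"
    and p_closed: "u \<in> carrier (M i) \<Longrightarrow> p i u \<in> carrier (M (i + 1))"
    and p_add: "u \<in> carrier (M i) \<Longrightarrow> v \<in> carrier (M i) \<Longrightarrow> p i (u \<oplus>\<^bsub>M i\<^esub> v) = p i u \<oplus>\<^bsub>M (i + 1)\<^esub> p i v"
    and p_smult: "a \<in> carrier R \<Longrightarrow> u \<in> carrier (M i) \<Longrightarrow> p i (a \<odot>\<^bsub>M i\<^esub> u) = a \<odot>\<^bsub>M (i + 1)\<^esub> p i u"
    and p_inj: "inj_on (p i) (carrier (M i))"
begin

lemma step: "i + int (Suc a) = i + int a + 1"
  by simp

lemma iter_closed: "u \<in> carrier (M i) \<Longrightarrow> iter_map p i a u \<in> carrier (M (i + int a))"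
proof (induction a)
  case (Suc a)
  then show ?case unfolding step iter_map.simps by (intro p_closed)
qed simp

lemma iter_add:
  assumes "u \<in> carrier (M i)" "v \<in> carrier (M i)"
  shows "iter_map p i a (u \<oplus>\<^bsub>M i\<^esub> v) = iter_map p i a u \<oplus>\<^bsub>M (i + int a)\<^esub> iter_map p i a v"
proof (induction a)
  case (Suc a)
  show ?case unfolding step iter_map.simps Suc by (intro p_add iter_closed assms)
qed simp

lemma iter_smult:
  assumes "b \<in> carrier R" "u \<in> carrier (M i)"
  shows "iter_map p i a (b \<odot>\<^bsub>M i\<^esub> u) = b \<odot>\<^bsub>M (i + int a)\<^esub> iter_map p i a u"
proof (induction a)
  case (Suc a)
  show ?case unfolding step iter_map.simps Suc by (intro p_smult iter_closed assms)
qed simp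

lemma iter_inj: "inj_on (iter_map p i a) (carrier (M i))"
proof (induction a)
  case (Suc a)
  show ?case
  proof (rule inj_onI)
    fix u v assume *: "u \<in> carrier (M i)" "v \<in> carrier (M i)" "iter_map p i (Suc a) u = iter_map p i (Suc a) v"
    have "iter_map p i a u = iter_map p i a v"
      by (rule inj_onD[OF p_inj _ iter_closed iter_closed]) (use * in simp_all)
    then show "u = v" by (rule inj_onD[OF Suc _ *(1,2)])
  qed
qed simp

end

text \<open>The stalks of an abelian \<open>\<tau>\<close>-sheaf at a point over \<open>\<infinity>\<close>: after \<open>l\<close> steps the image is \<open>D n\<close> times
  the target.\<close>

locale periodic_system = linear_system R M p for R :: "'a ring" (structure) and M :: "int \<Rightarrow> ('a, 'm) module" and p +
  fixes D :: "nat \<Rightarrow> 'a set" and r n l :: nat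
  assumes local: "maximalideal (nonunits R) R" and ideal_D: "ideal (D n) R"
    and basis: "\<exists>e. is_basis R (M i) r e" and n: "0 < n" and l: "0 < l"
    and image_sub: "u \<in> carrier (M i) \<Longrightarrow> \<exists>(N :: nat) g t. (\<forall>j<N. g j \<in> D n \<and> t j \<in> carrier (M (i + int l))) \<and>
        iter_map p i l u = (\<Oplus>\<^bsub>M (i + int l)\<^esub>j\<in>{..<N}. g j \<odot>\<^bsub>M (i + int l)\<^esub> t j)"
    and image_sup: "g \<in> D n \<Longrightarrow> v \<in> carrier (M (i + int l)) \<Longrightarrow>
        \<exists>u\<in>carrier (M i). iter_map p i l u = g \<odot>\<^bsub>M (i + int l)\<^esub> v"
begin

lemma free: "\<exists>e. free_module R (M i) r e"
  using module[of i] basis[of i] by (auto simp: free_module_def free_module_axioms_def)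

lemma D_nonzero_principal:
  assumes r: "0 < r"
  shows "\<exists>m\<in>D n. m \<noteq> \<zero> \<and> D n = PIdl m"
proof -
  obtain e where e: "free_module R (M 0) r e" using free by blast
  obtain e' where e': "free_module R (M (0 + int l)) r e'" using free by blast
  show ?thesis
    by (rule principal_of_free_image[OF e e' r domain_axioms local ideal_D, of "iter_map p 0 l"])
      (use iter_closed[of _ 0 l] iter_add[of _ 0 _ l] iter_smult[of _ _ 0 l] iter_inj[of 0 l] image_sub[of _ 0] image_sup[of _ _ 0]
        in \<open>auto simp del: add_0\<close>)
qed

context
  fixes w
  assumes w: "w \<in> carrier R" and D: "D n = PIdl (w [^] n)"
begin

lemma period_divisible:
  assumes u: "u \<in> carrier (M i)"
  shows "\<exists>v\<in>carrier (M (i + int l)). iter_map p i l u = (w [^] n) \<odot>\<^bsub>M (i + int l)\<^esub> v"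
proof -
  interpret M': module R "M (i + int l)" by (rule module)
  obtain N g t where g: "\<forall>j<(N::nat). g j \<in> D n \<and> t j \<in> carrier (M (i + int l))"
    and eq: "iter_map p i l u = (\<Oplus>\<^bsub>M (i + int l)\<^esub>j\<in>{..<N}. g j \<odot>\<^bsub>M (i + int l)\<^esub> t j)"
    using image_sub[OF u] by (elim exE conjE)
  have wn: "w [^] n \<in> carrier R" using w by simp
  have "\<forall>j<N. \<exists>x. x \<in> carrier R \<and> g j = w [^] n \<otimes> x"
  proof (intro allI impI)
    fix j assume "j < N"
    then have "g j \<in> PIdl (w [^] n)" using g D by blast
    then obtain x where x: "x \<in> carrier R" "g j = x \<otimes> w [^] n" unfolding cgenideal_def by blast
    then show "\<exists>x. x \<in> carrier R \<and> g j = w [^] n \<otimes> x" using m_comm[OF x(1) wn] by auto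
  qed
  then obtain x where x: "\<forall>j<N. x j \<in> carrier R \<and> g j = w [^] n \<otimes> x j" by metis
  have "iter_map p i l u = (\<Oplus>\<^bsub>M (i + int l)\<^esub>j\<in>{..<N}. (w [^] n) \<odot>\<^bsub>M (i + int l)\<^esub> (x j \<odot>\<^bsub>M (i + int l)\<^esub> t j))"
    unfolding eq by (rule M'.M.finsum_cong') (use g x wn in \<open>auto simp: M'.smult_assoc1\<close>)
  also have "\<dots> = (w [^] n) \<odot>\<^bsub>M (i + int l)\<^esub> (\<Oplus>\<^bsub>M (i + int l)\<^esub>j\<in>{..<N}. x j \<odot>\<^bsub>M (i + int l)\<^esub> t j)"
    by (rule M'.finsum_smult_ldistr[symmetric]) (use g x wn in auto)
  finally show ?thesis by (intro bexI[of _ "\<Oplus>\<^bsub>M (i + int l)\<^esub>j\<in>{..<N}. x j \<odot>\<^bsub>M (i + int l)\<^esub> t j"] M'.M.finsum_closed) (use g x in auto)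
qed

lemma periods_image:
  "(\<forall>u\<in>carrier (M i). \<exists>v\<in>carrier (M (i + int (l * q))). iter_map p i (l * q) u = (w [^] (n * q)) \<odot>\<^bsub>M (i + int (l * q))\<^esub> v) \<and>
   (\<forall>v\<in>carrier (M (i + int (l * q))). \<exists>u\<in>carrier (M i). iter_map p i (l * q) u = (w [^] (n * q)) \<odot>\<^bsub>M (i + int (l * q))\<^esub> v)"
proof (induction q)
  case 0
  interpret module R "M i" by (rule module)
  show ?case by auto
next
  case (Suc q)
  let ?j = "i + int (l * q)"
  have k: "i + int (l * Suc q) = ?j + int l" by (simp add: algebra_simps)
  have it: "iter_map p i (l * Suc q) u = iter_map p ?j l (iter_map p i (l * q) u)" for u
    using iter_map_add[of p i "l * q" l u] by (simp add: add.commute)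
  have wq: "w [^] (n * q) \<in> carrier R" "w [^] n \<in> carrier R" using w by simp_all
  have wp: "w [^] (n * Suc q) = w [^] (n * q) \<otimes> w [^] n" using nat_pow_mult[OF w, of "n * q" n] by (simp add: add.commute)
  interpret J: module R "M ?j" by (rule module)
  interpret J': module R "M (?j + int l)" by (rule module)
  show ?case unfolding k it wp
  proof (intro conjI ballI)
    fix u assume "u \<in> carrier (M i)"
    then obtain v where v: "v \<in> carrier (M ?j)" "iter_map p i (l * q) u = (w [^] (n * q)) \<odot>\<^bsub>M ?j\<^esub> v" using Suc by blast
    obtain v' where v': "v' \<in> carrier (M (?j + int l))" "iter_map p ?j l v = (w [^] n) \<odot>\<^bsub>M (?j + int l)\<^esub> v'"
      using period_divisible[OF v(1)] by blast
    show "\<exists>v\<in>carrier (M (?j + int l)). iter_map p ?j l (iter_map p i (l * q) u) = (w [^] (n * q) \<otimes> w [^] n) \<odot>\<^bsub>M (?j + int l)\<^esub> v"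
      by (rule bexI[OF _ v'(1)]) (simp only: v(2) iter_smult[OF wq(1) v(1)] v'(2) J'.smult_assoc1[OF wq v'(1)])
  next
    fix v assume v: "v \<in> carrier (M (?j + int l))"
    have "w [^] n \<in> D n" unfolding D by (rule cgenideal_self[OF wq(2)])
    from image_sup[OF this v] obtain v' where v': "v' \<in> carrier (M ?j)" "iter_map p ?j l v' = (w [^] n) \<odot>\<^bsub>M (?j + int l)\<^esub> v" by blast
    obtain u where u: "u \<in> carrier (M i)" "iter_map p i (l * q) u = (w [^] (n * q)) \<odot>\<^bsub>M ?j\<^esub> v'" using Suc v'(1) by blast
    show "\<exists>u\<in>carrier (M i). iter_map p ?j l (iter_map p i (l * q) u) = (w [^] (n * q) \<otimes> w [^] n) \<odot>\<^bsub>M (?j + int l)\<^esub> v"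
      by (rule bexI[OF _ u(1)]) (simp only: u(2) iter_smult[OF wq(1) v'(1)] v'(2) J'.smult_assoc1[OF wq v])
  qed
qed

end

end

text \<open>With different slopes \<open>n / l\<close>, comparing the periods makes every \<open>f i u\<close> divisible by all
  powers of the generator \<open>w\<close>. If \<open>F\<close> has the larger slope, this is seen by going \<open>N\<close> steps forward from \<open>i\<close>,
  where \<open>N\<close> is a common multiple of the periods, and otherwise by arriving at \<open>i\<close> from \<open>i - N\<close>.\<close>

lemma periodic_system_slope:
  fixes R :: "'a ring" (structure) and M :: "int \<Rightarrow> ('a, 'm) module" and M' :: "int \<Rightarrow> ('a, 'n) module"
  assumes S: "periodic_system R M p D r n l" and S': "periodic_system R M' p' D r' n' l'"
    and noeth: "noetherian_ring R"
    and D: "\<And>m. m \<in> carrier R \<Longrightarrow> m \<noteq> \<zero> \<Longrightarrow> D n = PIdl m \<Longrightarrow> \<exists>w\<in>nonunits R. \<forall>q. D q = PIdl (w [^] q)"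
    and f: "\<And>i u. u \<in> carrier (M i) \<Longrightarrow> f i u \<in> carrier (M' i)"
      "\<And>i a u. a \<in> carrier R \<Longrightarrow> u \<in> carrier (M i) \<Longrightarrow> f i (a \<odot>\<^bsub>M i\<^esub> u) = a \<odot>\<^bsub>M' i\<^esub> f i u"
      "\<And>i u. u \<in> carrier (M i) \<Longrightarrow> f (i + 1) (p i u) = p' i (f i u)"
    and r: "0 < r" and slope: "n * l' \<noteq> n' * l" and s: "s \<in> carrier (M i)"
  shows "f i s = \<zero>\<^bsub>M' i\<^esub>"
proof -
  interpret F: periodic_system R M p D r n l by fact
  interpret F': periodic_system R M' p' D r' n' l' by fact
  obtain m where m: "m \<in> D n" "m \<noteq> \<zero>" "D n = PIdl m" using F.D_nonzero_principal[OF r] by (elim bexE conjE)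
  obtain w where w: "w \<in> nonunits R" "\<forall>q. D q = PIdl (w [^] q)"
    using D[OF ideal.Icarr[OF F.ideal_D m(1)] m(2,3)] by (elim bexE)
  have wc: "w \<in> carrier R" using w(1) by (simp add: nonunits_def)
  have w0: "w [^] a \<noteq> \<zero>" for a :: nat
  proof
    assume z: "w [^] a = \<zero>"
    have "w = \<zero>"
    proof (rule ccontr)
      assume "w \<noteq> \<zero>"
      then have "w [^] (b::nat) \<noteq> \<zero>" for b using wc F.integral_iff by (induction b) auto
      then show False using z by blast
    qed
    then have "w [^] n = \<zero>" using F.n F.nat_pow_zero by simp
    then have "D n \<subseteq> {\<zero>}" using w(2) by (auto simp: cgenideal_def)
    then show False using m(1,2) by blast
  qed
  note im = F.periods_image[OF wc w(2)[rule_format]] and im' = F'.periods_image[OF wc w(2)[rule_format]]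
  have comm: "f (i + int a) (iter_map p i a u) = iter_map p' i a (f i u)" if "u \<in> carrier (M i)" for i a u
  proof (induction a)
    case (Suc a)
    show ?case unfolding F.step iter_map.simps f(3)[OF F.iter_closed[OF that]] Suc ..
  qed simp
  define a where "a = n * l'"
  define b where "b = n' * l"
  obtain e' where e': "free_module R (M' i) r' e'" using F'.free by blast
  interpret V: free_module R "M' i" r' e' by fact
  have div: "\<exists>c>(0::nat). \<forall>q. \<exists>v\<in>carrier (M' i). f i s = (w [^] (c * q)) \<odot>\<^bsub>M' i\<^esub> v"
  proof (cases "b < a")
    case True
    have "\<exists>v\<in>carrier (M' i). f i s = (w [^] ((a - b) * q)) \<odot>\<^bsub>M' i\<^esub> v" for q
    proof -
      define N where "N = l * (l' * q)"
      have N': "N = l' * (l * q)" by (simp add: N_def algebra_simps)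
      have ea: "n * (l' * q) = (a - b) * q + b * q" "n' * (l * q) = b * q"
        using True by (simp_all add: a_def b_def add_mult_distrib[symmetric])
      let ?j = "i + int N"
      interpret J: module R "M' ?j" by (rule F'.module)
      have wx: "w [^] ((a - b) * q) \<in> carrier R" "w [^] (b * q) \<in> carrier R" using wc by simp_all
      obtain v where v: "v \<in> carrier (M ?j)" "iter_map p i N s = (w [^] ((a - b) * q + b * q)) \<odot>\<^bsub>M ?j\<^esub> v"
        using im[of i "l' * q"] s unfolding N_def[symmetric] ea(1) by blast
      have fv: "f ?j v \<in> carrier (M' ?j)" by (rule f(1)[OF v(1)])
      obtain u where u: "u \<in> carrier (M' i)" "iter_map p' i N u = (w [^] (b * q)) \<odot>\<^bsub>M' ?j\<^esub> f ?j v"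
        using im'[of i "l * q"] fv unfolding N'[symmetric] ea(2) by blast
      have "iter_map p' i N (f i s) = f ?j (iter_map p i N s)" by (rule comm[OF s, symmetric])
      also have "\<dots> = (w [^] ((a - b) * q + b * q)) \<odot>\<^bsub>M' ?j\<^esub> f ?j v" unfolding v(2) by (rule f(2)) (use wc v(1) in auto)
      also have "\<dots> = (w [^] ((a - b) * q)) \<odot>\<^bsub>M' ?j\<^esub> iter_map p' i N u"
        unfolding u(2) F.nat_pow_mult[OF wc, symmetric] by (rule J.smult_assoc1[OF wx fv])
      also have "\<dots> = iter_map p' i N ((w [^] ((a - b) * q)) \<odot>\<^bsub>M' i\<^esub> u)" by (rule F'.iter_smult[OF wx(1) u(1), symmetric])
      finally have "f i s = (w [^] ((a - b) * q)) \<odot>\<^bsub>M' i\<^esub> u"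
        by (rule inj_onD[OF F'.iter_inj]) (use f(1)[OF s] wx(1) u(1) in auto)
      then show ?thesis using u(1) by blast
    qed
    then show ?thesis using True by (intro exI[of _ "a - b"] conjI allI) simp_all
  next
    case False
    then have ab: "a < b" using slope by (simp add: a_def b_def)
    have "\<exists>v\<in>carrier (M' i). f i s = (w [^] ((b - a) * q)) \<odot>\<^bsub>M' i\<^esub> v" for q
    proof -
      define N where "N = l * (l' * q)"
      have N': "N = l' * (l * q)" by (simp add: N_def algebra_simps)
      have ea: "n * (l' * q) = a * q" "n' * (l * q) = a * q + (b - a) * q"
        using ab by (simp_all add: a_def b_def add_mult_distrib[symmetric])
      define j where "j = i - int N"
      have i: "i = j + int N" by (simp add: j_def)
      have wx: "w [^] (a * q) \<in> carrier R" "w [^] ((b - a) * q) \<in> carrier R" using wc by simp_all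
      obtain u where u: "u \<in> carrier (M j)" "iter_map p j N u = (w [^] (a * q)) \<odot>\<^bsub>M i\<^esub> s"
        using im[of j "l' * q"] s unfolding N_def[symmetric] ea(1) i[symmetric] by blast
      obtain v where v: "v \<in> carrier (M' i)" "iter_map p' j N (f j u) = (w [^] (a * q + (b - a) * q)) \<odot>\<^bsub>M' i\<^esub> v"
        using im'[of j "l * q"] f(1)[OF u(1)] unfolding N'[symmetric] ea(2) i[symmetric] by blast
      have "(w [^] (a * q)) \<odot>\<^bsub>M' i\<^esub> f i s = f i (iter_map p j N u)" unfolding u(2) by (rule f(2)[OF wx(1) s, symmetric])
      also have "\<dots> = iter_map p' j N (f j u)" using comm[OF u(1), of N] unfolding i[symmetric] .
      also have "\<dots> = (w [^] (a * q)) \<odot>\<^bsub>M' i\<^esub> ((w [^] ((b - a) * q)) \<odot>\<^bsub>M' i\<^esub> v)"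
        unfolding v(2) F.nat_pow_mult[OF wc, symmetric] by (rule V.smult_assoc1[OF wx v(1)])
      finally have "f i s = (w [^] ((b - a) * q)) \<odot>\<^bsub>M' i\<^esub> v"
        by (rule V.smult_cancel[OF F.domain_axioms wx(1) w0 f(1)[OF s] V.smult_closed[OF wx(2) v(1)]])
      then show ?thesis using v(1) by blast
    qed
    then show ?thesis using ab by (intro exI[of _ "b - a"] conjI allI) simp_all
  qed
  then obtain c :: nat where c: "c > 0" "\<forall>q. \<exists>v\<in>carrier (M' i). f i s = (w [^] (c * q)) \<odot>\<^bsub>M' i\<^esub> v" by (elim exE conjE)
  show ?thesis
  proof (rule V.coord_eqI[OF f(1)[OF s]])
    fix j assume j: "j < r'"
    have "V.coord (f i s) j = \<zero>"
    proof (rule divisible_by_all_powers[OF F.domain_axioms noeth F.local w(1) V.coord_closed[OF f(1)[OF s] j]])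
      fix q :: nat
      obtain v where v: "v \<in> carrier (M' i)" "f i s = (w [^] (c * q)) \<odot>\<^bsub>M' i\<^esub> v" using c(2) by blast
      have cq: "c * q = q + (c - 1) * q" using c(1) by (cases c) simp_all
      have "V.coord (f i s) j = w [^] (c * q) \<otimes> V.coord v j" unfolding v(2) by (rule V.coord_smult[OF _ v(1) j]) (use wc in simp)
      also have "\<dots> = w [^] q \<otimes> (w [^] ((c - 1) * q) \<otimes> V.coord v j)"
        unfolding cq F.nat_pow_mult[OF wc, symmetric] by (rule F.m_assoc) (use wc V.coord_closed[OF v(1) j] in auto)
      finally show "\<exists>z\<in>carrier R. V.coord (f i s) j = w [^] q \<otimes> z"
        by (rule bexI) (use wc V.coord_closed[OF v(1) j] in auto)
    qed
    then show "V.coord (f i s) j = V.coord \<zero>\<^bsub>M' i\<^esub> j" using V.coord_zero[OF j] by simp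
  qed simp
qed

section \<open>Vanishing of homomorphisms of locally free sheaves\<close>

context integral_base_change
begin

lemma presheaf:
  assumes "locally_free X G r"
  shows "module_presheaf X G"
  by (rule sheaf_of_modules_presheaf[OF X.ringed_presheaf_axioms]) (use assms in \<open>simp add: locally_free_def\<close>)

lemma local_basis:
  assumes G: "locally_free X G r" and x: "x \<in> pts X"
  obtains U e where "opn X U" "x \<in> U" "e \<in> {..<r} \<rightarrow> msec G U"
    "\<forall>V. opn X V \<and> V \<subseteq> U \<longrightarrow> free_module (sect X V) (msect G V) r (\<lambda>j. mres G U V (e j))"
proof -
  obtain U e where U: "opn X U" "x \<in> U" "e \<in> {..<r} \<rightarrow> msec G U"
    and b: "\<forall>V. opn X V \<and> V \<subseteq> U \<longrightarrow> is_basis (sect X V) (msect G V) r (\<lambda>j. mres G U V (e j))"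
    using G x unfolding locally_free_def by blast
  have "free_module (sect X V) (msect G V) r (\<lambda>j. mres G U V (e j))" if V: "opn X V" "V \<subseteq> U" for V
    using module_presheaf.msect_module[OF presheaf[OF G] V(1)] b V by (simp add: free_module_def free_module_axioms_def)
  then have "\<forall>V. opn X V \<and> V \<subseteq> U \<longrightarrow> free_module (sect X V) (msect G V) r (\<lambda>j. mres G U V (e j))" by simp
  from that[OF U this] show thesis .
qed

lemma sections_eqI:
  assumes G: "locally_free X G r" and U: "opn X U" and t: "t \<in> msec G U" "t' \<in> msec G U"
    and loc: "\<And>x. x \<in> U \<Longrightarrow> \<exists>W. opn X W \<and> x \<in> W \<and> W \<subseteq> U \<and> mres G U W t = mres G U W t'"
  shows "t = t'"
proof -
  let ?V = "{W. opn X W \<and> W \<subseteq> U \<and> mres G U W t = mres G U W t'}"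
  have U': "\<Union>?V = U" using loc by blast
  have sh: "set_sheaf (space X) (\<lambda>U. msec G U) (mres G)"
    using G by (simp add: locally_free_def sheaf_of_modules_def)
  show ?thesis by (rule set_sheaf_separated[OF sh, of ?V]) (use t in \<open>simp_all add: U'\<close>)
qed

lemma rank_zero_sections:
  assumes G: "locally_free X G 0" and U: "opn X U" and s: "s \<in> msec G U"
  shows "s = \<zero>\<^bsub>msect G U\<^esub>"
proof -
  interpret G: module_presheaf X G by (rule presheaf[OF G])
  interpret U: module "sect X U" "msect G U" by (rule G.msect_module[OF U])
  show ?thesis
  proof (rule sections_eqI[OF G U s U.M.zero_closed])
    fix x assume x: "x \<in> U"
    obtain V e where V: "opn X V" "x \<in> V" "e \<in> {..<0::nat} \<rightarrow> msec G V"
      "\<forall>W. opn X W \<and> W \<subseteq> V \<longrightarrow> free_module (sect X W) (msect G W) 0 (\<lambda>j. mres G V W (e j))"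
      using local_basis[OF G subsetD[OF openin_subset[OF U] x]] .
    let ?W = "U \<inter> V"
    have W: "opn X ?W" "x \<in> ?W" "?W \<subseteq> U" "?W \<subseteq> V" using U V x by auto
    interpret W: free_module "sect X ?W" "msect G ?W" 0 "\<lambda>j. mres G V ?W (e j)" by (rule V(4)[rule_format, OF conjI[OF W(1,4)]])
    have "mres G U ?W s = \<zero>\<^bsub>msect G ?W\<^esub>"
      by (rule W.coord_eqI) (use G.mres_closed[OF U W(1,3) s] in auto)
    then show "\<exists>W. opn X W \<and> x \<in> W \<and> W \<subseteq> U \<and> mres G U W s = mres G U W \<zero>\<^bsub>msect G U\<^esub>"
      using W G.mres_zero[OF U W(1,3)] by (intro exI[of _ ?W]) simp
  qed
qed

text \<open>A homomorphism that vanishes on one stalk vanishes on a neighbourhood, since finitely many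
  sections form a basis there. Elsewhere the coordinates of its values are functions that vanish on
  a nonempty open set, hence have zero germs.\<close>

lemma hom_zero_everywhere:
  assumes G: "locally_free X G r" and H: "locally_free X H r'" and f: "sheaf_hom X G H f"
    and y: "y \<in> pts X" and zero: "\<And>u. u \<in> carrier (mstalk X G y) \<Longrightarrow> mstalk_map X H f y u = \<zero>\<^bsub>mstalk X H y\<^esub>"
    and U: "opn X U" and s: "s \<in> msec G U"
  shows "f U s = \<zero>\<^bsub>msect H U\<^esub>"
proof -
  interpret G: module_presheaf X G by (rule presheaf[OF G])
  interpret H: module_presheaf X H by (rule presheaf[OF H])
  interpret f: module_hom_presheaf X G H f
    by (intro module_hom_presheaf.intro module_hom_presheaf_axioms.intro G.module_presheaf_axioms H.module_presheaf_axioms f)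
  obtain U0 e where U0: "opn X U0" "y \<in> U0" "e \<in> {..<r} \<rightarrow> msec G U0"
    and "\<forall>V. opn X V \<and> V \<subseteq> U0 \<longrightarrow> free_module (sect X V) (msect G V) r (\<lambda>j. mres G U0 V (e j))"
    using local_basis[OF G y] .
  note e = this(4)[rule_format, OF conjI]
  have ec: "e j \<in> msec G U0" if "j < r" for j using U0(3) that by auto
  have nb: "\<exists>W. opn X W \<and> y \<in> W \<and> W \<subseteq> U0 \<and> (\<forall>j<m. mres H U0 W (f U0 (e j)) = \<zero>\<^bsub>msect H W\<^esub>)" if "m \<le> r" for m
    using that
  proof (induction m)
    case 0
    then show ?case using U0 by auto
  next
    case (Suc m)
    then have m: "m < r" by simp
    have IH: "\<exists>W. opn X W \<and> y \<in> W \<and> W \<subseteq> U0 \<and> (\<forall>j<m. mres H U0 W (f U0 (e j)) = \<zero>\<^bsub>msect H W\<^esub>)" using Suc by simp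
    obtain W where W: "opn X W" "y \<in> W" "W \<subseteq> U0" "\<forall>j<m. mres H U0 W (f U0 (e j)) = \<zero>\<^bsub>msect H W\<^esub>" using IH by (elim exE conjE)
    note fc = f.hom_closed[OF U0(1) ec]
    have "mgerm X H y U0 (f U0 (e m)) = \<zero>\<^bsub>mstalk X H y\<^esub>"
      using zero[OF G.mgerm_closed[OF U0(1,2) ec[OF m]]] f.mstalk_map_germ[OF U0(1,2) ec[OF m]] by simp
    then obtain V where V: "opn X V" "y \<in> V" "V \<subseteq> U0" "mres H U0 V (f U0 (e m)) = \<zero>\<^bsub>msect H V\<^esub>"
      using H.mgerm_zero_iff[OF U0(1,2) fc[OF m]] by auto
    let ?I = "W \<inter> V"
    have I: "opn X ?I" "y \<in> ?I" "?I \<subseteq> W" "?I \<subseteq> V" "?I \<subseteq> U0" using W V by auto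
    have "mres H U0 ?I (f U0 (e j)) = \<zero>\<^bsub>msect H ?I\<^esub>" if j: "j < Suc m" for j
    proof (cases "j = m")
      case True
      show ?thesis using H.mres_comp[OF U0(1) V(1) I(1,4) V(3) fc[OF m]] V(4) H.mres_zero[OF V(1) I(1,4)] True by simp
    next
      case False
      then have jm: "j < m" and jr: "j < r" using j m by auto
      have "mres H U0 ?I (f U0 (e j)) = mres H W ?I (mres H U0 W (f U0 (e j)))" by (rule H.mres_comp[OF U0(1) W(1) I(1,3) W(3) fc[OF jr], symmetric])
      also have "\<dots> = \<zero>\<^bsub>msect H ?I\<^esub>" unfolding W(4)[rule_format, OF jm] by (rule H.mres_zero[OF W(1) I(1,3)])
      finally show ?thesis .
    qed
    then show ?case using I by (intro exI[of _ ?I]) simp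
  qed
  from nb[OF order_refl] obtain W0 where W0: "opn X W0" "y \<in> W0" "W0 \<subseteq> U0"
    "\<forall>j<r. mres H U0 W0 (f U0 (e j)) = \<zero>\<^bsub>msect H W0\<^esub>" by (elim exE conjE)
  have small: "f Z v = \<zero>\<^bsub>msect H Z\<^esub>" if Z: "opn X Z" "Z \<subseteq> W0" and v: "v \<in> msec G Z" for Z v
  proof -
    have ZU: "Z \<subseteq> U0" using Z W0 by blast
    interpret GZ: free_module "sect X Z" "msect G Z" r "\<lambda>j. mres G U0 Z (e j)" by (rule e[OF Z(1) ZU])
    interpret HZ: module "sect X Z" "msect H Z" by (rule H.msect_module[OF Z(1)])
    have fe: "f Z (mres G U0 Z (e j)) = \<zero>\<^bsub>msect H Z\<^esub>" if "j < r" for j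
      using f.hom_res[OF U0(1) Z(1) ZU ec[OF that]] W0(4) that
        H.mres_comp[OF U0(1) W0(1) Z(1,2) W0(3) f.hom_closed[OF U0(1) ec[OF that]]] H.mres_zero[OF W0(1) Z] by simp
    have f0: "f Z \<zero>\<^bsub>msect G Z\<^esub> = \<zero>\<^bsub>msect H Z\<^esub>"
      using f.hom_smult[OF Z(1) GZ.R.zero_closed GZ.M.zero_closed] f.hom_closed[OF Z(1) GZ.M.zero_closed] by simp
    have "f Z (GZ.combination (GZ.coord v)) = (\<Oplus>\<^bsub>msect H Z\<^esub>j\<in>{..<r}. f Z (GZ.coord v j \<odot>\<^bsub>msect G Z\<^esub> mres G U0 Z (e j)))"
      by (rule finsum_lessThan_hom[OF GZ.M.abelian_monoid_axioms HZ.M.abelian_monoid_axioms])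
        (use f.hom_closed[OF Z(1)] f.hom_add[OF Z(1)] f0 GZ.coord_closed[OF v] GZ.e_closed in auto)
    also have "\<dots> = (\<Oplus>\<^bsub>msect H Z\<^esub>j\<in>{..<r}. \<zero>\<^bsub>msect H Z\<^esub>)"
      by (rule HZ.M.finsum_cong') (use f.hom_smult[OF Z(1)] fe GZ.coord_closed[OF v] GZ.e_closed in auto)
    finally show ?thesis using GZ.coord_expand[OF v] by simp
  qed
  interpret HU: module "sect X U" "msect H U" by (rule H.msect_module[OF U])
  note t = f.hom_closed[OF U s]
  show ?thesis
  proof (rule sections_eqI[OF H U t HU.M.zero_closed])
    fix z assume z: "z \<in> U"
    have zX: "z \<in> pts X" using openin_subset[OF U] z by blast
    obtain U1 b where U1: "opn X U1" "z \<in> U1" "b \<in> {..<r'} \<rightarrow> msec H U1"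
      and "\<forall>V. opn X V \<and> V \<subseteq> U1 \<longrightarrow> free_module (sect X V) (msect H V) r' (\<lambda>j. mres H U1 V (b j))"
      using local_basis[OF H zX] .
    note b = this(4)[rule_format, OF conjI]
    let ?V = "U1 \<inter> U" and ?Z = "(U1 \<inter> U) \<inter> W0"
    have V: "opn X ?V" "z \<in> ?V" "?V \<subseteq> U1" "?V \<subseteq> U" using U U1 z by auto
    have Z: "opn X ?Z" "?Z \<subseteq> ?V" "?Z \<subseteq> U1" "?Z \<subseteq> U" "?Z \<subseteq> W0" using V W0 by auto
    have Zne: "?Z \<noteq> {}" by (rule meet) (use V W0 in auto)
    interpret HV: free_module "sect X ?V" "msect H ?V" r' "\<lambda>j. mres H U1 ?V (b j)" by (rule b[OF V(1,3)])
    interpret HZ: free_module "sect X ?Z" "msect H ?Z" r' "\<lambda>j. mres H U1 ?Z (b j)" by (rule b[OF Z(1,3)])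
    let ?t = "mres H U ?V (f U s)"
    have tc: "?t \<in> msec H ?V" by (rule H.mres_closed[OF U V(1,4) t])
    have bc: "b j \<in> msec H U1" if "j < r'" for j using U1(3) that by auto
    let ?c = "HV.coord ?t"
    have cc: "?c j \<in> sec X ?V" if "j < r'" for j by (rule HV.coord_closed[OF tc that])
    have rc: "res X ?V ?Z (?c j) \<in> sec X ?Z" if "j < r'" for j by (rule X.res_closed[OF V(1) Z(1,2) cc[OF that]])
    have "\<zero>\<^bsub>msect H ?Z\<^esub> = f ?Z (mres G U ?Z s)" by (rule small[OF Z(1,5) G.mres_closed[OF U Z(1,4) s], symmetric])
    also have "\<dots> = mres H ?V ?Z ?t" using f.hom_res[OF U Z(1,4) s] H.mres_comp[OF U V(1) Z(1,2) V(4) t] by simp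
    also have "\<dots> = mres H ?V ?Z (HV.combination ?c)" using HV.coord_expand[OF tc] by simp
    also have "\<dots> = (\<Oplus>\<^bsub>msect H ?Z\<^esub>j\<in>{..<r'}. mres H ?V ?Z (?c j \<odot>\<^bsub>msect H ?V\<^esub> mres H U1 ?V (b j)))"
      by (rule finsum_lessThan_hom[OF HV.M.abelian_monoid_axioms HZ.M.abelian_monoid_axioms])
        (use H.mres_closed[OF V(1) Z(1,2)] H.mres_add[OF V(1) Z(1,2)] H.mres_zero[OF V(1) Z(1,2)] cc HV.e_closed in auto)
    also have "\<dots> = HZ.combination (\<lambda>j. res X ?V ?Z (?c j))"
    proof (rule HZ.M.finsum_cong')
      fix j assume "j \<in> {..<r'}"
      then have j: "j < r'" by simp
      show "mres H ?V ?Z (?c j \<odot>\<^bsub>msect H ?V\<^esub> mres H U1 ?V (b j)) = res X ?V ?Z (?c j) \<odot>\<^bsub>msect H ?Z\<^esub> mres H U1 ?Z (b j)"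
        unfolding H.mres_smult[OF V(1) Z(1,2) cc[OF j] HV.e_closed[OF j]] H.mres_comp[OF U1(1) V(1) Z(1,2) V(3) bc[OF j]] ..
    qed (use rc HZ.e_closed in auto)
    finally have eq: "HZ.combination (\<lambda>j. res X ?V ?Z (?c j)) = \<zero>\<^bsub>msect H ?Z\<^esub>" by (rule sym)
    have c0: "rgerm X z ?V (?c j) = \<zero>\<^bsub>stalk X z\<^esub>" if j: "j < r'" for j
    proof (rule germ_zero_everywhere[OF V(1,2) cc[OF j] Z(1) Zne Z(2)])
      have "HZ.coord (HZ.combination (\<lambda>j. res X ?V ?Z (?c j))) j = res X ?V ?Z (?c j)" by (rule HZ.coord_combination[OF _ j]) (rule rc)
      then have "res X ?V ?Z (?c j) = \<zero>\<^bsub>sect X ?Z\<^esub>" unfolding eq HZ.coord_zero[OF j] by (rule sym)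
      then have e: "restrict (?c j) ?Z = (\<lambda>p\<in>?Z. \<zero>\<^bsub>bc_loc p\<^esub>)" unfolding res_X zero_X .
      show "?c j p = \<zero>\<^bsub>bc_loc p\<^esub>" if p: "p \<in> ?Z" for p using fun_cong[OF e, of p] p by simp
    qed
    interpret A: domain "stalk X z" by (rule stalk_domain[OF zX])
    interpret Mz: module "stalk X z" "mstalk X H z" by (rule H.mstalk_module[OF A.is_cring zX])
    have "mgerm X H z ?V ?t = mgerm X H z ?V (HV.combination ?c)" using HV.coord_expand[OF tc] by simp
    also have "\<dots> = (\<Oplus>\<^bsub>mstalk X H z\<^esub>j\<in>{..<r'}. rgerm X z ?V (?c j) \<odot>\<^bsub>mstalk X H z\<^esub> mgerm X H z ?V (mres H U1 ?V (b j)))"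
      by (rule H.mgerm_finsum[OF A.is_cring V(1,2) cc HV.e_closed])
    also have "\<dots> = (\<Oplus>\<^bsub>mstalk X H z\<^esub>j\<in>{..<r'}. \<zero>\<^bsub>mstalk X H z\<^esub>)"
      by (rule Mz.M.finsum_cong') (use c0 H.mgerm_closed[OF V(1,2) HV.e_closed] in auto)
    finally have "mgerm X H z ?V ?t = \<zero>\<^bsub>mstalk X H z\<^esub>" by simp
    then obtain W where W: "opn X W" "z \<in> W" "W \<subseteq> ?V" "mres H ?V W ?t = \<zero>\<^bsub>msect H W\<^esub>"
      using H.mgerm_zero_iff[OF V(1,2) tc] by auto
    have WU: "W \<subseteq> U" using W V by blast
    have "mres H U W (f U s) = mres H U W \<zero>\<^bsub>msect H U\<^esub>"
      using H.mres_comp[OF U V(1) W(1,3) V(4) t] W(4) H.mres_zero[OF U W(1) WU] by simp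
    then show "\<exists>W. opn X W \<and> z \<in> W \<and> W \<subseteq> U \<and> mres H U W (f U s) = mres H U W \<zero>\<^bsub>msect H U\<^esub>"
      using W WU by blast
  qed
qed

end

section \<open>Stalks of abelian \<open>\<tau>\<close>-sheaves over \<open>\<infinity>\<close>\<close>

locale periodic_sheaf = germs_at_infinity +
  fixes T and n l :: nat
  assumes lf: "locally_free X (sheaf T i) (rank T)"
    and Pi_hom: "sheaf_hom X (sheaf T i) (sheaf T (i + 1)) (Pi_map T i)" and Pi_inj: "sheaf_inj X (sheaf T i) (Pi_map T i)"
    and n: "0 < n" and l: "0 < l"
    and period: "opn X U \<Longrightarrow> Pi_iter T i l U ` msec (sheaf T i) U =
      ideal_times X (sheaf T (i + int l)) (OM n) (\<lambda>W. msec (sheaf T (i + int l)) W) U"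
begin

lemma yX: "y \<in> pts X"
  using point by (simp add: pts_X)

lemma S: "module_presheaf X (sheaf T i)"
  by (rule presheaf[OF lf])

lemma Pi_presheaf: "module_hom_presheaf X (sheaf T i) (sheaf T (i + 1)) (Pi_map T i)"
  by (intro module_hom_presheaf.intro module_hom_presheaf_axioms.intro S Pi_hom)

abbreviation "stalk_at i \<equiv> mstalk X (sheaf T i) y"
abbreviation "p i \<equiv> mstalk_map X (sheaf T (i + 1)) (Pi_map T i) y"
abbreviation "mg i \<equiv> mgerm X (sheaf T i) y"

sublocale sys: linear_system A stalk_at p
proof (intro linear_system.intro linear_system_axioms.intro A.domain_axioms)
  show "module A (stalk_at i)" for i by (rule module_presheaf.mstalk_module[OF S A.is_cring yX])
  note h = Pi_presheaf
  show "p i u \<in> carrier (stalk_at (i + 1))" if "u \<in> carrier (stalk_at i)" for i u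
    by (rule module_hom_presheaf.mstalk_map_closed[OF h that])
  show "p i (u \<oplus>\<^bsub>stalk_at i\<^esub> v) = p i u \<oplus>\<^bsub>stalk_at (i + 1)\<^esub> p i v" if "u \<in> carrier (stalk_at i)" "v \<in> carrier (stalk_at i)" for i u v
    by (rule module_hom_presheaf.mstalk_map_add[OF h A.is_cring that])
  show "p i (a \<odot>\<^bsub>stalk_at i\<^esub> u) = a \<odot>\<^bsub>stalk_at (i + 1)\<^esub> p i u" if "a \<in> carrier A" "u \<in> carrier (stalk_at i)" for i a u
    by (rule module_hom_presheaf.mstalk_map_smult[OF h that])
  show "inj_on (p i) (carrier (stalk_at i))" for i
    by (rule module_hom_presheaf.mstalk_map_inj[OF h Pi_inj A.is_cring])
qed

lemma Pi_iter_closed: "opn X U \<Longrightarrow> s \<in> msec (sheaf T i) U \<Longrightarrow> Pi_iter T i a U s \<in> msec (sheaf T (i + int a)) U"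
proof (induction a)
  case (Suc a)
  then show ?case unfolding sys.step Pi_iter.simps by (intro module_hom_presheaf.hom_closed[OF Pi_presheaf])
qed simp

lemma Pi_iter_germ:
  assumes U: "opn X U" "y \<in> U" and s: "s \<in> msec (sheaf T i) U"
  shows "iter_map p i a (mg i U s) = mg (i + int a) U (Pi_iter T i a U s)"
proof (induction a)
  case (Suc a)
  show ?case unfolding sys.step Pi_iter.simps iter_map.simps Suc
    by (rule module_hom_presheaf.mstalk_map_germ[OF Pi_presheaf U Pi_iter_closed[OF U(1) s]])
qed simp

lemma stalk_basis: "\<exists>e. is_basis A (stalk_at i) (rank T) e"
proof -
  obtain U e where U: "opn X U" "y \<in> U" "e \<in> {..<rank T} \<rightarrow> msec (sheaf T i) U"
    and "\<forall>V. opn X V \<and> V \<subseteq> U \<longrightarrow> free_module (sect X V) (msect (sheaf T i) V) (rank T) (\<lambda>j. mres (sheaf T i) U V (e j))"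
    using local_basis[OF lf yX] .
  note e = this(4)[rule_format, OF conjI]
  show ?thesis
    by (rule exI, rule module_presheaf.mstalk_basis[OF S A.is_cring U]) (rule free_module.basis[OF e])
qed

lemma stalk_period_subset:
  assumes u: "u \<in> carrier (stalk_at i)"
  shows "\<exists>(N :: nat) g t. (\<forall>j<N. g j \<in> D n \<and> t j \<in> carrier (stalk_at (i + int l))) \<and>
    iter_map p i l u = (\<Oplus>\<^bsub>stalk_at (i + int l)\<^esub>j\<in>{..<N}. g j \<odot>\<^bsub>stalk_at (i + int l)\<^esub> t j)"
proof -
  let ?i = "i + int l"
  interpret Fl: module_presheaf X "sheaf T ?i" by (rule S)
  obtain U s where U: "opn X U" "y \<in> U" and s: "s \<in> msec (sheaf T i) U" "u = mg i U s"
    using module_presheaf.mstalk_cases[OF S u] .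
  let ?s = "Pi_iter T i l U s"
  have sc: "?s \<in> msec (sheaf T ?i) U" by (rule Pi_iter_closed[OF U(1) s(1)])
  have "?s \<in> Pi_iter T i l U ` msec (sheaf T i) U" by (rule imageI[OF s(1)])
  then have "\<forall>x\<in>U. \<exists>W. opn X W \<and> x \<in> W \<and> W \<subseteq> U \<and>
     (\<exists>(N :: nat) a t. a \<in> {..<N} \<rightarrow> OM n W \<and> t \<in> {..<N} \<rightarrow> msec (sheaf T ?i) W \<and>
        mres (sheaf T ?i) U W ?s = (\<Oplus>\<^bsub>msect (sheaf T ?i) W\<^esub>j\<in>{..<N}. a j \<odot>\<^bsub>msect (sheaf T ?i) W\<^esub> t j))"
    unfolding period[OF U(1)] ideal_times_def by (rule CollectE) (erule conjunct2)
  from bspec[OF this U(2)] obtain W N a t where W: "opn X W" "y \<in> W" "W \<subseteq> U" and a: "a \<in> {..<(N::nat)} \<rightarrow> OM n W"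
    and t: "t \<in> {..<N} \<rightarrow> msec (sheaf T ?i) W"
    and eq: "mres (sheaf T ?i) U W ?s = (\<Oplus>\<^bsub>msect (sheaf T ?i) W\<^esub>j\<in>{..<N}. a j \<odot>\<^bsub>msect (sheaf T ?i) W\<^esub> t j)"
    by (elim exE conjE)
  have aO: "a j \<in> OM n W" "t j \<in> msec (sheaf T ?i) W" if "j < N" for j using a t that by auto
  have "iter_map p i l u = mg ?i U ?s" unfolding s(2) by (rule Pi_iter_germ[OF U s(1)])
  also have "\<dots> = mg ?i W (mres (sheaf T ?i) U W ?s)" by (rule Fl.mgerm_res[OF U(1) sc W, symmetric])
  also have "\<dots> = (\<Oplus>\<^bsub>stalk_at ?i\<^esub>j\<in>{..<N}. rgerm X y W (a j) \<odot>\<^bsub>stalk_at ?i\<^esub> mg ?i W (t j))"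
    unfolding eq by (rule Fl.mgerm_finsum[OF A.is_cring W(1,2)]) (use aO OM_closed in blast)+
  finally show ?thesis
    using OM_germ[OF W(1,2) aO(1)] Fl.mgerm_closed[OF W(1,2) aO(2)]
    by (intro exI[of _ N] exI[of _ "\<lambda>j. rgerm X y W (a j)"] exI[of _ "\<lambda>j. mg ?i W (t j)"]) simp
qed

text \<open>The elements \<open>g\<close> for which \<open>g v\<close> is in the image form an ideal, so that it suffices to treat germs of
  pulled back sections of \<open>\<O>(-n\<cdot>\<infinity>)\<close>.\<close>

lemma stalk_period_superset:
  assumes g: "g \<in> D n" and v: "v \<in> carrier (stalk_at (i + int l))"
  shows "\<exists>u\<in>carrier (stalk_at i). iter_map p i l u = g \<odot>\<^bsub>stalk_at (i + int l)\<^esub> v"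
proof -
  let ?i = "i + int l"
  let ?J = "{g \<in> carrier A. \<exists>u\<in>carrier (stalk_at i). iter_map p i l u = g \<odot>\<^bsub>stalk_at ?i\<^esub> v}"
  interpret Fl: module_presheaf X "sheaf T ?i" by (rule S)
  interpret M: module A "stalk_at i" by (rule sys.module)
  interpret Ml: module A "stalk_at ?i" by (rule sys.module)
  have J: "ideal ?J A"
  proof (rule A.idealI_cring)
    show "\<zero>\<^bsub>A\<^esub> \<in> ?J"
      using sys.iter_smult[OF A.zero_closed M.M.zero_closed, of l] sys.iter_closed[OF M.M.zero_closed, of l] v by (auto intro!: bexI[of _ "\<zero>\<^bsub>stalk_at i\<^esub>"])
  next
    fix a b assume "a \<in> ?J" "b \<in> ?J"
    then obtain u u' where a: "a \<in> carrier A" "b \<in> carrier A" and u: "u \<in> carrier (stalk_at i)" "u' \<in> carrier (stalk_at i)"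
      and e: "iter_map p i l u = a \<odot>\<^bsub>stalk_at ?i\<^esub> v" "iter_map p i l u' = b \<odot>\<^bsub>stalk_at ?i\<^esub> v" by (elim CollectE conjE bexE)
    have "iter_map p i l (u \<oplus>\<^bsub>stalk_at i\<^esub> u') = (a \<oplus>\<^bsub>A\<^esub> b) \<odot>\<^bsub>stalk_at ?i\<^esub> v"
      unfolding sys.iter_add[OF u] e by (rule Ml.smult_l_distr[OF a v, symmetric])
    then show "a \<oplus>\<^bsub>A\<^esub> b \<in> ?J" using a u by (auto intro!: bexI[of _ "u \<oplus>\<^bsub>stalk_at i\<^esub> u'"])
  next
    fix a b assume "a \<in> ?J" and b: "b \<in> carrier A"
    then obtain u where a: "a \<in> carrier A" and u: "u \<in> carrier (stalk_at i)"
      and e: "iter_map p i l u = a \<odot>\<^bsub>stalk_at ?i\<^esub> v" by (elim CollectE conjE bexE)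
    have "iter_map p i l (b \<odot>\<^bsub>stalk_at i\<^esub> u) = (b \<otimes>\<^bsub>A\<^esub> a) \<odot>\<^bsub>stalk_at ?i\<^esub> v"
      unfolding sys.iter_smult[OF b u] e by (rule Ml.smult_assoc1[OF b a v, symmetric])
    then show "b \<otimes>\<^bsub>A\<^esub> a \<in> ?J" using a b u by (auto intro!: bexI[of _ "b \<odot>\<^bsub>stalk_at i\<^esub> u"])
  qed auto
  have "pr_germs (kpow n) \<subseteq> ?J"
  proof
    fix h assume "h \<in> pr_germs (kpow n)"
    then obtain V b where V: "opn C V" "xi \<in> V" and b: "b \<in> kpow n V" and h: "h = pr V b"
      unfolding pr_germs_def by (elim CollectE exE conjE)
    note bc = kpow_sec[OF V(1) b]
    obtain U s where U: "opn X U" "y \<in> U" and s: "s \<in> msec (sheaf T ?i) U" "v = mg ?i U s" using Fl.mstalk_cases[OF v] .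
    let ?W = "cover V \<inter> U"
    note oV = preimage_open[OF V(1)]
    have W: "opn X ?W" "y \<in> ?W" "?W \<subseteq> cover V" "?W \<subseteq> U" using oV y_pi[OF V(2)] U by auto
    interpret W: module "sect X ?W" "msect (sheaf T ?i) ?W" by (rule Fl.msect_module[OF W(1)])
    let ?a = "res X (cover V) ?W (pb V b)" and ?t = "mres (sheaf T ?i) U ?W s"
    have aO: "?a \<in> OM n ?W" by (rule OM_up[OF V(1) b W(1,3)])
    have ac: "?a \<in> sec X ?W" by (rule OM_closed[OF aO])
    have tc: "?t \<in> msec (sheaf T ?i) ?W" by (rule Fl.mres_closed[OF U(1) W(1,4) s(1)])
    let ?at = "?a \<odot>\<^bsub>msect (sheaf T ?i) ?W\<^esub> ?t"
    have atc: "?at \<in> msec (sheaf T ?i) ?W" using ac tc by simp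
    have "?at \<in> ideal_times X (sheaf T ?i) (OM n) (\<lambda>W. msec (sheaf T ?i) W) ?W"
      unfolding ideal_times_def
    proof (rule CollectI, rule conjI[OF atc], rule ballI)
      fix x assume x: "x \<in> ?W"
      have "mres (sheaf T ?i) ?W ?W ?at = (\<Oplus>\<^bsub>msect (sheaf T ?i) ?W\<^esub>j\<in>{..<1::nat}. ?at)"
        using Fl.mres_id[OF W(1) atc] atc by (simp add: lessThan_Suc)
      then show "\<exists>Z. opn X Z \<and> x \<in> Z \<and> Z \<subseteq> ?W \<and>
         (\<exists>(N :: nat) a t. a \<in> {..<N} \<rightarrow> OM n Z \<and> t \<in> {..<N} \<rightarrow> msec (sheaf T ?i) Z \<and>
            mres (sheaf T ?i) ?W Z ?at = (\<Oplus>\<^bsub>msect (sheaf T ?i) Z\<^esub>j\<in>{..<N}. a j \<odot>\<^bsub>msect (sheaf T ?i) Z\<^esub> t j))"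
        by (intro exI[of _ ?W] conjI W(1) x subset_refl exI[of _ "1::nat"] exI[of _ "\<lambda>_. ?a"] exI[of _ "\<lambda>_. ?t"]) (use aO tc in auto)
    qed
    then obtain s' where s': "s' \<in> msec (sheaf T i) ?W" "?at = Pi_iter T i l ?W s'"
      unfolding period[OF W(1), symmetric] by (elim imageE)
    have "iter_map p i l (mg i ?W s') = mg ?i ?W ?at" unfolding s'(2) by (rule Pi_iter_germ[OF W(1,2) s'(1)])
    also have "\<dots> = rgerm X y ?W ?a \<odot>\<^bsub>stalk_at ?i\<^esub> mg ?i ?W ?t" by (rule Fl.mgerm_smult[OF W(1,2) ac tc, symmetric])
    also have "\<dots> = h \<odot>\<^bsub>stalk_at ?i\<^esub> v"
      unfolding X.rgerm_res[OF oV up_closed[OF V(1) bc] W(1,2,3)] Fl.mgerm_res[OF U(1) s(1) W(1,2,4)] h pr_def s(2) ..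
    finally have "iter_map p i l (mg i ?W s') = h \<odot>\<^bsub>stalk_at ?i\<^esub> v" .
    moreover have "h \<in> carrier A" unfolding h by (rule pr_closed[OF V bc])
    moreover have "mg i ?W s' \<in> carrier (stalk_at i)" by (rule module_presheaf.mgerm_closed[OF S W(1,2) s'(1)])
    ultimately show "h \<in> ?J" by blast
  qed
  then have "D n \<subseteq> ?J" unfolding D_def stalk_ideal_def by (rule A.genideal_minimal[OF J])
  then show ?thesis using g by blast
qed

sublocale sys: periodic_system A stalk_at p D "rank T" n l
proof (intro periodic_system.intro periodic_system_axioms.intro sys.linear_system_axioms)
  show "maximalideal (nonunits A) A" by (rule stalk_local)
  show "ideal (D n) A" by (rule D_ideal)
  show "\<exists>e. is_basis A (stalk_at i) (rank T) e" for i by (rule stalk_basis)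
  show "0 < n" "0 < l" by (rule n l)+
qed (use stalk_period_subset stalk_period_superset in blast)+

end

text \<open>Equality of the slopes follows, since a homomorphism between systems of different slopes
  vanishes on the stalks over \<open>\<infinity>\<close>, hence everywhere.\<close>

lemma (in germs_at_infinity) nonzero_hom_slope:
  assumes F: "periodic_sheaf k C \<gamma> L \<iota> pinf P F n l" and F': "periodic_sheaf k C \<gamma> L \<iota> pinf P F' n' l'"
    and f: "f \<in> tau_Hom X \<sigma> F F'" and U: "opn X U" and s: "s \<in> msec (sheaf F i) U"
    and nz: "f i U s \<noteq> \<zero>\<^bsub>msect (sheaf F' i) U\<^esub>"
  shows "0 < rank F" "0 < rank F'" "n * l' = n' * l" "s \<noteq> \<zero>\<^bsub>msect (sheaf F i) U\<^esub>"
proof -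
  interpret F: periodic_sheaf k C \<gamma> L \<iota> pinf P F n l by (rule F)
  interpret F': periodic_sheaf k C \<gamma> L \<iota> pinf P F' n' l' by (rule F')
  have hom: "sheaf_hom X (sheaf F i) (sheaf F' i) (f i)" for i using f by (simp add: tau_Hom_def)
  have comm: "f (i + 1) V (Pi_map F i V t) = Pi_map F' i V (f i V t)"
    if "opn X V" "t \<in> msec (sheaf F i) V" for i V t using f that by (simp add: tau_Hom_def)
  have h: "module_hom_presheaf X (sheaf F i) (sheaf F' i) (f i)" for i
    by (intro module_hom_presheaf.intro module_hom_presheaf_axioms.intro F.S F'.S hom)
  interpret fi: module_hom_presheaf X "sheaf F i" "sheaf F' i" "f i" by (rule h)
  interpret GU: module "sect X U" "msect (sheaf F i) U" by (rule fi.F.msect_module[OF U])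
  interpret HU: module "sect X U" "msect (sheaf F' i) U" by (rule fi.G.msect_module[OF U])
  have f0: "f i U \<zero>\<^bsub>msect (sheaf F i) U\<^esub> = \<zero>\<^bsub>msect (sheaf F' i) U\<^esub>"
    using fi.hom_smult[OF U GU.R.zero_closed GU.M.zero_closed] fi.hom_closed[OF U GU.M.zero_closed] by simp
  show s0: "s \<noteq> \<zero>\<^bsub>msect (sheaf F i) U\<^esub>" using nz f0 by metis
  show r: "0 < rank F"
  proof (rule ccontr)
    assume "\<not> 0 < rank F"
    then have "locally_free X (sheaf F i) 0" using F.lf[of i] by simp
    from rank_zero_sections[OF this U s] show False using s0 by simp
  qed
  show "0 < rank F'"
  proof (rule ccontr)
    assume "\<not> 0 < rank F'"
    then have "locally_free X (sheaf F' i) 0" using F'.lf[of i] by simp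
    from rank_zero_sections[OF this U fi.hom_closed[OF U s]] show False using nz by simp
  qed
  show "n * l' = n' * l"
  proof (rule ccontr)
    assume slope: "n * l' \<noteq> n' * l"
    let ?f = "\<lambda>i. mstalk_map X (sheaf F' i) (f i) y"
    have "?f i u = \<zero>\<^bsub>F'.stalk_at i\<^esub>" if u: "u \<in> carrier (F.stalk_at i)" for u
    proof (rule periodic_system_slope[OF F.sys.periodic_system_axioms F'.sys.periodic_system_axioms stalk_noetherian _ _ _ _ r slope u])
      show "\<exists>w\<in>nonunits A. \<forall>q. D q = PIdl\<^bsub>A\<^esub> (w [^]\<^bsub>A\<^esub> q)" if "m \<in> carrier A" "m \<noteq> \<zero>\<^bsub>A\<^esub>" "D n = PIdl\<^bsub>A\<^esub> m" for m
        by (rule D_principal[OF F.n that(3,1,2)])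
      show "?f i u \<in> carrier (F'.stalk_at i)" if "u \<in> carrier (F.stalk_at i)" for i u
        by (rule module_hom_presheaf.mstalk_map_closed[OF h that])
      show "?f i (a \<odot>\<^bsub>F.stalk_at i\<^esub> u) = a \<odot>\<^bsub>F'.stalk_at i\<^esub> ?f i u" if "a \<in> carrier A" "u \<in> carrier (F.stalk_at i)" for i a u
        by (rule module_hom_presheaf.mstalk_map_smult[OF h that])
      show "?f (i + 1) (F.p i u) = F'.p i (?f i u)" if u: "u \<in> carrier (F.stalk_at i)" for i u
      proof -
        obtain V t where V: "opn X V" "y \<in> V" and t: "t \<in> msec (sheaf F i) V" "u = F.mg i V t"
          using module_presheaf.mstalk_cases[OF F.S u] .
        show ?thesis
          unfolding t(2) module_hom_presheaf.mstalk_map_germ[OF F.Pi_presheaf V t(1)] module_hom_presheaf.mstalk_map_germ[OF h V t(1)]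
            module_hom_presheaf.mstalk_map_germ[OF h V module_hom_presheaf.hom_closed[OF F.Pi_presheaf V(1) t(1)]]
            module_hom_presheaf.mstalk_map_germ[OF F'.Pi_presheaf V module_hom_presheaf.hom_closed[OF h V(1) t(1)]] comm[OF V(1) t(1)] ..
      qed
    qed
    then have "f i U s = \<zero>\<^bsub>msect (sheaf F' i) U\<^esub>"
      by (intro hom_zero_everywhere[OF F.lf F'.lf hom F.yX _ U s])
    then show False using nz by simp
  qed
qed

section \<open>The Frobenius of the ground field\<close>

lemma (in cring) binomial_theorem:
  assumes xy: "x \<in> carrier R" "y \<in> carrier R"
  shows "(x \<oplus> y) [^] n = (\<Oplus>j\<in>{..n}. [(n choose j)] \<cdot> (x [^] j \<otimes> y [^] (n - j)))"
proof (induction n)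
  case 0
  show ?case using xy by simp
next
  case (Suc n)
  let ?t = "\<lambda>j. x [^] j \<otimes> y [^] (n - j)" and ?u = "\<lambda>j. x [^] Suc j \<otimes> y [^] (n - j)"
    and ?g = "\<lambda>j. [(n choose j)] \<cdot> (x [^] j \<otimes> y [^] (Suc n - j))"
  have c: "?t j \<in> carrier R" "?u j \<in> carrier R" "x [^] j \<otimes> y [^] (Suc n - j) \<in> carrier R" for j using xy by auto
  let ?T = "\<Oplus>j\<in>{..n}. [(n choose j)] \<cdot> ?t j"
  have Tc: "?T \<in> carrier R" by (rule finsum_closed) (use c in auto)
  have xT: "x \<otimes> ?T = (\<Oplus>j\<in>{..n}. [(n choose j)] \<cdot> ?u j)"
  proof -
    have "x \<otimes> ?T = (\<Oplus>j\<in>{..n}. x \<otimes> [(n choose j)] \<cdot> ?t j)" by (rule finsum_rdistr) (use xy c in auto)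
    also have "\<dots> = (\<Oplus>j\<in>{..n}. [(n choose j)] \<cdot> ?u j)"
      by (rule finsum_cong') (use xy c in \<open>auto simp: add_pow_rdistr m_ac\<close>)
    finally show ?thesis .
  qed
  have gc: "?g j \<in> carrier R" and uc: "[(n choose j)] \<cdot> ?u j \<in> carrier R" for j using c by simp_all
  have yT: "y \<otimes> ?T = (\<Oplus>j\<in>{..Suc n}. ?g j)"
  proof -
    have "y \<otimes> ?T = (\<Oplus>j\<in>{..n}. y \<otimes> [(n choose j)] \<cdot> ?t j)" by (rule finsum_rdistr) (use xy c in auto)
    also have "\<dots> = (\<Oplus>j\<in>{..n}. ?g j)"
      by (rule finsum_cong') (use xy c in \<open>auto simp: add_pow_rdistr m_ac Suc_diff_le\<close>)
    finally have e: "y \<otimes> ?T = (\<Oplus>j\<in>{..n}. ?g j)" .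
    have "(\<Oplus>j\<in>{..Suc n}. ?g j) = ?g (Suc n) \<oplus> (\<Oplus>j\<in>{..n}. ?g j)" by (rule add.finprod_Suc) (use gc in blast)
    moreover have "?g (Suc n) = \<zero>" by (simp add: binomial_eq_0)
    moreover have "(\<Oplus>j\<in>{..n}. ?g j) \<in> carrier R" by (rule finsum_closed) (use gc in blast)
    ultimately show ?thesis unfolding e by simp
  qed
  let ?F = "\<lambda>j. [(Suc n choose j)] \<cdot> (x [^] j \<otimes> y [^] (Suc n - j))"
  have F: "?F j \<in> carrier R" for j using xy by simp
  have "(x \<oplus> y) [^] Suc n = ?T \<otimes> (x \<oplus> y)" using Suc by simp
  also have "\<dots> = x \<otimes> ?T \<oplus> y \<otimes> ?T" unfolding r_distr[OF xy Tc] m_comm[OF Tc xy(1)] m_comm[OF Tc xy(2)] ..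
  also have "y \<otimes> ?T = (\<Oplus>j\<in>{..n}. ?g (Suc j)) \<oplus> ?g 0" unfolding yT by (rule add.finprod_Suc2) (use gc in blast)
  also have "x \<otimes> ?T \<oplus> ((\<Oplus>j\<in>{..n}. ?g (Suc j)) \<oplus> ?g 0) = (x \<otimes> ?T \<oplus> (\<Oplus>j\<in>{..n}. ?g (Suc j))) \<oplus> ?g 0"
    by (rule a_assoc[symmetric, OF m_closed[OF xy(1) Tc] finsum_closed gc]) (use gc in blast)
  also have "x \<otimes> ?T \<oplus> (\<Oplus>j\<in>{..n}. ?g (Suc j)) = (\<Oplus>j\<in>{..n}. [(n choose j)] \<cdot> ?u j \<oplus> ?g (Suc j))"
    unfolding xT by (rule finsum_addf[symmetric]) (use uc gc in blast)+
  also have "\<dots> = (\<Oplus>j\<in>{..n}. ?F (Suc j))"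
    by (rule finsum_cong') (use c F in \<open>auto simp: add.nat_pow_mult\<close>)
  also have "?g 0 = ?F 0" by simp
  also have "(\<Oplus>j\<in>{..n}. ?F (Suc j)) \<oplus> ?F 0 = (\<Oplus>j\<in>{..Suc n}. ?F j)" by (rule add.finprod_Suc2[symmetric]) (use F in blast)
  finally show ?case .
qed

lemma (in cring) multiple_zero:
  assumes r: "[(r :: nat)] \<cdot> \<one> = \<zero>" and d: "r dvd c" and z: "z \<in> carrier R"
  shows "[c] \<cdot> z = \<zero>"
proof -
  have rz: "[r] \<cdot> z = \<zero>" using add_pow_ldistr[of \<one> z r] r z by simp
  obtain e where "c = r * e" using d by (elim dvdE)
  then show ?thesis using add.nat_pow_pow[OF z, of e r] rz by simp
qed

lemma (in cring) prime_power_additive: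
  assumes r: "prime (r :: nat)" "[r] \<cdot> \<one> = \<zero>" and xy: "x \<in> carrier R" "y \<in> carrier R"
  shows "(x \<oplus> y) [^] r = x [^] r \<oplus> y [^] r"
proof -
  obtain m where m: "r = Suc (Suc m)" using le_Suc_ex[OF prime_ge_2_nat[OF r(1)]] by auto
  let ?f = "\<lambda>j. [(r choose j)] \<cdot> (x [^] j \<otimes> y [^] (r - j))"
  have c: "?f j \<in> carrier R" for j using xy by simp
  have mid: "?f (Suc j) = \<zero>" if "j \<le> m" for j
    by (rule multiple_zero[OF r(2) dvd_choose_prime[OF _ _ _ r(1)]]) (use that m xy in auto)
  have "(x \<oplus> y) [^] r = (\<Oplus>j\<in>{..Suc (Suc m)}. ?f j)" using binomial_theorem[OF xy, of r] m by simp
  also have "\<dots> = ?f (Suc (Suc m)) \<oplus> (\<Oplus>j\<in>{..Suc m}. ?f j)" by (rule add.finprod_Suc) (use c in auto)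
  also have "(\<Oplus>j\<in>{..Suc m}. ?f j) = (\<Oplus>j\<in>{..m}. ?f (Suc j)) \<oplus> ?f 0" by (rule add.finprod_Suc2) (use c in auto)
  also have "(\<Oplus>j\<in>{..m}. ?f (Suc j)) = (\<Oplus>j\<in>{..m}. \<zero>)" by (rule finsum_cong') (use mid in auto)
  finally have "(x \<oplus> y) [^] r = ?f (Suc (Suc m)) \<oplus> ((\<Oplus>j\<in>{..m}. \<zero>) \<oplus> ?f 0)" .
  moreover have "?f (Suc (Suc m)) = x [^] r" "?f 0 = y [^] r" using xy m by simp_all
  ultimately show ?thesis using xy by simp
qed

text \<open>By Sylow's theorem the additive group of a finite field has elements of order \<open>r\<close> for every
  prime divisor \<open>r\<close> of the number of elements.\<close>

lemma (in field) prime_divisor_zero: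
  assumes fin: "finite (carrier R)" and r: "prime (r :: nat)" "r dvd card (carrier R)"
  shows "[r] \<cdot> \<one> = \<zero>"
proof -
  obtain m where m: "card (carrier R) = r * m" using r(2) by (elim dvdE)
  obtain H where H: "subgroup H (add_monoid R)" "card H = r ^ 1"
    using sylow_thm[OF r(1) add.is_group, of 1 m] m fin by (auto simp: order_def)
  have "\<not> H \<subseteq> {\<zero>}" using H(2) prime_ge_2_nat[OF r(1)] card_mono[of "{\<zero>}" H] by auto
  then obtain h where h: "h \<in> H" "h \<noteq> \<zero>" by auto
  have hc: "h \<in> carrier R" using subgroup.subset[OF H(1)] h(1) by auto
  interpret H: group "(add_monoid R)\<lparr>carrier := H\<rparr>" by (rule subgroup.subgroup_is_group[OF H(1) add.is_group])
  have "h [^]\<^bsub>(add_monoid R)\<lparr>carrier := H\<rparr>\<^esub> r = \<zero>" using H.pow_order_eq_1[of h] h(1) H(2) by (simp add: order_def)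
  then have "[r] \<cdot> h = \<zero>" by (simp add: add_pow_def nat_pow_def)
  then have "([r] \<cdot> \<one>) \<otimes> h = \<zero>" using add_pow_ldistr[of \<one> h r] hc by simp
  then show ?thesis using integral[of "[r] \<cdot> \<one>" h] h(2) hc by simp
qed

lemma (in field) finite_field_power:
  assumes fin: "finite (carrier R)" and c: "c \<in> carrier R"
  shows "c [^] card (carrier R) = c"
proof -
  have pos: "0 < card (carrier R)" using fin c by (auto simp: card_gt_0_iff)
  show ?thesis
  proof (cases "c = \<zero>")
    case True
    show ?thesis unfolding True by (rule nat_pow_zero) (use pos in simp)
  next
    case False
    interpret U: group "units_of R" by (rule units_group)
    have u: "c \<in> Units R" using field_Units c False by simp
    have "order (units_of R) = card (carrier R) - 1"
      using fin by (simp add: order_def units_of_carrier field_Units card_Diff_singleton)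
    then have "c [^] (card (carrier R) - 1) = \<one>"
      using U.pow_order_eq_1[of c] u units_of_pow[OF u] by (simp add: units_of_carrier units_of_one)
    then have "c [^] Suc (card (carrier R) - 1) = c" using c by simp
    then show ?thesis using pos by simp
  qed
qed

context base_change_setup
begin

abbreviation "q \<equiv> card (carrier k)"

lemma iota_multiple: "\<iota> ([(n::nat)] \<cdot>\<^bsub>k\<^esub> \<one>\<^bsub>k\<^esub>) = [n] \<cdot>\<^bsub>L\<^esub> \<one>\<^bsub>L\<^esub>"
  using ring_hom_add[OF iota] ring_hom_one[OF iota] ring_hom_zero[OF iota K.ring_axioms L.ring_axioms]
  by (induction n) (simp_all add: K.add.nat_pow_Suc L.add.nat_pow_Suc)

text \<open>Every divisor \<open>d\<close> of \<open>q\<close> is a product of primes \<open>r\<close> that are zero in \<open>L\<close>, and the \<open>d\<close>-th power map is the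
  composition of the corresponding \<open>r\<close>-th power maps.\<close>

lemma power_dvd_additive:
  assumes "d dvd q" "x \<in> carrier L" "y \<in> carrier L"
  shows "(x \<oplus>\<^bsub>L\<^esub> y) [^]\<^bsub>L\<^esub> d = x [^]\<^bsub>L\<^esub> d \<oplus>\<^bsub>L\<^esub> y [^]\<^bsub>L\<^esub> d"
  using assms
proof (induction d arbitrary: x y rule: less_induct)
  case (less d)
  have qpos: "0 < q" using fin K.zero_closed by (auto simp: card_gt_0_iff)
  show ?case
  proof (cases "d = 1")
    case True then show ?thesis using less by simp
  next
    case False
    then obtain r where r: "prime r" "r dvd d" using prime_factor_nat by blast
    then obtain e where e: "d = r * e" by (elim dvdE)
    have d0: "0 < d" using less(2) qpos by (rule dvd_pos_nat[rotated])
    have ed: "e < d" using n_less_m_mult_n[of e r] e d0 prime_ge_2_nat[OF r(1)] by simp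
    have eq: "e dvd q" by (rule dvd_trans[OF _ less(2)]) (simp add: e)
    have "[r] \<cdot>\<^bsub>k\<^esub> \<one>\<^bsub>k\<^esub> = \<zero>\<^bsub>k\<^esub>" by (rule K.prime_divisor_zero[OF fin r(1) dvd_trans[OF r(2) less(2)]])
    then have r0: "[r] \<cdot>\<^bsub>L\<^esub> \<one>\<^bsub>L\<^esub> = \<zero>\<^bsub>L\<^esub>"
      using iota_multiple[of r] ring_hom_zero[OF iota K.ring_axioms L.ring_axioms] by simp
    have "(x \<oplus>\<^bsub>L\<^esub> y) [^]\<^bsub>L\<^esub> d = (x [^]\<^bsub>L\<^esub> r \<oplus>\<^bsub>L\<^esub> y [^]\<^bsub>L\<^esub> r) [^]\<^bsub>L\<^esub> e"
      using L.prime_power_additive[OF r(1) r0 less(3,4)] L.nat_pow_pow[of "x \<oplus>\<^bsub>L\<^esub> y" r e] less(3,4) e by simp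
    also have "\<dots> = (x [^]\<^bsub>L\<^esub> r) [^]\<^bsub>L\<^esub> e \<oplus>\<^bsub>L\<^esub> (y [^]\<^bsub>L\<^esub> r) [^]\<^bsub>L\<^esub> e"
      by (rule less(1)[OF ed eq]) (use less(3,4) in auto)
    finally show ?thesis using L.nat_pow_pow less(3,4) e by simp
  qed
qed

lemma frobenius_iota: "c \<in> carrier k \<Longrightarrow> \<iota> c [^]\<^bsub>L\<^esub> q = \<iota> c"
proof -
  assume c: "c \<in> carrier k"
  have "\<iota> (c [^]\<^bsub>k\<^esub> n) = \<iota> c [^]\<^bsub>L\<^esub> n" for n :: nat
    using c ring_hom_mult[OF iota] ring_hom_one[OF iota] by (induction n) simp_all
  then show ?thesis using K.finite_field_power[OF fin c] by metis
qed

subsection \<open>Frobenius on the fibres\<close>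

text \<open>The Frobenius of \<open>L\<close> on representatives of elements of \<open>O \<otimes> L\<close>.\<close>

definition fr :: "('b \<times> 'l \<Rightarrow>\<^sub>0 int) \<Rightarrow> ('b \<times> 'l \<Rightarrow>\<^sub>0 int)" where
  "fr c = frag_extend (\<lambda>(a, e). frag_of (a, e [^]\<^bsub>L\<^esub> q)) c"

lemma fr_of [simp]: "fr (frag_of (a, e)) = frag_of (a, e [^]\<^bsub>L\<^esub> q)"
  by (simp add: fr_def)

lemma fr_zero [simp]: "fr 0 = 0"
  by (simp add: fr_def)

lemma fr_diff: "fr (c - d) = fr c - fr d"
  by (simp add: fr_def frag_extend_diff)

lemma fr_add: "fr (c + d) = fr c + fr d"
  by (simp add: fr_def frag_extend_add)

lemma keys_fr: "Poly_Mapping.keys c \<subseteq> S \<times> carrier L \<Longrightarrow> Poly_Mapping.keys (fr c) \<subseteq> S \<times> carrier L"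
proof (induction c rule: frag_induction)
  case (one x)
  then show ?case by (cases x) auto
next
  case (diff a b)
  then show ?case unfolding fr_diff by (rule keys_diff_subset)
qed simp

lemma fr_pair_map: "fr (pair_map g c) = pair_map g (fr c)"
proof -
  have "Poly_Mapping.keys c \<subseteq> UNIV" by simp
  then show ?thesis
  proof (induction c rule: frag_induction)
    case (one x)
    then show ?case by (cases x) simp
  next
    case (diff a b)
    then show ?case by (simp add: fr_diff pair_map_diff)
  qed simp
qed

lemma fr_mult:
  assumes x: "x \<in> pts C" and c: "ochains x c" and d: "ochains x d"
  shows "fr (pair_mult (OC x) L c d) = pair_mult (OC x) L (fr c) (fr d)"
proof -
  interpret x: two_algebras "OC x" L k "kO x" \<iota> using fiber[OF x] .
  show ?thesis using c
  proof (induction c rule: x.pair_induct)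
    case (one a b)
    show ?case using d
    proof (induction d rule: x.pair_induct)
      case (one a' b')
      then show ?case using \<open>b \<in> carrier L\<close> by (simp add: pair_mult_of L.nat_pow_distrib)
    qed (simp_all add: fr_diff pair_mult_diff_right)
  qed (simp_all add: fr_diff pair_mult_diff_left)
qed

lemma fr_tensor_ideal:
  assumes x: "x \<in> pts C" and c: "c \<in> tensor_ideal k (OC x) (kO x) L \<iota>"
  shows "fr c \<in> tensor_ideal k (OC x) (kO x) L \<iota>"
proof -
  interpret x: two_algebras "OC x" L k "kO x" \<iota> using fiber[OF x] .
  interpret T: ideal x.T "pair_ring (OC x) L" by (rule x.T_ideal)
  let ?J = "{c. ochains x c \<and> fr c \<in> x.T}"
  have "x.T \<subseteq> ?J"
  proof (rule x.T_minimal)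
    show "ideal ?J (pair_ring (OC x) L)"
    proof (rule x.pair_idealI)
      show "0 \<in> ?J" using T.zero_closed by simp
      show "c - d \<in> ?J" if "c \<in> ?J" "d \<in> ?J" for c d
        using x.pair.ideal_diff[OF x.T_ideal, of "fr c" "fr d"] that keys_fr[of d "carrier (OC x)"] by (simp add: fr_diff keys_diff_subset)
      show "pair_mult (OC x) L (frag_of (a, b)) c \<in> ?J" if *: "a \<in> carrier (OC x)" "b \<in> carrier L" "c \<in> ?J" for a b c
      proof -
        have ab: "ochains x (frag_of (a, b))" "ochains x (frag_of (a, b [^]\<^bsub>L\<^esub> q))" using * by simp_all
        have "pair_mult (OC x) L (frag_of (a, b [^]\<^bsub>L\<^esub> q)) (fr c) \<in> x.T"
          using T.I_l_closed[of "fr c" "frag_of (a, b [^]\<^bsub>L\<^esub> q)"] * ab(2) by simp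
        then show ?thesis using fr_mult[OF x ab(1), of c] x.pair_mult_closed[OF ab(1), of c] * by simp
      qed
    qed simp
    have 1: "frag_of (a \<oplus>\<^bsub>OC x\<^esub> a', b) - frag_of (a, b) - frag_of (a', b) \<in> ?J"
      if "a \<in> carrier (OC x)" "a' \<in> carrier (OC x)" "b \<in> carrier L" for a a' b
      using that x.T_add_left[of a a' "b [^]\<^bsub>L\<^esub> q"] by (simp add: fr_diff keys_diff_subset)
    have 2: "frag_of (a, b \<oplus>\<^bsub>L\<^esub> b') - frag_of (a, b) - frag_of (a, b') \<in> ?J"
      if "a \<in> carrier (OC x)" "b \<in> carrier L" "b' \<in> carrier L" for a b b'
      using that x.T_add_right[of a "b [^]\<^bsub>L\<^esub> q" "b' [^]\<^bsub>L\<^esub> q"] power_dvd_additive[OF dvd_refl that(2,3)] by (simp add: fr_diff keys_diff_subset)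
    have 3: "frag_of (kO x c \<otimes>\<^bsub>OC x\<^esub> a, b) - frag_of (a, \<iota> c \<otimes>\<^bsub>L\<^esub> b) \<in> ?J"
      if "a \<in> carrier (OC x)" "b \<in> carrier L" "c \<in> carrier k" for a b c
      using that x.T_const[of a "b [^]\<^bsub>L\<^esub> q" c] kO_closed[OF x that(3)] iota_closed[OF that(3)] frobenius_iota[OF that(3)]
      by (simp add: fr_diff keys_diff_subset L.nat_pow_distrib)
    show "tensor_relations k (OC x) (kO x) L \<iota> \<subseteq> ?J" unfolding tensor_relations_def
      by (intro Un_least subsetI; elim CollectE exE conjE) (use 1 2 3 in simp_all)
  qed
  then show ?thesis using c by blast
qed

abbreviation "ff \<equiv> fib_frob k C \<gamma> L \<iota>"
abbreviation "\<sigma> \<equiv> rel_frob k C \<gamma> L \<iota>"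
abbreviation "\<sigma>p \<equiv> frob_pts k C \<gamma> L \<iota>"

lemma frob_cls:
  assumes x: "x \<in> pts C" and c: "ochains x c"
  shows "ff x (cls x c) = cls x (fr c)"
proof -
  interpret x: two_algebras "OC x" L k "kO x" \<iota> using fiber[OF x] .
  interpret T: ideal x.T "pair_ring (OC x) L" by (rule x.T_ideal)
  have cm: "d \<in> cls x c \<longleftrightarrow> (\<exists>t\<in>x.T. d = t + c)" for d
    unfolding cls_eq tensor_class_def a_r_coset_def' by simp
  have "cls x (fr d) = cls x (fr c)" if d: "d \<in> cls x c" for d
  proof -
    obtain t where t: "t \<in> x.T" "d = t + c" using d cm by blast
    have tc: "ochains x t" using T.Icarr[OF t(1)] by simp
    have dc: "ochains x d" unfolding t(2) by (rule keys_add_subset[OF tc c])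
    have "fr d - fr c \<in> x.T" using fr_tensor_ideal[OF x t(1)] t(2) by (simp add: fr_add)
    then show ?thesis using x.cl_eq_iff[OF keys_fr[OF dc] keys_fr[OF c]] unfolding cls_eq by simp
  qed
  moreover have "c \<in> cls x c" using cm T.zero_closed by (auto intro!: bexI[of _ 0])
  ultimately show ?thesis unfolding fib_frob_def fr_def[symmetric] by blast
qed

lemma frob_hom:
  assumes x: "x \<in> pts C"
  shows "ff x \<in> ring_hom (B x) (B x)"
proof (rule ring_hom_memI)
  interpret x: two_algebras "OC x" L k "kO x" \<iota> using fiber[OF x] .
  interpret O: cring "OC x" by (rule O_cring[OF x])
  note kf = keys_fr[of _ "carrier (OC x)"]
  show "ff x b \<in> carrier (B x)" if b: "b \<in> carrier (B x)" for b
  proof -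
    obtain c where c: "ochains x c" "b = cls x c" using carrier_B[OF x b] by (elim exE conjE)
    show ?thesis unfolding c(2) frob_cls[OF x c(1)] by (rule cls_closed[OF x kf[OF c(1)]])
  qed
  fix b b' assume b: "b \<in> carrier (B x)" and b': "b' \<in> carrier (B x)"
  obtain c where c: "ochains x c" "b = cls x c" using carrier_B[OF x b] by (elim exE conjE)
  obtain d where d: "ochains x d" "b' = cls x d" using carrier_B[OF x b'] by (elim exE conjE)
  show "ff x (b \<otimes>\<^bsub>B x\<^esub> b') = ff x b \<otimes>\<^bsub>B x\<^esub> ff x b'"
    unfolding c(2) d(2) cls_mult[OF x c(1) d(1), symmetric] frob_cls[OF x x.pair_mult_closed[OF c(1) d(1)]]
      frob_cls[OF x c(1)] frob_cls[OF x d(1)] fr_mult[OF x c(1) d(1)] by (rule cls_mult[OF x kf[OF c(1)] kf[OF d(1)]])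
  have ca: "cls x (u + v) = cls x u \<oplus>\<^bsub>B x\<^esub> cls x v" if "ochains x u" "ochains x v" for u v
    using x.cl_add[OF that] unfolding cls_eq B_eq .
  show "ff x (b \<oplus>\<^bsub>B x\<^esub> b') = ff x b \<oplus>\<^bsub>B x\<^esub> ff x b'"
    unfolding c(2) d(2) ca[OF c(1) d(1), symmetric] frob_cls[OF x keys_add_subset[OF c(1) d(1)]]
      frob_cls[OF x c(1)] frob_cls[OF x d(1)] fr_add by (rule ca[OF kf[OF c(1)] kf[OF d(1)]])
next
  interpret O: cring "OC x" by (rule O_cring[OF x])
  show "ff x \<one>\<^bsub>B x\<^esub> = \<one>\<^bsub>B x\<^esub>"
    using frob_cls[OF x, of "emb L (\<one>\<^bsub>OC x\<^esub>)"] cls_one[OF x] by simp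
qed

lemma frob_pts_point:
  assumes p: "(x, P) \<in> points"
  shows "\<sigma>p (x, P) = (x, {z \<in> carrier (B x). ff x z \<in> P})" "(x, {z \<in> carrier (B x). ff x z \<in> P}) \<in> points"
proof -
  show "\<sigma>p (x, P) = (x, {z \<in> carrier (B x). ff x z \<in> P})" by (simp add: frob_pts_def)
  let ?Q = "{z \<in> carrier (B x). ff x z \<in> P}"
  note x = pointD(1)[OF p]
  interpret P: primeideal P "B x" by (rule pointD(2)[OF p])
  interpret O: cring "OC x" by (rule O_cring[OF x])
  note h = frob_hom[OF x]
  note hc = ring_hom_closed[OF h]
  have i: "ideal ?Q (B x)"
    by (rule P.idealI_cring)
      (use hc ring_hom_add[OF h] ring_hom_mult[OF h] ring_hom_zero[OF h P.ring_axioms P.ring_axioms] P.ideal_add[OF P.is_ideal] P.I_l_closed P.zero_closed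
        in \<open>auto simp: additive_subgroup.zero_closed[OF P.additive_subgroup_axioms]\<close>)
  have "primeideal ?Q (B x)"
  proof (rule primeidealI[OF i P.is_cring])
    have "\<one>\<^bsub>B x\<^esub> \<notin> ?Q" using ring_hom_one[OF h] one_notin[OF p] by simp
    then show "carrier (B x) \<noteq> ?Q" using P.one_closed by metis
    fix a b assume "a \<in> carrier (B x)" "b \<in> carrier (B x)" "a \<otimes>\<^bsub>B x\<^esub> b \<in> ?Q"
    then show "a \<in> ?Q \<or> b \<in> ?Q" using ring_hom_mult[OF h] P.I_prime[OF hc hc] by auto
  qed
  moreover have "{a \<in> carrier (OC x). cls x (emb L a) \<in> ?Q} = nonunits (OC x)"
  proof -
    have "cls x (emb L a) \<in> ?Q \<longleftrightarrow> cls x (emb L a) \<in> P" if a: "a \<in> carrier (OC x)" for a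
      using frob_cls[OF x, of "emb L a"] cls_closed[OF x, of "emb L a"] a by simp
    then show ?thesis using pointD(3)[OF p] by (auto simp: nonunits_def)
  qed
  ultimately show "(x, ?Q) \<in> points" unfolding bc_pts_def using x by simp
qed

lemma frob_pts_closed: "p \<in> points \<Longrightarrow> \<sigma>p p \<in> points"
  using frob_pts_point by (cases p) simp

lemma frob_val: "opn C U \<Longrightarrow> x \<in> U \<Longrightarrow> schains U c \<Longrightarrow> ff x (val U c x) = val U (fr c) x"
  unfolding val_eq by (simp add: frob_cls opn_pts germs_ochains fr_pair_map)

lemma pre_sigma: "pre X \<sigma> V = {p \<in> points. \<sigma>p p \<in> V}"
  by (simp add: pre_def pts_X rel_frob_def)

lemma pre_sigma_open:
  assumes V: "opn X V"
  shows "opn X (pre X \<sigma> V)"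
proof -
  let ?S = "{{(x, P) \<in> points. x \<in> U \<and> val U c x \<notin> P} | U c. opn C U \<and> schains U c}"
  have sp: "space X = topology_generated_by ?S" by (simp add: X_eq bc_top_def)
  have "continuous_map (space X) (topology_generated_by ?S) \<sigma>p"
  proof (rule continuous_on_generated_topo)
    fix D assume "D \<in> ?S"
    then obtain U c where D: "D = {(x, P) \<in> points. x \<in> U \<and> val U c x \<notin> P}" and U: "opn C U" and c: "schains U c" by (elim CollectE exE conjE)
    have "\<sigma>p -` D \<inter> pts X = {(x, P) \<in> points. x \<in> U \<and> val U (fr c) x \<notin> P}"
    proof (rule Set.set_eqI)
      fix p :: "('p, 's, 'l) bc_point"
      obtain x P where p: "p = (x, P)" by (cases p)
      show "p \<in> \<sigma>p -` D \<inter> pts X \<longleftrightarrow> p \<in> {(x, P) \<in> points. x \<in> U \<and> val U (fr c) x \<notin> P}"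
        using frob_pts_point[of x P] frob_val[OF U _ c, of x] val_closed[OF U _ c, of x] by (auto simp: p D pts_X)
    qed
    then show "opn X (\<sigma>p -` D \<inter> pts X)" using D_open[OF U keys_fr[OF c]] by simp
  next
    have "\<Union>?S = pts X" unfolding sp topspace_generated ..
    then show "\<sigma>p ` pts X \<subseteq> \<Union>?S" using frob_pts_closed by (auto simp: pts_X)
  qed
  then have "continuous_map (space X) (space X) \<sigma>p" unfolding sp[symmetric] .
  from openin_continuous_map_preimage[OF this V] show ?thesis by (simp add: pre_sigma pts_X)
qed

subsection \<open>Frobenius on functions and germs\<close>

lemma comor_sigma_fraction:
  assumes p: "(x, P) \<in> points" and V: "\<sigma>p (x, P) \<in> V"
    and a: "a \<in> carrier (B x)" "f \<in> carrier (B x)" "f \<notin> snd (\<sigma>p (x, P))"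
    and s: "s (\<sigma>p (x, P)) = fraction (B x) (snd (\<sigma>p (x, P))) a f"
  shows "comor \<sigma> V s (x, P) = fraction (B x) P (ff x a) (ff x f)" "ff x a \<in> carrier (B x)" "ff x f \<in> carrier (B x) - P"
proof -
  let ?Q = "{z \<in> carrier (B x). ff x z \<in> P}"
  have sx: "\<sigma>p (x, P) = (x, ?Q)" by (rule frob_pts_point(1)[OF p])
  note h = frob_hom[OF pointD(1)[OF p]]
  note hc = ring_hom_closed[OF h]
  interpret P: prime_localization "B x" P by (rule loc_point[OF p])
  interpret Q: prime_localization "B x" ?Q by (rule loc_point[OF frob_pts_point(2)[OF p]])
  have f: "f \<in> carrier (B x) - ?Q" using a(2,3) sx by simp
  have S: "ff x t \<in> carrier (B x) - P" if "t \<in> carrier (B x) - ?Q" for t using that hc by auto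
  show "ff x a \<in> carrier (B x)" by (rule hc[OF a(1)])
  show "ff x f \<in> carrier (B x) - P" by (rule S[OF f])
  have "(\<Union>(a, f) \<in> fraction (B x) ?Q a f. fraction (B x) P (ff x a) (ff x f)) = fraction (B x) P (ff x a) (ff x f)"
  proof (rule UN_pair_constant[OF Q.fraction_self[OF a(1) f]])
    fix b t assume m: "(b, t) \<in> fraction (B x) ?Q a f"
    note bt = Q.fraction_memD[OF m a(1) f]
    obtain u where u: "u \<in> carrier (B x) - ?Q" "u \<otimes>\<^bsub>B x\<^esub> (t \<otimes>\<^bsub>B x\<^esub> a) = u \<otimes>\<^bsub>B x\<^esub> (f \<otimes>\<^bsub>B x\<^esub> b)" using bt(4) by (elim bexE)
    have c: "u \<in> carrier (B x)" "t \<in> carrier (B x)" using u(1) bt(2) by auto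
    have "ff x u \<otimes>\<^bsub>B x\<^esub> (ff x t \<otimes>\<^bsub>B x\<^esub> ff x a) = ff x (u \<otimes>\<^bsub>B x\<^esub> (t \<otimes>\<^bsub>B x\<^esub> a))"
      using c a(1) by (simp add: ring_hom_mult[OF h])
    also have "\<dots> = ff x u \<otimes>\<^bsub>B x\<^esub> (ff x f \<otimes>\<^bsub>B x\<^esub> ff x b)"
      unfolding u(2) using c a(2) bt(1) by (simp add: ring_hom_mult[OF h])
    finally show "fraction (B x) P (ff x b) (ff x t) = fraction (B x) P (ff x a) (ff x f)"
      by (intro P.fraction_eqI[OF hc[OF a(1)] S[OF f] hc[OF bt(1)] S[OF bt(2)] S[OF u(1)], symmetric])
  qed
  then show "comor \<sigma> V s (x, P) = fraction (B x) P (ff x a) (ff x f)"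
    using p V s sx by (simp add: rel_frob_def)
qed

lemma comor_sigma_closed:
  assumes V: "opn X V" and s: "s \<in> sec X V"
  shows "comor \<sigma> V s \<in> sec X (pre X \<sigma> V)"
  unfolding carrier_X local_sections_def
proof (intro CollectI conjI ballI)
  have loc: "\<exists>Z. opn X Z \<and> p \<in> Z \<and> Z \<subseteq> pre X \<sigma> V \<and> (\<exists>b\<in>bc_fractions Z. \<forall>x\<in>Z. comor \<sigma> V s x = b x \<and> b x \<in> carrier (bc_loc x))"
    if p: "p \<in> pre X \<sigma> V" for p
  proof -
    have pV: "p \<in> points" "\<sigma>p p \<in> V" using p pre_sigma by auto
    obtain W U a f where W: "opn X W" "\<sigma>p p \<in> W" "W \<subseteq> V" and U: "opn C U" and a: "schains U a" and f: "schains U f"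
      and rep: "\<forall>(x, P)\<in>W. x \<in> U \<and> val U f x \<notin> P \<and> s (x, P) = fraction (B x) P (val U a x) (val U f x)"
      using section_local[OF s pV(2)] .
    let ?Z = "pre X \<sigma> W" and ?b = "\<lambda>(x, P). fraction (B x) P (val U (fr a) x) (val U (fr f) x)"
    have Z: "opn X ?Z" "p \<in> ?Z" "?Z \<subseteq> pre X \<sigma> V" using pre_sigma_open[OF W(1)] W pV by (auto simp: pre_sigma)
    have fact: "x \<in> U \<and> val U (fr f) x \<notin> P \<and> comor \<sigma> V s (x, P) = ?b (x, P) \<and> ?b (x, P) \<in> carrier (bc_loc (x, P))" if xP: "(x, P) \<in> ?Z" for x P
    proof -
      let ?Q = "{z \<in> carrier (B x). ff x z \<in> P}"
      have pt: "(x, P) \<in> points" and sw: "\<sigma>p (x, P) \<in> W" using xP pre_sigma by auto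
      have sx: "\<sigma>p (x, P) = (x, ?Q)" by (rule frob_pts_point(1)[OF pt])
      have r: "x \<in> U" "val U f x \<notin> ?Q" "s (x, ?Q) = fraction (B x) ?Q (val U a x) (val U f x)" using rep sw sx by auto
      interpret P: prime_localization "B x" P by (rule loc_point[OF pt])
      have "\<sigma>p (x, P) \<in> V" using sw W(3) by blast
      note F = comor_sigma_fraction[OF pt this val_closed[OF U r(1) a] val_closed[OF U r(1) f], of s, unfolded sx snd_conv, OF r(2,3)]
      show ?thesis using F r(1) unfolding frob_val[OF U r(1) a] frob_val[OF U r(1) f] by (auto simp: bc_loc_def P.carrier_localization)
    qed
    have "?b \<in> bc_fractions ?Z" unfolding bc_fractions_def
      by (rule CollectI, rule exI[of _ U], rule exI[of _ "fr a"], rule exI[of _ "fr f"])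
        (use U keys_fr[OF a] keys_fr[OF f] fact in auto)
    moreover have "\<forall>x\<in>?Z. comor \<sigma> V s x = ?b x \<and> ?b x \<in> carrier (bc_loc x)" using fact by fast
    ultimately show ?thesis using Z by blast
  qed
  show "comor \<sigma> V s \<in> (\<Pi>\<^sub>E p\<in>pre X \<sigma> V. carrier (bc_loc p))"
  proof (rule PiE_I)
    show "comor \<sigma> V s p \<in> carrier (bc_loc p)" if "p \<in> pre X \<sigma> V" for p using loc[OF that] by auto
    show "comor \<sigma> V s p = undefined" if "p \<notin> pre X \<sigma> V" for p using that by (auto simp: rel_frob_def pre_def pts_X)
  qed
  show "\<exists>Z. openin bc_top Z \<and> p \<in> Z \<and> Z \<subseteq> pre X \<sigma> V \<and> (\<exists>b\<in>bc_fractions Z. \<forall>x\<in>Z. comor \<sigma> V s x = b x)" if "p \<in> pre X \<sigma> V" for p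
    using loc[OF that] by (auto simp: X_eq) blast
qed

end

context integral_base_change
begin

text \<open>The relations that define the pullback along \<open>\<sigma>\<close> contain the images of germs under \<open>\<sigma>\<close>. As these images are germs,
  the relations generate a subgroup of the free Abelian group.\<close>

lemma stalk_map_closed:
  assumes p: "p \<in> points" and g: "g \<in> carrier (stalk X (\<sigma>p p))"
  shows "stalk_map X \<sigma> p g \<in> carrier (stalk X p)"
proof -
  obtain V s where V: "opn X V" "\<sigma>p p \<in> V" and s: "s \<in> sec X V" "g = rgerm X (\<sigma>p p) V s" using X.stalk_cases[OF g] .
  have pV: "p \<in> pre X \<sigma> V'" if "\<sigma>p p \<in> V'" for V' using that p by (simp add: pre_sigma)
  have "stalk_map X \<sigma> p g = rgerm X p (pre X \<sigma> V) (comor \<sigma> V s)"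
    unfolding stalk_map_def s(2)
  proof (rule UN_pair_constant[OF X.rgerm_self[OF V s(1)]])
    fix V' s' assume m: "(V', s') \<in> rgerm X (\<sigma>p p) V s"
    note V' = X.rgerm_memD[OF m V(1) s(1)]
    obtain W where W: "opn X W" "\<sigma>p p \<in> W" "W \<subseteq> V'" "W \<subseteq> V" "res X V' W s' = res X V W s"
      using X.rgerm_eqD[OF V'(4) V s(1)] by (elim exE conjE)
    have "restrict (comor \<sigma> V' s') (pre X \<sigma> W) = restrict (comor \<sigma> V s) (pre X \<sigma> W)"
    proof (rule restrict_ext)
      fix z assume z: "z \<in> pre X \<sigma> W"
      then have zp: "z \<in> points" "\<sigma>p z \<in> W" by (auto simp: pre_sigma)
      have "s' (\<sigma>p z) = s (\<sigma>p z)" using fun_cong[OF W(5), of "\<sigma>p z"] zp(2) by (simp add: res_X)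
      then show "comor \<sigma> V' s' z = comor \<sigma> V s z" using zp W(3,4) by (cases z) (auto simp: rel_frob_def)
    qed
    then show "rgerm X p (pre X \<sigma> V') (comor \<sigma> V' s') = rgerm X p (pre X \<sigma> V) (comor \<sigma> V s)"
      by (intro X.rgerm_eqI[OF pre_sigma_open[OF V'(1)] comor_sigma_closed[OF V'(1,3)] pre_sigma_open[OF V(1)] comor_sigma_closed[OF V(1) s(1)]
          pre_sigma_open[OF W(1)] pV[OF W(2)]]) (use W(3,4) in \<open>auto simp: pre_def res_X\<close>)
  qed
  then show ?thesis using X.rgerm_closed[OF pre_sigma_open[OF V(1)] pV[OF V(2)] comor_sigma_closed[OF V(1) s(1)]] by simp
qed

end

section \<open>The zero homomorphism\<close>

lemma zero_ext_rel: "0 \<in> ext_rel R M h S"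
  unfolding ext_rel_def using generate.one[of "free_Abelian_group (carrier M \<times> carrier S)"] by simp

text \<open>A \<open>generate\<close>d subgroup of a free Abelian group is closed under addition and negation, so the class
  of any of its elements is the class of \<open>0\<close>.\<close>

lemma ext_class_zero:
  assumes M: "module R M" and S: "cring S" and h: "\<forall>a\<in>carrier R. h a \<in> carrier S"
  shows "c \<in> ext_rel R M h S \<Longrightarrow> ext_class R M h S c = ext_rel R M h S"
    and "ext_rel R M h S <#>\<^bsub>free_Abelian_group (carrier M \<times> carrier S)\<^esub> ext_rel R M h S = ext_rel R M h S"
    and "ext_rel R M h S \<subseteq> {c. Poly_Mapping.keys c \<subseteq> carrier M \<times> carrier S}"
    and "Poly_Mapping.keys d \<subseteq> UNIV \<times> carrier S \<Longrightarrow> frag_extend (\<lambda>(A, b). frag_of (\<zero>\<^bsub>M\<^esub>, b)) d \<in> ext_rel R M h S"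
proof -
  interpret M: module R M by fact
  interpret S: cring S by fact
  let ?G = "free_Abelian_group (carrier M \<times> carrier S)"
  interpret G: group ?G by (rule group_free_Abelian_group)
  have sub: "subgroup (ext_rel R M h S) ?G"
    unfolding ext_rel_def
  proof (rule G.generate_is_subgroup, intro Un_least subsetI; elim CollectE exE conjE)
    fix x m m' b assume "x = frag_of (m \<oplus>\<^bsub>M\<^esub> m', b) - frag_of (m, b) - frag_of (m', b)" "m \<in> carrier M" "m' \<in> carrier M" "b \<in> carrier S"
    then show "x \<in> carrier ?G" by (simp add: keys_diff_subset)
  next
    fix x m b b' assume "x = frag_of (m, b \<oplus>\<^bsub>S\<^esub> b') - frag_of (m, b) - frag_of (m, b')" "m \<in> carrier M" "b \<in> carrier S" "b' \<in> carrier S"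
    then show "x \<in> carrier ?G" by (simp add: keys_diff_subset)
  next
    fix x m b a assume "x = frag_of (a \<odot>\<^bsub>M\<^esub> m, b) - frag_of (m, h a \<otimes>\<^bsub>S\<^esub> b)" "m \<in> carrier M" "b \<in> carrier S" "a \<in> carrier R"
    then show "x \<in> carrier ?G" using h by (simp add: keys_diff_subset)
  qed
  interpret H: subgroup "ext_rel R M h S" ?G by (rule sub)
  have carr: "Poly_Mapping.keys c \<subseteq> carrier M \<times> carrier S" if "c \<in> ext_rel R M h S" for c using H.mem_carrier[OF that] by simp
  have diff: "c - d \<in> ext_rel R M h S" if "c \<in> ext_rel R M h S" "d \<in> ext_rel R M h S" for c d
    using H.m_closed[OF that(1) H.m_inv_closed[OF that(2)]] carr[OF that(2)] by simp
  have zero: "0 \<in> ext_rel R M h S" using H.one_closed by simp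
  have plus: "c + d \<in> ext_rel R M h S" if "c \<in> ext_rel R M h S" "d \<in> ext_rel R M h S" for c d
    using H.m_closed[OF that] by simp
  show "ext_rel R M h S \<subseteq> {c. Poly_Mapping.keys c \<subseteq> carrier M \<times> carrier S}" using carr by blast
  show "ext_class R M h S c = ext_rel R M h S" if c: "c \<in> ext_rel R M h S"
    unfolding ext_class_def r_coset_def
  proof (intro Set.equalityI subsetI)
    show "x \<in> ext_rel R M h S" if "x \<in> (\<Union>e\<in>ext_rel R M h S. {e \<otimes>\<^bsub>?G\<^esub> c})" for x using that plus[OF _ c] by auto
    show "x \<in> (\<Union>e\<in>ext_rel R M h S. {e \<otimes>\<^bsub>?G\<^esub> c})" if "x \<in> ext_rel R M h S" for x using diff[OF that c] by (intro UN_I[of "x - c"]) auto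
  qed
  show "ext_rel R M h S <#>\<^bsub>?G\<^esub> ext_rel R M h S = ext_rel R M h S"
    unfolding set_mult_def
  proof (intro Set.equalityI subsetI)
    show "x \<in> ext_rel R M h S" if "x \<in> (\<Union>e\<in>ext_rel R M h S. \<Union>d\<in>ext_rel R M h S. {e \<otimes>\<^bsub>?G\<^esub> d})" for x using that plus by auto
    show "x \<in> (\<Union>e\<in>ext_rel R M h S. \<Union>d\<in>ext_rel R M h S. {e \<otimes>\<^bsub>?G\<^esub> d})" if "x \<in> ext_rel R M h S" for x
      using that zero by (intro UN_I[of x] UN_I[of 0]) auto
  qed
  have z: "frag_of (\<zero>\<^bsub>M\<^esub>, b) \<in> ext_rel R M h S" if b: "b \<in> carrier S" for b
  proof -
    have "frag_of (\<zero>\<^bsub>M\<^esub> \<oplus>\<^bsub>M\<^esub> \<zero>\<^bsub>M\<^esub>, b) - frag_of (\<zero>\<^bsub>M\<^esub>, b) - frag_of (\<zero>\<^bsub>M\<^esub>, b) \<in> ext_rel R M h S"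
      unfolding ext_rel_def by (rule generate.incl) (use b M.M.zero_closed in blast)
    then have "- frag_of (\<zero>\<^bsub>M\<^esub>, b) \<in> ext_rel R M h S" by simp
    from diff[OF zero this] show ?thesis by simp
  qed
  show "frag_extend (\<lambda>(A, b). frag_of (\<zero>\<^bsub>M\<^esub>, b)) d \<in> ext_rel R M h S" if "Poly_Mapping.keys d \<subseteq> UNIV \<times> carrier S"
    using that
  proof (induction d rule: frag_induction)
    case (one x)
    then show ?case using z by (cases x) auto
  next
    case (diff a b)
    then show ?case using \<open>\<And>d c. c \<in> ext_rel R M h S \<Longrightarrow> d \<in> ext_rel R M h S \<Longrightarrow> c - d \<in> ext_rel R M h S\<close> by (simp add: frag_extend_diff)
  qed (use zero in simp)
qed

context integral_base_change
begin

text \<open>The pullback along \<open>\<sigma>\<close> of the zero homomorphism sends every section to the section \<open>\<zeta>\<close>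
  of zero classes, and \<open>\<zeta> + \<zeta> = \<zeta>\<close>.\<close>

lemma pullback_zero:
  assumes G: "module_presheaf X G" and H: "module_presheaf X H" and Hlf: "module_presheaf X H'"
    and \<theta>: "sheaf_hom X (pullback X X \<sigma> H) H' \<theta>"
    and z: "\<And>V s. opn X V \<Longrightarrow> s \<in> msec G V \<Longrightarrow> z V s = \<zero>\<^bsub>msect H V\<^esub>"
    and U: "opn X U" and s: "s \<in> msec (pullback X X \<sigma> G) U"
  shows "\<theta> U (pullback_map X X \<sigma> H z U s) = \<zero>\<^bsub>msect H' U\<^esub>"
proof -
  interpret G: module_presheaf X G by fact
  interpret H: module_presheaf X H by fact
  interpret H': module_presheaf X H' by fact
  let ?E = "\<lambda>F p. ext_rel (stalk X (\<sigma>p p)) (mstalk X F (\<sigma>p p)) (stalk_map X \<sigma> p) (stalk X p)"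
  have op: "on_pts \<sigma> = \<sigma>p" by (simp add: rel_frob_def)
  have Up: "p \<in> points" "\<sigma>p p \<in> points" "p \<in> pts X" "\<sigma>p p \<in> pts X" if "p \<in> U" for p
    using opn_points[OF U that] frob_pts_closed[OF opn_points[OF U that]] by (simp_all add: pts_X)
  have A: "cring (stalk X p)" if "p \<in> pts X" for p using stalk_domain[OF that] by (simp add: domain_def)
  have hc: "\<forall>a\<in>carrier (stalk X (\<sigma>p p)). stalk_map X \<sigma> p a \<in> carrier (stalk X p)" if "p \<in> U" for p
    using stalk_map_closed[OF Up(1)[OF that]] by blast
  note eH = ext_class_zero[OF H.mstalk_module[OF A[OF Up(4)] Up(4)] A[OF Up(3)] hc]
  define \<zeta> where "\<zeta> = (\<lambda>p\<in>U. ?E H p)"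
  have zg: "mstalk_map X H z p g = \<zero>\<^bsub>mstalk X H p\<^esub>" if p: "p \<in> pts X" and g: "g \<in> carrier (mstalk X G p)" for p g
  proof -
    obtain V t where V: "opn X V" "p \<in> V" and t: "t \<in> msec G V" "g = mgerm X G p V t" using G.mstalk_cases[OF g] .
    show ?thesis unfolding mstalk_map_def t(2)
    proof (rule UN_pair_constant[OF G.mgerm_self[OF V t(1)]])
      fix W t' assume m: "(W, t') \<in> mgerm X G p V t"
      note W = G.mgerm_memD[OF m V(1) t(1)]
      show "mgerm X H p W (z W t') = \<zero>\<^bsub>mstalk X H p\<^esub>" unfolding z[OF W(1,3)] by (rule H.mgerm_zero[OF W(1,2)])
    qed
  qed
  have sl: "s \<in> (\<Pi>\<^sub>E p\<in>U. carrier (ext_scalars (stalk X (\<sigma>p p)) (mstalk X G (\<sigma>p p)) (stalk_map X \<sigma> p) (stalk X p)))"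
    using s unfolding pullback_def function_module_def op by (simp add: local_sections_def)
  have "pullback_map X X \<sigma> H z U s = \<zeta>"
    unfolding pullback_map_def \<zeta>_def op
  proof (rule restrict_ext)
    fix p assume p: "p \<in> U"
    note P = Up[OF p]
    note EG = ext_class_zero[OF G.mstalk_module[OF A[OF P(4)] P(4)] A[OF P(3)] hc[OF p]]
      and EH = ext_class_zero[OF H.mstalk_module[OF A[OF P(4)] P(4)] A[OF P(3)] hc[OF p]]
    obtain c0 where c0: "Poly_Mapping.keys c0 \<subseteq> carrier (mstalk X G (\<sigma>p p)) \<times> carrier (stalk X p)"
      "s p = ext_class (stalk X (\<sigma>p p)) (mstalk X G (\<sigma>p p)) (stalk_map X \<sigma> p) (stalk X p) c0"
      using PiE_mem[OF sl p] by (auto simp: ext_scalars_def)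
    have mem: "c \<in> s p \<longleftrightarrow> (\<exists>e\<in>?E G p. c = e + c0)" for c unfolding c0(2) ext_class_def r_coset_def by simp
    have "pb_class X X \<sigma> H p (frag_extend (\<lambda>(A, b). frag_of (mstalk_map X H z (\<sigma>p p) A, b)) c) = ?E H p" if c: "c \<in> s p" for c
    proof -
      obtain e where e: "e \<in> ?E G p" "c = e + c0" using c mem by blast
      have ck: "Poly_Mapping.keys c \<subseteq> carrier (mstalk X G (\<sigma>p p)) \<times> carrier (stalk X p)"
        unfolding e(2) using subsetD[OF EG(3) e(1)] c0(1) by (intro keys_add_subset) auto
      have "frag_extend (\<lambda>(A, b). frag_of (mstalk_map X H z (\<sigma>p p) A, b)) c = frag_extend (\<lambda>(A, b). frag_of (\<zero>\<^bsub>mstalk X H (\<sigma>p p)\<^esub>, b)) c"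
      proof (rule frag_extend_eq)
        fix Ab assume "Ab \<in> Poly_Mapping.keys c"
        then obtain A b where "Ab = (A, b)" "A \<in> carrier (mstalk X G (\<sigma>p p))" using ck by blast
        then show "(case Ab of (A, b) \<Rightarrow> frag_of (mstalk_map X H z (\<sigma>p p) A, b)) = (case Ab of (A, b) \<Rightarrow> frag_of (\<zero>\<^bsub>mstalk X H (\<sigma>p p)\<^esub>, b))"
          using zg[OF P(4)] by simp
      qed
      also have "\<dots> \<in> ?E H p" by (rule EH(4)) (use ck in auto)
      finally show ?thesis unfolding pb_class_def op by (rule EH(1))
    qed
    moreover have "c0 \<in> s p" unfolding mem by (rule bexI[OF _ zero_ext_rel]) simp
    ultimately show "(\<Union>c\<in>s p. pb_class X X \<sigma> H p (frag_extend (\<lambda>(A, b). frag_of (mstalk_map X H z (\<sigma>p p) A, b)) c)) = ?E H p"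
      by (intro UN_constant_eq[of c0] ballI)
  qed
  moreover have "\<theta> U \<zeta> = \<zero>\<^bsub>msect H' U\<^esub>"
  proof -
    interpret U': module "sect X U" "msect H' U" by (rule H'.msect_module[OF U])
    have r0: "ext_class (stalk X (\<sigma>p p)) (mstalk X H (\<sigma>p p)) (stalk_map X \<sigma> p) (stalk X p) 0 = ?E H p" for p
      by (simp add: ext_class_def r_coset_def)
    have pre: "U \<subseteq> pre X \<sigma> (pts X)" using Up by (auto simp: pre_def op)
    have \<zeta>c: "\<zeta> \<in> msec (pullback X X \<sigma> H) U"
    proof -
      let ?S = "\<lambda>p. carrier (ext_scalars (stalk X (\<sigma>p p)) (mstalk X H (\<sigma>p p)) (stalk_map X \<sigma> p) (stalk X p))"
        and ?B = "\<lambda>V. {\<lambda>x. pb_class X X \<sigma> H x (frag_extend (\<lambda>(t, a). frag_of (mgerm X H (\<sigma>p x) W t, rgerm X x V a)) c) | W c.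
         opn X W \<and> V \<subseteq> pre X \<sigma> W \<and> Poly_Mapping.keys c \<subseteq> msec H W \<times> sec X V}"
      have "(\<lambda>p. ?E H p) \<in> ?B U"
        by (rule CollectI, rule exI[of _ "pts X"], rule exI[of _ 0]) (use pre in \<open>simp add: pb_class_def op r0\<close>)
      moreover have "?E H p \<in> ?S p" for p
        unfolding r0[symmetric] ext_scalars_def partial_object.simps by (rule CollectI, rule exI[of _ 0]) simp
      ultimately have "(\<lambda>p\<in>U. ?E H p) \<in> local_sections (space X) ?S ?B U" by (rule local_sectionsI[OF U])
      then show ?thesis by (simp add: pullback_def function_module_def op \<zeta>_def)
    qed
    have "\<zeta> \<oplus>\<^bsub>msect (pullback X X \<sigma> H) U\<^esub> \<zeta> = \<zeta>"
      unfolding pullback_def function_module_def op \<zeta>_def module_sheaf.simps ring.simps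
      by (rule restrict_ext) (use Up eH(2) in \<open>simp add: ext_scalars_def\<close>)
    moreover have "\<theta> U (\<zeta> \<oplus>\<^bsub>msect (pullback X X \<sigma> H) U\<^esub> \<zeta>) = \<theta> U \<zeta> \<oplus>\<^bsub>msect H' U\<^esub> \<theta> U \<zeta>"
      using \<theta> U \<zeta>c by (simp add: sheaf_hom_def)
    moreover have "\<theta> U \<zeta> \<in> msec H' U" using \<theta> U \<zeta>c by (auto simp: sheaf_hom_def)
    ultimately show ?thesis using U'.M.add.l_cancel_one[of "\<theta> U \<zeta>" "\<theta> U \<zeta>"] by simp
  qed
  ultimately show ?thesis by simp
qed

lemma zero_hom_in_tau_Hom:
  assumes F: "\<And>i. module_presheaf X (sheaf F i)" and F': "\<And>i. module_presheaf X (sheaf F' i)"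
    and Pi: "\<And>i. sheaf_hom X (sheaf F i) (sheaf F (i + 1)) (Pi_map F i)"
    and Pi': "\<And>i. sheaf_hom X (sheaf F' i) (sheaf F' (i + 1)) (Pi_map F' i)"
    and tau: "\<And>i. sheaf_hom X (pullback X X \<sigma> (sheaf F i)) (sheaf F (i + 1)) (tau_map F i)"
    and tau': "\<And>i. sheaf_hom X (pullback X X \<sigma> (sheaf F' i)) (sheaf F' (i + 1)) (tau_map F' i)"
  shows "tau_zero_hom X F F' \<in> tau_Hom X \<sigma> F F'"
proof -
  let ?z = "tau_zero_hom X F F'"
  have z: "?z i U s = \<zero>\<^bsub>msect (sheaf F' i) U\<^esub>" if "opn X U" "s \<in> msec (sheaf F i) U" for i U s
    using that by (simp add: tau_zero_hom_def)
  have cl: "h U s \<in> msec H U" if "sheaf_hom X G H h" "opn X U" "s \<in> msec G U" for G :: "(_, _, 'x) module_sheaf" and H :: "(_, _, 'y) module_sheaf" and h U s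
    using that by (auto simp: sheaf_hom_def)
  have hom: "sheaf_hom X (sheaf F i) (sheaf F' i) (?z i)" for i
  proof -
    interpret G: module_presheaf X "sheaf F i" by (rule F)
    interpret H: module_presheaf X "sheaf F' i" by (rule F')
    note m = G.msect_module and m' = H.msect_module
    note g = abelian_group.axioms(1)[OF module.axioms(2)[OF m]] and g' = abelian_group.axioms(1)[OF module.axioms(2)[OF m']]
    have zc: "\<zero>\<^bsub>msect (sheaf F' i) U\<^esub> \<in> msec (sheaf F' i) U" if "opn X U" for U by (rule abelian_monoid.zero_closed[OF g'[OF that]])
    have rz: "a \<odot>\<^bsub>msect (sheaf F' i) U\<^esub> \<zero>\<^bsub>msect (sheaf F' i) U\<^esub> = \<zero>\<^bsub>msect (sheaf F' i) U\<^esub>" if "opn X U" "a \<in> sec X U" for a U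
      by (rule module.smult_r_null[OF m'[OF that(1)] that(2)])
    show ?thesis
      unfolding sheaf_hom_def
      by (intro allI impI conjI ballI funcsetI)
        (simp_all add: z zc rz abelian_monoid.a_closed[OF g] abelian_monoid.l_zero[OF g'] module.smult_closed[OF m] G.mres_closed H.mres_zero)
  qed
  have 1: "?z (i + 1) U (Pi_map F i U s) = Pi_map F' i U (?z i U s)"
    if U: "opn X U" and s: "s \<in> msec (sheaf F i) U" for i U s
  proof -
    interpret H: module_presheaf X "sheaf F' i" by (rule F')
    interpret H1: module_presheaf X "sheaf F' (i + 1)" by (rule F')
    interpret HU: module "sect X U" "msect (sheaf F' i) U" by (rule H.msect_module[OF U])
    interpret H1U: module "sect X U" "msect (sheaf F' (i + 1)) U" by (rule H1.msect_module[OF U])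
    have "Pi_map F' i U (\<zero>\<^bsub>sect X U\<^esub> \<odot>\<^bsub>msect (sheaf F' i) U\<^esub> \<zero>\<^bsub>msect (sheaf F' i) U\<^esub>) =
        \<zero>\<^bsub>sect X U\<^esub> \<odot>\<^bsub>msect (sheaf F' (i + 1)) U\<^esub> Pi_map F' i U \<zero>\<^bsub>msect (sheaf F' i) U\<^esub>"
      using Pi'[of i] U HU.R.zero_closed HU.M.zero_closed unfolding sheaf_hom_def by blast
    then show ?thesis using z[OF U s] z[OF U cl[OF Pi U s]] cl[OF Pi' U HU.M.zero_closed] by simp
  qed
  have 2: "?z (i + 1) U (tau_map F i U s) = tau_map F' i U (pullback_map X X \<sigma> (sheaf F' i) (?z i) U s)"
    if U: "opn X U" and s: "s \<in> msec (pullback X X \<sigma> (sheaf F i)) U" for i U s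
    using pullback_zero[OF F F' F' tau' z U s] z[OF U cl[OF tau U s]] by simp
  have "?z i U \<in> extensional (if opn X U then msec (sheaf F i) U else {})" for i U
    unfolding tau_zero_hom_def by (rule restrict_extensional)
  then show ?thesis using hom 1 2 by (simp add: tau_Hom_def)
qed

end

section \<open>Weights\<close>

text \<open>Smoothness makes the local rings of \<open>C\<^sub>L\<close> regular, hence noetherian domains, and geometric irreducibility makes
  \<open>C\<^sub>L\<close> irreducible.\<close>

lemma curve_germs_at_infinity:
  assumes "field k" and "finite (carrier k)" and curve: "smooth_projective_curve TYPE('l) k C \<gamma>"
    and pinf: "morphism_over k (Spec k) (spec_const k) C \<gamma> pinf"
    and "field (L :: 'l ring)" and "\<iota> \<in> ring_hom k L"
    and X: "\<forall>U. opn (base_change k C \<gamma> L \<iota>) U \<longrightarrow> cring (sect (base_change k C \<gamma> L \<iota>) U)"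
  shows "\<exists>P. germs_at_infinity k C \<gamma> L \<iota> pinf P"
proof -
  have "scheme_over k C \<gamma>" and smooth: "ext_regular TYPE('l) k C \<gamma>" and irr: "ext_irreducible TYPE('l) k C \<gamma>"
    using curve by (simp_all add: smooth_projective_curve_def smooth_over_def geometrically_irreducible_def)
  then have b: "base_change_setup k C \<gamma> L \<iota>"
    using assms by (simp add: base_change_setup_def base_change_setup_axioms_def scheme_over_def)
  interpret b: base_change_setup k C \<gamma> L \<iota> by (rule b)
  have reg: "regular_local_ring (stalk b.X y)" if "y \<in> pts b.X" for y
    using smooth assms(5,6) that by (simp add: ext_regular_def)
  interpret i: integral_base_change k C \<gamma> L \<iota>
  proof (rule integral_base_change.intro[OF b], rule integral_base_change_axioms.intro)
    show "irreducible_in (space b.X) (pts b.X)" using irr assms(5,6) by (simp add: ext_irreducible_def)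
    show "domain (stalk b.X y)" if "y \<in> pts b.X" for y by (rule regular_local_ring_domain[OF reg[OF that]])
  qed (use X in simp)
  interpret p: pointed_base_change k C \<gamma> L \<iota> pinf
    by (rule pointed_base_change.intro[OF b], rule pointed_base_change_axioms.intro, rule pinf)
  obtain P where P: "(p.xi, P) \<in> b.points" using p.point_over_infinity by (elim exE)
  have R: "regular_local_ring (stalk b.X (p.xi, P))" by (rule reg) (simp add: b.pts_X P)
  have "germs_at_infinity k C \<gamma> L \<iota> pinf P"
  proof (rule germs_at_infinity.intro[OF i.integral_base_change_axioms p.pointed_base_change_axioms], rule germs_at_infinity_axioms.intro)
    show "(p.xi, P) \<in> b.points" by (rule P)
    show "noetherian_ring (stalk b.X (p.xi, P))" using R by (simp add: regular_local_ring_def)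
    show "maximalideal (nonunits (stalk b.X (p.xi, P))) (stalk b.X (p.xi, P))" by (rule regular_local_ring_nonunits[OF R])
  qed
  then show ?thesis by (rule exI)
qed

lemma (in germs_at_infinity) abelian_tau_sheaf_periodic:
  assumes "abelian_tau_sheaf k C \<gamma> pinf L \<iota> \<Gamma> T"
  shows "\<exists>n l. l * dimension T = n * rank T \<and> periodic_sheaf k C \<gamma> L \<iota> pinf P T n l"
proof -
  note T = assms[unfolded abelian_tau_sheaf_def abelian_tau_sheaf_on_def]
  obtain n l where nl: "0 < n" "0 < l" "l * dimension T = n * rank T"
    and per: "\<forall>i U. opn X U \<longrightarrow>
           Pi_iter T i l U ` msec (sheaf T i) U =
             ideal_times X (sheaf T (i + int l)) (OM n) (\<lambda>W. msec (sheaf T (i + int l)) W) U \<and>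
           (\<forall>s \<in> msec (pullback X X \<sigma> (sheaf T i)) U.
              tau_map T (i + int l) U (pullback_map X X \<sigma> (sheaf T (i + int l)) (Pi_iter T i l) U s) =
              Pi_iter T (i + 1) l U (tau_map T i U s))"
    using conjunct1[OF conjunct2[OF conjunct2[OF conjunct2[OF conjunct2[OF T]]]]] by (elim exE conjE)
  have "periodic_sheaf k C \<gamma> L \<iota> pinf P T n l"
  proof (rule periodic_sheaf.intro[OF germs_at_infinity_axioms], rule periodic_sheaf_axioms.intro)
    show "locally_free X (sheaf T i) (rank T)" for i using conjunct1[OF T] by simp
    show "sheaf_hom X (sheaf T i) (sheaf T (i + 1)) (Pi_map T i)" "sheaf_inj X (sheaf T i) (Pi_map T i)" for i
      using conjunct1[OF conjunct2[OF T]] by simp_all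
    show "0 < n" "0 < l" by (rule nl)+
    show "Pi_iter T i l U ` msec (sheaf T i) U =
      ideal_times X (sheaf T (i + int l)) (OM n) (\<lambda>W. msec (sheaf T (i + int l)) W) U" if "opn X U" for i U
      using per that by simp
  qed
  then show ?thesis using nl(3) by (intro exI conjI)
qed

theorem proposition1p18:
  fixes k :: "'k ring" and L :: "'l ring" and \<iota> :: "'k \<Rightarrow> 'l"
    and C :: "('p, 's) ringed_space" and \<gamma> :: "'k \<Rightarrow> 's"
    and pinf :: "('k set, 'k set \<Rightarrow> ('k \<times> 'k) set, 'p, 's) rs_map"
    and c :: "('l set, 'l set \<Rightarrow> ('l \<times> 'l) set, 'p, 's) rs_map"
    and \<Gamma> :: "('l set, 'l set \<Rightarrow> ('l \<times> 'l) set, ('p, 's, 'l) bc_point, ('p, 's, 'l) bc_fun) rs_map"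
    and F :: "(('p, 's, 'l) bc_point, ('p, 's, 'l) bc_fun, 'm) tau_sheaf"
    and F' :: "(('p, 's, 'l) bc_point, ('p, 's, 'l) bc_fun, 'n) tau_sheaf"
  assumes "field k" and "finite (carrier k)"
    and "smooth_projective_curve TYPE('l) k C \<gamma>"
    and "morphism_over k (Spec k) (spec_const k) C \<gamma> pinf"
    and "field L" and "\<iota> \<in> ring_hom k L"
    and "morphism_over k (Spec L) (spec_const L \<circ> \<iota>) C \<gamma> c"
    and "is_graph k C \<gamma> L \<iota> c \<Gamma>"
    and "abelian_tau_sheaf k C \<gamma> pinf L \<iota> \<Gamma> F"
    and "abelian_tau_sheaf k C \<gamma> pinf L \<iota> \<Gamma> F'"
    and "tau_Hom (base_change k C \<gamma> L \<iota>) (rel_frob k C \<gamma> L \<iota>) F F' \<noteq>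
      {tau_zero_hom (base_change k C \<gamma> L \<iota>) F F'}"
  shows "weight (base_change k C \<gamma> L \<iota>) F = weight (base_change k C \<gamma> L \<iota>) F'"
proof -
  let ?X = "base_change k C \<gamma> L \<iota>"
  note T = assms(9)[unfolded abelian_tau_sheaf_def abelian_tau_sheaf_on_def]
    and T' = assms(10)[unfolded abelian_tau_sheaf_def abelian_tau_sheaf_on_def]
  have "locally_free ?X (sheaf F 0) (rank F)" using conjunct1[OF T] by simp
  then have cr: "\<forall>U. opn ?X U \<longrightarrow> cring (sect ?X U)"
    by (simp add: locally_free_def sheaf_of_modules_def module_def)
  obtain P where "germs_at_infinity k C \<gamma> L \<iota> pinf P"
    using curve_germs_at_infinity[OF assms(1-6) cr] by (elim exE)
  then interpret y: germs_at_infinity k C \<gamma> L \<iota> pinf P .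
  obtain n l where nl: "l * dimension F = n * rank F" and F: "periodic_sheaf k C \<gamma> L \<iota> pinf P F n l"
    using y.abelian_tau_sheaf_periodic[OF assms(9)] by (elim exE conjE)
  obtain n' l' where nl': "l' * dimension F' = n' * rank F'" and F': "periodic_sheaf k C \<gamma> L \<iota> pinf P F' n' l'"
    using y.abelian_tau_sheaf_periodic[OF assms(10)] by (elim exE conjE)
  have "tau_zero_hom ?X F F' \<in> tau_Hom ?X y.\<sigma> F F'"
    by (rule y.zero_hom_in_tau_Hom)
      (use periodic_sheaf.S[OF F] periodic_sheaf.S[OF F'] conjunct1[OF conjunct2[OF T]] conjunct1[OF conjunct2[OF T']]
        conjunct1[OF conjunct2[OF conjunct2[OF T]]] conjunct1[OF conjunct2[OF conjunct2[OF T']]] in simp_all)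
  then obtain f where f: "f \<in> tau_Hom ?X y.\<sigma> F F'" "f \<noteq> tau_zero_hom ?X F F'" using assms(11) by blast
  have "\<exists>i U s. f i U s \<noteq> tau_zero_hom ?X F F' i U s"
  proof (rule ccontr)
    assume "\<not> ?thesis"
    then have "f = tau_zero_hom ?X F F'" by (intro ext) simp
    then show False using f(2) by simp
  qed
  then obtain i U s where ne: "f i U s \<noteq> tau_zero_hom ?X F F' i U s" by (elim exE)
  let ?S = "if opn ?X U then carrier (msect (sheaf F i) U) else {}"
  have fe: "f i U \<in> extensional ?S" using f(1) by (simp add: tau_Hom_def)
  have "s \<in> ?S"
  proof (rule ccontr)
    assume "s \<notin> ?S"
    from extensional_arb[OF fe this] restrict_apply[of "\<lambda>s. \<zero>\<^bsub>msect (sheaf F' i) U\<^esub>" ?S s]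
    show False using ne \<open>s \<notin> ?S\<close> by (simp add: tau_zero_hom_def)
  qed
  then have U: "opn ?X U" and s: "s \<in> carrier (msect (sheaf F i) U)" by (simp_all split: if_splits)
  have nz: "f i U s \<noteq> \<zero>\<^bsub>msect (sheaf F' i) U\<^esub>" using ne U s by (simp add: tau_zero_hom_def)
  note res = y.nonzero_hom_slope[OF F F' f(1) U s nz]
  have nonzero: "\<not> is_zero_tau_sheaf ?X F" "\<not> is_zero_tau_sheaf ?X F'"
  proof -
    show "\<not> is_zero_tau_sheaf ?X F" using U s res(4) unfolding is_zero_tau_sheaf_def by blast
    have "sheaf_hom ?X (sheaf F i) (sheaf F' i) (f i)" using f(1) by (simp add: tau_Hom_def)
    then have "f i U \<in> carrier (msect (sheaf F i) U) \<rightarrow> carrier (msect (sheaf F' i) U)" using U by (simp add: sheaf_hom_def)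
    from funcset_mem[OF this s] have "f i U s \<in> carrier (msect (sheaf F' i) U)" .
    then show "\<not> is_zero_tau_sheaf ?X F'" using U nz unfolding is_zero_tau_sheaf_def by blast
  qed
  note pos = periodic_sheaf.l[OF F] periodic_sheaf.l[OF F']
  have w: "of_nat d / of_nat r = (of_nat n / of_nat l :: rat)" if "l * d = n * r" "0 < r" "0 < l" for d r n l :: nat
  proof -
    have "(of_nat (l * d) :: rat) = of_nat (n * r)" using that(1) by (rule arg_cong)
    then show ?thesis using that(2,3) by (simp add: field_simps)
  qed
  have "(of_nat (n * l') :: rat) = of_nat (n' * l)" using res(3) by (rule arg_cong)
  then have "(of_nat n / of_nat l :: rat) = of_nat n' / of_nat l'" using pos by (simp add: field_simps)
  then show ?thesis
    unfolding weight_def using nonzero w[OF nl res(1) pos(1)] w[OF nl' res(2) pos(2)] by simp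
qed

end
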